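(* Let $\kappa>0$ and $\mathcal{L}f=\frac{\kappa}{2}f''$ (the generator of $X_t=\sqrt{\kappa}B_t$, $B$ a standard Brownian motion). Let $\sigma:\mathbf{R}\to\mathbf{R}$ be Lipschitz continuous with Lipschitz constant $\mathrm{Lip}_\sigma$, with $\sigma(0)=0$ and $\mathrm{L}_\sigma:=\inf_{x\in\mathbf{R}}|\sigma(x)/x|>0$. Let $u_0:\mathbf{R}\to\mathbf{R}_+$ be bounded, lower semicontinuous, with compact support of positive Lebesgue measure, and let $u$ be the mild solution of $\partial_t u_t(x)=\frac{\kappa}{2}\partial_x^2u_t(x)+\sigma(u_t(x))\,\partial^2_{tx}W(t,x)$ with initial datum $u_0$. Then $0<\underline{\lambda}(\nu)\le\overline{\lambda}(\nu)<\infty$ for all $\nu\in[2,\infty)$, and moreover $$\frac{\mathrm{L}_\sigma^2}{2\pi}\le\underline{\lambda}(2)\le\overline{\lambda}(2)\le\frac{\mathrm{Lip}_\sigma^2}{2}.$$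
   Context: $W$ is a two-parameter Brownian sheet indexed by $\mathbf{R}_+\times\mathbf{R}$. The mild solution is the predictable random field $u$ with $u_t(x)=(P_tu_0)(x)+\int_{[0,t]\times\mathbf{R}}p_{t-s}(y-x)\sigma(u_s(y))\,W(ds\,dy)$, where $p_t(x)=(2\pi\kappa t)^{-1/2}e^{-x^2/(2\kappa t)}$ and $(P_tf)(x)=\int p_t(y-x)f(y)\,dy$. Growth indices: $\overline{\lambda}(\nu):=\inf\{\alpha>0:\limsup_{t\to\infty}\frac1t\sup_{|x|\ge\alpha t}\ln\mathrm{E}(|u_t(x)|^\nu)<0\}$ (with $\inf\varnothing=\infty$), and $\underline{\lambda}(\nu):=\sup\{\alpha>0:\limsup_{t\to\infty}\frac1t\sup_{|x|\ge\alpha t}\ln\mathrm{E}(|u_t(x)|^\nu)>0\}$ (with $\sup\varnothing=0$). *)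

theory Defs
  imports "HOL-Probability.Probability"
begin

definition heat_kernel :: "real \<Rightarrow> real \<Rightarrow> real \<Rightarrow> real" where
  "heat_kernel \<kappa> t x = exp (- x\<^sup>2 / (2 * \<kappa> * t)) / sqrt (2 * pi * \<kappa> * t)"

definition heat_semigroup :: "real \<Rightarrow> real \<Rightarrow> (real \<Rightarrow> real) \<Rightarrow> real \<Rightarrow> real" where
  "heat_semigroup \<kappa> t f x = (LINT y|lborel. heat_kernel \<kappa> t (y - x) * f y)"

definition filtration_on :: "'a measure \<Rightarrow> (real \<Rightarrow> 'a measure) \<Rightarrow> bool" where
  "filtration_on M F \<longleftrightarrow> (\<forall>t. subalgebra M (F t)) \<and> (\<forall>s t. s \<le> t \<longrightarrow> sets (F s) \<subseteq> sets (F t))"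

definition fin_borel :: "real set set" where
  "fin_borel = {A. A \<in> sets lborel \<and> emeasure lborel A < \<infinity>}"

text \<open>W t A is the white noise of the set [0,t] x A, i.e. the Walsh martingale measure
  associated with the two-parameter Brownian sheet, relative to the filtration F.\<close>
definition white_noise ::
  "'a measure \<Rightarrow> (real \<Rightarrow> 'a measure) \<Rightarrow> (real \<Rightarrow> real set \<Rightarrow> 'a \<Rightarrow> real) \<Rightarrow> bool" where
  "white_noise M F W \<longleftrightarrow>
     (\<forall>t A. 0 \<le> t \<longrightarrow> A \<in> fin_borel \<longrightarrow> W t A \<in> borel_measurable (F t))
   \<and> (\<forall>A\<in>fin_borel. AE \<omega> in M. W 0 A \<omega> = 0)
   \<and> (\<forall>t A B. 0 \<le> t \<longrightarrow> A \<in> fin_borel \<longrightarrow> B \<in> fin_borel \<longrightarrow> A \<inter> B = {} \<longrightarrow>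
        (AE \<omega> in M. W t (A \<union> B) \<omega> = W t A \<omega> + W t B \<omega>))
   \<and> (\<forall>s t J. 0 \<le> s \<longrightarrow> s \<le> t \<longrightarrow> finite J \<longrightarrow> J \<subseteq> fin_borel \<longrightarrow> disjoint J \<longrightarrow>
        prob_space.indep_vars M (\<lambda>_. borel) (\<lambda>A \<omega>. W t A \<omega> - W s A \<omega>) J
      \<and> prob_space.indep_set M (sets (F s))
          (sigma_sets (space M) (\<Union>A\<in>J. {(\<lambda>\<omega>. W t A \<omega> - W s A \<omega>) -` B \<inter> space M | B. B \<in> sets borel}))
      \<and> (\<forall>A\<in>J. if (t - s) * measure lborel A > 0
           then distributed M lborel (\<lambda>\<omega>. W t A \<omega> - W s A \<omega>)
                  (\<lambda>x. ennreal (normal_density 0 (sqrt ((t - s) * measure lborel A)) x))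
           else (AE \<omega> in M. W t A \<omega> - W s A \<omega> = 0)))"

definition pred_sets :: "'a measure \<Rightarrow> (real \<Rightarrow> 'a measure) \<Rightarrow> (real \<times> real \<times> 'a) set set" where
  "pred_sets M F = sigma_sets ({0<..} \<times> UNIV \<times> space M)
     {{a<..b} \<times> A \<times> G | a b A G. 0 \<le> a \<and> a \<le> b \<and> A \<in> sets borel \<and> G \<in> sets (F a)}"

definition predictable ::
  "'a measure \<Rightarrow> (real \<Rightarrow> 'a measure) \<Rightarrow> (real \<Rightarrow> real \<Rightarrow> 'a \<Rightarrow> real) \<Rightarrow> bool" where
  "predictable M F \<phi> \<longleftrightarrow>
     (\<forall>B\<in>sets borel. {(t, x, \<omega>). 0 < t \<and> \<omega> \<in> space M \<and> \<phi> t x \<omega> \<in> B} \<in> pred_sets M F)"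

type_synonym 'a simple_rep = "(real \<times> real \<times> real set \<times> ('a \<Rightarrow> real)) list"

definition simple_ok :: "'a measure \<Rightarrow> (real \<Rightarrow> 'a measure) \<Rightarrow> 'a simple_rep \<Rightarrow> bool" where
  "simple_ok M F rep \<longleftrightarrow> (\<forall>(a, b, A, X) \<in> set rep. 0 \<le> a \<and> a \<le> b \<and> A \<in> fin_borel
      \<and> X \<in> borel_measurable (F a) \<and> (\<exists>C. \<forall>\<omega>\<in>space M. \<bar>X \<omega>\<bar> \<le> C))"

definition simple_fn :: "'a simple_rep \<Rightarrow> real \<Rightarrow> real \<Rightarrow> 'a \<Rightarrow> real" where
  "simple_fn rep s y \<omega> = (\<Sum>(a, b, A, X) \<leftarrow> rep. indicator {a<..b} s * indicator A y * X \<omega>)"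

definition simple_int :: "(real \<Rightarrow> real set \<Rightarrow> 'a \<Rightarrow> real) \<Rightarrow> 'a simple_rep \<Rightarrow> 'a \<Rightarrow> real" where
  "simple_int W rep \<omega> = (\<Sum>(a, b, A, X) \<leftarrow> rep. X \<omega> * (W b A \<omega> - W a A \<omega>))"

definition walsh_integral ::
  "'a measure \<Rightarrow> (real \<Rightarrow> 'a measure) \<Rightarrow> (real \<Rightarrow> real set \<Rightarrow> 'a \<Rightarrow> real)
     \<Rightarrow> (real \<Rightarrow> real \<Rightarrow> 'a \<Rightarrow> real) \<Rightarrow> ('a \<Rightarrow> real) \<Rightarrow> bool" where
  "walsh_integral M F W \<phi> I \<longleftrightarrow> predictable M F \<phi> \<and> I \<in> borel_measurable M \<and>
     (\<exists>reps. (\<forall>n. simple_ok M F (reps n))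
       \<and> ((\<lambda>n. \<integral>\<^sup>+\<omega>. (\<integral>\<^sup>+s. (\<integral>\<^sup>+y. indicator {0<..} s *
              ennreal ((\<phi> s y \<omega> - simple_fn (reps n) s y \<omega>)\<^sup>2) \<partial>lborel) \<partial>lborel) \<partial>M)
            \<longlonglongrightarrow> 0)
       \<and> ((\<lambda>n. \<integral>\<^sup>+\<omega>. ennreal ((I \<omega> - simple_int W (reps n) \<omega>)\<^sup>2) \<partial>M) \<longlonglongrightarrow> 0))"

definition mild_solution ::
  "'a measure \<Rightarrow> (real \<Rightarrow> 'a measure) \<Rightarrow> (real \<Rightarrow> real set \<Rightarrow> 'a \<Rightarrow> real) \<Rightarrow> real
     \<Rightarrow> (real \<Rightarrow> real) \<Rightarrow> (real \<Rightarrow> real) \<Rightarrow> (real \<Rightarrow> real \<Rightarrow> 'a \<Rightarrow> real) \<Rightarrow> bool" where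
  "mild_solution M F W \<kappa> \<sigma> u0 u \<longleftrightarrow> predictable M F u
   \<and> (\<forall>T>0. \<exists>C. \<forall>t\<in>{0<..T}. \<forall>x. (\<integral>\<^sup>+\<omega>. ennreal ((u t x \<omega>)\<^sup>2) \<partial>M) \<le> C)
   \<and> (\<forall>t>0. \<forall>x. \<exists>I. walsh_integral M F W
          (\<lambda>s y \<omega>. indicator {0<..<t} s * heat_kernel \<kappa> (t - s) (y - x) * \<sigma> (u s y \<omega>)) I
        \<and> (AE \<omega> in M. u t x \<omega> = heat_semigroup \<kappa> t u0 x + I \<omega>))"

definition moment :: "'a measure \<Rightarrow> (real \<Rightarrow> real \<Rightarrow> 'a \<Rightarrow> real) \<Rightarrow> real \<Rightarrow> real \<Rightarrow> real \<Rightarrow> real" where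
  "moment M u \<nu> t x = enn2real (\<integral>\<^sup>+\<omega>. ennreal (\<bar>u t x \<omega>\<bar> powr \<nu>) \<partial>M)"

definition growth_rate :: "'a measure \<Rightarrow> (real \<Rightarrow> real \<Rightarrow> 'a \<Rightarrow> real) \<Rightarrow> real \<Rightarrow> real \<Rightarrow> ereal" where
  "growth_rate M u \<nu> \<alpha> = Limsup at_top (\<lambda>t::real.
      ereal (1 / t) * (SUP x\<in>{x. \<bar>x\<bar> \<ge> \<alpha> * t}. ereal (ln (moment M u \<nu> t x))))"

definition upper_index :: "'a measure \<Rightarrow> (real \<Rightarrow> real \<Rightarrow> 'a \<Rightarrow> real) \<Rightarrow> real \<Rightarrow> ereal" where
  "upper_index M u \<nu> = Inf {ereal \<alpha> | \<alpha>. \<alpha> > 0 \<and> growth_rate M u \<nu> \<alpha> < 0}"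

definition lower_index :: "'a measure \<Rightarrow> (real \<Rightarrow> real \<Rightarrow> 'a \<Rightarrow> real) \<Rightarrow> real \<Rightarrow> ereal" where
  "lower_index M u \<nu> = Sup (insert 0 {ereal \<alpha> | \<alpha>. \<alpha> > 0 \<and> growth_rate M u \<nu> \<alpha> > 0})"

definition lip_const :: "(real \<Rightarrow> real) \<Rightarrow> real" where
  "lip_const \<sigma> = Inf {C. C-lipschitz_on UNIV \<sigma>}"

definition L_const :: "(real \<Rightarrow> real) \<Rightarrow> real" where
  "L_const \<sigma> = Inf {\<bar>\<sigma> x / x\<bar> | x. x \<noteq> 0}"

definition lsc :: "(real \<Rightarrow> real) \<Rightarrow> bool" where
  "lsc f \<longleftrightarrow> (\<forall>a. open {x. f x > a})"

end

theory Submission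
  imports Defs "HOL-Real_Asymp.Real_Asymp"
begin

text \<open>
  The isometry of the Walsh integral turns \<open>V t x = E (u t x)\<^sup>2\<close> into a two-sided renewal inequality
  with kernel \<open>heat_sq\<close>, the squared heat kernel \<open>p\<^sup>2\<close>, and constants \<open>Lip\<^sup>2\<close> and \<open>L\<^sup>2\<close>. Comparing with the
  supersolutions \<open>exp (\<beta> t - c x)\<close>, whose renewal constant is computed by the substitution \<open>z = r v\<close>,
  and optimising over \<open>\<beta>\<close> and \<open>c\<close> gives the upper bound \<open>Lip\<^sup>2 / 2\<close>. For the lower bound,
  the mass of \<open>V\<close> beyond the line \<open>x = \<alpha> t\<close> satisfies a one-dimensional renewal inequality whose kernel has
  total mass \<open>1 / (2 \<pi> \<alpha>)\<close>, so it grows exponentially as soon as \<open>\<alpha> < L\<^sup>2 / (2 \<pi>)\<close>.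

  Higher moments come without Picard iteration. Taylor's formula for the truncated powers
  \<open>x\<^sup>2 (x\<^sup>2 / (1 + \<epsilon> x\<^sup>2))\<^sup>m\<close>, applied along a fine time grid, yields a Burkholder inequality with a
  constant that does not depend on \<open>\<epsilon>\<close>. The truncated moments of the solution are finite a priori, so the
  renewal argument applies to them, and \<open>\<epsilon>\<close> tends to \<open>0\<close> at the end.

  In \<^const>\<open>mild_solution\<close> the local bound on the second moment is an extended real that may be infinite.
  Local boundedness of \<open>V\<close> is therefore proved first: the stochastic integral lies in \<open>L\<^sup>2\<close> and
  \<open>L > 0\<close>, so \<open>V\<close> is integrable against the kernel, and a subsolution with that property is
  locally bounded.
\<close>

section \<open>Truncated powers\<close>

text \<open>Young's inequality without a weight would turn the quadratic Taylor term for the moment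
  of order \<open>2 * m + 2\<close> into the power \<open>2 * m + 2\<close> of the heat kernel,
  which is not integrable near time zero. A deterministic weight \<open>q\<close> leaves instead
  \<open>f\<^sup>2 * (f\<^sup>2 / q) ^ m\<close> in the limit of vanishing truncation. With
  \<open>q\<close> the discounted squared kernel, all factors of that kernel but one cancel, so
  every moment obeys a renewal inequality with the kernel of the second moment; only the constant
  and the exponential rate change. Truncation is forced by the absorption steps:
  \<open>G \<le> G / 2 + b\<close> says nothing unless \<open>G\<close> is finite. Origin of the two
  constants: a supersolution with decay rate \<open>c\<close> needs \<open>\<beta>\<close> above
  \<open>\<kappa> * c\<^sup>2 / 4 + Lip ^ 4 / (4 * \<kappa>)\<close> and spreads with speed
  \<open>\<beta> / c\<close>; the infimum of these speeds is \<open>Lip\<^sup>2 / 2\<close>, reached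
  for \<open>c = Lip\<^sup>2 / \<kappa>\<close>. In velocity coordinates \<open>z = r * v\<close>
  the squared kernel integrates in time to \<open>1 / (2 * pi * v\<^sup>2)\<close>, whose mass on
  velocities above \<open>\<alpha>\<close> is \<open>1 / (2 * pi * \<alpha>)\<close>. In both cases
  \<open>\<kappa>\<close> drops out.\<close>

definition truncated_weight :: "real \<Rightarrow> nat \<Rightarrow> real \<Rightarrow> real" where
  "truncated_weight \<epsilon> m x = (x\<^sup>2 / (1 + \<epsilon> * x\<^sup>2)) ^ m"

text \<open>For fixed \<open>\<epsilon>\<close> this grows only quadratically, so it is integrable
  as soon as the second moment is finite; as \<open>\<epsilon>\<close> decreases to 0 it increases
  to the power \<open>2 * m + 2\<close>.\<close>

definition truncated_power :: "real \<Rightarrow> nat \<Rightarrow> real \<Rightarrow> real" where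
  "truncated_power \<epsilon> m x = x\<^sup>2 * truncated_weight \<epsilon> m x"

text \<open>The term in \<open>f\<close> that Young's inequality with weight \<open>q\<close>
  produces, see \<open>truncated_weight_young\<close>; without truncation it would be the power
  \<open>2 * m + 2\<close> of \<open>f\<close> divided by \<open>q ^ m\<close>. For
  \<open>f = 0\<close> it vanishes even when \<open>q = 0\<close>.\<close>

definition weighted_power :: "real \<Rightarrow> nat \<Rightarrow> real \<Rightarrow> real \<Rightarrow> real" where
  "weighted_power \<epsilon> m q f = f\<^sup>2 * (f\<^sup>2 / (q + \<epsilon> * f\<^sup>2)) ^ m"

lemma one_plus_pos: "\<epsilon> > 0 \<Longrightarrow> 1 + \<epsilon> * (x::real)\<^sup>2 > 0"
  by (smt (verit) mult_nonneg_nonneg zero_le_power2)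

lemma truncated_weight_nonneg: "\<epsilon> > 0 \<Longrightarrow> 0 \<le> truncated_weight \<epsilon> m x"
  unfolding truncated_weight_def using one_plus_pos[of \<epsilon> x] by simp

lemma truncated_power_nonneg: "\<epsilon> > 0 \<Longrightarrow> 0 \<le> truncated_power \<epsilon> m x"
  unfolding truncated_power_def using truncated_weight_nonneg[of \<epsilon> m x] by simp

lemma weighted_power_nonneg: "\<epsilon> > 0 \<Longrightarrow> q \<ge> 0 \<Longrightarrow> 0 \<le> weighted_power \<epsilon> m q f"
  unfolding weighted_power_def by simp

lemma measurable_truncated_weight[measurable]: "truncated_weight \<epsilon> m \<in> borel_measurable borel"
  unfolding truncated_weight_def[abs_def] by measurable

lemma measurable_truncated_power[measurable]: "truncated_power \<epsilon> m \<in> borel_measurable borel"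
  unfolding truncated_power_def[abs_def] by measurable

lemma measurable_weighted_power[measurable (raw)]:
  assumes [measurable]: "f \<in> borel_measurable N" "g \<in> borel_measurable N" 
  shows "(\<lambda>x. weighted_power \<epsilon> m (f x) (g x)) \<in> borel_measurable N"
  unfolding weighted_power_def by measurable

lemma truncated_weight_le_const: 
  assumes "\<epsilon> > 0" shows "truncated_weight \<epsilon> m x \<le> (1/\<epsilon>) ^ m"
proof -
  have "x\<^sup>2 / (1 + \<epsilon> * x\<^sup>2) \<le> 1/\<epsilon>"
    using assms one_plus_pos[OF assms, of x] by (simp add: field_simps)
  then show ?thesis unfolding truncated_weight_def
    using one_plus_pos[OF assms, of x] by (intro power_mono) auto
qed

lemma truncated_weight_le_power: 
  assumes "\<epsilon> > 0" shows "truncated_weight \<epsilon> m x \<le> x ^ (2*m)"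
proof -
  have "x\<^sup>2 / (1 + \<epsilon> * x\<^sup>2) \<le> x\<^sup>2"
    using assms one_plus_pos[OF assms, of x] by (simp add: divide_le_eq mult_le_cancel_left1)
  then show ?thesis unfolding truncated_weight_def power_mult
    using one_plus_pos[OF assms, of x] by (intro power_mono) auto
qed

lemma truncated_power_le_const: "\<epsilon> > 0 \<Longrightarrow> truncated_power \<epsilon> m x \<le> (1/\<epsilon>) ^ m * x\<^sup>2"
  unfolding truncated_power_def using mult_left_mono[OF truncated_weight_le_const[of \<epsilon> m x], of "x\<^sup>2"]
  by (simp add: mult.commute)

lemma truncated_power_le_power: "\<epsilon> > 0 \<Longrightarrow> truncated_power \<epsilon> m x \<le> x ^ (2*m+2)"
  unfolding truncated_power_def using mult_left_mono[OF truncated_weight_le_power[of \<epsilon> m x], of "x\<^sup>2"]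
  by (simp add: power_add power2_eq_square mult_ac)

lemma ratio_mono:
  assumes "\<epsilon> > 0" "0 \<le> (a::real)" "a \<le> b" 
  shows "a / (1 + \<epsilon> * a) \<le> b / (1 + \<epsilon> * b)"
proof -
  have "1 + \<epsilon> * a > 0" "1 + \<epsilon> * b > 0"
    using assms by (smt (verit) mult_nonneg_nonneg)+
  then show ?thesis using assms by (simp add: divide_simps) (simp add: algebra_simps)
qed

lemma truncated_weight_mono:
  assumes "\<epsilon> > 0" "\<bar>x\<bar> \<le> \<bar>y\<bar>"
  shows "truncated_weight \<epsilon> m x \<le> truncated_weight \<epsilon> m y"
  unfolding truncated_weight_def 
  using ratio_mono[OF assms(1), of "x\<^sup>2" "y\<^sup>2"] assms one_plus_pos[OF assms(1), of x]
  by (intro power_mono) (auto simp: abs_le_square_iff)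

text \<open>Enlarging the argument only enlarges the denominator, so the factor is that of the
  untruncated power. It does not depend on \<epsilon>, and neither do the constants of the additive
  bounds built on it.\<close>

lemma truncated_weight_scale:
  assumes "\<epsilon> > 0" "c \<ge> 1"
  shows "truncated_weight \<epsilon> m (c * x) \<le> c ^ (2*m) * truncated_weight \<epsilon> m x"
proof -
  have c: "c\<^sup>2 \<ge> 1" using assms by simp
  have "1 + \<epsilon> * x\<^sup>2 \<le> 1 + \<epsilon> * (c*x)\<^sup>2"
    using mult_right_mono[OF c, of "\<epsilon> * x\<^sup>2"] assms by (simp add: power_mult_distrib mult_ac)
  then have "(c*x)\<^sup>2 / (1 + \<epsilon> * (c*x)\<^sup>2) \<le> (c*x)\<^sup>2 / (1 + \<epsilon> * x\<^sup>2)"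
    using one_plus_pos[OF assms(1), of x] by (intro divide_left_mono mult_pos_pos) auto
  also have "\<dots> = c\<^sup>2 * (x\<^sup>2 / (1 + \<epsilon> * x\<^sup>2))" by (simp add: power_mult_distrib)
  finally have "((c*x)\<^sup>2 / (1 + \<epsilon> * (c*x)\<^sup>2))^m \<le> (c\<^sup>2 * (x\<^sup>2 / (1 + \<epsilon> * x\<^sup>2)))^m"
    using one_plus_pos[OF assms(1), of "c*x"] by (intro power_mono) auto
  also have "\<dots> = c ^ (2*m) * (x\<^sup>2 / (1 + \<epsilon> * x\<^sup>2))^m"
    by (simp only: power_mult power_mult_distrib)
  finally show ?thesis unfolding truncated_weight_def .
qed

lemma truncated_power_mono:
  assumes "\<epsilon> > 0" "\<bar>x\<bar> \<le> \<bar>y\<bar>"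
  shows "truncated_power \<epsilon> m x \<le> truncated_power \<epsilon> m y"
  unfolding truncated_power_def using truncated_weight_mono[OF assms] assms
  by (intro mult_mono truncated_weight_nonneg) (auto simp: abs_le_square_iff)

lemma truncated_power_scale:
  assumes "\<epsilon> > 0" "c \<ge> 1"
  shows "truncated_power \<epsilon> m (c * x) \<le> c ^ (2*m+2) * truncated_power \<epsilon> m x"
proof -
  have "(c*x)\<^sup>2 * truncated_weight \<epsilon> m (c * x) \<le> (c*x)\<^sup>2 * (c ^ (2*m) * truncated_weight \<epsilon> m x)"
    by (rule mult_left_mono[OF truncated_weight_scale[OF assms]]) simp
  also have "\<dots> = c ^ (2*m+2) * (x\<^sup>2 * truncated_weight \<epsilon> m x)"
    by (simp add: power_mult_distrib power_add power2_eq_square)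
  finally show ?thesis unfolding truncated_power_def .
qed

text \<open>The sum is at most twice the larger of the two arguments in absolute value, so
  monotonicity and scaling by 2 suffice. The same argument serves \<open>truncated_power_add\<close>
  and \<open>weighted_power_add\<close>.\<close>

lemma truncated_weight_add:
  assumes "\<epsilon> > 0"
  shows "truncated_weight \<epsilon> m (a + b) \<le> 4 ^ m * (truncated_weight \<epsilon> m a + truncated_weight \<epsilon> m b)"
proof -
  define c where "c = (if \<bar>a\<bar> \<le> \<bar>b\<bar> then b else a)"
  have "truncated_weight \<epsilon> m (a + b) \<le> truncated_weight \<epsilon> m (2 * c)"
    by (rule truncated_weight_mono[OF assms]) (auto simp: c_def)
  also have "\<dots> \<le> 4 ^ m * truncated_weight \<epsilon> m c"
    using truncated_weight_scale[OF assms, of 2 m c] by (simp add: power_mult)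
  also have "\<dots> \<le> 4 ^ m * (truncated_weight \<epsilon> m a + truncated_weight \<epsilon> m b)"
    using truncated_weight_nonneg[OF assms] by (auto simp: c_def)
  finally show ?thesis .
qed

lemma truncated_power_add:
  assumes "\<epsilon> > 0"
  shows "truncated_power \<epsilon> m (a + b) \<le> 4 ^ (m+1) * (truncated_power \<epsilon> m a + truncated_power \<epsilon> m b)"
proof -
  define c where "c = (if \<bar>a\<bar> \<le> \<bar>b\<bar> then b else a)"
  have "truncated_power \<epsilon> m (a + b) \<le> truncated_power \<epsilon> m (2 * c)"
    by (rule truncated_power_mono[OF assms]) (auto simp: c_def)
  also have "\<dots> \<le> 4 ^ (m+1) * truncated_power \<epsilon> m c"
    using truncated_power_scale[OF assms, of 2 m c] by (simp add: power_mult)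
  also have "\<dots> \<le> 4 ^ (m+1) * (truncated_power \<epsilon> m a + truncated_power \<epsilon> m b)"
    using truncated_power_nonneg[OF assms] by (auto simp: c_def)
  finally show ?thesis .
qed

lemma weighted_power_mono:
  assumes "\<epsilon> > 0" "q \<ge> 0" "\<bar>x\<bar> \<le> \<bar>y\<bar>"
  shows "weighted_power \<epsilon> m q x \<le> weighted_power \<epsilon> m q y"
proof (cases "x = 0")
  case True then show ?thesis using assms weighted_power_nonneg by (auto simp: weighted_power_def)
next
  case False
  have xy: "x\<^sup>2 \<le> y\<^sup>2" using assms by (simp add: abs_le_square_iff)
  have "x\<^sup>2 > 0" using False by simp
  then have p: "q + \<epsilon> * x\<^sup>2 > 0" "q + \<epsilon> * y\<^sup>2 > 0" 
    using xy assms by (smt (verit) mult_pos_pos)+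
  have "q * x\<^sup>2 \<le> q * y\<^sup>2" using xy assms by (simp add: mult_left_mono)
  then have "x\<^sup>2 / (q + \<epsilon> * x\<^sup>2) \<le> y\<^sup>2 / (q + \<epsilon> * y\<^sup>2)"
    using p by (simp add: divide_simps) (simp add: algebra_simps)
  then have "(x\<^sup>2 / (q + \<epsilon> * x\<^sup>2))^m \<le> (y\<^sup>2 / (q + \<epsilon> * y\<^sup>2))^m"
    using p by (intro power_mono) auto
  then show ?thesis unfolding weighted_power_def
    using xy p by (intro mult_mono) auto
qed

lemma weighted_power_le_const:
  assumes "\<epsilon> > 0" "q \<ge> 0"
  shows "weighted_power \<epsilon> m q f \<le> (1/\<epsilon>) ^ m * f\<^sup>2"
proof (cases "f = 0")
  case False
  then have "f\<^sup>2 > 0" by simp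
  then have p: "q + \<epsilon> * f\<^sup>2 > 0" using assms by (smt (verit) mult_pos_pos)
  have "f\<^sup>2 / (q + \<epsilon> * f\<^sup>2) \<le> 1/\<epsilon>" using p assms by (simp add: field_simps)
  then have "(f\<^sup>2 / (q + \<epsilon> * f\<^sup>2))^m \<le> (1/\<epsilon>)^m" using p by (intro power_mono) auto
  then have "f\<^sup>2 * (f\<^sup>2 / (q + \<epsilon> * f\<^sup>2))^m \<le> f\<^sup>2 * (1/\<epsilon>)^m" by (rule mult_left_mono) simp
  then show ?thesis unfolding weighted_power_def by (simp only: mult.commute)
qed (simp add: weighted_power_def)

lemma weighted_power_add:
  assumes "\<epsilon> > 0" "q \<ge> 0"
  shows "weighted_power \<epsilon> m q (a + b) \<le> 4 ^ (m+1) * (weighted_power \<epsilon> m q a + weighted_power \<epsilon> m q b)"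
proof -
  define c where "c = (if \<bar>a\<bar> \<le> \<bar>b\<bar> then b else a)"
  have "weighted_power \<epsilon> m q (a + b) \<le> weighted_power \<epsilon> m q (2 * c)"
    by (rule weighted_power_mono[OF assms]) (auto simp: c_def)
  also have "\<dots> \<le> 4 ^ (m+1) * weighted_power \<epsilon> m q c"
  proof (cases "c = 0")
    case False
    then have "c\<^sup>2 > 0" by simp
    then have p: "q + \<epsilon> * c\<^sup>2 > 0" using assms by (smt (verit) mult_pos_pos)
    have "q + \<epsilon> * c\<^sup>2 \<le> q + \<epsilon> * (2*c)\<^sup>2" using assms by (simp add: power_mult_distrib)
    then have "(2*c)\<^sup>2 / (q + \<epsilon> * (2*c)\<^sup>2) \<le> (2*c)\<^sup>2 / (q + \<epsilon> * c\<^sup>2)"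
      using p by (intro divide_left_mono mult_pos_pos) auto
    then have "((2*c)\<^sup>2 / (q + \<epsilon> * (2*c)\<^sup>2))^m \<le> ((2*c)\<^sup>2 / (q + \<epsilon> * c\<^sup>2))^m"
      using assms by (intro power_mono) auto
    also have "\<dots> = 4^m * (c\<^sup>2 / (q + \<epsilon> * c\<^sup>2))^m"
      by (simp add: power_mult_distrib power_divide)
    finally show ?thesis unfolding weighted_power_def
      using mult_left_mono[of _ _ "4 * c\<^sup>2"] by (fastforce simp: power_mult_distrib mult_ac)
  qed (simp add: weighted_power_def)
  also have "\<dots> \<le> 4 ^ (m+1) * (weighted_power \<epsilon> m q a + weighted_power \<epsilon> m q b)"
    using weighted_power_nonneg[OF assms] by (auto simp: c_def)
  finally show ?thesis .
qed

text \<open>Either \<open>f\<^sup>2\<close> is at most \<open>q * z\<^sup>2\<close> and can be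
  replaced by it, or \<open>q * z\<^sup>2\<close> is smaller than \<open>f\<^sup>2\<close> and the
  weight of \<open>z\<close> is dominated by the quotient in \<open>weighted_power\<close>. The case
  \<open>q = 0\<close> is covered by the second alternative or is trivial.\<close>

lemma truncated_weight_young:
  assumes "\<epsilon> > 0" "q \<ge> 0"
  shows "truncated_weight \<epsilon> m z * f\<^sup>2 \<le> q * truncated_power \<epsilon> m z + weighted_power \<epsilon> m q f"
proof (cases "f\<^sup>2 \<le> q * z\<^sup>2")
  case True
  then have "truncated_weight \<epsilon> m z * f\<^sup>2 \<le> truncated_weight \<epsilon> m z * (q * z\<^sup>2)"
    using truncated_weight_nonneg[OF assms(1)] by (intro mult_left_mono)
  then show ?thesis using weighted_power_nonneg[OF assms, of m f] unfolding truncated_power_def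
    by (simp add: mult_ac)
next
  case False
  have "q * z\<^sup>2 \<ge> 0" using assms by simp
  then have f: "f\<^sup>2 > 0" using False by linarith
  then have p: "q + \<epsilon> * f\<^sup>2 > 0" using assms by (smt (verit) mult_pos_pos)
  have "z\<^sup>2 / (1 + \<epsilon> * z\<^sup>2) \<le> f\<^sup>2 / (q + \<epsilon> * f\<^sup>2)"
    using p one_plus_pos[OF assms(1), of z] False by (simp add: divide_simps) (simp add: algebra_simps)
  then have "truncated_weight \<epsilon> m z \<le> (f\<^sup>2 / (q + \<epsilon> * f\<^sup>2))^m"
    unfolding truncated_weight_def using one_plus_pos[OF assms(1), of z] by (intro power_mono) auto
  then have "f\<^sup>2 * truncated_weight \<epsilon> m z \<le> f\<^sup>2 * (f\<^sup>2 / (q + \<epsilon> * f\<^sup>2))^m"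
    by (rule mult_left_mono) simp
  then have "truncated_weight \<epsilon> m z * f\<^sup>2 \<le> weighted_power \<epsilon> m q f"
    unfolding weighted_power_def by (simp only: mult.commute)
  moreover have "q * truncated_power \<epsilon> m z \<ge> 0" using assms truncated_power_nonneg by simp
  ultimately show ?thesis by linarith
qed

section \<open>Derivatives and Taylor expansion of the truncated powers\<close>

definition truncated_power_deriv :: "real \<Rightarrow> nat \<Rightarrow> real \<Rightarrow> real" where
  "truncated_power_deriv \<epsilon> m x = 2 * x * truncated_weight \<epsilon> m x * (1 + m / (1 + \<epsilon> * x\<^sup>2))"

lemma measurable_truncated_power_deriv[measurable]: "truncated_power_deriv \<epsilon> m \<in> borel_measurable borel"
  unfolding truncated_power_deriv_def[abs_def] by measurable

lemma truncated_power_deriv_bound: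
  assumes "\<epsilon> > 0"
  shows "\<bar>truncated_power_deriv \<epsilon> m x\<bar> \<le> 2 * (1/\<epsilon>)^m * (1 + real m) * \<bar>x\<bar>"
proof -
  have "m / (1 + \<epsilon> * x\<^sup>2) \<le> m" using assms by (simp add: divide_le_eq one_plus_pos mult_le_cancel_left1)
  then have "\<bar>x\<bar> * (truncated_weight \<epsilon> m x * (1 + m / (1 + \<epsilon> * x\<^sup>2))) \<le> \<bar>x\<bar> * ((1/\<epsilon>)^m * (1 + m))"
    using truncated_weight_le_const[OF assms, of m x] truncated_weight_nonneg[OF assms, of m x] one_plus_pos[OF assms, of x] assms
    by (intro mult_mono mult_left_mono) auto
  then show ?thesis unfolding truncated_power_deriv_def abs_mult
    using truncated_weight_nonneg[OF assms, of m x] one_plus_pos[OF assms, of x] by (simp add: mult_ac)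
qed

text \<open>The extra factor \<open>x\<close> keeps the whole weight as a factor of the derivative;
  differentiating the weight alone would lower its order. Two such factors give
  \<open>truncated_power\<close>.\<close>

lemma has_derivative_truncated_weight:
  assumes "\<epsilon> > 0"
  shows "((\<lambda>x. x * truncated_weight \<epsilon> m x) has_real_derivative truncated_weight \<epsilon> m x * (1 + 2 * real m / (1 + \<epsilon> * x\<^sup>2))) (at x)"
proof (cases m)
  case 0 then show ?thesis unfolding truncated_weight_def by simp
next
  case (Suc k)
  have p: "1 + \<epsilon> * x\<^sup>2 \<noteq> 0" using one_plus_pos[OF assms, of x] by simp
  show ?thesis unfolding truncated_weight_def Suc
    apply (rule derivative_eq_intros p | simp add: p)+
    using p apply (simp add: divide_simps power2_eq_square)
    apply (simp add: algebra_simps)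
    done
qed

lemma has_derivative_truncated_power:
  assumes "\<epsilon> > 0"
  shows "(truncated_power \<epsilon> m has_real_derivative truncated_power_deriv \<epsilon> m x) (at x)"
proof -
  have p: "1 + \<epsilon> * x\<^sup>2 \<noteq> 0" using one_plus_pos[OF assms, of x] by simp
  have eq: "truncated_power \<epsilon> m = (\<lambda>x. x * (x * truncated_weight \<epsilon> m x))"
    by (simp add: truncated_power_def fun_eq_iff power2_eq_square)
  show ?thesis unfolding eq truncated_power_deriv_def
    apply (rule DERIV_cong[OF DERIV_mult[OF DERIV_ident has_derivative_truncated_weight[OF assms]]])
    using p by (simp add: field_simps)
qed

definition truncated_power_deriv2 :: "real \<Rightarrow> nat \<Rightarrow> real \<Rightarrow> real" where
  "truncated_power_deriv2 \<epsilon> m x = 2 * truncated_weight \<epsilon> m x * 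
     ((1 + 2 * real m / (1 + \<epsilon> * x\<^sup>2)) * (1 + m / (1 + \<epsilon> * x\<^sup>2)) - 2 * real m * \<epsilon> * x\<^sup>2 / (1 + \<epsilon> * x\<^sup>2)\<^sup>2)"

lemma has_derivative_truncated_power_deriv:
  assumes "\<epsilon> > 0"
  shows "(truncated_power_deriv \<epsilon> m has_real_derivative truncated_power_deriv2 \<epsilon> m x) (at x)"
proof -
  have p: "1 + \<epsilon> * x\<^sup>2 \<noteq> 0" using one_plus_pos[OF assms, of x] by simp
  have eq: "truncated_power_deriv \<epsilon> m = (\<lambda>x. (x * truncated_weight \<epsilon> m x) * (2 * (1 + m / (1 + \<epsilon> * x\<^sup>2))))"
    by (simp add: truncated_power_deriv_def fun_eq_iff)
  have d: "((\<lambda>x. 2 * (1 + m / (1 + \<epsilon> * x\<^sup>2))) has_real_derivative - 4 * real m * \<epsilon> * x / (1 + \<epsilon> * x\<^sup>2)\<^sup>2) (at x)"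
    by (rule derivative_eq_intros p refl | simp add: p)+ (simp add: power2_eq_square)
  show ?thesis unfolding eq truncated_power_deriv2_def
    apply (rule DERIV_cong[OF DERIV_mult[OF has_derivative_truncated_weight[OF assms] d]])
    using p by (simp add: algebra_simps power2_eq_square)
qed

lemma truncated_power_deriv2_le:
  assumes "\<epsilon> > 0"
  shows "truncated_power_deriv2 \<epsilon> m x \<le> 2 * (1 + 2 * real m) * (1 + real m) * truncated_weight \<epsilon> m x"
proof -
  define d where "d = 1 + \<epsilon> * x\<^sup>2"
  have d: "d \<ge> 1" using assms by (simp add: d_def)
  have a: "m / d \<le> m" "2 * real m / d \<le> 2 * real m" using d by (auto simp: divide_le_eq mult_le_cancel_left1)
  have "(1 + 2 * real m / d) * (1 + m / d) - 2 * real m * \<epsilon> * x\<^sup>2 / d\<^sup>2 \<le> (1 + 2 * real m / d) * (1 + m / d)"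
    using assms by simp
  also have "\<dots> \<le> (1 + 2 * real m) * (1 + real m)" using a d by (intro mult_mono) auto
  finally have "2 * truncated_weight \<epsilon> m x * ((1 + 2 * real m / d) * (1 + m / d) - 2 * real m * \<epsilon> * x\<^sup>2 / d\<^sup>2)
     \<le> 2 * truncated_weight \<epsilon> m x * ((1 + 2 * real m) * (1 + real m))"
    using truncated_weight_nonneg[OF assms, of m x] by (intro mult_left_mono) auto
  then show ?thesis unfolding truncated_power_deriv2_def d_def by (simp only: mult_ac)
qed

text \<open>The Lagrange remainder involves the weight at an intermediate point. It is bounded by
  the weights at \<open>z\<close> and at \<open>h\<close>: the first yields the quadratic variation
  term, the second a truncated power of the increment, which is of higher order in the step
  size.\<close>

lemma truncated_power_taylor:
  assumes "\<epsilon> > 0"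
  shows "truncated_power \<epsilon> m (z + h) \<le> truncated_power \<epsilon> m z + truncated_power_deriv \<epsilon> m z * h
     + (1 + 2 * real m) * (1 + real m) * 4 ^ m * (truncated_weight \<epsilon> m z + truncated_weight \<epsilon> m h) * h\<^sup>2"
proof -
  \<comment> \<open>The function and its first two derivatives along the segment from
    \<open>z\<close> to \<open>z + h\<close>, parametrised by the unit interval.\<close>
  define df where "df k t = (case k of 0 \<Rightarrow> truncated_power \<epsilon> m (z + t * h)
     | Suc 0 \<Rightarrow> truncated_power_deriv \<epsilon> m (z + t * h) * h 
     | _ \<Rightarrow> truncated_power_deriv2 \<epsilon> m (z + t * h) * h\<^sup>2)" for k :: nat and t
  have "\<exists>t>0. t < 1 \<and> truncated_power \<epsilon> m (z + 1 * h) = (\<Sum>k<2. df k 0 / fact k * 1 ^ k) + df 2 t / fact 2 * 1 ^ 2"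
  proof (rule Maclaurin)
    show "\<forall>k t. k < 2 \<and> 0 \<le> t \<and> t \<le> 1 \<longrightarrow> DERIV (df k) t :> df (Suc k) t"
    proof (intro allI impI)
      fix k :: nat and t :: real assume "k < 2 \<and> 0 \<le> t \<and> t \<le> 1"
      then consider "k = 0" | "k = 1" by linarith
      then show "DERIV (df k) t :> df (Suc k) t"
      proof cases
        case 1
        have "((\<lambda>t. truncated_power \<epsilon> m (z + t * h)) has_real_derivative truncated_power_deriv \<epsilon> m (z + t * h) * h) (at t)"
          by (rule DERIV_chain2[OF has_derivative_truncated_power[OF assms]]) (auto intro!: derivative_eq_intros)
        then show ?thesis unfolding 1 df_def by simp
      next
        case 2
        have "((\<lambda>t. truncated_power_deriv \<epsilon> m (z + t * h) * h) has_real_derivative truncated_power_deriv2 \<epsilon> m (z + t * h) * h * h) (at t)"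
          by (rule DERIV_cmult_right, rule DERIV_chain2[OF has_derivative_truncated_power_deriv[OF assms]])
            (auto intro!: derivative_eq_intros)
        then show ?thesis unfolding 2 df_def by (simp add: power2_eq_square mult.assoc)
      qed
    qed
  qed (auto simp: df_def)
  then obtain t where t: "0 < t" "t < 1" and
    eq: "truncated_power \<epsilon> m (z + h) = truncated_power \<epsilon> m z + truncated_power_deriv \<epsilon> m z * h 
      + truncated_power_deriv2 \<epsilon> m (z + t * h) * h\<^sup>2 / 2"
    by (auto simp: df_def numeral_2_eq_2)
  have "truncated_power_deriv2 \<epsilon> m (z + t * h) \<le> 2 * (1 + 2 * real m) * (1 + real m) * truncated_weight \<epsilon> m (z + t * h)"
    by (rule truncated_power_deriv2_le[OF assms])
  also have "\<dots> \<le> 2 * (1 + 2 * real m) * (1 + real m) * (4 ^ m * (truncated_weight \<epsilon> m z + truncated_weight \<epsilon> m (t * h)))"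
    by (rule mult_left_mono[OF truncated_weight_add[OF assms]]) simp
  also have "\<dots> \<le> 2 * (1 + 2 * real m) * (1 + real m) * (4 ^ m * (truncated_weight \<epsilon> m z + truncated_weight \<epsilon> m h))"
    using t by (intro mult_left_mono add_left_mono truncated_weight_mono[OF assms]) 
      (auto simp: abs_mult mult_le_cancel_right1 mult_left_le_one_le)
  finally have "truncated_power_deriv2 \<epsilon> m (z + t * h) * h\<^sup>2 
     \<le> 2 * (1 + 2 * real m) * (1 + real m) * (4 ^ m * (truncated_weight \<epsilon> m z + truncated_weight \<epsilon> m h)) * h\<^sup>2"
    by (rule mult_right_mono) simp
  then show ?thesis unfolding eq by (simp add: algebra_simps)
qed

section \<open>Increments of the white noise\<close>

locale noise = prob_space M for M :: "'a measure" +
  fixes F :: "real \<Rightarrow> 'a measure" and W :: "real \<Rightarrow> real set \<Rightarrow> 'a \<Rightarrow> real"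
  assumes filt: "filtration_on M F" and white: "white_noise M F W"
begin

abbreviation dW :: "real \<Rightarrow> real \<Rightarrow> real set \<Rightarrow> 'a \<Rightarrow> real" where
  "dW s t A \<omega> \<equiv> W t A \<omega> - W s A \<omega>"

lemma F_subalgebra: "subalgebra M (F t)"
  using filt unfolding filtration_on_def by blast

lemma F_measurable_M: "X \<in> borel_measurable (F t) \<Longrightarrow> X \<in> borel_measurable M"
  using measurable_from_subalg[OF F_subalgebra] .

lemma F_measurable_mono: "X \<in> borel_measurable (F s) \<Longrightarrow> s \<le> t \<Longrightarrow> X \<in> borel_measurable (F t)"
  using filt unfolding filtration_on_def subalgebra_def
  by (intro measurable_from_subalg[of "F t" "F s"]) (auto simp: subalgebra_def)

lemma W_measurable_F: "0 \<le> s \<Longrightarrow> s \<le> t \<Longrightarrow> A \<in> fin_borel \<Longrightarrow> W s A \<in> borel_measurable (F t)"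
  by (rule F_measurable_mono[of _ s], rule white[unfolded white_noise_def, THEN conjunct1, rule_format])

lemmas W_additive = white[unfolded white_noise_def, THEN conjunct2, THEN conjunct2, THEN conjunct1, rule_format]

lemmas dW_joint = white[unfolded white_noise_def, THEN conjunct2, THEN conjunct2, THEN conjunct2, rule_format]

lemma W_measurable: "0 \<le> s \<Longrightarrow> A \<in> fin_borel \<Longrightarrow> W s A \<in> borel_measurable M"
  using W_measurable_F[of s s A] F_measurable_M by simp

lemma dW_distribution:
  assumes "0 \<le> s" "s \<le> t" "A \<in> fin_borel"
  shows "if (t - s) * measure lborel A > 0
      then distributed M lborel (dW s t A) (\<lambda>x. ennreal (normal_density 0 (sqrt ((t - s) * measure lborel A)) x))
      else (AE \<omega> in M. dW s t A \<omega> = 0)"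
proof -
  have "finite {A}" "{A} \<subseteq> fin_borel" "disjoint {A}" using assms by auto
  from dW_joint[OF assms(1,2) this, THEN conjunct2, THEN conjunct2] show ?thesis by simp
qed

lemma dW_power_integrable:
  assumes "0 \<le> s" "s \<le> t" "A \<in> fin_borel"
  shows "integrable M (\<lambda>\<omega>. dW s t A \<omega> ^ k)"
proof -
  have [measurable]: "dW s t A \<in> borel_measurable M"
    using W_measurable assms by auto
  let ?v = "(t - s) * measure lborel A"
  show ?thesis
  proof (cases "?v > 0")
    case True
    then have D: "distributed M lborel (dW s t A) (\<lambda>x. ennreal (normal_density 0 (sqrt ?v) x))"
      using dW_distribution[OF assms] by simp
    have "integrable lborel (\<lambda>x. normal_density 0 (sqrt ?v) x * x ^ k)"
      using integrable_normal_moment[of "sqrt ?v" 0 k] True by simp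
    then show ?thesis using distributed_integrable[OF D, of "\<lambda>x. x ^ k"] by simp
  next
    case False
    then have "AE \<omega> in M. dW s t A \<omega> = 0" using dW_distribution[OF assms] by simp
    then have "AE \<omega> in M. (0::real) ^ k = dW s t A \<omega> ^ k" by auto
    then show ?thesis by (rule integrable_cong_AE_imp[rotated 2]) auto
  qed
qed

lemma dW_integrable:
  assumes "0 \<le> s" "s \<le> t" "A \<in> fin_borel"
  shows "integrable M (dW s t A)"
  using dW_power_integrable[OF assms, of 1] by simp

lemma dW_expectation:
  assumes "0 \<le> s" "s \<le> t" "A \<in> fin_borel"
  shows "expectation (dW s t A) = 0"
proof -
  let ?v = "(t - s) * measure lborel A"
  show ?thesis
  proof (cases "?v > 0")
    case True
    then have D: "distributed M lborel (dW s t A) (\<lambda>x. ennreal (normal_density 0 (sqrt ?v) x))"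
      using dW_distribution[OF assms] by simp
    show ?thesis
      using normal_distributed_expectation[OF _ D] True by simp
  next
    case False
    then have "AE \<omega> in M. dW s t A \<omega> = 0" using dW_distribution[OF assms] by simp
    then show ?thesis by (rule integral_eq_zero_AE)
  qed
qed

lemma dW_even_moment:
  assumes "0 \<le> s" "s \<le> t" "A \<in> fin_borel"
  shows "expectation (\<lambda>\<omega>. dW s t A \<omega> ^ (2 * k)) = fact (2 * k) / (2 ^ k * fact k) * ((t - s) * measure lborel A) ^ k"
proof -
  have [measurable]: "dW s t A \<in> borel_measurable M"
    using W_measurable assms by auto
  let ?v = "(t - s) * measure lborel A"
  show ?thesis
  proof (cases "?v > 0")
    case True
    then have D: "distributed M lborel (dW s t A) (\<lambda>x. ennreal (normal_density 0 (sqrt ?v) x))"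
      using dW_distribution[OF assms] by simp
    have "expectation (\<lambda>\<omega>. dW s t A \<omega> ^ (2 * k)) = (\<integral>x. normal_density 0 (sqrt ?v) x * x ^ (2 * k) \<partial>lborel)"
      using distributed_integral[OF D, of "\<lambda>x. x ^ (2 * k)"] by simp
    also have "\<dots> = fact (2 * k) / ((2 / (sqrt ?v)\<^sup>2)^k * fact k)"
      using integral_normal_moment_even[of "sqrt ?v" 0 k] True by simp
    also have "\<dots> = fact (2 * k) / (2 ^ k * fact k) * ?v ^ k"
      using True by (simp add: power_divide)
    finally show ?thesis .
  next
    case False
    then have z: "?v = 0" using assms by (smt (verit) measure_nonneg mult_nonneg_nonneg)
    have ae: "AE \<omega> in M. dW s t A \<omega> = 0" using dW_distribution[OF assms] False by simp
    have "expectation (\<lambda>\<omega>. dW s t A \<omega> ^ (2 * k)) = expectation (\<lambda>\<omega>. 0 ^ (2 * k))"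
      by (rule integral_cong_AE) (use ae in auto)
    then show ?thesis unfolding z by (cases k) (auto simp: prob_space)
  qed
qed

lemma dW_variance:
  assumes "0 \<le> s" "s \<le> t" "A \<in> fin_borel"
  shows "expectation (\<lambda>\<omega>. dW s t A \<omega> * dW s t A \<omega>) = (t - s) * measure lborel A"
  using dW_even_moment[OF assms, of 1] by (simp add: power2_eq_square)

lemma dW_product:
  assumes "0 \<le> s" "s \<le> t" "A \<in> fin_borel" "B \<in> fin_borel" "A \<inter> B = {}" "A \<noteq> B"
  shows "expectation (\<lambda>\<omega>. dW s t A \<omega> * dW s t B \<omega>) = 0" "integrable M (\<lambda>\<omega>. dW s t A \<omega> * dW s t B \<omega>)"
proof -
  have "finite {A, B}" "{A, B} \<subseteq> fin_borel" "disjoint {A, B}" using assms by (auto simp: disjoint_def)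
  note i = dW_joint[OF assms(1,2) this, THEN conjunct1]
  have int: "integrable M (dW s t C)" if "C \<in> {A, B}" for C
    using that dW_integrable[OF assms(1,2)] assms(3,4) by blast
  have eq: "(\<Prod>C\<in>{A, B}. dW s t C \<omega>) = dW s t A \<omega> * dW s t B \<omega>" for \<omega>
    using assms(6) by simp
  show "integrable M (\<lambda>\<omega>. dW s t A \<omega> * dW s t B \<omega>)"
    using indep_vars_integrable[OF _ i int] unfolding eq by simp
  show "expectation (\<lambda>\<omega>. dW s t A \<omega> * dW s t B \<omega>) = 0"
    using indep_vars_lebesgue_integral[OF _ i int] dW_expectation[OF assms(1-3)] assms(6) unfolding eq by simp
qed

lemma dW_product_integrable:
  assumes "0 \<le> s" "s \<le> t" "A \<in> J" "B \<in> J" "disjoint J" "J \<subseteq> fin_borel"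
  shows "integrable M (\<lambda>\<omega>. dW s t A \<omega> * dW s t B \<omega>)"
proof (cases "A = B")
  case True
  have "A \<in> fin_borel" by (rule subsetD[OF assms(6,3)])
  then show ?thesis using dW_power_integrable[OF assms(1,2), of A 2] True by (simp add: power2_eq_square)
next
  case False
  have "A \<in> fin_borel" "B \<in> fin_borel" using subsetD[OF assms(6)] assms(3,4) by simp_all
  moreover have "A \<inter> B = {}" by (rule disjointD[OF assms(5,3,4) False])
  ultimately  show ?thesis using dW_product(2)[OF assms(1,2)] False by simp
qed

text \<open>Independence is assumed between the past and the sigma-algebra generated by all
  increments over \<open>J\<close>; hence it also holds for functions of several increments, such as
  the products in \<open>mult_dW_dW\<close>.\<close>

lemma dW_independent:
  assumes "0 \<le> s" "s \<le> t" "finite J" "J \<subseteq> fin_borel" "disjoint J"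
    and G: "G \<in> borel_measurable (F s)"
    and H: "H \<in> borel_measurable (sigma (space M) (\<Union>A\<in>J. {dW s t A -` B \<inter> space M | B. B \<in> sets borel}))"
  shows "indep_var borel G borel H"
proof -
  let ?S = "\<Union>A\<in>J. {dW s t A -` B \<inter> space M | B. B \<in> sets borel}"
  note ind = dW_joint[OF assms(1-5), THEN conjunct2, THEN conjunct1]
  have Ssub: "?S \<subseteq> Pow (space M)" by auto
  have sigma: "sigma_sets (space M) ?S \<subseteq> events" using indep_setD_ev2[OF ind] .
  have setsS: "sets (sigma (space M) ?S) = sigma_sets (space M) ?S" by (rule sets_measure_of[OF Ssub])
  have spaceS: "space (sigma (space M) ?S) = space M" by (rule space_measure_of[OF Ssub])
  have HM: "H \<in> borel_measurable M"
    by (rule measurable_from_subalg[OF _ H]) (use sigma in \<open>simp add: subalgebra_def setsS spaceS\<close>)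
  have spF: "space (F s) = space M" using F_subalgebra unfolding subalgebra_def by blast
  have 1: "sigma_sets (space M) {G -` A \<inter> space M |A. A \<in> sets borel} \<subseteq> sets (F s)"
    using sets.sigma_sets_subset[of "{G -` A \<inter> space M |A. A \<in> sets borel}" "F s"] measurable_sets[OF G] 
    unfolding spF by blast
  have 2: "sigma_sets (space M) {H -` A \<inter> space M |A. A \<in> sets borel} \<subseteq> sigma_sets (space M) ?S"
    using measurable_sets[OF H] unfolding setsS spaceS by (intro sigma_sets_mono) auto
  have "indep_set (sigma_sets (space M) {G -` A \<inter> space M |A. A \<in> sets borel}) (sigma_sets (space M) {H -` A \<inter> space M |A. A \<in> sets borel})"
    using ind 1 2 unfolding indep_sets2_eq by blast
  then show ?thesis unfolding indep_var_eq using F_measurable_M[OF G] HM by simp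
qed

lemma dW_generated_measurable:
  assumes "A \<in> J"
  shows "dW s t A \<in> borel_measurable (sigma (space M) (\<Union>A\<in>J. {dW s t A -` B \<inter> space M | B. B \<in> sets borel}))"
proof (rule measurableI)
  fix B :: "real set" assume "B \<in> sets borel"
  then show "dW s t A -` B \<inter> space (sigma (space M) (\<Union>A\<in>J. {dW s t A -` B \<inter> space M | B. B \<in> sets borel}))
     \<in> sets (sigma (space M) (\<Union>A\<in>J. {dW s t A -` B \<inter> space M | B. B \<in> sets borel}))"
    using assms by (subst sets_measure_of, force, subst space_measure_of, force) (auto intro!: sigma_sets.Basic)
qed simp

lemma mult_dW:
  assumes "0 \<le> s" "s \<le> t" "A \<in> fin_borel" "G \<in> borel_measurable (F s)" "integrable M G"
  shows "integrable M (\<lambda>\<omega>. G \<omega> * dW s t A \<omega>)" "expectation (\<lambda>\<omega>. G \<omega> * dW s t A \<omega>) = 0"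
proof -
  have "indep_var borel G borel (dW s t A)"
    by (rule dW_independent[of s t "{A}"]) (use assms in \<open>auto intro: dW_generated_measurable[of _ "{A}", simplified]\<close>)
  note ind = this and int = dW_integrable[OF assms(1-3)]
  show "integrable M (\<lambda>\<omega>. G \<omega> * dW s t A \<omega>)" by (rule indep_var_integrable[OF ind assms(5) int])
  show "expectation (\<lambda>\<omega>. G \<omega> * dW s t A \<omega>) = 0" 
    using indep_var_lebesgue_integral[OF ind assms(5) int] dW_expectation[OF assms(1-3)] by simp
qed

text \<open>The past factor splits off by independence. For distinct disjoint sets the two
  increments are independent and centred, so only the diagonal survives.\<close>

lemma mult_dW_dW:
  assumes "0 \<le> s" "s \<le> t" "finite J" "J \<subseteq> fin_borel" "disjoint J" "A \<in> J" "B \<in> J"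
    "G \<in> borel_measurable (F s)" "integrable M G"
  shows "integrable M (\<lambda>\<omega>. G \<omega> * (dW s t A \<omega> * dW s t B \<omega>))" 
    "expectation (\<lambda>\<omega>. G \<omega> * (dW s t A \<omega> * dW s t B \<omega>)) = (if A = B then expectation G * ((t - s) * measure lborel A) else 0)"
proof -
  have i: "indep_var borel G borel (\<lambda>\<omega>. dW s t A \<omega> * dW s t B \<omega>)"
    by (rule dW_independent[of s t J]) (use assms in \<open>auto intro!: borel_measurable_times dW_generated_measurable\<close>)
  have int: "integrable M (\<lambda>\<omega>. dW s t A \<omega> * dW s t B \<omega>)" 
    using dW_product_integrable[of s t A J B] assms by auto
  show "integrable M (\<lambda>\<omega>. G \<omega> * (dW s t A \<omega> * dW s t B \<omega>))"
    by (rule indep_var_integrable[OF i _ int]) fact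
  have 1: "expectation (\<lambda>\<omega>. G \<omega> * (dW s t A \<omega> * dW s t B \<omega>)) = expectation G * expectation (\<lambda>\<omega>. dW s t A \<omega> * dW s t B \<omega>)"
    by (rule indep_var_lebesgue_integral[OF i _ int]) fact
  show "expectation (\<lambda>\<omega>. G \<omega> * (dW s t A \<omega> * dW s t B \<omega>)) = (if A = B then expectation G * ((t - s) * measure lborel A) else 0)"
  proof (cases "A = B")
    case True
    have "A \<in> fin_borel" using assms by blast
    show ?thesis using 1 dW_variance[OF assms(1,2) \<open>A \<in> fin_borel\<close>] True by simp
  next
    case False
    have "A \<in> fin_borel" "B \<in> fin_borel" using assms by blast+
    moreover have "A \<inter> B = {}" by (rule disjointD[OF assms(5-7) False])
    ultimately show ?thesis using 1 dW_product(1)[OF assms(1,2)] False by simp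
  qed
qed

lemma bounded_integrable:
  "X \<in> borel_measurable M \<Longrightarrow> (\<And>\<omega>. \<omega> \<in> space M \<Longrightarrow> \<bar>X \<omega>\<bar> \<le> C) \<Longrightarrow> integrable M X" for X :: "'a \<Rightarrow> real"
  by (rule integrable_const_bound[of _ C]) auto

lemma integrable_mult_bounded:
  assumes "integrable M X" "Y \<in> borel_measurable M" "\<And>\<omega>. \<omega> \<in> space M \<Longrightarrow> \<bar>Y \<omega>\<bar> \<le> C"
  shows "integrable M (\<lambda>\<omega>. X \<omega> * Y \<omega> :: real)"
proof (rule Bochner_Integration.integrable_bound[of _ "\<lambda>\<omega>. C * X \<omega>"])
  show "AE \<omega> in M. norm (X \<omega> * Y \<omega>) \<le> norm (C * X \<omega>)"
  proof (rule AE_I2)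
    fix \<omega> assume "\<omega> \<in> space M"
    then have "\<bar>Y \<omega>\<bar> \<le> \<bar>C\<bar>" using assms(3) by fastforce
    then have "\<bar>X \<omega>\<bar> * \<bar>Y \<omega>\<bar> \<le> \<bar>X \<omega>\<bar> * \<bar>C\<bar>" by (rule mult_left_mono) simp
    then show "norm (X \<omega> * Y \<omega>) \<le> norm (C * X \<omega>)" by (simp add: abs_mult mult.commute)
  qed
qed (use assms in auto)

end

text \<open>Every summand is at most the largest one, which is itself one of the summands. The crude
  constant is harmless: it enters only the remainder that disappears when the mesh tends to
  0.\<close>

lemma sum_power_le:
  fixes a :: "'b \<Rightarrow> real"
  assumes "finite J" "\<And>i. i \<in> J \<Longrightarrow> 0 \<le> a i" "n > 0"
  shows "(\<Sum>i\<in>J. a i) ^ n \<le> real (card J) ^ n * (\<Sum>i\<in>J. a i ^ n)"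
proof (cases "J = {}")
  case True then show ?thesis using assms(3) by (simp add: power_0_left)
next
  case False
  define c where "c = Max (a ` J)"
  have c: "c \<in> a ` J" unfolding c_def using assms False by (intro Max_in) auto
  then obtain i where i: "i \<in> J" "c = a i" by blast
  have "(\<Sum>i\<in>J. a i) \<le> real (card J) * c"
    using sum_bounded_above[of J a c] assms by (auto simp: c_def)
  then have "(\<Sum>i\<in>J. a i) ^ n \<le> (real (card J) * c) ^ n"
    using assms by (intro power_mono sum_nonneg) auto
  also have "\<dots> = real (card J) ^ n * a i ^ n" by (simp add: power_mult_distrib i)
  also have "\<dots> \<le> real (card J) ^ n * (\<Sum>i\<in>J. a i ^ n)"
    using assms i by (intro mult_left_mono member_le_sum) auto
  finally show ?thesis .
qed

section \<open>One time step with coefficients frozen at its left end\<close>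

context noise begin

lemma truncated_power_integrable:
  assumes "\<epsilon> > 0" "X \<in> borel_measurable M" "integrable M (\<lambda>\<omega>. (X \<omega>)\<^sup>2)"
  shows "integrable M (\<lambda>\<omega>. truncated_power \<epsilon> m (X \<omega>))"
proof (rule Bochner_Integration.integrable_bound[of _ "\<lambda>\<omega>. (1/\<epsilon>) ^ m * (X \<omega>)\<^sup>2"])
  show "AE \<omega> in M. norm (truncated_power \<epsilon> m (X \<omega>)) \<le> norm ((1/\<epsilon>) ^ m * (X \<omega>)\<^sup>2)"
    by (intro AE_I2) (use assms(1) truncated_power_le_const[OF assms(1)] truncated_power_nonneg[OF assms(1)] in \<open>simp add: abs_mult\<close>)
qed (use assms in auto)

context
  fixes s t :: real and J :: "real set set" and Y :: "real set \<Rightarrow> 'a \<Rightarrow> real" and K :: real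
  assumes st: "0 \<le> s" "s \<le> t" and J: "finite J" "J \<subseteq> fin_borel" "disjoint J"
    and Y: "\<And>B. B \<in> J \<Longrightarrow> Y B \<in> borel_measurable (F s)"
    and K: "\<And>B \<omega>. B \<in> J \<Longrightarrow> \<omega> \<in> space M \<Longrightarrow> \<bar>Y B \<omega>\<bar> \<le> K"
begin

lemma J_fin_borel: "B \<in> J \<Longrightarrow> B \<in> fin_borel"
  using J(2) by (rule subsetD)

lemma Y_measurable: "B \<in> J \<Longrightarrow> Y B \<in> borel_measurable M"
  by (rule F_measurable_M[OF Y])

lemma dW_measurable: "B \<in> J \<Longrightarrow> dW s t B \<in> borel_measurable M"
  by (intro borel_measurable_diff W_measurable J_fin_borel) (use st in simp_all)

text \<open>The martingale property of one step. The weight \<open>V\<close> is kept general because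
  the first-order Taylor term multiplies the increment by \<open>truncated_power_deriv\<close> of
  the past value.\<close>

lemma step_linear:
  assumes V: "V \<in> borel_measurable (F s)" "integrable M V"
  shows "integrable M (\<lambda>\<omega>. V \<omega> * (\<Sum>B\<in>J. Y B \<omega> * dW s t B \<omega>))"
    "expectation (\<lambda>\<omega>. V \<omega> * (\<Sum>B\<in>J. Y B \<omega> * dW s t B \<omega>)) = 0"
proof -
  have eq: "(\<lambda>\<omega>. V \<omega> * (\<Sum>B\<in>J. Y B \<omega> * dW s t B \<omega>)) = (\<lambda>\<omega>. \<Sum>B\<in>J. (V \<omega> * Y B \<omega>) * dW s t B \<omega>)"
    by (simp add: sum_distrib_left mult.assoc)
  have "integrable M (\<lambda>\<omega>. (V \<omega> * Y B \<omega>) * dW s t B \<omega>) \<and> expectation (\<lambda>\<omega>. (V \<omega> * Y B \<omega>) * dW s t B \<omega>) = 0"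
    if "B \<in> J" for B
    by (intro conjI mult_dW[OF st J_fin_borel[OF that]] borel_measurable_times V(1) Y[OF that]
      integrable_mult_bounded[where C = K] V(2) Y_measurable[OF that] K[OF that])
  then show "integrable M (\<lambda>\<omega>. V \<omega> * (\<Sum>B\<in>J. Y B \<omega> * dW s t B \<omega>))"
    "expectation (\<lambda>\<omega>. V \<omega> * (\<Sum>B\<in>J. Y B \<omega> * dW s t B \<omega>)) = 0"
    unfolding eq by auto
qed

text \<open>Cross terms vanish by \<open>mult_dW_dW\<close>. With \<open>V = 1\<close> this is the
  isometry of one step, and with the truncated weight of the past value it is the quadratic Taylor
  term.\<close>

lemma step_quadratic:
  assumes V: "V \<in> borel_measurable (F s)" "integrable M V"
  shows "integrable M (\<lambda>\<omega>. V \<omega> * (\<Sum>B\<in>J. Y B \<omega> * dW s t B \<omega>)\<^sup>2)"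
    "expectation (\<lambda>\<omega>. V \<omega> * (\<Sum>B\<in>J. Y B \<omega> * dW s t B \<omega>)\<^sup>2) 
      = (\<Sum>B\<in>J. expectation (\<lambda>\<omega>. V \<omega> * (Y B \<omega>)\<^sup>2) * ((t - s) * measure lborel B))"
proof -
  have eq: "(\<lambda>\<omega>. V \<omega> * (\<Sum>B\<in>J. Y B \<omega> * dW s t B \<omega>)\<^sup>2) 
     = (\<lambda>\<omega>. \<Sum>A\<in>J. \<Sum>B\<in>J. (V \<omega> * Y A \<omega> * Y B \<omega>) * (dW s t A \<omega> * dW s t B \<omega>))"
    by (simp add: power2_eq_square sum_product sum_distrib_left mult_ac)
  have *: "integrable M (\<lambda>\<omega>. (V \<omega> * Y A \<omega> * Y B \<omega>) * (dW s t A \<omega> * dW s t B \<omega>)) \<and> 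
    expectation (\<lambda>\<omega>. (V \<omega> * Y A \<omega> * Y B \<omega>) * (dW s t A \<omega> * dW s t B \<omega>)) = 
    (if A = B then expectation (\<lambda>\<omega>. V \<omega> * Y A \<omega> * Y B \<omega>) * ((t - s) * measure lborel A) else 0)"
    if AB: "A \<in> J" "B \<in> J" for A B
  proof -
    have m: "(\<lambda>\<omega>. V \<omega> * Y A \<omega> * Y B \<omega>) \<in> borel_measurable (F s)"
      using Y V AB by (auto intro: borel_measurable_times)
    have i: "integrable M (\<lambda>\<omega>. V \<omega> * Y A \<omega> * Y B \<omega>)"
      by (intro integrable_mult_bounded[where C = K] V(2) Y_measurable K AB)
    show ?thesis using mult_dW_dW[OF st J AB m i] by blast
  qed
  show "integrable M (\<lambda>\<omega>. V \<omega> * (\<Sum>B\<in>J. Y B \<omega> * dW s t B \<omega>)\<^sup>2)"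
    unfolding eq by (intro Bochner_Integration.integrable_sum) (rule *[THEN conjunct1])
  have "expectation (\<lambda>\<omega>. V \<omega> * (\<Sum>B\<in>J. Y B \<omega> * dW s t B \<omega>)\<^sup>2)
     = (\<Sum>A\<in>J. \<Sum>B\<in>J. expectation (\<lambda>\<omega>. (V \<omega> * Y A \<omega> * Y B \<omega>) * (dW s t A \<omega> * dW s t B \<omega>)))"
  proof -
    have "integrable M (\<lambda>\<omega>. (V \<omega> * Y A \<omega> * Y B \<omega>) * (dW s t A \<omega> * dW s t B \<omega>))" if "A \<in> J" "B \<in> J" for A B
      using *[OF that] by (rule conjunct1)
    note i = this
    show ?thesis unfolding eq
      by (subst Bochner_Integration.integral_sum, rule Bochner_Integration.integrable_sum, erule i, assumption,
        intro sum.cong refl Bochner_Integration.integral_sum i)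
  qed
  also have "\<dots> = (\<Sum>A\<in>J. \<Sum>B\<in>J. (if A = B then expectation (\<lambda>\<omega>. V \<omega> * Y A \<omega> * Y B \<omega>) * ((t - s) * measure lborel A) else 0))"
    by (intro sum.cong refl) (rule *[THEN conjunct2])
  also have "\<dots> = (\<Sum>A\<in>J. expectation (\<lambda>\<omega>. V \<omega> * (Y A \<omega>)\<^sup>2) * ((t - s) * measure lborel A))"
    using J by (intro sum.cong refl) (simp add: power2_eq_square mult.assoc)
  finally show "expectation (\<lambda>\<omega>. V \<omega> * (\<Sum>B\<in>J. Y B \<omega> * dW s t B \<omega>)\<^sup>2) 
      = (\<Sum>B\<in>J. expectation (\<lambda>\<omega>. V \<omega> * (Y B \<omega>)\<^sup>2) * ((t - s) * measure lborel B))" .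
qed

text \<open>What matters is the power \<open>(t - s) ^ k\<close>; the constant in front depends on
  the representation but not on the times. For \<open>k = m + 1\<close> with \<open>m > 0\<close>
  the bound is of smaller order than the step length.\<close>

lemma step_even_moment:
  assumes "k > 0"
  shows "integrable M (\<lambda>\<omega>. (\<Sum>B\<in>J. Y B \<omega> * dW s t B \<omega>) ^ (2 * k))"
    "expectation (\<lambda>\<omega>. (\<Sum>B\<in>J. Y B \<omega> * dW s t B \<omega>) ^ (2 * k))
      \<le> (\<Sum>B\<in>J. (real (card J) * K) ^ (2 * k) * (fact (2 * k) / (2 ^ k * fact k) * measure lborel B ^ k)) * (t - s) ^ k"
proof -
  let ?h = "\<lambda>\<omega>. \<Sum>B\<in>J. Y B \<omega> * dW s t B \<omega>"
  let ?b = "\<lambda>\<omega>. \<Sum>B\<in>J. (real (card J) * K) ^ (2 * k) * dW s t B \<omega> ^ (2 * k)"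
  have le: "?h \<omega> ^ (2 * k) \<le> ?b \<omega>" if "\<omega> \<in> space M" for \<omega>
  proof -
    have "?h \<omega> ^ (2 * k) = \<bar>?h \<omega>\<bar> ^ (2 * k)" by (simp add: power_even_abs)
    also have "\<dots> \<le> (\<Sum>B\<in>J. \<bar>Y B \<omega> * dW s t B \<omega>\<bar>) ^ (2 * k)"
      by (intro power_mono) auto
    also have "\<dots> \<le> real (card J) ^ (2 * k) * (\<Sum>B\<in>J. \<bar>Y B \<omega> * dW s t B \<omega>\<bar> ^ (2 * k))"
      using J assms by (intro sum_power_le) auto
    also have "\<dots> \<le> real (card J) ^ (2 * k) * (\<Sum>B\<in>J. K ^ (2 * k) * dW s t B \<omega> ^ (2 * k))"
    proof (intro mult_left_mono sum_mono)
      fix B assume B: "B \<in> J"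
      have "\<bar>Y B \<omega> * dW s t B \<omega>\<bar> ^ (2 * k) = \<bar>Y B \<omega>\<bar> ^ (2 * k) * dW s t B \<omega> ^ (2 * k)"
        by (simp add: abs_mult power_mult_distrib power_even_abs)
      also have "\<dots> \<le> K ^ (2 * k) * dW s t B \<omega> ^ (2 * k)"
        using K[OF B that] by (intro mult_right_mono power_mono) auto
      finally show "\<bar>Y B \<omega> * dW s t B \<omega>\<bar> ^ (2 * k) \<le> K ^ (2 * k) * dW s t B \<omega> ^ (2 * k)" .
    qed simp
    finally show ?thesis by (simp add: sum_distrib_left power_mult_distrib mult.assoc)
  qed
  note [measurable] = dW_measurable Y_measurable
  have ib: "integrable M ?b"
    by (intro Bochner_Integration.integrable_sum integrable_mult_right dW_power_integrable st J_fin_borel)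
  show i: "integrable M (\<lambda>\<omega>. ?h \<omega> ^ (2 * k))"
  proof (rule Bochner_Integration.integrable_bound[OF ib])
    show "(\<lambda>\<omega>. ?h \<omega> ^ (2 * k)) \<in> borel_measurable M" by measurable
    show "AE \<omega> in M. norm (?h \<omega> ^ (2 * k)) \<le> norm (?b \<omega>)"
      by (rule AE_I2) (use le in \<open>fastforce simp: abs_of_nonneg\<close>)
  qed
  have "expectation (\<lambda>\<omega>. ?h \<omega> ^ (2 * k)) \<le> expectation ?b"
    by (rule integral_mono[OF i ib le])
  also have "\<dots> = (\<Sum>B\<in>J. (real (card J) * K) ^ (2 * k) * (fact (2 * k) / (2 ^ k * fact k) * ((t - s) * measure lborel B) ^ k))"
    by (subst Bochner_Integration.integral_sum, intro integrable_mult_right dW_power_integrable st J_fin_borel)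
      (auto intro!: sum.cong simp: dW_even_moment[OF st J_fin_borel])
  also have "\<dots> = (\<Sum>B\<in>J. (real (card J) * K) ^ (2 * k) * (fact (2 * k) / (2 ^ k * fact k) * measure lborel B ^ k)) * (t - s) ^ k"
    by (simp add: sum_distrib_left sum_distrib_right power_mult_distrib mult_ac)
  finally show "expectation (\<lambda>\<omega>. ?h \<omega> ^ (2 * k))
      \<le> (\<Sum>B\<in>J. (real (card J) * K) ^ (2 * k) * (fact (2 * k) / (2 ^ k * fact k) * measure lborel B ^ k)) * (t - s) ^ k" .
qed

lemma step_square:
  assumes Z: "Z \<in> borel_measurable (F s)" "integrable M (\<lambda>\<omega>. (Z \<omega>)\<^sup>2)"
  shows "integrable M (\<lambda>\<omega>. (Z \<omega> + (\<Sum>B\<in>J. Y B \<omega> * dW s t B \<omega>))\<^sup>2)"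
    "expectation (\<lambda>\<omega>. (Z \<omega> + (\<Sum>B\<in>J. Y B \<omega> * dW s t B \<omega>))\<^sup>2) = 
      expectation (\<lambda>\<omega>. (Z \<omega>)\<^sup>2) + (\<Sum>B\<in>J. expectation (\<lambda>\<omega>. (Y B \<omega>)\<^sup>2) * ((t - s) * measure lborel B))"
proof -
  let ?h = "\<lambda>\<omega>. \<Sum>B\<in>J. Y B \<omega> * dW s t B \<omega>"
  have ZM: "Z \<in> borel_measurable M" using Z F_measurable_M by blast
  have iZ: "integrable M Z" using square_integrable_imp_integrable[OF ZM Z(2)] .
  have eq: "(\<lambda>\<omega>. (Z \<omega> + ?h \<omega>)\<^sup>2) = (\<lambda>\<omega>. (Z \<omega>)\<^sup>2 + (2 * (Z \<omega> * ?h \<omega>) + 1 * (?h \<omega>)\<^sup>2))"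
    by (simp add: power2_sum fun_eq_iff)
  have l: "integrable M (\<lambda>\<omega>. Z \<omega> * ?h \<omega>)" "expectation (\<lambda>\<omega>. Z \<omega> * ?h \<omega>) = 0"
    using step_linear[OF Z(1) iZ] by auto
  have q: "integrable M (\<lambda>\<omega>. 1 * (?h \<omega>)\<^sup>2)" "expectation (\<lambda>\<omega>. 1 * (?h \<omega>)\<^sup>2) = (\<Sum>B\<in>J. expectation (\<lambda>\<omega>. 1 * (Y B \<omega>)\<^sup>2) * ((t - s) * measure lborel B))"
    by (rule step_quadratic[OF borel_measurable_const integrable_const])+
  have i2: "integrable M (\<lambda>\<omega>. 2 * (Z \<omega> * ?h \<omega>))" using l(1) by (rule integrable_mult_right)
  show "integrable M (\<lambda>\<omega>. (Z \<omega> + ?h \<omega>)\<^sup>2)"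
    unfolding eq by (intro Bochner_Integration.integrable_add Z(2) i2 q(1))
  have "expectation (\<lambda>\<omega>. (Z \<omega>)\<^sup>2 + (2 * (Z \<omega> * ?h \<omega>) + 1 * (?h \<omega>)\<^sup>2)) =
    expectation (\<lambda>\<omega>. (Z \<omega>)\<^sup>2) + (expectation (\<lambda>\<omega>. 2 * (Z \<omega> * ?h \<omega>)) + expectation (\<lambda>\<omega>. 1 * (?h \<omega>)\<^sup>2))"
    by (subst Bochner_Integration.integral_add[OF Z(2) Bochner_Integration.integrable_add[OF i2 q(1)]],
        subst Bochner_Integration.integral_add[OF i2 q(1)]) simp
  also have "expectation (\<lambda>\<omega>. 2 * (Z \<omega> * ?h \<omega>)) = 0" using l(2) by (subst integral_mult_right_zero) simp
  finally show "expectation (\<lambda>\<omega>. (Z \<omega> + ?h \<omega>)\<^sup>2) = 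
      expectation (\<lambda>\<omega>. (Z \<omega>)\<^sup>2) + (\<Sum>B\<in>J. expectation (\<lambda>\<omega>. (Y B \<omega>)\<^sup>2) * ((t - s) * measure lborel B))"
    unfolding eq q(2) by simp
qed

text \<open>Expectation of the Taylor bound: the linear term has mean zero, the quadratic one is
  evaluated exactly, and the part with the weight of the increment is bounded by its full power of
  order \<open>2 * (m + 1)\<close>.\<close>

lemma step_truncated_power:
  fixes m :: nat
  assumes \<epsilon>: "\<epsilon> > 0" and Z: "Z \<in> borel_measurable (F s)" "integrable M (\<lambda>\<omega>. (Z \<omega>)\<^sup>2)"
  defines "c \<equiv> (1 + 2 * real m) * (1 + real m) * 4 ^ m"
  shows "expectation (\<lambda>\<omega>. truncated_power \<epsilon> m (Z \<omega> + (\<Sum>B\<in>J. Y B \<omega> * dW s t B \<omega>))) \<le> 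
      expectation (\<lambda>\<omega>. truncated_power \<epsilon> m (Z \<omega>)) 
      + c * (\<Sum>B\<in>J. expectation (\<lambda>\<omega>. truncated_weight \<epsilon> m (Z \<omega>) * (Y B \<omega>)\<^sup>2) * ((t - s) * measure lborel B))
      + c * (\<Sum>B\<in>J. (real (card J) * K) ^ (2 * (m+1)) * (fact (2 * (m+1)) / (2 ^ (m+1) * fact (m+1)) * measure lborel B ^ (m+1))) * (t - s) ^ (m+1)"
proof -
  let ?h = "\<lambda>\<omega>. \<Sum>B\<in>J. Y B \<omega> * dW s t B \<omega>"
  let ?R = "(\<Sum>B\<in>J. (real (card J) * K) ^ (2 * (m+1)) * (fact (2 * (m+1)) / (2 ^ (m+1) * fact (m+1)) * measure lborel B ^ (m+1))) * (t - s) ^ (m+1)"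
  note [measurable] = dW_measurable Y_measurable
  have ZM[measurable]: "Z \<in> borel_measurable M" using Z F_measurable_M by blast
  note [measurable] = Z(1)
  have c0: "c \<ge> 0" unfolding c_def by simp
  have iZ: "integrable M Z" using square_integrable_imp_integrable[OF ZM Z(2)] .
  let ?V = "\<lambda>\<omega>. truncated_power_deriv \<epsilon> m (Z \<omega>)" and ?w = "\<lambda>\<omega>. truncated_weight \<epsilon> m (Z \<omega>)"
  have V: "?V \<in> borel_measurable (F s)" by measurable
  have w: "?w \<in> borel_measurable (F s)" by measurable
  have iV: "integrable M ?V"
  proof (rule Bochner_Integration.integrable_bound[of _ "\<lambda>\<omega>. 2 * (1/\<epsilon>)^m * (1 + real m) * Z \<omega>"])
    show "AE \<omega> in M. norm (?V \<omega>) \<le> norm (2 * (1/\<epsilon>)^m * (1 + real m) * Z \<omega>)"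
      using truncated_power_deriv_bound[OF \<epsilon>, of m] \<epsilon> by (intro AE_I2) (simp add: abs_mult)
  qed (use iZ in auto)
  have iw: "integrable M ?w"
    using truncated_weight_le_const[OF \<epsilon>] truncated_weight_nonneg[OF \<epsilon>] 
    by (intro bounded_integrable[of _ "(1/\<epsilon>)^m"]) (auto simp: abs_of_nonneg)
  have l: "integrable M (\<lambda>\<omega>. ?V \<omega> * ?h \<omega>)" "expectation (\<lambda>\<omega>. ?V \<omega> * ?h \<omega>) = 0"
    using step_linear[OF V iV] by auto
  note q = step_quadratic[OF w iw]
  have "0 < m + 1" by simp
  note e = step_even_moment[OF this]
  have ip: "integrable M (\<lambda>\<omega>. truncated_power \<epsilon> m (Z \<omega>))" 
    by (rule truncated_power_integrable[OF \<epsilon> ZM Z(2)])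
  have ip': "integrable M (\<lambda>\<omega>. truncated_power \<epsilon> m (Z \<omega> + ?h \<omega>))" 
    by (rule truncated_power_integrable[OF \<epsilon> _ step_square(1)[OF Z]]) measurable
  have "expectation (\<lambda>\<omega>. truncated_power \<epsilon> m (Z \<omega> + ?h \<omega>)) \<le> 
     expectation (\<lambda>\<omega>. (truncated_power \<epsilon> m (Z \<omega>) + ?V \<omega> * ?h \<omega>) + (c * (?w \<omega> * (?h \<omega>)\<^sup>2) + c * ?h \<omega> ^ (2 * (m+1))))"
  proof (rule integral_mono[OF ip'])
    show "integrable M (\<lambda>\<omega>. (truncated_power \<epsilon> m (Z \<omega>) + ?V \<omega> * ?h \<omega>) + (c * (?w \<omega> * (?h \<omega>)\<^sup>2) + c * ?h \<omega> ^ (2 * (m+1))))"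
      by (intro Bochner_Integration.integrable_add ip l(1) integrable_mult_right q(1) e(1))
    fix \<omega>
    have "truncated_power \<epsilon> m (Z \<omega> + ?h \<omega>) \<le> truncated_power \<epsilon> m (Z \<omega>) + ?V \<omega> * ?h \<omega> + c * (?w \<omega> + truncated_weight \<epsilon> m (?h \<omega>)) * (?h \<omega>)\<^sup>2"
      unfolding c_def by (rule truncated_power_taylor[OF \<epsilon>])
    also have "\<dots> = truncated_power \<epsilon> m (Z \<omega>) + ?V \<omega> * ?h \<omega> + (c * (?w \<omega> * (?h \<omega>)\<^sup>2) + c * truncated_power \<epsilon> m (?h \<omega>))"
      unfolding truncated_power_def by (simp add: algebra_simps)
    also have "\<dots> \<le> (truncated_power \<epsilon> m (Z \<omega>) + ?V \<omega> * ?h \<omega>) + (c * (?w \<omega> * (?h \<omega>)\<^sup>2) + c * ?h \<omega> ^ (2 * (m+1)))"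
      using truncated_power_le_power[OF \<epsilon>, of m "?h \<omega>"] c0 by (simp add: mult_left_mono)
    finally show "truncated_power \<epsilon> m (Z \<omega> + ?h \<omega>) \<le> (truncated_power \<epsilon> m (Z \<omega>) + ?V \<omega> * ?h \<omega>) + (c * (?w \<omega> * (?h \<omega>)\<^sup>2) + c * ?h \<omega> ^ (2 * (m+1)))" .
  qed
  also have "\<dots> = expectation (\<lambda>\<omega>. truncated_power \<epsilon> m (Z \<omega>)) + expectation (\<lambda>\<omega>. ?V \<omega> * ?h \<omega>)
     + (expectation (\<lambda>\<omega>. c * (?w \<omega> * (?h \<omega>)\<^sup>2)) + expectation (\<lambda>\<omega>. c * ?h \<omega> ^ (2 * (m+1))))"
    by (subst Bochner_Integration.integral_add[OF Bochner_Integration.integrable_add[OF ip l(1)]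
       Bochner_Integration.integrable_add[OF integrable_mult_right[OF q(1)] integrable_mult_right[OF e(1)]]],
      subst Bochner_Integration.integral_add[OF ip l(1)], 
      subst Bochner_Integration.integral_add[OF integrable_mult_right[OF q(1)] integrable_mult_right[OF e(1)]]) simp
  also have "\<dots> = expectation (\<lambda>\<omega>. truncated_power \<epsilon> m (Z \<omega>)) + (c * expectation (\<lambda>\<omega>. ?w \<omega> * (?h \<omega>)\<^sup>2) + c * expectation (\<lambda>\<omega>. ?h \<omega> ^ (2 * (m+1))))"
    unfolding l(2) by (simp only: integral_mult_right_zero add_0_right)
  also have "\<dots> \<le> expectation (\<lambda>\<omega>. truncated_power \<epsilon> m (Z \<omega>)) + (c * expectation (\<lambda>\<omega>. ?w \<omega> * (?h \<omega>)\<^sup>2) + c * ?R)"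
    by (intro add_left_mono mult_left_mono e(2) c0)
  finally show ?thesis unfolding q(2) by (simp only: mult.assoc add.assoc)
qed

end

end

section \<open>Simple integrands\<close>

text \<open>A transitive relation between times needs to be checked only on intervals with no point
  of \<open>P\<close> in their interior: any other interval is cut at such a point, which lowers the
  number of interior points on both sides.\<close>

lemma chain_cells:
  fixes R :: "real \<Rightarrow> real \<Rightarrow> bool"
  assumes "finite P"
    and cell: "\<And>r t. a \<le> r \<Longrightarrow> r \<le> t \<Longrightarrow> t \<le> b \<Longrightarrow> P \<inter> {r<..<t} = {} \<Longrightarrow> R r t"
    and trans: "\<And>r s t. a \<le> r \<Longrightarrow> r \<le> s \<Longrightarrow> s \<le> t \<Longrightarrow> t \<le> b \<Longrightarrow> R r s \<Longrightarrow> R s t \<Longrightarrow> R r t"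
  shows "a \<le> r \<Longrightarrow> r \<le> t \<Longrightarrow> t \<le> b \<Longrightarrow> R r t"
proof (induction "card (P \<inter> {r<..<t})" arbitrary: r t rule: less_induct)
  case less
  show ?case
  proof (cases "P \<inter> {r<..<t} = {}")
    case True then show ?thesis using less cell by blast
  next
    case False
    then obtain p where p: "p \<in> P" "r < p" "p < t" by auto
    have "P \<inter> {r<..<p} \<subset> P \<inter> {r<..<t}" "P \<inter> {p<..<t} \<subset> P \<inter> {r<..<t}" using p by auto
    then have "card (P \<inter> {r<..<p}) < card (P \<inter> {r<..<t})" "card (P \<inter> {p<..<t}) < card (P \<inter> {r<..<t})"
      using \<open>finite P\<close> by (auto intro!: psubset_card_mono)
    then have "R r p" "R p t" using less p by auto
    then show ?thesis using trans[of r p t] less p by auto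
  qed
qed

text \<open>With \<open>n\<close> equal steps the errors add up to at most
  \<open>D * (r' - r) ^ (m+1) / n\<close>, because \<open>m > 0\<close>, and this tends to 0. The
  additive part \<open>k\<close> telescopes and is unaffected by refinement.\<close>

lemma subdivide:
  fixes e :: "real \<Rightarrow> ennreal" and k :: "real \<Rightarrow> real \<Rightarrow> ennreal"
  assumes step: "\<And>s t. r \<le> s \<Longrightarrow> s \<le> t \<Longrightarrow> t \<le> r' \<Longrightarrow> e t \<le> e s + k s t + ennreal (D * (t - s) ^ (m+1))"
    and add: "\<And>s t u. r \<le> s \<Longrightarrow> s \<le> t \<Longrightarrow> t \<le> u \<Longrightarrow> u \<le> r' \<Longrightarrow> k s u = k s t + k t u"
    and "m > 0" "D \<ge> 0" "r \<le> r'"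
  shows "e r' \<le> e r + k r r'"
proof -
  have bound: "e r' \<le> e r + k r r' + ennreal (D * (r' - r) ^ (m+1) / real n)" if "n > 0" for n
  proof -
    define h where "h = (r' - r) / n"
    have h: "h \<ge> 0" "r' = r + real n * h" using that \<open>r \<le> r'\<close> by (auto simp: h_def)
    have "j \<le> n \<Longrightarrow> e (r + real j * h) \<le> e r + k r (r + real j * h) + ennreal (real j * (D * h ^ (m+1)))" for j
    proof (induction j)
      case 0 then show ?case by simp
    next
      case (Suc j)
      have le: "r + real (Suc j) * h \<le> r'"
        unfolding h(2) using Suc.prems h(1) by (intro add_left_mono mult_right_mono) auto
      have "r + real (Suc j) * h - (r + real j * h) = h" by (simp add: algebra_simps)
      then have "e (r + real (Suc j) * h) \<le> e (r + real j * h) + k (r + real j * h) (r + real (Suc j) * h) + ennreal (D * h ^ (m+1))"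
        using step[of "r + real j * h" "r + real (Suc j) * h"] h(1) le by (simp add: mult_right_mono)
      also have "\<dots> \<le> (e r + k r (r + real j * h) + ennreal (real j * (D * h ^ (m+1)))) + k (r + real j * h) (r + real (Suc j) * h) + ennreal (D * h ^ (m+1))"
        using Suc by (intro add_right_mono) auto
      also have "\<dots> = e r + (k r (r + real j * h) + k (r + real j * h) (r + real (Suc j) * h)) + (ennreal (real j * (D * h ^ (m+1))) + ennreal (D * h ^ (m+1)))"
        by (simp add: ac_simps)
      also have "k r (r + real j * h) + k (r + real j * h) (r + real (Suc j) * h) = k r (r + real (Suc j) * h)"
        using h(1) le by (intro add[symmetric]) (auto simp: mult_right_mono)
      also have "ennreal (real j * (D * h ^ (m+1))) + ennreal (D * h ^ (m+1)) = ennreal (real (Suc j) * (D * h ^ (m+1)))"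
        using \<open>D \<ge> 0\<close> h(1) by (subst ennreal_plus[symmetric]) (auto simp: algebra_simps)
      finally show ?case .
    qed
    from this[of n] have "e r' \<le> e r + k r r' + ennreal (real n * (D * h ^ (m+1)))" using h by simp
    also have "real n * (D * h ^ (m+1)) \<le> D * (r' - r) ^ (m+1) / real n"
    proof -
      have "real n * (D * h ^ (m+1)) = D * (r' - r) ^ (m+1) * (1 / real n ^ m)"
        using that by (simp add: h_def power_divide)
      also have "\<dots> \<le> D * (r' - r) ^ (m+1) * (1 / real n)"
        using that \<open>D \<ge> 0\<close> \<open>r \<le> r'\<close> self_le_power[of "real n" m] \<open>m > 0\<close> by (intro mult_left_mono divide_left_mono) auto
      finally show ?thesis by simp
    qed
    finally show ?thesis by (simp add: ennreal_leI add_left_mono)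
  qed
  have "(\<lambda>n. ennreal (D * (r' - r) ^ (m+1) / real n)) \<longlonglongrightarrow> ennreal 0"
    by (intro tendsto_ennrealI lim_const_over_n)
  then have "(\<lambda>n. e r + k r r' + ennreal (D * (r' - r) ^ (m+1) / real n)) \<longlonglongrightarrow> e r + k r r' + ennreal 0"
    by (intro tendsto_add tendsto_const)
  then have "e r' \<le> e r + k r r' + ennreal 0"
    by (rule LIMSEQ_le_const) (use bound in \<open>auto intro!: exI[of _ 1]\<close>)
  then show ?thesis by simp
qed

lemma fin_borel_Int: "A \<in> fin_borel \<Longrightarrow> B \<in> sets borel \<Longrightarrow> A \<inter> B \<in> fin_borel"
  unfolding fin_borel_def using emeasure_mono[of "A \<inter> B" A lborel] by (auto simp: less_top[symmetric] top_unique)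

lemma fin_borel_Un: "A \<in> fin_borel \<Longrightarrow> B \<in> fin_borel \<Longrightarrow> A \<union> B \<in> fin_borel"
  unfolding fin_borel_def using emeasure_subadditive[of A lborel B] by (auto simp: less_top[symmetric] top_unique)

lemma fin_borel_empty: "{} \<in> fin_borel"
  unfolding fin_borel_def by auto

lemma fin_borel_Union: "finite J \<Longrightarrow> J \<subseteq> fin_borel \<Longrightarrow> \<Union>J \<in> fin_borel"
  by (induction rule: finite_induct) (auto intro: fin_borel_empty fin_borel_Un)

lemma emeasure_fin_borel: "B \<in> fin_borel \<Longrightarrow> emeasure lborel B = ennreal (measure lborel B)"
  unfolding fin_borel_def by (auto intro: emeasure_eq_ennreal_measure)

text \<open>An atom collects the points with the same membership pattern. Atoms are pairwise
  disjoint, and each given set is the union of those it contains.\<close>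

lemma fin_borel_atoms:
  assumes "finite \<A>" "\<A> \<subseteq> fin_borel"
  obtains J where "finite J" "J \<subseteq> fin_borel" "disjoint J" 
    "\<And>A. A \<in> \<A> \<Longrightarrow> \<Union>{B\<in>J. B \<subseteq> A} = A"
proof -
  define atom where "atom K = {x. {A\<in>\<A>. x \<in> A} = K}" for K
  \<comment> \<open>The empty pattern is left out: its atom is the complement of the union of all
    sets and has infinite measure.\<close>
  define J where "J = atom ` (Pow \<A> - {{}})"
  have borel: "A \<in> sets borel" if "A \<in> \<A>" for A using that assms unfolding fin_borel_def by auto
  have atom_fin: "atom K \<in> fin_borel" if K: "K \<subseteq> \<A>" "K \<noteq> {}" for K
  proof -
    obtain A where A: "A \<in> K" using K by blast
    have eq: "atom K = A \<inter> ((\<Inter>B\<in>K. B) \<inter> (\<Inter>B\<in>\<A> - K. - B))"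
      unfolding atom_def using K A by auto
    have "finite K" "finite (\<A> - K)" using assms K finite_subset by auto
    then have "(\<Inter>B\<in>K. B) \<in> sets borel" "(\<Inter>B\<in>\<A> - K. - B) \<in> sets borel"
    proof -
      show "(\<Inter>B\<in>K. B) \<in> sets borel" using \<open>finite K\<close> K borel by (intro sets.finite_INT) auto
      show "(\<Inter>B\<in>\<A> - K. - B) \<in> sets borel"
      proof (cases "\<A> - K = {}")
        case True then show ?thesis by (simp only: True) auto
      next
        case False 
        have "- B \<in> sets borel" if "B \<in> \<A>" for B
          using borel[OF that] by (intro borel_comp) 
        then show ?thesis using False \<open>finite (\<A> - K)\<close> by (intro sets.finite_INT) auto
      qed
    qed
    then show ?thesis unfolding eq using assms K A by (intro fin_borel_Int) auto
  qed
  show thesis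
  proof (rule that)
    show "finite J" unfolding J_def using assms by auto
    show "J \<subseteq> fin_borel" unfolding J_def using atom_fin by auto
    show "disjoint J" unfolding J_def disjoint_def atom_def by auto
    show "\<Union>{B\<in>J. B \<subseteq> A} = A" if A: "A \<in> \<A>" for A
    proof (intro equalityI subsetI)
      fix x assume x: "x \<in> A"
      have "atom {A\<in>\<A>. x \<in> A} \<in> J" unfolding J_def using A x by blast
      moreover have "atom {A\<in>\<A>. x \<in> A} \<subseteq> A" unfolding atom_def using A x by auto
      ultimately show "x \<in> \<Union>{B\<in>J. B \<subseteq> A}" by (auto simp: atom_def)
    qed auto
  qed
qed

section \<open>Simple integrals as processes in time\<close>

context noise begin

lemma W_empty: "0 \<le> t \<Longrightarrow> AE \<omega> in M. W t {} \<omega> = 0"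
  using W_additive[OF _ fin_borel_empty fin_borel_empty, of t] by simp

lemma W_Union:
  assumes "0 \<le> t" "finite J" "J \<subseteq> fin_borel" "disjoint J"
  shows "AE \<omega> in M. W t (\<Union>J) \<omega> = (\<Sum>B\<in>J. W t B \<omega>)"
  using assms(2,3,4)
proof (induction rule: finite_induct)
  case empty
  then show ?case using W_empty[OF assms(1)] by simp
next
  case (insert B J)
  have B: "B \<in> fin_borel" and J: "J \<subseteq> fin_borel" using insert.prems by auto
  have d: "disjoint J" using insert.prems(2) by (rule pairwise_subset) auto
  have UJ: "\<Union>J \<in> fin_borel" by (rule fin_borel_Union[OF insert.hyps(1) J])
  have "B \<inter> \<Union>J = {}" using insert.prems(2) insert.hyps(2) by (auto simp: disjoint_def)
  then have 1: "AE \<omega> in M. W t (B \<union> \<Union>J) \<omega> = W t B \<omega> + W t (\<Union>J) \<omega>"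
    by (rule W_additive[OF assms(1) B UJ])
  have 2: "AE \<omega> in M. W t (\<Union>J) \<omega> = (\<Sum>B\<in>J. W t B \<omega>)" by (rule insert.IH[OF J d])
  show ?case using 1 2 by eventually_elim (simp add: insert.hyps)
qed

text \<open>The simple integral stopped at time \<open>r\<close>. It starts at 0 and equals
  \<open>simple_int\<close> from the last endpoint on.\<close>

definition run :: "'a simple_rep \<Rightarrow> real \<Rightarrow> 'a \<Rightarrow> real" where
  "run rep r \<omega> = (\<Sum>(a, b, A, X) \<leftarrow> rep. X \<omega> * (W (min b r) A \<omega> - W (min a r) A \<omega>))"

lemma run_Nil: "run [] r = (\<lambda>\<omega>. 0)" by (simp add: run_def fun_eq_iff)

lemma run_Cons: "run ((a, b, A, X) # rep) r = (\<lambda>\<omega>. X \<omega> * (W (min b r) A \<omega> - W (min a r) A \<omega>) + run rep r \<omega>)"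
  by (simp add: run_def fun_eq_iff)

lemma simple_ok_Cons: "simple_ok M F ((a, b, A, X) # rep) \<longleftrightarrow> 0 \<le> a \<and> a \<le> b \<and> A \<in> fin_borel
      \<and> X \<in> borel_measurable (F a) \<and> (\<exists>C. \<forall>\<omega>\<in>space M. \<bar>X \<omega>\<bar> \<le> C) \<and> simple_ok M F rep"
  unfolding simple_ok_def by auto

lemma run_measurable:
  assumes "simple_ok M F rep" "0 \<le> r"
  shows "run rep r \<in> borel_measurable (F r)"
  using assms(1)
proof (induction rep)
  case Nil then show ?case by (simp add: run_Nil)
next
  case (Cons e rep)
  obtain a b A X where e: "e = (a, b, A, X)" by (cases e)
  note ok = Cons.prems[unfolded e simple_ok_Cons]
  have "(\<lambda>\<omega>. X \<omega> * (W (min b r) A \<omega> - W (min a r) A \<omega>)) \<in> borel_measurable (F r)"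
  \<comment> \<open>The coefficient \<open>X\<close> is measurable only with respect to
    \<open>F a\<close>; before time \<open>a\<close> both stopped times coincide and the term is
    identically 0.\<close>
  proof (cases "r \<le> a")
    case True
    then have "min b r = r" "min a r = r" using ok by auto
    then show ?thesis by simp
  next
    case False
    have "X \<in> borel_measurable (F r)" by (rule F_measurable_mono[of _ a]) (use ok False in simp_all)
    moreover have "W (min b r) A \<in> borel_measurable (F r)" "W (min a r) A \<in> borel_measurable (F r)"
      by (rule W_measurable_F; use ok assms in simp)+
    ultimately show ?thesis by measurable
  qed
  then show ?case unfolding e run_Cons using Cons.IH ok by (intro borel_measurable_add) simp_all
qed

lemma run_0: "simple_ok M F rep \<Longrightarrow> run rep 0 = (\<lambda>\<omega>. 0)"
proof (induction rep)
  case Nil then show ?case by (simp add: run_Nil)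
next
  case (Cons e rep)
  obtain a b A X where e: "e = (a, b, A, X)" by (cases e)
  note ok = Cons.prems[unfolded e simple_ok_Cons]
  have "min b 0 = 0" "min a 0 = 0" using ok by auto
  then show ?case unfolding e run_Cons using Cons.IH ok by simp
qed

definition endpoints :: "'a simple_rep \<Rightarrow> real set" where
  "endpoints rep = (\<Union>(a, b, A, X)\<in>set rep. {a, b})"

lemma endpoints_Cons: "endpoints ((a, b, A, X) # rep) = {a, b} \<union> endpoints rep"
  unfolding endpoints_def by auto

lemma finite_endpoints: "finite (endpoints rep)"
  unfolding endpoints_def by auto

lemma run_eq_simple_int:
  assumes "simple_ok M F rep" "\<And>p. p \<in> endpoints rep \<Longrightarrow> p \<le> r"
  shows "run rep r = simple_int W rep"
  using assms
proof (induction rep)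
  case Nil then show ?case by (simp add: run_def simple_int_def fun_eq_iff)
next
  case (Cons e rep)
  obtain a b A X where e: "e = (a, b, A, X)" by (cases e)
  have "a \<le> r" "b \<le> r" using Cons.prems(2) unfolding e endpoints_Cons by auto
  then have "min b r = b" "min a r = a" by auto
  moreover have "run rep r = simple_int W rep"
    using Cons unfolding e simple_ok_Cons endpoints_Cons by auto
  ultimately show ?case unfolding e run_Cons by (simp add: simple_int_def fun_eq_iff)
qed

lemma simple_fn_eq_0_after:
  assumes "\<And>p. p \<in> endpoints rep \<Longrightarrow> p \<le> r" "r < s"
  shows "simple_fn rep s y \<omega> = 0"
  using assms(1)
proof (induction rep)
  case Nil then show ?case by (simp add: simple_fn_def)
next
  case (Cons e rep)
  obtain a b A X where e: "e = (a, b, A, X)" by (cases e)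
  have "b \<le> r" using Cons.prems unfolding e endpoints_Cons by auto
  moreover have "simple_fn rep s y \<omega> = 0" using Cons unfolding e endpoints_Cons by auto
  ultimately show ?case unfolding e using assms(2) by (simp add: simple_fn_def)
qed

text \<open>The coefficient of the white noise of the atom \<open>B\<close> on a time interval \<open>(r, t]\<close> without
  endpoints of the representation.\<close>
definition coef :: "'a simple_rep \<Rightarrow> real \<Rightarrow> real \<Rightarrow> real set \<Rightarrow> 'a \<Rightarrow> real" where
  "coef rep r t B \<omega> = (\<Sum>(a, b, A, X) \<leftarrow> rep. if a \<le> r \<and> t \<le> b \<and> B \<subseteq> A then X \<omega> else 0)"

lemma coef_Cons: "coef ((a, b, A, X) # rep) r t B \<omega> = (if a \<le> r \<and> t \<le> b \<and> B \<subseteq> A then X \<omega> else 0) + coef rep r t B \<omega>"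
  unfolding coef_def by simp

lemma coef_measurable: "simple_ok M F rep \<Longrightarrow> coef rep r t B \<in> borel_measurable (F r)"
proof (induction rep)
  case Nil then show ?case by (simp add: coef_def[abs_def])
next
  case (Cons e rep)
  obtain a b A X where e: "e = (a, b, A, X)" by (cases e)
  note ok = Cons.prems[unfolded e simple_ok_Cons]
  have "(\<lambda>\<omega>. if a \<le> r \<and> t \<le> b \<and> B \<subseteq> A then X \<omega> else 0) \<in> borel_measurable (F r)"
  proof (cases "a \<le> r \<and> t \<le> b \<and> B \<subseteq> A")
    case True
    then have "X \<in> borel_measurable (F r)" using F_measurable_mono[of X a r] ok by simp
    then show ?thesis using True by simp
  next
    case False then show ?thesis by (simp only: if_False borel_measurable_const)
  qed
  then have "(\<lambda>\<omega>. (if a \<le> r \<and> t \<le> b \<and> B \<subseteq> A then X \<omega> else 0) + coef rep r t B \<omega>) \<in> borel_measurable (F r)"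
    using Cons.IH ok by (intro borel_measurable_add) simp_all
  then show ?case unfolding e by (simp add: coef_Cons[abs_def])
qed

lemma coef_bounded:
  "simple_ok M F rep \<Longrightarrow> \<exists>K. \<forall>r t B. \<forall>\<omega>\<in>space M. \<bar>coef rep r t B \<omega>\<bar> \<le> K"
proof (induction rep)
  case Nil then show ?case by (auto simp: coef_def)
next
  case (Cons e rep)
  obtain a b A X where e: "e = (a, b, A, X)" by (cases e)
  note ok = Cons.prems[unfolded e simple_ok_Cons]
  obtain K where K: "\<And>r t B \<omega>. \<omega> \<in> space M \<Longrightarrow> \<bar>coef rep r t B \<omega>\<bar> \<le> K" using Cons.IH ok by blast
  obtain C where C: "\<And>\<omega>. \<omega> \<in> space M \<Longrightarrow> \<bar>X \<omega>\<bar> \<le> C" using ok by blast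
  have "\<bar>coef ((a, b, A, X) # rep) r t B \<omega>\<bar> \<le> C + K" if "\<omega> \<in> space M" for r t B \<omega>
    using K[OF that, of r t B] C[OF that] unfolding coef_Cons by auto
  then show ?case unfolding e by blast
qed

text \<open>On an interval with no endpoint inside, an entry either spans the interval or does not
  change there. Spanning entries are distributed over the atoms, which is where the almost sure
  additivity of the noise enters.\<close>

lemma run_increment:
  assumes J: "finite J" "J \<subseteq> fin_borel" "disjoint J"
    and st: "0 \<le> s" "s \<le> t"
  shows "simple_ok M F rep \<Longrightarrow> endpoints rep \<inter> {s<..<t} = {} \<Longrightarrow>
    (\<And>a b A X. (a, b, A, X) \<in> set rep \<Longrightarrow> \<Union>{B\<in>J. B \<subseteq> A} = A) \<Longrightarrow>
     AE \<omega> in M. run rep t \<omega> = run rep s \<omega> + (\<Sum>B\<in>J. coef rep s t B \<omega> * dW s t B \<omega>)"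
proof (induction rep)
  case Nil then show ?case by (simp add: run_Nil coef_def)
next
  case (Cons e rep)
  obtain a b A X where e: "e = (a, b, A, X)" by (cases e)
  note ok = Cons.prems(1)[unfolded e simple_ok_Cons]
  have IH: "AE \<omega> in M. run rep t \<omega> = run rep s \<omega> + (\<Sum>B\<in>J. coef rep s t B \<omega> * dW s t B \<omega>)"
  proof (rule Cons.IH)
    show "simple_ok M F rep" using ok by simp
    show "endpoints rep \<inter> {s<..<t} = {}" using Cons.prems(2) unfolding e endpoints_Cons by blast
    show "\<Union>{B\<in>J. B \<subseteq> A'} = A'" if "(a', b', A', X') \<in> set rep" for a' b' A' X'
      by (rule Cons.prems(3)[of a' b' A' X']) (simp add: that)
  qed
  have A: "\<Union>{B\<in>J. B \<subseteq> A} = A" by (rule Cons.prems(3)[of a b A X]) (simp add: e)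
  have ab: "a \<le> s \<or> t \<le> a" "b \<le> s \<or> t \<le> b" "a \<le> b" 
    using Cons.prems(2) ok unfolding e endpoints_Cons by auto
  let ?J = "{B\<in>J. B \<subseteq> A}"
  have J': "finite ?J" "?J \<subseteq> fin_borel" "disjoint ?J" using J by (auto intro: pairwise_subset)
  have t0: "0 \<le> t" using st by simp
  have Ws: "AE \<omega> in M. W s A \<omega> = (\<Sum>B\<in>?J. W s B \<omega>)" using W_Union[OF st(1) J'] unfolding A .
  have Wt: "AE \<omega> in M. W t A \<omega> = (\<Sum>B\<in>?J. W t B \<omega>)" using W_Union[OF t0 J'] unfolding A .
  have "AE \<omega> in M. X \<omega> * (W (min b t) A \<omega> - W (min a t) A \<omega>) = X \<omega> * (W (min b s) A \<omega> - W (min a s) A \<omega>)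
      + (\<Sum>B\<in>J. (if a \<le> s \<and> t \<le> b \<and> B \<subseteq> A then X \<omega> else 0) * dW s t B \<omega>)"
  proof (cases "a \<le> s \<and> t \<le> b")
    case True
    then have m: "min b t = t" "min a t = a" "min b s = s" "min a s = a" using st by auto
    show ?thesis
      using Ws Wt
    proof eventually_elim
      case (elim \<omega>)
      have "(\<Sum>B\<in>J. (if a \<le> s \<and> t \<le> b \<and> B \<subseteq> A then X \<omega> else 0) * dW s t B \<omega>) = (\<Sum>B\<in>?J. X \<omega> * dW s t B \<omega>)"
        using True J(1) by (intro sum.mono_neutral_cong_right) auto
      also have "\<dots> = X \<omega> * (W t A \<omega> - W s A \<omega>)"
        unfolding elim by (simp add: sum_distrib_left sum_subtractf algebra_simps)
      finally show ?case unfolding m by (simp add: algebra_simps)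
    qed
  next
    case False
    \<comment> \<open>The degenerate interval \<open>s = t\<close> has to be listed separately,
      since it has no interior that could exclude endpoints.\<close>
    then consider "t \<le> a" | "b \<le> s" | "s = t" using ab st by linarith
    then have "W (min b t) A \<omega> - W (min a t) A \<omega> = W (min b s) A \<omega> - W (min a s) A \<omega>" for \<omega>
    proof cases
      case 1
      then have "min b t = t" "min a t = t" "min b s = s" "min a s = s" using ab st by auto
      then show ?thesis by simp
    next
      case 2
      then have "min b t = b" "min a t = a" "min b s = b" "min a s = a" using ab st by auto
      then show ?thesis by simp
    qed simp
    moreover have "(\<Sum>B\<in>J. (if a \<le> s \<and> t \<le> b \<and> B \<subseteq> A then X \<omega> else 0) * dW s t B \<omega>) = 0" for \<omega>
      using False by (intro sum.neutral) auto
    ultimately show ?thesis by simp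
  qed
  then show ?case using IH unfolding e run_Cons coef_Cons 
    by eventually_elim (simp only: distrib_right sum.distrib add.assoc add.left_commute)
qed

lemma simple_fn_cell:
  assumes J: "finite J" "disjoint J" and s: "r < s" "s \<le> t"
  shows "endpoints rep \<inter> {r<..<t} = {} \<Longrightarrow>
    (\<And>a b A X. (a, b, A, X) \<in> set rep \<Longrightarrow> a \<le> b \<and> \<Union>{B\<in>J. B \<subseteq> A} = A) \<Longrightarrow>
    simple_fn rep s y \<omega> = (\<Sum>B\<in>J. indicator B y * coef rep r t B \<omega>)"
proof (induction rep)
  case Nil then show ?case by (simp add: simple_fn_def coef_def)
next
  case (Cons e rep)
  obtain a b A X where e: "e = (a, b, A, X)" by (cases e)
  have A: "a \<le> b" "\<Union>{B\<in>J. B \<subseteq> A} = A" using Cons.prems(2)[of a b A X] by (simp_all add: e)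
  have ab: "a \<le> r \<or> t \<le> a" "b \<le> r \<or> t \<le> b"
    using Cons.prems(1) unfolding e endpoints_Cons by auto
  have IH: "simple_fn rep s y \<omega> = (\<Sum>B\<in>J. indicator B y * coef rep r t B \<omega>)"
  proof (rule Cons.IH)
    show "endpoints rep \<inter> {r<..<t} = {}" using Cons.prems(1) unfolding e endpoints_Cons by blast
    show "a' \<le> b' \<and> \<Union>{B\<in>J. B \<subseteq> A'} = A'" if "(a', b', A', X') \<in> set rep" for a' b' A' X'
      by (rule Cons.prems(2)[of a' b' A' X']) (simp add: that)
  qed
  have ind: "(\<Sum>B\<in>J. indicator B y * (if B \<subseteq> A then 1 else 0)) = (indicator A y :: real)"
  proof (cases "y \<in> A")
    case True
    then obtain B0 where B0: "B0 \<in> J" "B0 \<subseteq> A" "y \<in> B0" using A(2) by blast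
    have "(\<Sum>B\<in>J. indicator B y * (if B \<subseteq> A then 1 else 0)) = (\<Sum>B\<in>J. if B = B0 then 1 else (0::real))"
    proof (rule sum.cong[OF refl])
      fix B assume "B \<in> J"
      then show "indicator B y * (if B \<subseteq> A then 1 else 0) = (if B = B0 then 1 else (0::real))"
        using B0 J(2) disjointD[OF J(2) _ B0(1), of B] by (auto simp: indicator_def)
    qed
    then show ?thesis using True B0 J(1) by simp
  next
    case False
    then show ?thesis by (intro sum.neutral[THEN trans]) (auto simp: indicator_def)
  qed
  have "indicator {a<..b} s * indicator A y * X \<omega> = (\<Sum>B\<in>J. indicator B y * (if a \<le> r \<and> t \<le> b \<and> B \<subseteq> A then X \<omega> else 0))"
  proof (cases "a \<le> r \<and> t \<le> b")
    case True
    have "(\<Sum>B\<in>J. indicator B y * (if a \<le> r \<and> t \<le> b \<and> B \<subseteq> A then X \<omega> else 0)) = (\<Sum>B\<in>J. indicator B y * (if B \<subseteq> A then 1 else 0)) * X \<omega>"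
      using True unfolding sum_distrib_right by (intro sum.cong) auto
    then show ?thesis unfolding ind using True s by (auto simp: indicator_def)
  next
    case False
    then have "indicator {a<..b} s = (0::real)" using ab s by (auto simp: indicator_def)
    then show ?thesis using False by (auto intro!: sum.neutral[symmetric])
  qed
  then show ?case unfolding e using IH by (simp add: simple_fn_def coef_Cons sum.distrib distrib_left)
qed

text \<open>At a given point at most one atom contributes, so squaring produces no cross
  terms.\<close>

lemma simple_fn_square_cell:
  assumes J: "finite J" "disjoint J" and s: "r < s" "s \<le> t"
    and "endpoints rep \<inter> {r<..<t} = {}" "\<And>a b A X. (a, b, A, X) \<in> set rep \<Longrightarrow> a \<le> b \<and> \<Union>{B\<in>J. B \<subseteq> A} = A"
  shows "(simple_fn rep s y \<omega>)\<^sup>2 = (\<Sum>B\<in>J. indicator B y * (coef rep r t B \<omega>)\<^sup>2)"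
proof -
  have eq: "simple_fn rep s y \<omega> = (\<Sum>B\<in>J. indicator B y * coef rep r t B \<omega>)"
    by (rule simple_fn_cell[OF J s assms(5)]) (rule assms(6))
  have "(simple_fn rep s y \<omega>)\<^sup>2 = (\<Sum>A\<in>J. \<Sum>B\<in>J. (indicator A y * coef rep r t A \<omega>) * (indicator B y * coef rep r t B \<omega>))"
    unfolding power2_eq_square eq by (rule sum_product)
  also have "\<dots> = (\<Sum>A\<in>J. \<Sum>B\<in>J. if A = B then indicator A y * (coef rep r t A \<omega>)\<^sup>2 else 0)"
  proof (intro sum.cong refl)
    fix A B assume "A \<in> J" "B \<in> J"
    then show "(indicator A y * coef rep r t A \<omega>) * (indicator B y * coef rep r t B \<omega>) = (if A = B then indicator A y * (coef rep r t A \<omega>)\<^sup>2 else 0)"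
      using disjointD[OF J(2), of A B] by (auto simp: indicator_def power2_eq_square)
  qed
  also have "\<dots> = (\<Sum>B\<in>J. indicator B y * (coef rep r t B \<omega>)\<^sup>2)" using J(1) by simp
  finally show ?thesis .
qed

end


section \<open>The isometry for simple integrands\<close>

context noise begin

abbreviation T3 :: "('a \<times> real \<times> real) measure" where
  "T3 \<equiv> M \<Otimes>\<^sub>M (lborel \<Otimes>\<^sub>M lborel)"

abbreviation SF :: "'a simple_rep \<Rightarrow> 'a \<times> real \<times> real \<Rightarrow> real" where
  "SF rep z \<equiv> simple_fn rep (fst (snd z)) (snd (snd z)) (fst z)"

text \<open>This order of integration is the one in \<open>walsh_integral\<close>;
  \<open>T3_iterated'\<close> has the expectation innermost, as needed for moments at a fixed point
  of space-time.\<close>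

lemma T3_iterated:
  assumes [measurable]: "g \<in> borel_measurable T3"
  shows "(\<integral>\<^sup>+z. g z \<partial>T3) = (\<integral>\<^sup>+\<omega>. (\<integral>\<^sup>+s. (\<integral>\<^sup>+y. g (\<omega>, s, y) \<partial>lborel) \<partial>lborel) \<partial>M)"
proof -
  have "(\<integral>\<^sup>+z. g z \<partial>T3) = (\<integral>\<^sup>+\<omega>. (\<integral>\<^sup>+w. g (\<omega>, w) \<partial>(lborel \<Otimes>\<^sub>M lborel)) \<partial>M)"
    by (rule sigma_finite_measure.nn_integral_fst[OF sigma_finite_pair_measure[OF sigma_finite_lborel sigma_finite_lborel], symmetric]) measurable
  also have "\<dots> = (\<integral>\<^sup>+\<omega>. (\<integral>\<^sup>+s. (\<integral>\<^sup>+y. g (\<omega>, s, y) \<partial>lborel) \<partial>lborel) \<partial>M)"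
  proof (rule nn_integral_cong)
    fix \<omega> assume [measurable]: "\<omega> \<in> space M"
    show "(\<integral>\<^sup>+w. g (\<omega>, w) \<partial>(lborel \<Otimes>\<^sub>M lborel)) = (\<integral>\<^sup>+s. (\<integral>\<^sup>+y. g (\<omega>, s, y) \<partial>lborel) \<partial>lborel)"
      by (rule lborel.nn_integral_fst[symmetric]) measurable
  qed
  finally show ?thesis .
qed

lemma T3_iterated':
  assumes [measurable]: "g \<in> borel_measurable T3"
  shows "(\<integral>\<^sup>+z. g z \<partial>T3) = (\<integral>\<^sup>+s. (\<integral>\<^sup>+y. (\<integral>\<^sup>+\<omega>. g (\<omega>, s, y) \<partial>M) \<partial>lborel) \<partial>lborel)"
proof -
  interpret L: pair_sigma_finite "lborel :: real measure" "lborel :: real measure" ..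
  interpret P: pair_sigma_finite M "lborel \<Otimes>\<^sub>M lborel :: (real \<times> real) measure" ..
  have "(\<integral>\<^sup>+z. g z \<partial>T3) = (\<integral>\<^sup>+w. (\<integral>\<^sup>+\<omega>. g (\<omega>, w) \<partial>M) \<partial>(lborel \<Otimes>\<^sub>M lborel))"
    by (rule P.nn_integral_snd[symmetric]) measurable
  also have "\<dots> = (\<integral>\<^sup>+s. (\<integral>\<^sup>+y. (\<integral>\<^sup>+\<omega>. g (\<omega>, s, y) \<partial>M) \<partial>lborel) \<partial>lborel)"
    by (subst lborel.nn_integral_fst[symmetric]) simp_all
  finally show ?thesis .
qed

lemma SF_measurable[measurable]: "simple_ok M F rep \<Longrightarrow> SF rep \<in> borel_measurable T3"
proof (induction rep)
  case Nil then show ?case by (simp add: simple_fn_def)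
next
  case (Cons e rep)
  obtain a b A X where e: "e = (a, b, A, X)" by (cases e)
  note ok = Cons.prems[unfolded e simple_ok_Cons]
  have "X \<in> borel_measurable (F a)" using ok by simp
  then have [measurable]: "X \<in> borel_measurable M" by (rule F_measurable_M)
  have [measurable]: "A \<in> sets borel" using ok by (simp add: fin_borel_def)
  have [measurable]: "SF rep \<in> borel_measurable T3" using Cons.IH ok by simp
  have eq: "SF (e # rep) = (\<lambda>z. indicator {a<..b} (fst (snd z)) * indicator A (snd (snd z)) * X (fst z) + SF rep z)"
    unfolding e by (simp add: simple_fn_def fun_eq_iff)
  show ?case unfolding eq by measurable
qed

lemma T3_split:
  assumes [measurable]: "g \<in> borel_measurable T3" and "r \<le> s" "s \<le> t"
  shows "(\<integral>\<^sup>+z. indicator {r<..t} (fst (snd z)) * g z \<partial>T3) = 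
    (\<integral>\<^sup>+z. indicator {r<..s} (fst (snd z)) * g z \<partial>T3) + (\<integral>\<^sup>+z. indicator {s<..t} (fst (snd z)) * g z \<partial>T3)"
  by (subst nn_integral_add[symmetric]) (use assms in \<open>auto intro!: nn_integral_cong simp: indicator_def\<close>)

text \<open>\<open>J\<close> is a family of spatial atoms that resolves every set of the
  representation. The time intervals are described separately, by the condition that they contain no
  endpoint.\<close>

definition is_cell :: "'a simple_rep \<Rightarrow> real set set \<Rightarrow> bool" where
  "is_cell rep J \<longleftrightarrow> finite J \<and> J \<subseteq> fin_borel \<and> disjoint J \<and> (\<forall>(a, b, A, X)\<in>set rep. \<Union>{B\<in>J. B \<subseteq> A} = A)"

lemma is_cell_exists:
  assumes "simple_ok M F rep"
  obtains J where "is_cell rep J"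
proof -
  have "finite ((\<lambda>(a, b, A, X). A) ` set rep)" "((\<lambda>(a, b, A, X). A) ` set rep) \<subseteq> fin_borel"
    using assms by (auto simp: simple_ok_def)
  then obtain J where J: "finite J" "J \<subseteq> fin_borel" "disjoint J" 
    "\<And>A. A \<in> (\<lambda>(a, b, A, X). A) ` set rep \<Longrightarrow> \<Union>{B\<in>J. B \<subseteq> A} = A"
    by (rule fin_borel_atoms) (rule that, blast+)
  have "is_cell rep J"
    unfolding is_cell_def
  proof (intro conjI J ballI)
    fix e assume e: "e \<in> set rep"
    obtain a b A X where eq: "e = (a, b, A, X)" by (cases e)
    have "A \<in> (\<lambda>(a, b, A, X). A) ` set rep" using e unfolding eq by force
    from J(4)[OF this] show "case e of (a, b, A, X) \<Rightarrow> \<Union>{B\<in>J. B \<subseteq> A} = A" unfolding eq by simp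
  qed
  then show thesis by (rule that)
qed

lemma is_cellD:
  assumes "is_cell rep J"
  shows "finite J" "J \<subseteq> fin_borel" "disjoint J" "(a, b, A, X) \<in> set rep \<Longrightarrow> \<Union>{B\<in>J. B \<subseteq> A} = A"
  using assms unfolding is_cell_def by auto

lemma cell_run_increment:
  assumes "simple_ok M F rep" "is_cell rep J" "0 \<le> r" "r \<le> t" "endpoints rep \<inter> {r<..<t} = {}"
  shows "AE \<omega> in M. run rep t \<omega> = run rep r \<omega> + (\<Sum>B\<in>J. coef rep r t B \<omega> * dW r t B \<omega>)"
  by (rule run_increment[OF is_cellD(1-3)[OF assms(2)] assms(3,4,1,5)]) (rule is_cellD(4)[OF assms(2)])

text \<open>Identifies the sum over atoms coming from \<open>step_quadratic\<close> with a
  space-time integral, a form that no longer mentions the atoms and is additive in time. The weight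
  \<open>v\<close> is 1 for the isometry and a truncated weight for higher moments.\<close>

lemma cell_integral:
  assumes ok: "simple_ok M F rep" and J: "is_cell rep J" and rt: "0 \<le> r" "r \<le> t" 
    and cell: "endpoints rep \<inter> {r<..<t} = {}"
    and v[measurable]: "v \<in> borel_measurable M" and C: "\<And>\<omega>. \<omega> \<in> space M \<Longrightarrow> 0 \<le> v \<omega> \<and> v \<omega> \<le> C"
  shows "(\<integral>\<^sup>+z. indicator {r<..t} (fst (snd z)) * ennreal (v (fst z) * (SF rep z)\<^sup>2) \<partial>T3)
    = ennreal (\<Sum>B\<in>J. expectation (\<lambda>\<omega>. v \<omega> * (coef rep r t B \<omega>)\<^sup>2) * ((t - r) * measure lborel B))"
proof -
  note J' = is_cellD[OF J]
  obtain K where K: "\<And>r t B \<omega>. \<omega> \<in> space M \<Longrightarrow> \<bar>coef rep r t B \<omega>\<bar> \<le> K" using coef_bounded[OF ok] by blast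
  have Y[measurable]: "coef rep r t B \<in> borel_measurable M" for B
    by (rule F_measurable_M[OF coef_measurable[OF ok]])
  have Jb[measurable]: "B \<in> sets borel" if "B \<in> J" for B using that J' by (auto simp: fin_borel_def)
  have ok': "a \<le> b \<and> \<Union>{B\<in>J. B \<subseteq> A} = A" if "(a, b, A, X) \<in> set rep" for a b A X
    using that ok J'(4)[OF that] by (auto simp: simple_ok_def)
  have sq: "indicator {r<..t} s * (v \<omega> * (simple_fn rep s y \<omega>)\<^sup>2) = (\<Sum>B\<in>J. (v \<omega> * (coef rep r t B \<omega>)\<^sup>2) * (indicator {r<..t} s * indicator B y))" for s y \<omega>
  proof (cases "r < s \<and> s \<le> t")
    case True
    have "(simple_fn rep s y \<omega>)\<^sup>2 = (\<Sum>B\<in>J. indicator B y * (coef rep r t B \<omega>)\<^sup>2)"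
      by (rule simple_fn_square_cell[OF J'(1,3) _ _ cell ok']) (use True in simp_all)
    then show ?thesis using True by (simp add: sum_distrib_left mult_ac)
  next
    case False
    then have "indicator {r<..t} s = (0::real)" by (simp add: indicator_def)
    then show ?thesis by simp
  qed
  have i: "integrable M (\<lambda>\<omega>. v \<omega> * (coef rep r t B \<omega>)\<^sup>2)" for B
  proof (rule bounded_integrable)
    fix \<omega> assume \<omega>: "\<omega> \<in> space M"
    have "\<bar>coef rep r t B \<omega>\<bar>\<^sup>2 \<le> K\<^sup>2" by (intro power_mono K \<omega>) simp
    then show "\<bar>v \<omega> * (coef rep r t B \<omega>)\<^sup>2\<bar> \<le> C * K\<^sup>2" using C[OF \<omega>] by (simp add: abs_mult mult_mono)
  qed measurable
  have "(\<integral>\<^sup>+z. indicator {r<..t} (fst (snd z)) * ennreal (v (fst z) * (SF rep z)\<^sup>2) \<partial>T3)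
    = (\<integral>\<^sup>+z. (\<Sum>B\<in>J. ennreal (v (fst z) * (coef rep r t B (fst z))\<^sup>2) * (indicator {r<..t} (fst (snd z)) * indicator B (snd (snd z)))) \<partial>T3)"
  proof (rule nn_integral_cong)
    fix z assume "z \<in> space T3"
    then have \<omega>: "fst z \<in> space M" by (auto simp: space_pair_measure)
    have "indicator {r<..t} (fst (snd z)) * ennreal (v (fst z) * (SF rep z)\<^sup>2) = ennreal (indicator {r<..t} (fst (snd z)) * (v (fst z) * (SF rep z)\<^sup>2))"
      by (simp add: indicator_def)
    also have "\<dots> = (\<Sum>B\<in>J. ennreal ((v (fst z) * (coef rep r t B (fst z))\<^sup>2) * (indicator {r<..t} (fst (snd z)) * indicator B (snd (snd z)))))"
      unfolding sq using C[OF \<omega>] by (intro sum_ennreal[symmetric]) simp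
    also have "\<dots> = (\<Sum>B\<in>J. ennreal (v (fst z) * (coef rep r t B (fst z))\<^sup>2) * (indicator {r<..t} (fst (snd z)) * indicator B (snd (snd z))))"
      by (intro sum.cong refl) (auto simp: indicator_def)
    finally show "indicator {r<..t} (fst (snd z)) * ennreal (v (fst z) * (SF rep z)\<^sup>2) = \<dots>" .
  qed
  also have "\<dots> = (\<Sum>B\<in>J. (\<integral>\<^sup>+z. ennreal (v (fst z) * (coef rep r t B (fst z))\<^sup>2) * (indicator {r<..t} (fst (snd z)) * indicator B (snd (snd z))) \<partial>T3))"
    by (rule nn_integral_sum) measurable
  also have "\<dots> = (\<Sum>B\<in>J. ennreal (expectation (\<lambda>\<omega>. v \<omega> * (coef rep r t B \<omega>)\<^sup>2) * ((t - r) * measure lborel B)))"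
  proof (rule sum.cong[OF refl])
    fix B assume B[measurable]: "B \<in> J"
    note [measurable] = Jb[OF B]
    have "(\<integral>\<^sup>+z. ennreal (v (fst z) * (coef rep r t B (fst z))\<^sup>2) * (indicator {r<..t} (fst (snd z)) * indicator B (snd (snd z))) \<partial>T3)
      = (\<integral>\<^sup>+\<omega>. (\<integral>\<^sup>+s. (\<integral>\<^sup>+y. ennreal (v \<omega> * (coef rep r t B \<omega>)\<^sup>2) * (indicator {r<..t} s * indicator B y) \<partial>lborel) \<partial>lborel) \<partial>M)"
      by (subst T3_iterated) simp_all
    also have "\<dots> = (\<integral>\<^sup>+\<omega>. ennreal (v \<omega> * (coef rep r t B \<omega>)\<^sup>2) * (ennreal (t - r) * emeasure lborel B) \<partial>M)"
      using rt by (simp add: nn_integral_cmult nn_integral_multc)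
    also have "\<dots> = (\<integral>\<^sup>+\<omega>. ennreal (v \<omega> * (coef rep r t B \<omega>)\<^sup>2) \<partial>M) * (ennreal (t - r) * emeasure lborel B)"
      by (rule nn_integral_multc) measurable
    also have "(\<integral>\<^sup>+\<omega>. ennreal (v \<omega> * (coef rep r t B \<omega>)\<^sup>2) \<partial>M) = ennreal (expectation (\<lambda>\<omega>. v \<omega> * (coef rep r t B \<omega>)\<^sup>2))"
      using C by (intro nn_integral_eq_integral i AE_I2) simp
    also have "emeasure lborel B = ennreal (measure lborel B)"
      by (rule emeasure_fin_borel) (use J' B in blast)
    also have "ennreal (expectation (\<lambda>\<omega>. v \<omega> * (coef rep r t B \<omega>)\<^sup>2)) * (ennreal (t - r) * ennreal (measure lborel B)) 
       = ennreal (expectation (\<lambda>\<omega>. v \<omega> * (coef rep r t B \<omega>)\<^sup>2) * ((t - r) * measure lborel B))"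
      using rt C by (subst ennreal_mult[symmetric], simp, simp, subst ennreal_mult[symmetric])
        (auto intro!: Bochner_Integration.integral_nonneg_AE AE_I2)
    finally show "(\<integral>\<^sup>+z. ennreal (v (fst z) * (coef rep r t B (fst z))\<^sup>2) * (indicator {r<..t} (fst (snd z)) * indicator B (snd (snd z))) \<partial>T3) = \<dots>" .
  qed
  also have "\<dots> = ennreal (\<Sum>B\<in>J. expectation (\<lambda>\<omega>. v \<omega> * (coef rep r t B \<omega>)\<^sup>2) * ((t - r) * measure lborel B))"
    using rt C by (intro sum_ennreal mult_nonneg_nonneg Bochner_Integration.integral_nonneg_AE AE_I2) auto
  finally show ?thesis .
qed

text \<open>Integrability at the earlier time is a premise inside the statement, not of the lemma,
  because only then is the relation between \<open>r\<close> and \<open>t\<close> transitive in the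
  sense of \<open>chain_cells\<close>.\<close>

lemma run_square:
  assumes ok: "simple_ok M F rep" and "0 \<le> r" "r \<le> t"
  shows "integrable M (\<lambda>\<omega>. (run rep r \<omega>)\<^sup>2) \<longrightarrow> integrable M (\<lambda>\<omega>. (run rep t \<omega>)\<^sup>2) \<and> 
    expectation (run rep t) = expectation (run rep r) \<and>
    ennreal (expectation (\<lambda>\<omega>. (run rep t \<omega>)\<^sup>2)) = ennreal (expectation (\<lambda>\<omega>. (run rep r \<omega>)\<^sup>2)) 
      + (\<integral>\<^sup>+z. indicator {r<..t} (fst (snd z)) * ennreal ((SF rep z)\<^sup>2) \<partial>T3)"
proof (rule chain_cells[where a = 0 and b = t and P = "endpoints rep" and r = r and t = t])
  show "finite (endpoints rep)" by (rule finite_endpoints)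
next
  fix r t :: real assume rt: "0 \<le> r" "r \<le> t" and cell: "endpoints rep \<inter> {r<..<t} = {}"
  obtain J where J: "is_cell rep J" using is_cell_exists[OF ok] .
  note J' = is_cellD[OF J]
  obtain K where K: "\<And>r t B \<omega>. \<omega> \<in> space M \<Longrightarrow> \<bar>coef rep r t B \<omega>\<bar> \<le> K" using coef_bounded[OF ok] by blast
  let ?h = "\<lambda>\<omega>. \<Sum>B\<in>J. coef rep r t B \<omega> * dW r t B \<omega>"
  note Y = coef_measurable[OF ok, of r t]
  have Z: "run rep r \<in> borel_measurable (F r)" by (rule run_measurable[OF ok rt(1)])
  have ZM[measurable]: "run rep r \<in> borel_measurable M" "run rep t \<in> borel_measurable M" 
    using rt by (auto intro!: F_measurable_M[OF run_measurable] ok)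
  have hM[measurable]: "?h \<in> borel_measurable M"
    by (intro borel_measurable_sum borel_measurable_times F_measurable_M[OF Y] dW_measurable[OF rt J'(1-3) Y K])
  note ae = cell_run_increment[OF ok J rt cell]
  show "integrable M (\<lambda>\<omega>. (run rep r \<omega>)\<^sup>2) \<longrightarrow> integrable M (\<lambda>\<omega>. (run rep t \<omega>)\<^sup>2) \<and> 
    expectation (run rep t) = expectation (run rep r) \<and>
    ennreal (expectation (\<lambda>\<omega>. (run rep t \<omega>)\<^sup>2)) = ennreal (expectation (\<lambda>\<omega>. (run rep r \<omega>)\<^sup>2)) 
      + (\<integral>\<^sup>+z. indicator {r<..t} (fst (snd z)) * ennreal ((SF rep z)\<^sup>2) \<partial>T3)"
  proof (intro impI conjI)
    assume i: "integrable M (\<lambda>\<omega>. (run rep r \<omega>)\<^sup>2)"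
    note sq = step_square[OF rt J'(1-3) Y K Z i]
    have ae2: "AE \<omega> in M. (run rep r \<omega> + ?h \<omega>)\<^sup>2 = (run rep t \<omega>)\<^sup>2" using ae by eventually_elim simp
    show "integrable M (\<lambda>\<omega>. (run rep t \<omega>)\<^sup>2)"
      by (rule integrable_cong_AE_imp[OF sq(1) _ ae2]) measurable
    have l: "integrable M (\<lambda>\<omega>. 1 * ?h \<omega>)" "expectation (\<lambda>\<omega>. 1 * ?h \<omega>) = 0"
      by (rule step_linear[OF rt J'(1-3) Y K borel_measurable_const integrable_const]; assumption)+
    have iZ: "integrable M (run rep r)" by (rule square_integrable_imp_integrable[OF ZM(1) i])
    have "expectation (run rep t) = expectation (\<lambda>\<omega>. run rep r \<omega> + 1 * ?h \<omega>)"
      by (rule integral_cong_AE) (use ae in auto)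
    also have "\<dots> = expectation (run rep r) + expectation (\<lambda>\<omega>. 1 * ?h \<omega>)"
      by (rule Bochner_Integration.integral_add[OF iZ l(1)])
    finally show "expectation (run rep t) = expectation (run rep r)" unfolding l(2) by simp
    have "expectation (\<lambda>\<omega>. (run rep t \<omega>)\<^sup>2) = expectation (\<lambda>\<omega>. (run rep r \<omega> + ?h \<omega>)\<^sup>2)"
      by (rule integral_cong_AE) (use ae2 in \<open>auto elim: eventually_mono\<close>)
    also have "\<dots> = expectation (\<lambda>\<omega>. (run rep r \<omega>)\<^sup>2) + (\<Sum>B\<in>J. expectation (\<lambda>\<omega>. (coef rep r t B \<omega>)\<^sup>2) * ((t - r) * measure lborel B))"
      by (rule sq(2))
    finally have "ennreal (expectation (\<lambda>\<omega>. (run rep t \<omega>)\<^sup>2)) = ennreal (expectation (\<lambda>\<omega>. (run rep r \<omega>)\<^sup>2)) 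
        + ennreal (\<Sum>B\<in>J. expectation (\<lambda>\<omega>. (coef rep r t B \<omega>)\<^sup>2) * ((t - r) * measure lborel B))"
      using rt by (simp add: sum_nonneg)
    also have "ennreal (\<Sum>B\<in>J. expectation (\<lambda>\<omega>. (coef rep r t B \<omega>)\<^sup>2) * ((t - r) * measure lborel B)) 
      = (\<integral>\<^sup>+z. indicator {r<..t} (fst (snd z)) * ennreal ((SF rep z)\<^sup>2) \<partial>T3)"
      using cell_integral[OF ok J rt cell, of "\<lambda>_. 1" 1] by simp
    finally show "ennreal (expectation (\<lambda>\<omega>. (run rep t \<omega>)\<^sup>2)) = ennreal (expectation (\<lambda>\<omega>. (run rep r \<omega>)\<^sup>2)) 
      + (\<integral>\<^sup>+z. indicator {r<..t} (fst (snd z)) * ennreal ((SF rep z)\<^sup>2) \<partial>T3)" .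
  qed
next
  fix r s t :: real assume rst: "r \<le> s" "s \<le> t"
  note [measurable] = SF_measurable[OF ok]
  have split: "(\<integral>\<^sup>+z. indicator {r<..t} (fst (snd z)) * ennreal ((SF rep z)\<^sup>2) \<partial>T3) = 
    (\<integral>\<^sup>+z. indicator {r<..s} (fst (snd z)) * ennreal ((SF rep z)\<^sup>2) \<partial>T3) + (\<integral>\<^sup>+z. indicator {s<..t} (fst (snd z)) * ennreal ((SF rep z)\<^sup>2) \<partial>T3)"
    by (rule T3_split[OF _ rst]) measurable
  show "integrable M (\<lambda>\<omega>. (run rep r \<omega>)\<^sup>2) \<longrightarrow> integrable M (\<lambda>\<omega>. (run rep s \<omega>)\<^sup>2) \<and> 
    expectation (run rep s) = expectation (run rep r) \<and>
    ennreal (expectation (\<lambda>\<omega>. (run rep s \<omega>)\<^sup>2)) = ennreal (expectation (\<lambda>\<omega>. (run rep r \<omega>)\<^sup>2)) 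
      + (\<integral>\<^sup>+z. indicator {r<..s} (fst (snd z)) * ennreal ((SF rep z)\<^sup>2) \<partial>T3) \<Longrightarrow>
   integrable M (\<lambda>\<omega>. (run rep s \<omega>)\<^sup>2) \<longrightarrow> integrable M (\<lambda>\<omega>. (run rep t \<omega>)\<^sup>2) \<and> 
    expectation (run rep t) = expectation (run rep s) \<and>
    ennreal (expectation (\<lambda>\<omega>. (run rep t \<omega>)\<^sup>2)) = ennreal (expectation (\<lambda>\<omega>. (run rep s \<omega>)\<^sup>2)) 
      + (\<integral>\<^sup>+z. indicator {s<..t} (fst (snd z)) * ennreal ((SF rep z)\<^sup>2) \<partial>T3) \<Longrightarrow>
   integrable M (\<lambda>\<omega>. (run rep r \<omega>)\<^sup>2) \<longrightarrow> integrable M (\<lambda>\<omega>. (run rep t \<omega>)\<^sup>2) \<and> 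
    expectation (run rep t) = expectation (run rep r) \<and>
    ennreal (expectation (\<lambda>\<omega>. (run rep t \<omega>)\<^sup>2)) = ennreal (expectation (\<lambda>\<omega>. (run rep r \<omega>)\<^sup>2)) 
      + (\<integral>\<^sup>+z. indicator {r<..t} (fst (snd z)) * ennreal ((SF rep z)\<^sup>2) \<partial>T3)"
    unfolding split by (intro impI, drule (1) mp, elim conjE, drule (1) mp, elim conjE, simp only: add.assoc simp_thms)
qed (use assms in simp_all)

lemma run_square_0:
  assumes ok: "simple_ok M F rep" and "0 \<le> t"
  shows "integrable M (\<lambda>\<omega>. (run rep t \<omega>)\<^sup>2)" "expectation (run rep t) = 0"
    "ennreal (expectation (\<lambda>\<omega>. (run rep t \<omega>)\<^sup>2)) = (\<integral>\<^sup>+z. indicator {0<..t} (fst (snd z)) * ennreal ((SF rep z)\<^sup>2) \<partial>T3)"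
  using run_square[OF ok order_refl assms(2)] unfolding run_0[OF ok] by simp_all

text \<open>Any time beyond all endpoints will do as \<open>T\<close>; the value 0 is inserted so
  that the maximum exists and is nonnegative even for the empty representation.\<close>

lemma simple_int_run:
  assumes ok: "simple_ok M F rep"
  obtains T where "T \<ge> 0" "run rep T = simple_int W rep" "\<And>s y \<omega>. T < s \<Longrightarrow> simple_fn rep s y \<omega> = 0"
proof -
  define T where "T = Max (insert 0 (endpoints rep))"
  have T: "T \<ge> 0" "\<And>p. p \<in> endpoints rep \<Longrightarrow> p \<le> T" unfolding T_def using finite_endpoints by auto
  show thesis by (rule that[OF T(1) run_eq_simple_int[OF ok T(2)] simple_fn_eq_0_after[OF T(2)]])
qed

lemma simple_int_measurable: "simple_ok M F rep \<Longrightarrow> simple_int W rep \<in> borel_measurable M"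
  using simple_int_run[of rep] run_measurable F_measurable_M by metis

lemma simple_int_square:
  assumes ok: "simple_ok M F rep"
  shows "integrable M (\<lambda>\<omega>. (simple_int W rep \<omega>)\<^sup>2)" "expectation (simple_int W rep) = 0"
    "(\<integral>\<^sup>+\<omega>. ennreal ((simple_int W rep \<omega>)\<^sup>2) \<partial>M) = (\<integral>\<^sup>+z. indicator {0<..} (fst (snd z)) * ennreal ((SF rep z)\<^sup>2) \<partial>T3)"
proof -
  obtain T where T: "T \<ge> 0" "run rep T = simple_int W rep" "\<And>s y \<omega>. T < s \<Longrightarrow> simple_fn rep s y \<omega> = 0"
    using simple_int_run[OF ok] by blast
  note r = run_square_0[OF ok T(1), unfolded T(2)]
  show "integrable M (\<lambda>\<omega>. (simple_int W rep \<omega>)\<^sup>2)" "expectation (simple_int W rep) = 0" by (rule r)+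
  have "(\<integral>\<^sup>+\<omega>. ennreal ((simple_int W rep \<omega>)\<^sup>2) \<partial>M) = ennreal (expectation (\<lambda>\<omega>. (simple_int W rep \<omega>)\<^sup>2))"
    by (rule nn_integral_eq_integral[OF r(1)]) simp
  also have "\<dots> = (\<integral>\<^sup>+z. indicator {0<..} (fst (snd z)) * ennreal ((SF rep z)\<^sup>2) \<partial>T3)"
    unfolding r(3) using T(3) by (intro nn_integral_cong) (force simp: indicator_def)
  finally show "(\<integral>\<^sup>+\<omega>. ennreal ((simple_int W rep \<omega>)\<^sup>2) \<partial>M) = (\<integral>\<^sup>+z. indicator {0<..} (fst (snd z)) * ennreal ((SF rep z)\<^sup>2) \<partial>T3)" .
qed

end


text \<open>Finiteness of \<open>G\<close> is essential, as the premise holds trivially for infinite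
  \<open>G\<close>. All a priori finiteness results of the development exist to feed this kind of
  step.\<close>

lemma ennreal_half_absorb:
  fixes G a b :: ennreal
  assumes "G \<le> a * G + b" "a \<le> ennreal (1/2)" "G < \<infinity>"
  shows "G \<le> 2 * b"
proof (cases "b = \<infinity>")
  case True then show ?thesis by (simp add: ennreal_mult_top)
next
  case False
  obtain g where g: "G = ennreal g" "g \<ge> 0" using assms(3) by (cases G) auto
  obtain c where c: "b = ennreal c" "c \<ge> 0" using False by (cases b) auto
  have "G \<le> a * G + b" by (rule assms(1))
  also have "\<dots> \<le> ennreal (1/2) * G + b" by (intro add_right_mono mult_right_mono assms(2)) simp
  also have "\<dots> = ennreal (1/2 * g + c)" unfolding g(1) c(1) 
    using g c by (simp only: ennreal_mult[symmetric] ennreal_plus[symmetric] mult_nonneg_nonneg zero_le_divide_1_iff zero_le_numeral)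
  finally have "ennreal g \<le> ennreal (g / 2 + c)" unfolding g(1) by simp
  then have "g \<le> g / 2 + c" using g c by (subst (asm) ennreal_le_iff) simp_all
  then have "g \<le> 2 * c" by simp
  then have "ennreal g \<le> ennreal (2 * c)" by (rule ennreal_leI)
  then show ?thesis unfolding g(1) c(1) by (simp add: ennreal_mult')
qed

text \<open>The constant in front of the second-order term of
  \<open>truncated_power_taylor\<close>.\<close>

definition taylor_const :: "nat \<Rightarrow> real" where
  "taylor_const m = (1 + 2 * real m) * (1 + real m) * 4 ^ m"

lemma taylor_const_pos: "taylor_const m > 0"
  unfolding taylor_const_def by (intro mult_pos_pos add_pos_nonneg) auto

section \<open>A moment inequality for simple integrands\<close>

context noise begin

context
  fixes rep :: "'a simple_rep" and q :: "real \<Rightarrow> real \<Rightarrow> real" and \<epsilon> :: real and m :: nat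
  assumes ok: "simple_ok M F rep" and \<epsilon>: "\<epsilon> > 0" and m: "m > 0"
    and q_measurable[measurable]: "(\<lambda>w. q (fst w) (snd w)) \<in> borel_measurable (lborel \<Otimes>\<^sub>M lborel)" 
    and q_nonneg: "\<And>s y. q s y \<ge> 0"
begin

abbreviation WP :: "'a \<times> real \<times> real \<Rightarrow> real" where
  "WP z \<equiv> weighted_power \<epsilon> m (q (fst (snd z)) (snd (snd z))) (SF rep z)"

lemma q_measurable_T3[measurable]: "(\<lambda>z. q (fst (snd z)) (snd (snd z))) \<in> borel_measurable T3"
proof -
  have "(\<lambda>w. q (fst w) (snd w)) \<circ> snd \<in> borel_measurable T3" 
    by (rule measurable_comp[OF measurable_snd q_measurable])
  then show ?thesis by (simp add: comp_def)
qed

lemma SF_measurable'[measurable]: "SF rep \<in> borel_measurable T3"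
  by (rule SF_measurable[OF ok])

definition "EP r = (\<integral>\<^sup>+\<omega>. ennreal (truncated_power \<epsilon> m (run rep r \<omega>)) \<partial>M)"

lemma EP_expectation:
  assumes "0 \<le> r" shows "EP r = ennreal (expectation (\<lambda>\<omega>. truncated_power \<epsilon> m (run rep r \<omega>)))"
  unfolding EP_def
  by (rule nn_integral_eq_integral[OF truncated_power_integrable[OF \<epsilon>]])
    (use run_square_0[OF ok assms] F_measurable_M[OF run_measurable[OF ok assms]] truncated_power_nonneg[OF \<epsilon>] in auto)

text \<open>Young's inequality splits the quadratic term into \<open>q\<close> times the truncated
  power of the past value and a term without the past. As \<open>q\<close> is deterministic, the
  first factors into the mass of \<open>q\<close> on the interval and \<open>EP r\<close>, which is
  replaced by the uniform bound \<open>G\<close> to make the estimate additive in time.\<close>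

lemma EP_cell:
  assumes J: "is_cell rep J" and K: "\<And>r t B \<omega>. \<omega> \<in> space M \<Longrightarrow> \<bar>coef rep r t B \<omega>\<bar> \<le> K"
    and rt: "0 \<le> r" "r \<le> t" and cell: "endpoints rep \<inter> {r<..<t} = {}" and G: "EP r \<le> G"
  shows "EP t \<le> EP r + ennreal (taylor_const m) * 
      ((\<integral>\<^sup>+z. indicator {r<..t} (fst (snd z)) * ennreal (q (fst (snd z)) (snd (snd z))) \<partial>T3) * G 
       + (\<integral>\<^sup>+z. indicator {r<..t} (fst (snd z)) * ennreal (WP z) \<partial>T3))
     + ennreal (taylor_const m * (\<Sum>B\<in>J. (real (card J) * K) ^ (2 * (m+1)) * (fact (2 * (m+1)) / (2 ^ (m+1) * fact (m+1)) * measure lborel B ^ (m+1))) * (t - r) ^ (m+1))"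
proof -
  note J' = is_cellD[OF J]
  let ?c = "taylor_const m"
  let ?D = "\<Sum>B\<in>J. (real (card J) * K) ^ (2 * (m+1)) * (fact (2 * (m+1)) / (2 ^ (m+1) * fact (m+1)) * measure lborel B ^ (m+1))"
  let ?h = "\<lambda>\<omega>. \<Sum>B\<in>J. coef rep r t B \<omega> * dW r t B \<omega>"
  let ?w = "\<lambda>\<omega>. truncated_weight \<epsilon> m (run rep r \<omega>)"
  let ?S = "\<Sum>B\<in>J. expectation (\<lambda>\<omega>. ?w \<omega> * (coef rep r t B \<omega>)\<^sup>2) * ((t - r) * measure lborel B)"
  note Y = coef_measurable[OF ok, of r t]
  have Z: "run rep r \<in> borel_measurable (F r)" by (rule run_measurable[OF ok rt(1)])
  have t0: "0 \<le> t" using rt by simp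
  have ZM[measurable]: "run rep r \<in> borel_measurable M" "run rep t \<in> borel_measurable M" 
    using rt by (auto intro!: F_measurable_M[OF run_measurable] ok)
  have hM[measurable]: "?h \<in> borel_measurable M"
    by (intro borel_measurable_sum borel_measurable_times F_measurable_M[OF Y] dW_measurable[OF rt J'(1-3) Y K])
  note ae = cell_run_increment[OF ok J rt cell]
  note c0 = taylor_const_pos[of m]
  have S0: "?S \<ge> 0"
    using rt truncated_weight_nonneg[OF \<epsilon>] by (intro sum_nonneg mult_nonneg_nonneg Bochner_Integration.integral_nonneg) auto
  have "expectation (\<lambda>\<omega>. truncated_power \<epsilon> m (run rep t \<omega>)) = expectation (\<lambda>\<omega>. truncated_power \<epsilon> m (run rep r \<omega> + ?h \<omega>))"
    by (rule integral_cong_AE) (use ae in \<open>auto elim: eventually_mono\<close>)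
  also have "\<dots> \<le> expectation (\<lambda>\<omega>. truncated_power \<epsilon> m (run rep r \<omega>)) + ?c * ?S + ?c * ?D * (t - r) ^ (m+1)"
    unfolding taylor_const_def
    by (rule step_truncated_power[OF rt J'(1-3) Y K \<epsilon> Z run_square_0(1)[OF ok rt(1)]])
  finally have "EP t \<le> ennreal (expectation (\<lambda>\<omega>. truncated_power \<epsilon> m (run rep r \<omega>)) + ?c * ?S + ?c * ?D * (t - r) ^ (m+1))"
    unfolding EP_expectation[OF t0] by (rule ennreal_leI)
  also have "\<dots> = EP r + ennreal ?c * ennreal ?S + ennreal (?c * ?D * (t - r) ^ (m+1))"
  proof -
    have "?D \<ge> 0" by (intro sum_nonneg mult_nonneg_nonneg zero_le_even_power') simp_all
    then have "0 \<le> ?c * ?D * (t - r) ^ (m+1)" using c0 rt by simp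
    moreover have "expectation (\<lambda>\<omega>. truncated_power \<epsilon> m (run rep r \<omega>)) \<ge> 0" 
      using truncated_power_nonneg[OF \<epsilon>] by (intro Bochner_Integration.integral_nonneg) auto
    moreover have "?c * ?S \<ge> 0" using c0 S0 by simp
    ultimately show ?thesis unfolding EP_expectation[OF rt(1)] using c0 S0
      by (simp only: ennreal_plus add_nonneg_nonneg ennreal_mult less_imp_le)
  qed
  finally have 1: "EP t \<le> EP r + ennreal ?c * ennreal ?S + ennreal (?c * ?D * (t - r) ^ (m+1))" .
  have "ennreal ?S = (\<integral>\<^sup>+z. indicator {r<..t} (fst (snd z)) * ennreal (?w (fst z) * (SF rep z)\<^sup>2) \<partial>T3)"
    by (rule cell_integral[OF ok J rt cell, symmetric, of _ "(1/\<epsilon>)^m"])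
      (use truncated_weight_nonneg[OF \<epsilon>] truncated_weight_le_const[OF \<epsilon>] in auto)
  also have "\<dots> \<le> (\<integral>\<^sup>+z. indicator {r<..t} (fst (snd z)) * ennreal (q (fst (snd z)) (snd (snd z))) * ennreal (truncated_power \<epsilon> m (run rep r (fst z))) 
        + indicator {r<..t} (fst (snd z)) * ennreal (WP z) \<partial>T3)"
  proof (rule nn_integral_mono)
    fix z :: "'a \<times> real \<times> real"
    have "ennreal (?w (fst z) * (SF rep z)\<^sup>2) \<le> ennreal (q (fst (snd z)) (snd (snd z)) * truncated_power \<epsilon> m (run rep r (fst z)) + WP z)"
      by (rule ennreal_leI[OF truncated_weight_young[OF \<epsilon> q_nonneg]])
    also have "\<dots> = ennreal (q (fst (snd z)) (snd (snd z))) * ennreal (truncated_power \<epsilon> m (run rep r (fst z))) + ennreal (WP z)"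
      using q_nonneg truncated_power_nonneg[OF \<epsilon>] weighted_power_nonneg[OF \<epsilon> q_nonneg]
      by (simp add: ennreal_mult)
    finally show "indicator {r<..t} (fst (snd z)) * ennreal (?w (fst z) * (SF rep z)\<^sup>2) \<le> indicator {r<..t} (fst (snd z)) * ennreal (q (fst (snd z)) (snd (snd z))) * ennreal (truncated_power \<epsilon> m (run rep r (fst z))) 
        + indicator {r<..t} (fst (snd z)) * ennreal (WP z)"
      by (simp add: indicator_def)
  qed
  also have "\<dots> = (\<integral>\<^sup>+z. indicator {r<..t} (fst (snd z)) * ennreal (q (fst (snd z)) (snd (snd z))) * ennreal (truncated_power \<epsilon> m (run rep r (fst z))) \<partial>T3)
       + (\<integral>\<^sup>+z. indicator {r<..t} (fst (snd z)) * ennreal (WP z) \<partial>T3)"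
    by (rule nn_integral_add) measurable
  \<comment> \<open>Fubini with the expectation innermost; the factor \<open>EP r\<close> is then
    carried back under a trivial expectation, since \<open>M\<close> has total mass 1.\<close>
  also have "(\<integral>\<^sup>+z. indicator {r<..t} (fst (snd z)) * ennreal (q (fst (snd z)) (snd (snd z))) * ennreal (truncated_power \<epsilon> m (run rep r (fst z))) \<partial>T3)
      = (\<integral>\<^sup>+z. indicator {r<..t} (fst (snd z)) * ennreal (q (fst (snd z)) (snd (snd z))) \<partial>T3) * EP r"
  proof -
    have "(\<integral>\<^sup>+z. indicator {r<..t} (fst (snd z)) * ennreal (q (fst (snd z)) (snd (snd z))) * ennreal (truncated_power \<epsilon> m (run rep r (fst z))) \<partial>T3)
      = (\<integral>\<^sup>+s. (\<integral>\<^sup>+y. (\<integral>\<^sup>+\<omega>. indicator {r<..t} s * ennreal (q s y) * ennreal (truncated_power \<epsilon> m (run rep r \<omega>)) \<partial>M) \<partial>lborel) \<partial>lborel)"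
      by (subst T3_iterated') simp_all
    also have "\<dots> = (\<integral>\<^sup>+s. (\<integral>\<^sup>+y. indicator {r<..t} s * ennreal (q s y) * EP r \<partial>lborel) \<partial>lborel)"
      unfolding EP_def by (simp add: nn_integral_cmult)
    also have "\<dots> = (\<integral>\<^sup>+s. (\<integral>\<^sup>+y. (\<integral>\<^sup>+\<omega>. indicator {r<..t} s * ennreal (q s y) * EP r \<partial>M) \<partial>lborel) \<partial>lborel)"
      by (simp add: emeasure_space_1)
    also have "\<dots> = (\<integral>\<^sup>+z. indicator {r<..t} (fst (snd z)) * ennreal (q (fst (snd z)) (snd (snd z))) * EP r \<partial>T3)"
      by (subst T3_iterated') simp_all
    also have "\<dots> = (\<integral>\<^sup>+z. indicator {r<..t} (fst (snd z)) * ennreal (q (fst (snd z)) (snd (snd z))) \<partial>T3) * EP r"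
      by (rule nn_integral_multc) measurable
    finally show ?thesis .
  qed
  also have "(\<integral>\<^sup>+z. indicator {r<..t} (fst (snd z)) * ennreal (q (fst (snd z)) (snd (snd z))) \<partial>T3) * EP r + (\<integral>\<^sup>+z. indicator {r<..t} (fst (snd z)) * ennreal (WP z) \<partial>T3)
      \<le> (\<integral>\<^sup>+z. indicator {r<..t} (fst (snd z)) * ennreal (q (fst (snd z)) (snd (snd z))) \<partial>T3) * G + (\<integral>\<^sup>+z. indicator {r<..t} (fst (snd z)) * ennreal (WP z) \<partial>T3)"
    by (intro add_right_mono mult_left_mono G) simp
  finally show ?thesis
    by (intro order_trans[OF 1] add_right_mono add_left_mono mult_left_mono) simp_all
qed

lemma EP_increment:
  assumes "0 \<le> r" "r \<le> t" and G: "\<And>s. 0 \<le> s \<Longrightarrow> s \<le> t \<Longrightarrow> EP s \<le> G"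
  shows "EP t \<le> EP r + ennreal (taylor_const m) * 
      ((\<integral>\<^sup>+z. indicator {r<..t} (fst (snd z)) * ennreal (q (fst (snd z)) (snd (snd z))) \<partial>T3) * G 
       + (\<integral>\<^sup>+z. indicator {r<..t} (fst (snd z)) * ennreal (WP z) \<partial>T3))" (is "EP t \<le> EP r + ?k r t")
proof -
  have k_add: "?k r t = ?k r s + ?k s t" if "r \<le> s" "s \<le> t" for r s t
  proof -
    have 1: "(\<integral>\<^sup>+z. indicator {r<..t} (fst (snd z)) * ennreal (q (fst (snd z)) (snd (snd z))) \<partial>T3) =
      (\<integral>\<^sup>+z. indicator {r<..s} (fst (snd z)) * ennreal (q (fst (snd z)) (snd (snd z))) \<partial>T3) + 
      (\<integral>\<^sup>+z. indicator {s<..t} (fst (snd z)) * ennreal (q (fst (snd z)) (snd (snd z))) \<partial>T3)"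
      by (rule T3_split[OF _ that]) measurable
    have 2: "(\<integral>\<^sup>+z. indicator {r<..t} (fst (snd z)) * ennreal (WP z) \<partial>T3) =
      (\<integral>\<^sup>+z. indicator {r<..s} (fst (snd z)) * ennreal (WP z) \<partial>T3) + 
      (\<integral>\<^sup>+z. indicator {s<..t} (fst (snd z)) * ennreal (WP z) \<partial>T3)"
      by (rule T3_split[OF _ that]) measurable
    show ?thesis unfolding 1 2 by (simp add: algebra_simps)
  qed
  obtain J where J: "is_cell rep J" using is_cell_exists[OF ok] .
  obtain K where K: "\<And>r t B \<omega>. \<omega> \<in> space M \<Longrightarrow> \<bar>coef rep r t B \<omega>\<bar> \<le> K" using coef_bounded[OF ok] by blast
  show ?thesis
  proof (rule chain_cells[where a = 0 and b = t and P = "endpoints rep" and r = r and t = t and R = "\<lambda>r t. EP t \<le> EP r + ?k r t"])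
    show "finite (endpoints rep)" by (rule finite_endpoints)
  next
    fix r t' assume rt: "0 \<le> r" "r \<le> t'" "t' \<le> t" and cell: "endpoints rep \<inter> {r<..<t'} = {}"
    let ?D = "taylor_const m * (\<Sum>B\<in>J. (real (card J) * K) ^ (2 * (m+1)) * (fact (2 * (m+1)) / (2 ^ (m+1) * fact (m+1)) * measure lborel B ^ (m+1)))"
    show "EP t' \<le> EP r + ?k r t'"
    \<comment> \<open>Every subinterval of a cell is a cell with the same atoms \<open>J\<close> and
      the same bound \<open>K\<close>, so the error constant does not depend on the mesh.\<close>
    proof (rule subdivide[where D = ?D and m = m and r = r and r' = t' and e = EP])
      fix s u assume su: "r \<le> s" "s \<le> u" "u \<le> t'"
      show "EP u \<le> EP s + ?k s u + ennreal (?D * (u - s) ^ (m+1))"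
        by (rule EP_cell[OF J K]) (use rt su cell in \<open>auto intro!: G\<close>)
    next
      show "?D \<ge> 0" using taylor_const_pos[of m] by (intro mult_nonneg_nonneg sum_nonneg zero_le_even_power') simp_all
    next
      show "m > 0" "r \<le> t'" by (rule m, rule rt(2))
    qed (rule k_add)
  next
    fix r s t' :: real assume "r \<le> s" "s \<le> t'" and 1: "EP s \<le> EP r + ?k r s" "EP t' \<le> EP s + ?k s t'"
    have "EP t' \<le> EP s + ?k s t'" by (rule 1)
    also have "\<dots> \<le> EP r + ?k r s + ?k s t'" by (intro add_right_mono 1)
    also have "\<dots> = EP r + ?k r t'" using k_add[OF \<open>r \<le> s\<close> \<open>s \<le> t'\<close>] by (simp add: add.assoc)
    finally show "EP t' \<le> EP r + ?k r t'" .
  qed (use assms in simp_all)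
qed

text \<open>No Gronwall argument is needed: the supremum \<open>G\<close> of the truncated moments
  up to the final time satisfies \<open>G \<le> G / 2 + b\<close>, because the mass of
  \<open>q\<close> is small.\<close>

lemma simple_int_truncated_power:
  assumes Q: "ennreal (taylor_const m) * (\<integral>\<^sup>+z. indicator {0<..} (fst (snd z)) * ennreal (q (fst (snd z)) (snd (snd z))) \<partial>T3) \<le> ennreal (1/2)"
  shows "(\<integral>\<^sup>+\<omega>. ennreal (truncated_power \<epsilon> m (simple_int W rep \<omega>)) \<partial>M) \<le> 
     ennreal (2 * taylor_const m) * (\<integral>\<^sup>+z. indicator {0<..} (fst (snd z)) * ennreal (WP z) \<partial>T3)"
proof -
  obtain T where T: "T \<ge> 0" "run rep T = simple_int W rep"
    by (rule simple_int_run[OF ok])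
  define G where "G = (SUP s\<in>{0..T}. EP s)"
  let ?c = "ennreal (taylor_const m)"
  let ?q = "\<lambda>t. (\<integral>\<^sup>+z. indicator {0<..t} (fst (snd z)) * ennreal (q (fst (snd z)) (snd (snd z))) \<partial>T3)"
  let ?p = "\<lambda>t. (\<integral>\<^sup>+z. indicator {0<..t} (fst (snd z)) * ennreal (WP z) \<partial>T3)"
  let ?Q = "(\<integral>\<^sup>+z. indicator {0<..} (fst (snd z)) * ennreal (q (fst (snd z)) (snd (snd z))) \<partial>T3)"
  let ?P = "(\<integral>\<^sup>+z. indicator {0<..} (fst (snd z)) * ennreal (WP z) \<partial>T3)"
  have G: "EP s \<le> G" if "0 \<le> s" "s \<le> T" for s unfolding G_def by (rule SUP_upper) (use that in simp)
  have EP0: "EP 0 = 0" unfolding EP_def run_0[OF ok] by (simp add: truncated_power_def)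
  have le: "?q t \<le> ?Q" "?p t \<le> ?P" for t by (intro nn_integral_mono; simp add: indicator_def)+
  have "G \<le> ?c * (?Q * G + ?P)"
    unfolding G_def
  proof (rule SUP_least)
    fix t assume t: "t \<in> {0..T}"
    have "EP t \<le> EP 0 + ?c * (?q t * G + ?p t)"
      by (rule EP_increment) (use t in \<open>auto intro: G\<close>)
    also have "\<dots> \<le> ?c * (?Q * G + ?P)" unfolding EP0 using le[of t]
      by (simp add: add_mono mult_left_mono mult_right_mono)
    finally show "EP t \<le> ?c * (?Q * (SUP s\<in>{0..T}. EP s) + ?P)" unfolding G_def .
  qed
  then have G1: "G \<le> (?c * ?Q) * G + ?c * ?P" by (simp add: algebra_simps)
  \<comment> \<open>This bound degenerates as \<epsilon> tends to 0, but it serves only to show that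
    \<open>G\<close> is finite and leaves no trace in the final constant.\<close>
  have "G \<le> ennreal ((1/\<epsilon>)^m) * (\<integral>\<^sup>+\<omega>. ennreal ((simple_int W rep \<omega>)\<^sup>2) \<partial>M)"
    unfolding G_def
  proof (rule SUP_least)
    fix t assume t: "t \<in> {0..T}"
    then have t0: "0 \<le> t" by simp
    have [measurable]: "run rep t \<in> borel_measurable M" by (rule F_measurable_M[OF run_measurable[OF ok t0]])
    have "EP t \<le> (\<integral>\<^sup>+\<omega>. ennreal ((1/\<epsilon>)^m) * ennreal ((run rep t \<omega>)\<^sup>2) \<partial>M)"
      unfolding EP_def using \<epsilon> by (intro nn_integral_mono) (simp add: ennreal_mult'[symmetric] truncated_power_le_const ennreal_leI)
    also have "\<dots> = ennreal ((1/\<epsilon>)^m) * (\<integral>\<^sup>+\<omega>. ennreal ((run rep t \<omega>)\<^sup>2) \<partial>M)"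
      by (rule nn_integral_cmult) measurable
    also have "(\<integral>\<^sup>+\<omega>. ennreal ((run rep t \<omega>)\<^sup>2) \<partial>M) = ennreal (expectation (\<lambda>\<omega>. (run rep t \<omega>)\<^sup>2))"
      by (rule nn_integral_eq_integral[OF run_square_0(1)[OF ok t0]]) simp
    also have "\<dots> \<le> (\<integral>\<^sup>+z. indicator {0<..} (fst (snd z)) * ennreal ((SF rep z)\<^sup>2) \<partial>T3)"
      unfolding run_square_0(3)[OF ok t0] by (intro nn_integral_mono) (simp add: indicator_def)
    also have "\<dots> = (\<integral>\<^sup>+\<omega>. ennreal ((simple_int W rep \<omega>)\<^sup>2) \<partial>M)"
      by (rule simple_int_square(3)[OF ok, symmetric])
    finally show "EP t \<le> ennreal ((1/\<epsilon>)^m) * (\<integral>\<^sup>+\<omega>. ennreal ((simple_int W rep \<omega>)\<^sup>2) \<partial>M)"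
      by (simp add: mult_left_mono)
  qed
  also have "(\<integral>\<^sup>+\<omega>. ennreal ((simple_int W rep \<omega>)\<^sup>2) \<partial>M) = ennreal (expectation (\<lambda>\<omega>. (simple_int W rep \<omega>)\<^sup>2))"
    by (rule nn_integral_eq_integral[OF simple_int_square(1)[OF ok]]) simp
  also have "ennreal ((1/\<epsilon>)^m) * \<dots> < \<infinity>" by (simp add: ennreal_mult_less_top)
  finally have "G < \<infinity>" .
  then have "G \<le> 2 * (?c * ?P)" by (rule ennreal_half_absorb[OF G1 Q])
  moreover have "(\<integral>\<^sup>+\<omega>. ennreal (truncated_power \<epsilon> m (simple_int W rep \<omega>)) \<partial>M) \<le> G"
    using G[of T] T by (simp add: EP_def)
  ultimately show ?thesis using taylor_const_pos[of m] by (simp add: ennreal_mult mult.assoc)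
qed

end

section \<open>Measurability of predictable fields\<close>

lemma pred_sets_measurable:
  assumes "S \<in> pred_sets M F"
  shows "{z \<in> space T3. (fst (snd z), snd (snd z), fst z) \<in> S} \<in> sets T3"
  using assms unfolding pred_sets_def
proof (induction rule: sigma_sets.induct)
  case (Basic S)
  then obtain a b A G where S: "S = {a<..b} \<times> A \<times> G" and A[measurable]: "A \<in> sets borel" and "G \<in> sets (F a)" by blast
  then have [measurable]: "G \<in> sets M" using F_subalgebra unfolding subalgebra_def by blast
  have "{z \<in> space T3. (fst (snd z), snd (snd z), fst z) \<in> S} = {z \<in> space T3. fst (snd z) \<in> {a<..b} \<and> snd (snd z) \<in> A \<and> fst z \<in> G}"
    unfolding S by auto
  also have "\<dots> \<in> sets T3" by measurable
  finally show ?case .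
next
  case Empty then show ?case by simp
next
  case (Compl S)
  have "{z \<in> space T3. (fst (snd z), snd (snd z), fst z) \<in> {0<..} \<times> UNIV \<times> space M - S} = 
     {z \<in> space T3. fst (snd z) \<in> {0<..}} - {z \<in> space T3. (fst (snd z), snd (snd z), fst z) \<in> S}"
    by (auto simp: space_pair_measure)
  also have "\<dots> \<in> sets T3" by (rule sets.Diff[OF _ Compl.IH]) measurable
  finally show ?case .
next
  case (Union S)
  have "{z \<in> space T3. (fst (snd z), snd (snd z), fst z) \<in> (\<Union>i. S i)} = (\<Union>i. {z \<in> space T3. (fst (snd z), snd (snd z), fst z) \<in> S i})"
    by auto
  also have "\<dots> \<in> sets T3" using Union.IH by blast
  finally show ?case .
qed

text \<open>Predictability is a statement about positive times only; the indicator sets the field to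
  0 elsewhere so that it becomes measurable on the whole product space.\<close>

lemma predictable_measurable:
  assumes "predictable M F \<phi>"
  shows "(\<lambda>z. indicator {0<..} (fst (snd z)) * \<phi> (fst (snd z)) (snd (snd z)) (fst z)) \<in> borel_measurable T3"
proof (rule measurableI)
  fix B :: "real set" assume B: "B \<in> sets borel"
  let ?S = "{(t, x, \<omega>). 0 < t \<and> \<omega> \<in> space M \<and> \<phi> t x \<omega> \<in> B}"
  have S: "?S \<in> pred_sets M F" using assms B unfolding predictable_def by blast
  have "(\<lambda>z. indicator {0<..} (fst (snd z)) * \<phi> (fst (snd z)) (snd (snd z)) (fst z)) -` B \<inter> space T3
     = {z \<in> space T3. (fst (snd z), snd (snd z), fst z) \<in> ?S} \<union> {z \<in> space T3. fst (snd z) \<le> 0 \<and> 0 \<in> B}"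
    by (auto simp: indicator_def of_bool_def space_pair_measure split: if_splits)
  also have "\<dots> \<in> sets T3" by (rule sets.Un[OF pred_sets_measurable[OF S]]) measurable
  finally show "(\<lambda>z. indicator {0<..} (fst (snd z)) * \<phi> (fst (snd z)) (snd (snd z)) (fst z)) -` B \<inter> space T3 \<in> sets T3" .
qed simp

lemma predictable_section:
  assumes "predictable M F \<phi>" "0 < t"
  shows "\<phi> t x \<in> borel_measurable M"
proof -
  have "(\<lambda>\<omega>. (\<omega>, t, x)) \<in> measurable M T3" by measurable
  from measurable_comp[OF this predictable_measurable[OF assms(1)]]
  show ?thesis using assms(2) by (simp add: comp_def)
qed

end

section \<open>Walsh integrals\<close>

text \<open>A substitute for the triangle inequality in the space of square integrable functions
  that remains meaningful when the integrals are infinite. The leading constant can be brought as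
  close to 1 as desired, so equalities survive the limit.\<close>

lemma nn_integral_square_le:
  fixes f g :: "'b \<Rightarrow> real"
  assumes [measurable]: "f \<in> borel_measurable N" "g \<in> borel_measurable N" and \<eta>: "\<eta> > 0"
  shows "(\<integral>\<^sup>+x. ennreal ((f x)\<^sup>2) \<partial>N) \<le> ennreal (1 + \<eta>) * (\<integral>\<^sup>+x. ennreal ((g x)\<^sup>2) \<partial>N) + ennreal (1 + 1/\<eta>) * (\<integral>\<^sup>+x. ennreal ((f x - g x)\<^sup>2) \<partial>N)"
proof -
  have pt: "(f x)\<^sup>2 \<le> (1 + \<eta>) * (g x)\<^sup>2 + (1 + 1/\<eta>) * (f x - g x)\<^sup>2" for x
  proof -
    \<comment> \<open>Young's inequality for the cross term, obtained by expanding a square.\<close>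
    have "0 \<le> \<eta> * (g x - (f x - g x) / \<eta>)\<^sup>2" using \<eta> by simp
    also have "\<dots> = \<eta> * (g x)\<^sup>2 - 2 * g x * (f x - g x) + (f x - g x)\<^sup>2 / \<eta>"
      using \<eta> by (simp add: power2_eq_square field_simps)
    finally have "0 \<le> \<eta> * (g x)\<^sup>2 - 2 * g x * (f x - g x) + 1/\<eta> * (f x - g x)\<^sup>2" by simp
    moreover have "(f x)\<^sup>2 = (g x)\<^sup>2 + 2 * g x * (f x - g x) + (f x - g x)\<^sup>2" 
      by (simp add: power2_eq_square algebra_simps)
    ultimately show ?thesis unfolding distrib_right by linarith
  qed
  have "(\<integral>\<^sup>+x. ennreal ((f x)\<^sup>2) \<partial>N) \<le> (\<integral>\<^sup>+x. ennreal (1 + \<eta>) * ennreal ((g x)\<^sup>2) + ennreal (1 + 1/\<eta>) * ennreal ((f x - g x)\<^sup>2) \<partial>N)"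
    using \<eta> by (intro nn_integral_mono) (simp add: ennreal_mult[symmetric] ennreal_plus[symmetric] pt ennreal_leI del: ennreal_plus)
  also have "\<dots> = ennreal (1 + \<eta>) * (\<integral>\<^sup>+x. ennreal ((g x)\<^sup>2) \<partial>N) + ennreal (1 + 1/\<eta>) * (\<integral>\<^sup>+x. ennreal ((f x - g x)\<^sup>2) \<partial>N)"
    by (simp add: nn_integral_add nn_integral_cmult)
  finally show ?thesis .
qed

text \<open>The limit in \<open>n\<close> is taken for fixed \<eta> and removes the errors
  \<open>a\<close> and \<open>b\<close>; afterwards \<eta> runs through \<open>1 / (n + 1)\<close>
  and the two factors \<open>1 + \<eta>\<close> tend to 1.\<close>

lemma ennreal_approx_le:
  fixes A B :: ennreal and X a b :: "nat \<Rightarrow> ennreal"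
  assumes A: "\<And>\<eta> n. \<eta> > 0 \<Longrightarrow> A \<le> ennreal (1 + \<eta>) * X n + ennreal (1 + 1/\<eta>) * a n"
    and X: "\<And>\<eta> n. \<eta> > 0 \<Longrightarrow> X n \<le> ennreal (1 + \<eta>) * B + ennreal (1 + 1/\<eta>) * b n"
    and lim: "a \<longlonglongrightarrow> 0" "b \<longlonglongrightarrow> 0"
  shows "A \<le> B"
proof (cases "B = \<infinity>")
  case False
  have sq: "A \<le> ennreal (1 + \<eta>) * (ennreal (1 + \<eta>) * B)" if \<eta>: "\<eta> > 0" for \<eta>
  proof -
    have lim': "(\<lambda>n. ennreal (1 + \<eta>) * (ennreal (1 + \<eta>) * B + ennreal (1 + 1/\<eta>) * b n) + ennreal (1 + 1/\<eta>) * a n)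
      \<longlonglongrightarrow> ennreal (1 + \<eta>) * (ennreal (1 + \<eta>) * B + ennreal (1 + 1/\<eta>) * 0) + ennreal (1 + 1/\<eta>) * 0"
      by (intro tendsto_add tendsto_const ennreal_tendsto_cmult lim) auto
    have "A \<le> ennreal (1 + \<eta>) * (ennreal (1 + \<eta>) * B + ennreal (1 + 1/\<eta>) * b n) + ennreal (1 + 1/\<eta>) * a n" for n
      by (rule order_trans[OF A[OF \<eta>, of n]]) (intro add_right_mono mult_left_mono X[OF \<eta>], simp)
    then have "A \<le> ennreal (1 + \<eta>) * (ennreal (1 + \<eta>) * B + ennreal (1 + 1/\<eta>) * 0) + ennreal (1 + 1/\<eta>) * 0"
      by (intro LIMSEQ_le_const[OF lim'] exI allI impI)
    then show ?thesis by simp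
  qed
  obtain c where c: "B = ennreal c" "c \<ge> 0" using False by (cases B) auto
  have lim': "(\<lambda>n. ennreal ((1 + 1 / real (Suc n)) * ((1 + 1 / real (Suc n)) * c))) \<longlonglongrightarrow> ennreal ((1 + 0) * ((1 + 0) * c))"
    by (intro tendsto_ennrealI tendsto_mult tendsto_add tendsto_const LIMSEQ_Suc[OF lim_const_over_n])
  have "A \<le> ennreal ((1 + 1 / real (Suc n)) * ((1 + 1 / real (Suc n)) * c))" for n
    using sq[of "1 / real (Suc n)"] c by (simp add: ennreal_mult)
  then have "A \<le> ennreal ((1 + 0) * ((1 + 0) * c))" by (intro LIMSEQ_le_const[OF lim'] exI allI impI)
  then show ?thesis using c by simp
qed simp

context noise begin

abbreviation field0 :: "(real \<Rightarrow> real \<Rightarrow> 'a \<Rightarrow> real) \<Rightarrow> 'a \<times> real \<times> real \<Rightarrow> real" where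
  "field0 \<phi> z \<equiv> indicator {0<..} (fst (snd z)) * \<phi> (fst (snd z)) (snd (snd z)) (fst z)"

lemma walsh_approx:
  assumes "walsh_integral M F W \<phi> I"
  obtains reps where "\<And>n. simple_ok M F (reps n)"
    "(\<lambda>n. \<integral>\<^sup>+z. ennreal ((field0 \<phi> z - field0 (simple_fn (reps n)) z)\<^sup>2) \<partial>T3) \<longlonglongrightarrow> 0"
    "(\<lambda>n. \<integral>\<^sup>+\<omega>. ennreal ((I \<omega> - simple_int W (reps n) \<omega>)\<^sup>2) \<partial>M) \<longlonglongrightarrow> 0"
proof -
  obtain reps where r: "\<And>n. simple_ok M F (reps n)" and
    l1: "(\<lambda>n. \<integral>\<^sup>+\<omega>. (\<integral>\<^sup>+s. (\<integral>\<^sup>+y. indicator {0<..} s * ennreal ((\<phi> s y \<omega> - simple_fn (reps n) s y \<omega>)\<^sup>2) \<partial>lborel) \<partial>lborel) \<partial>M) \<longlonglongrightarrow> 0" and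
    l2: "(\<lambda>n. \<integral>\<^sup>+\<omega>. ennreal ((I \<omega> - simple_int W (reps n) \<omega>)\<^sup>2) \<partial>M) \<longlonglongrightarrow> 0"
    using assms unfolding walsh_integral_def by blast
  have P: "predictable M F \<phi>" using assms unfolding walsh_integral_def by blast
  note [measurable] = predictable_measurable[OF P] SF_measurable[OF r]
  have "(\<integral>\<^sup>+\<omega>. (\<integral>\<^sup>+s. (\<integral>\<^sup>+y. indicator {0<..} s * ennreal ((\<phi> s y \<omega> - simple_fn (reps n) s y \<omega>)\<^sup>2) \<partial>lborel) \<partial>lborel) \<partial>M)
    = (\<integral>\<^sup>+z. ennreal ((field0 \<phi> z - field0 (simple_fn (reps n)) z)\<^sup>2) \<partial>T3)" for n
  proof -
    have "(\<integral>\<^sup>+z. ennreal ((field0 \<phi> z - field0 (simple_fn (reps n)) z)\<^sup>2) \<partial>T3) = 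
      (\<integral>\<^sup>+\<omega>. (\<integral>\<^sup>+s. (\<integral>\<^sup>+y. ennreal ((indicator {0<..} s * \<phi> s y \<omega> - indicator {0<..} s * simple_fn (reps n) s y \<omega>)\<^sup>2) \<partial>lborel) \<partial>lborel) \<partial>M)"
      by (subst T3_iterated) simp_all
    also have "\<dots> = (\<integral>\<^sup>+\<omega>. (\<integral>\<^sup>+s. (\<integral>\<^sup>+y. indicator {0<..} s * ennreal ((\<phi> s y \<omega> - simple_fn (reps n) s y \<omega>)\<^sup>2) \<partial>lborel) \<partial>lborel) \<partial>M)"
      by (intro nn_integral_cong) (simp add: indicator_def)
    finally show ?thesis by simp
  qed
  with l1 show thesis by (intro that[OF r _ l2]) simp
qed

lemma walsh_measurable:
  assumes "walsh_integral M F W \<phi> I"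
  shows "I \<in> borel_measurable M" "field0 \<phi> \<in> borel_measurable T3"
  using assms predictable_measurable unfolding walsh_integral_def by blast+

lemma field0_SF_measurable: "simple_ok M F rep \<Longrightarrow> field0 (simple_fn rep) \<in> borel_measurable T3"
  using SF_measurable by measurable

lemma simple_int_square':
  assumes "simple_ok M F rep"
  shows "(\<integral>\<^sup>+\<omega>. ennreal ((simple_int W rep \<omega>)\<^sup>2) \<partial>M) = (\<integral>\<^sup>+z. ennreal ((field0 (simple_fn rep) z)\<^sup>2) \<partial>T3)"
  unfolding simple_int_square(3)[OF assms] by (intro nn_integral_cong) (simp add: indicator_def)

text \<open>Both sides are approximated by the same simple integrals, and the comparison
  \<open>ennreal_approx_le\<close> is applied in either direction. Infinite values are not excluded
  beforehand.\<close>

lemma walsh_isometry: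
  assumes w: "walsh_integral M F W \<phi> I"
  shows "(\<integral>\<^sup>+\<omega>. ennreal ((I \<omega>)\<^sup>2) \<partial>M) = (\<integral>\<^sup>+z. ennreal ((field0 \<phi> z)\<^sup>2) \<partial>T3)"
proof -
  obtain reps where r: "\<And>n. simple_ok M F (reps n)" and
    b: "(\<lambda>n. \<integral>\<^sup>+z. ennreal ((field0 \<phi> z - field0 (simple_fn (reps n)) z)\<^sup>2) \<partial>T3) \<longlonglongrightarrow> 0" and
    a: "(\<lambda>n. \<integral>\<^sup>+\<omega>. ennreal ((I \<omega> - simple_int W (reps n) \<omega>)\<^sup>2) \<partial>M) \<longlonglongrightarrow> 0"
    using walsh_approx[OF w] by blast
  note m = walsh_measurable[OF w] and fm = field0_SF_measurable[OF r] and im = simple_int_measurable[OF r]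
  have b': "(\<lambda>n. \<integral>\<^sup>+z. ennreal ((field0 (simple_fn (reps n)) z - field0 \<phi> z)\<^sup>2) \<partial>T3) \<longlonglongrightarrow> 0" 
    using b by (simp add: power2_commute)
  have a': "(\<lambda>n. \<integral>\<^sup>+\<omega>. ennreal ((simple_int W (reps n) \<omega> - I \<omega>)\<^sup>2) \<partial>M) \<longlonglongrightarrow> 0"
    using a by (simp add: power2_commute)
  show ?thesis
  proof (rule antisym)
    show "(\<integral>\<^sup>+\<omega>. ennreal ((I \<omega>)\<^sup>2) \<partial>M) \<le> (\<integral>\<^sup>+z. ennreal ((field0 \<phi> z)\<^sup>2) \<partial>T3)"
      by (rule ennreal_approx_le[OF nn_integral_square_le[OF m(1) im] 
          nn_integral_square_le[OF fm m(2), folded simple_int_square'[OF r]] a b'])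
    show "(\<integral>\<^sup>+z. ennreal ((field0 \<phi> z)\<^sup>2) \<partial>T3) \<le> (\<integral>\<^sup>+\<omega>. ennreal ((I \<omega>)\<^sup>2) \<partial>M)"
      by (rule ennreal_approx_le[OF nn_integral_square_le[OF m(2) fm] 
          nn_integral_square_le[OF im m(1), unfolded simple_int_square'[OF r]] b a'])
  qed
qed

lemma square_integrable_finite:
  assumes "X \<in> borel_measurable M" "(\<integral>\<^sup>+\<omega>. ennreal ((X \<omega>)\<^sup>2) \<partial>M) < \<infinity>"
  shows "integrable M (\<lambda>\<omega>. (X \<omega> :: real)\<^sup>2)"
  by (rule integrableI_bounded) (use assms in simp_all)

text \<open>Simple integrals have mean zero, so the squared mean of \<open>I\<close> equals the
  squared mean of the approximation error and is at most its second moment.\<close>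

lemma walsh_expectation:
  assumes w: "walsh_integral M F W \<phi> I" and fin: "(\<integral>\<^sup>+\<omega>. ennreal ((I \<omega>)\<^sup>2) \<partial>M) < \<infinity>"
  shows "expectation I = 0"
proof -
  obtain reps where r: "\<And>n. simple_ok M F (reps n)" and
    a: "(\<lambda>n. \<integral>\<^sup>+\<omega>. ennreal ((I \<omega> - simple_int W (reps n) \<omega>)\<^sup>2) \<partial>M) \<longlonglongrightarrow> 0"
    using walsh_approx[OF w] by blast
  have I: "I \<in> borel_measurable M" by (rule walsh_measurable[OF w])
  have iI: "integrable M I" by (rule square_integrable_imp_integrable[OF I square_integrable_finite[OF I fin]])
  have iS: "integrable M (simple_int W (reps n))" for n
    by (rule square_integrable_imp_integrable[OF simple_int_measurable[OF r] simple_int_square(1)[OF r]])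
  have le: "ennreal ((expectation I)\<^sup>2) \<le> (\<integral>\<^sup>+\<omega>. ennreal ((I \<omega> - simple_int W (reps n) \<omega>)\<^sup>2) \<partial>M)" for n
  proof (cases "(\<integral>\<^sup>+\<omega>. ennreal ((I \<omega> - simple_int W (reps n) \<omega>)\<^sup>2) \<partial>M) < \<infinity>")
    case True
    define X where "X = (\<lambda>\<omega>. I \<omega> - simple_int W (reps n) \<omega>)"
    have Xm: "X \<in> borel_measurable M" unfolding X_def using I simple_int_measurable[OF r] by measurable
    have i2: "integrable M (\<lambda>\<omega>. (X \<omega>)\<^sup>2)" by (rule square_integrable_finite[OF Xm]) (use True in \<open>simp add: X_def\<close>)
    have iX: "integrable M X" by (rule square_integrable_imp_integrable[OF Xm i2])
    have EX: "expectation X = expectation I" unfolding X_def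
      using Bochner_Integration.integral_diff[OF iI iS] simple_int_square(2)[OF r] by simp
    have "0 \<le> variance X" by (rule variance_positive)
    then have "(expectation X)\<^sup>2 \<le> expectation (\<lambda>\<omega>. (X \<omega>)\<^sup>2)" using variance_eq[OF iX i2] by simp
    then have "ennreal ((expectation I)\<^sup>2) \<le> ennreal (expectation (\<lambda>\<omega>. (X \<omega>)\<^sup>2))" unfolding EX by (rule ennreal_leI)
    also have "\<dots> = (\<integral>\<^sup>+\<omega>. ennreal ((X \<omega>)\<^sup>2) \<partial>M)" by (rule nn_integral_eq_integral[symmetric, OF i2]) simp
    finally show ?thesis unfolding X_def .
  next
    \<comment> \<open>An infinite approximation error makes the inequality trivial.\<close>
    case False then show ?thesis by (simp add: not_less top_unique)
  qed
  have "ennreal ((expectation I)\<^sup>2) \<le> 0" by (rule LIMSEQ_le_const[OF a]) (use le in blast)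
  then show ?thesis by (simp add: ennreal_eq_0_iff)
qed

lemma nn_integral_const_bound_add:
  fixes f g h :: "'b \<Rightarrow> real"
  assumes [measurable]: "g \<in> borel_measurable N" "h \<in> borel_measurable N" 
    and "\<And>x. f x \<le> c * (g x + d * h x)" "c \<ge> 0" "d \<ge> 0" "\<And>x. g x \<ge> 0" "\<And>x. h x \<ge> 0"
  shows "(\<integral>\<^sup>+x. ennreal (f x) \<partial>N) \<le> ennreal c * ((\<integral>\<^sup>+x. ennreal (g x) \<partial>N) + ennreal d * (\<integral>\<^sup>+x. ennreal (h x) \<partial>N))"
proof -
  have "(\<integral>\<^sup>+x. ennreal (f x) \<partial>N) \<le> (\<integral>\<^sup>+x. ennreal c * (ennreal (g x) + ennreal d * ennreal (h x)) \<partial>N)"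
  proof (rule nn_integral_mono)
    fix x
    have "ennreal (f x) \<le> ennreal (c * (g x + d * h x))" by (rule ennreal_leI) fact
    also have "\<dots> = ennreal c * (ennreal (g x) + ennreal d * ennreal (h x))"
      using assms(4-7) by (simp add: ennreal_mult)
    finally show "ennreal (f x) \<le> ennreal c * (ennreal (g x) + ennreal d * ennreal (h x))" .
  qed
  also have "\<dots> = ennreal c * ((\<integral>\<^sup>+x. ennreal (g x) \<partial>N) + ennreal d * (\<integral>\<^sup>+x. ennreal (h x) \<partial>N))"
    by (simp add: nn_integral_add nn_integral_cmult)
  finally show ?thesis .
qed

lemma weighted_power_0: "weighted_power \<epsilon> m q 0 = 0"
  by (simp add: weighted_power_def)

text \<open>A Burkholder inequality, uniform in \<open>\<epsilon>\<close>; the deterministic weight \<open>q\<close> must have small total mass.\<close>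
lemma walsh_truncated_power:
  assumes w: "walsh_integral M F W \<phi> I" and \<epsilon>: "\<epsilon> > 0" and m: "m > 0"
    and qm: "(\<lambda>w. q (fst w) (snd w)) \<in> borel_measurable (lborel \<Otimes>\<^sub>M lborel)" and q0: "\<And>s y. q s y \<ge> 0"
    and Q: "ennreal (taylor_const m) * (\<integral>\<^sup>+s. (\<integral>\<^sup>+y. indicator {0<..} s * ennreal (q s y) \<partial>lborel) \<partial>lborel) \<le> ennreal (1/2)"
  shows "(\<integral>\<^sup>+\<omega>. ennreal (truncated_power \<epsilon> m (I \<omega>)) \<partial>M) \<le> 
     ennreal (2 * taylor_const m * 16 ^ (m+1)) * (\<integral>\<^sup>+z. ennreal (weighted_power \<epsilon> m (q (fst (snd z)) (snd (snd z))) (field0 \<phi> z)) \<partial>T3)"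
proof -
  obtain reps where r: "\<And>n. simple_ok M F (reps n)" and
    b: "(\<lambda>n. \<integral>\<^sup>+z. ennreal ((field0 \<phi> z - field0 (simple_fn (reps n)) z)\<^sup>2) \<partial>T3) \<longlonglongrightarrow> 0" and
    a: "(\<lambda>n. \<integral>\<^sup>+\<omega>. ennreal ((I \<omega> - simple_int W (reps n) \<omega>)\<^sup>2) \<partial>M) \<longlonglongrightarrow> 0"
    using walsh_approx[OF w] by blast
  let ?q = "\<lambda>z. q (fst (snd z)) (snd (snd z))"
  note m1 = walsh_measurable[OF w] and fm = field0_SF_measurable[OF r] and im = simple_int_measurable[OF r]
  note [measurable] = m1 fm im q_measurable_T3[OF r[of 0] \<epsilon> m qm q0]
  let ?c = "ennreal (4 ^ (m+1))" and ?e = "ennreal ((1/\<epsilon>)^m)"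
  let ?a = "\<lambda>n. \<integral>\<^sup>+\<omega>. ennreal ((I \<omega> - simple_int W (reps n) \<omega>)\<^sup>2) \<partial>M"
  let ?b = "\<lambda>n. \<integral>\<^sup>+z. ennreal ((field0 \<phi> z - field0 (simple_fn (reps n)) z)\<^sup>2) \<partial>T3"
  let ?P = "\<integral>\<^sup>+z. ennreal (weighted_power \<epsilon> m (?q z) (field0 \<phi> z)) \<partial>T3"
  have Q': "ennreal (taylor_const m) * (\<integral>\<^sup>+z. indicator {0<..} (fst (snd z)) * ennreal (?q z) \<partial>T3) \<le> ennreal (1/2)"
    using Q by (subst T3_iterated) (simp_all add: emeasure_space_1)
  have I: "(\<integral>\<^sup>+\<omega>. ennreal (truncated_power \<epsilon> m (I \<omega>)) \<partial>M) \<le> ?c * ((\<integral>\<^sup>+\<omega>. ennreal (truncated_power \<epsilon> m (simple_int W (reps n) \<omega>)) \<partial>M) + ?e * ?a n)" for n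
  proof (rule nn_integral_const_bound_add)
    fix \<omega>
    have "truncated_power \<epsilon> m (I \<omega>) \<le> 4 ^ (m+1) * (truncated_power \<epsilon> m (simple_int W (reps n) \<omega>) + truncated_power \<epsilon> m (I \<omega> - simple_int W (reps n) \<omega>))"
      using truncated_power_add[OF \<epsilon>, of m "simple_int W (reps n) \<omega>" "I \<omega> - simple_int W (reps n) \<omega>"] by simp
    also have "\<dots> \<le> 4 ^ (m+1) * (truncated_power \<epsilon> m (simple_int W (reps n) \<omega>) + (1/\<epsilon>)^m * (I \<omega> - simple_int W (reps n) \<omega>)\<^sup>2)"
      by (intro mult_left_mono add_left_mono truncated_power_le_const \<epsilon>) simp
    finally show "truncated_power \<epsilon> m (I \<omega>) \<le> 4 ^ (m+1) * (truncated_power \<epsilon> m (simple_int W (reps n) \<omega>) + (1/\<epsilon>)^m * (I \<omega> - simple_int W (reps n) \<omega>)\<^sup>2)" .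
  next
    show "(\<lambda>\<omega>. truncated_power \<epsilon> m (simple_int W (reps n) \<omega>)) \<in> borel_measurable M"
      "(\<lambda>\<omega>. (I \<omega> - simple_int W (reps n) \<omega>)\<^sup>2) \<in> borel_measurable M" by measurable
    show "0 \<le> truncated_power \<epsilon> m (simple_int W (reps n) \<omega>)" for \<omega> by (rule truncated_power_nonneg[OF \<epsilon>])
    show "0 \<le> (1/\<epsilon>)^m" using \<epsilon> by simp
  qed simp_all
  have S: "(\<integral>\<^sup>+\<omega>. ennreal (truncated_power \<epsilon> m (simple_int W (reps n) \<omega>)) \<partial>M) \<le> ennreal (2 * taylor_const m) * (\<integral>\<^sup>+z. ennreal (weighted_power \<epsilon> m (?q z) (field0 (simple_fn (reps n)) z)) \<partial>T3)" for n
  proof -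
    have "(\<integral>\<^sup>+z. indicator {0<..} (fst (snd z)) * ennreal (weighted_power \<epsilon> m (?q z) (SF (reps n) z)) \<partial>T3)
      = (\<integral>\<^sup>+z. ennreal (weighted_power \<epsilon> m (?q z) (field0 (simple_fn (reps n)) z)) \<partial>T3)"
      by (intro nn_integral_cong) (simp add: indicator_def weighted_power_0)
    then show ?thesis using simple_int_truncated_power[OF r[of n] \<epsilon> m qm q0 Q'] by (simp only:)
  qed
  \<comment> \<open>The approximation runs backwards here, from the simple integrand to the given
    one; hence the difference enters with the opposite sign, which the square ignores.\<close>
  have B: "(\<integral>\<^sup>+z. ennreal (weighted_power \<epsilon> m (?q z) (field0 (simple_fn (reps n)) z)) \<partial>T3) \<le> ?c * (?P + ?e * ?b n)" for n
  proof (rule nn_integral_const_bound_add)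
    fix z
    let ?d = "field0 \<phi> z - field0 (simple_fn (reps n)) z"
    have "weighted_power \<epsilon> m (?q z) (field0 (simple_fn (reps n)) z) \<le> 4 ^ (m+1) * (weighted_power \<epsilon> m (?q z) (field0 \<phi> z) + weighted_power \<epsilon> m (?q z) (- ?d))"
      using weighted_power_add[OF \<epsilon> q0[of "fst (snd z)" "snd (snd z)"], of m "field0 \<phi> z" "- ?d"] by simp
    also have "\<dots> \<le> 4 ^ (m+1) * (weighted_power \<epsilon> m (?q z) (field0 \<phi> z) + (1/\<epsilon>)^m * ?d\<^sup>2)"
      using weighted_power_le_const[OF \<epsilon> q0[of "fst (snd z)" "snd (snd z)"], of m "- ?d", unfolded power2_minus] by (intro mult_left_mono add_left_mono) simp_all
    finally show "weighted_power \<epsilon> m (?q z) (field0 (simple_fn (reps n)) z) \<le> 4 ^ (m+1) * (weighted_power \<epsilon> m (?q z) (field0 \<phi> z) + (1/\<epsilon>)^m * ?d\<^sup>2)" .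
  next
    show "(\<lambda>z. weighted_power \<epsilon> m (?q z) (field0 \<phi> z)) \<in> borel_measurable T3"
      "(\<lambda>z. (field0 \<phi> z - field0 (simple_fn (reps n)) z)\<^sup>2) \<in> borel_measurable T3" by measurable
    show "0 \<le> weighted_power \<epsilon> m (?q z) (field0 \<phi> z)" for z by (rule weighted_power_nonneg[OF \<epsilon> q0])
    show "0 \<le> (1/\<epsilon>)^m" using \<epsilon> by simp
  qed simp_all
  \<comment> \<open>The factors depending on \<epsilon> multiply only approximation errors and
    vanish with them. The passages to and from simple integrals each cost \<open>4 ^ (m+1)\<close>,
    whence the factor \<open>16 ^ (m+1)\<close>.\<close>
  have bound: "(\<integral>\<^sup>+\<omega>. ennreal (truncated_power \<epsilon> m (I \<omega>)) \<partial>M) \<le> ?c * ((ennreal (2 * taylor_const m) * (?c * (?P + ?e * ?b n))) + ?e * ?a n)" for n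
  proof -
    have "(\<integral>\<^sup>+\<omega>. ennreal (truncated_power \<epsilon> m (simple_int W (reps n) \<omega>)) \<partial>M) \<le> ennreal (2 * taylor_const m) * (?c * (?P + ?e * ?b n))"
      by (rule order_trans[OF S]) (intro mult_left_mono B, simp)
    then show ?thesis
      by (intro order_trans[OF I[of n]] mult_left_mono add_right_mono) simp_all
  qed
  have "(\<lambda>n. ?c * ((ennreal (2 * taylor_const m) * (?c * (?P + ?e * ?b n))) + ?e * ?a n)) \<longlonglongrightarrow> ?c * ((ennreal (2 * taylor_const m) * (?c * (?P + ?e * 0))) + ?e * 0)"
    by (intro tendsto_add tendsto_const ennreal_tendsto_cmult a b) simp_all
  then have "(\<integral>\<^sup>+\<omega>. ennreal (truncated_power \<epsilon> m (I \<omega>)) \<partial>M) \<le> ?c * ((ennreal (2 * taylor_const m) * (?c * (?P + ?e * 0))) + ?e * 0)"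
    by (rule LIMSEQ_le_const) (intro exI[of _ 0] allI impI bound)
  also have "\<dots> = ?c * ennreal (2 * taylor_const m) * ?c * ?P" by (simp add: mult.assoc)
  also have "?c * ennreal (2 * taylor_const m) * ?c = ennreal (2 * taylor_const m * 16 ^ (m+1))"
  proof -
    have "?c * ennreal (2 * taylor_const m) * ?c = ennreal (4 ^ (m+1) * (2 * taylor_const m) * 4 ^ (m+1))"
      using taylor_const_pos[of m] by (simp only: ennreal_mult[symmetric] zero_le_power zero_le_numeral mult_nonneg_nonneg less_imp_le)
    also have "(4::real) ^ (m+1) * (2 * taylor_const m) * 4 ^ (m+1) = 2 * taylor_const m * (4 * 4) ^ (m+1)"
      unfolding power_mult_distrib by simp
    finally show ?thesis by simp
  qed
  finally show ?thesis .
qed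

end

section \<open>The squared heat kernel\<close>

text \<open>The value 0 at nonpositive times lets all time integrals run over the real line, so that
  translations and reflections need no change of domain.\<close>

definition heat_sq :: "real \<Rightarrow> real \<Rightarrow> real \<Rightarrow> real" where
  "heat_sq \<kappa> r z = (if r > 0 then exp (- z\<^sup>2 / (\<kappa> * r)) / (2 * pi * \<kappa> * r) else 0)"

definition heat_sq_op :: "real \<Rightarrow> (real \<Rightarrow> real \<Rightarrow> ennreal) \<Rightarrow> real \<Rightarrow> real \<Rightarrow> ennreal" where
  "heat_sq_op \<kappa> V t x = (\<integral>\<^sup>+s. (\<integral>\<^sup>+y. ennreal (heat_sq \<kappa> (t - s) (y - x)) * V s y \<partial>lborel) \<partial>lborel)"

text \<open>The total mass of \<open>heat_sq\<close> in space, which by the semigroup property is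
  the heat kernel at time \<open>2 * r\<close> and the origin.\<close>

definition heat_time :: "real \<Rightarrow> real \<Rightarrow> real" where
  "heat_time \<kappa> r = (if r > 0 then 1 / sqrt (4 * pi * \<kappa> * r) else 0)"

lemma heat_sq_nonneg: "\<kappa> > 0 \<Longrightarrow> 0 \<le> heat_sq \<kappa> r z"
  unfolding heat_sq_def by simp

lemma heat_time_nonneg: "\<kappa> > 0 \<Longrightarrow> 0 \<le> heat_time \<kappa> r"
  unfolding heat_time_def by simp

lemma heat_sq_measurable[measurable (raw)]:
  assumes [measurable]: "f \<in> borel_measurable N" "g \<in> borel_measurable N"
  shows "(\<lambda>x. heat_sq \<kappa> (f x) (g x)) \<in> borel_measurable N"
  unfolding heat_sq_def by measurable

lemma heat_time_measurable[measurable]: "heat_time \<kappa> \<in> borel_measurable borel"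
  unfolding heat_time_def[abs_def] by measurable

lemma heat_kernel_square: "\<kappa> > 0 \<Longrightarrow> r > 0 \<Longrightarrow> (heat_kernel \<kappa> r z)\<^sup>2 = heat_sq \<kappa> r z"
  unfolding heat_kernel_def heat_sq_def
  by (simp add: power_divide exp_double[symmetric] mult.assoc)

lemma heat_sq_uminus: "heat_sq \<kappa> r (- z) = heat_sq \<kappa> r z"
  unfolding heat_sq_def by simp

text \<open>The square of a centred Gaussian density with variance \<open>\<kappa> * r\<close> is
  proportional to the one with half that variance. This gives access to the integrals and
  convolutions of normal densities.\<close>

lemma heat_sq_eq_normal:
  assumes "\<kappa> > 0" "r > 0"
  shows "heat_sq \<kappa> r z = heat_time \<kappa> r * normal_density 0 (sqrt (\<kappa> * r / 2)) z"
proof -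
  have "sqrt (4 * pi * \<kappa> * r) * sqrt (2 * pi * (sqrt (\<kappa> * r / 2))\<^sup>2) = sqrt ((2 * pi * \<kappa> * r)\<^sup>2)"
    using assms by (subst real_sqrt_mult[symmetric]) (simp add: power2_eq_square algebra_simps)
  also have "\<dots> = 2 * pi * \<kappa> * r" using assms by simp
  finally have "1 / (2 * pi * \<kappa> * r) = (1 / sqrt (4 * pi * \<kappa> * r)) * (1 / sqrt (2 * pi * (sqrt (\<kappa> * r / 2))\<^sup>2))"
    by simp
  moreover have "- z\<^sup>2 / (\<kappa> * r) = - (z - 0)\<^sup>2 / (2 * (sqrt (\<kappa> * r / 2))\<^sup>2)"
    using assms by simp
  ultimately show ?thesis unfolding heat_sq_def heat_time_def normal_density_def
    using assms by (simp only: if_True) (simp add: mult_ac)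
qed

lemma nn_integral_exp_neg:
  fixes a :: real assumes "a > 0"
  shows "(\<integral>\<^sup>+r. indicator {0<..} r * ennreal (exp (- a * r)) \<partial>lborel) = ennreal (1 / a)"
proof -
  have lim: "((\<lambda>r. - exp (- a * r) / a) \<longlongrightarrow> 0) at_top"
    using assms by real_asymp
  have "(\<integral>\<^sup>+r. ennreal (exp (- a * r)) * indicator {0..} r \<partial>lborel) = ennreal (0 - (- exp (- a * 0) / a))"
    by (rule nn_integral_FTC_atLeast[OF _ _ _ lim]) (use assms in \<open>auto intro!: derivative_eq_intros\<close>)
  also have "(\<integral>\<^sup>+r. ennreal (exp (- a * r)) * indicator {0..} r \<partial>lborel) = (\<integral>\<^sup>+r. indicator {0<..} r * ennreal (exp (- a * r)) \<partial>lborel)"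
  proof (rule nn_integral_cong_AE)
    have "AE r in lborel. r \<noteq> (0::real)" by (rule AE_lborel_singleton)
    then show "AE r in lborel. ennreal (exp (- a * r)) * indicator {0..} r = indicator {0<..} r * ennreal (exp (- a * r))"
      by eventually_elim (auto simp: indicator_def)
  qed
  finally show ?thesis by simp
qed

text \<open>The substitution \<open>z = r v\<close> decouples space and time.\<close>
lemma heat_sq_laplace:
  assumes \<kappa>: "\<kappa> > 0" and S[measurable]: "S \<in> sets borel" and pos: "\<And>v. v \<in> S \<Longrightarrow> v\<^sup>2 / \<kappa> + c * v + \<beta> > 0"
  shows "(\<integral>\<^sup>+r. (\<integral>\<^sup>+z. ennreal (heat_sq \<kappa> r z * exp (- c * z - \<beta> * r)) * indicator S (z / r) \<partial>lborel) \<partial>lborel)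
    = (\<integral>\<^sup>+v. indicator S v * ennreal (1 / (2 * pi * (v\<^sup>2 + c * \<kappa> * v + \<beta> * \<kappa>))) \<partial>lborel)"
proof -
  have "(\<integral>\<^sup>+r. (\<integral>\<^sup>+z. ennreal (heat_sq \<kappa> r z * exp (- c * z - \<beta> * r)) * indicator S (z / r) \<partial>lborel) \<partial>lborel)
     = (\<integral>\<^sup>+r. (\<integral>\<^sup>+v. indicator S v * (indicator {0<..} r * ennreal (exp (- (v\<^sup>2 / \<kappa> + c * v + \<beta>) * r) / (2 * pi * \<kappa>))) \<partial>lborel) \<partial>lborel)"
  proof (rule nn_integral_cong)
    fix r :: real
    show "(\<integral>\<^sup>+z. ennreal (heat_sq \<kappa> r z * exp (- c * z - \<beta> * r)) * indicator S (z / r) \<partial>lborel) = 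
      (\<integral>\<^sup>+v. indicator S v * (indicator {0<..} r * ennreal (exp (- (v\<^sup>2 / \<kappa> + c * v + \<beta>) * r) / (2 * pi * \<kappa>))) \<partial>lborel)"
    proof (cases "r > 0")
      case True
      have "(\<integral>\<^sup>+z. ennreal (heat_sq \<kappa> r z * exp (- c * z - \<beta> * r)) * indicator S (z / r) \<partial>lborel)
        = ennreal \<bar>r\<bar> * (\<integral>\<^sup>+v. ennreal (heat_sq \<kappa> r (0 + r * v) * exp (- c * (0 + r * v) - \<beta> * r)) * indicator S ((0 + r * v) / r) \<partial>lborel)"
        by (rule nn_integral_real_affine) (use True in simp_all)
      also have "\<dots> = (\<integral>\<^sup>+v. ennreal r * (ennreal (heat_sq \<kappa> r (r * v) * exp (- c * (r * v) - \<beta> * r)) * indicator S v) \<partial>lborel)"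
        using True by (subst nn_integral_cmult[symmetric]) simp_all
      also have "\<dots> = (\<integral>\<^sup>+v. indicator S v * (indicator {0<..} r * ennreal (exp (- (v\<^sup>2 / \<kappa> + c * v + \<beta>) * r) / (2 * pi * \<kappa>))) \<partial>lborel)"
      proof (rule nn_integral_cong)
        fix v
        \<comment> \<open>After the substitution the exponent is linear in \<open>r\<close>, and the
          Jacobian \<open>r\<close> cancels the singularity of the kernel; the time integral becomes
          that of an exponential.\<close>
        have "- (r * v)\<^sup>2 / (\<kappa> * r) + (- c * (r * v) - \<beta> * r) = - (v\<^sup>2 / \<kappa> + c * v + \<beta>) * r"
          using True \<kappa> by (simp add: power2_eq_square field_simps)
        then have "r * (heat_sq \<kappa> r (r * v) * exp (- c * (r * v) - \<beta> * r)) = exp (- (v\<^sup>2 / \<kappa> + c * v + \<beta>) * r) / (2 * pi * \<kappa>)"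
          unfolding heat_sq_def using True \<kappa> by (simp only: if_True times_divide_eq_left exp_add[symmetric]) simp
        then have "ennreal r * ennreal (heat_sq \<kappa> r (r * v) * exp (- c * (r * v) - \<beta> * r)) = ennreal (exp (- (v\<^sup>2 / \<kappa> + c * v + \<beta>) * r) / (2 * pi * \<kappa>))"
          using True heat_sq_nonneg[OF \<kappa>] by (simp add: ennreal_mult[symmetric])
        then show "ennreal r * (ennreal (heat_sq \<kappa> r (r * v) * exp (- c * (r * v) - \<beta> * r)) * indicator S v) = 
          indicator S v * (indicator {0<..} r * ennreal (exp (- (v\<^sup>2 / \<kappa> + c * v + \<beta>) * r) / (2 * pi * \<kappa>)))"
          using True by (simp add: indicator_def)
      qed
      finally show ?thesis .
    next
      case False
      then show ?thesis by (simp add: heat_sq_def)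
    qed
  qed
  also have "\<dots> = (\<integral>\<^sup>+v. (\<integral>\<^sup>+r. indicator S v * (indicator {0<..} r * ennreal (exp (- (v\<^sup>2 / \<kappa> + c * v + \<beta>) * r) / (2 * pi * \<kappa>))) \<partial>lborel) \<partial>lborel)"
    by (rule lborel_pair.Fubini') measurable
  also have "\<dots> = (\<integral>\<^sup>+v. indicator S v * ennreal (1 / (2 * pi * (v\<^sup>2 + c * \<kappa> * v + \<beta> * \<kappa>))) \<partial>lborel)"
  proof (rule nn_integral_cong)
    fix v :: real
    show "(\<integral>\<^sup>+r. indicator S v * (indicator {0<..} r * ennreal (exp (- (v\<^sup>2 / \<kappa> + c * v + \<beta>) * r) / (2 * pi * \<kappa>))) \<partial>lborel)
       = indicator S v * ennreal (1 / (2 * pi * (v\<^sup>2 + c * \<kappa> * v + \<beta> * \<kappa>)))"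
    proof (cases "v \<in> S")
      case True
      let ?a = "v\<^sup>2 / \<kappa> + c * v + \<beta>"
      have "(\<integral>\<^sup>+r. indicator {0<..} r * ennreal (exp (- ?a * r) / (2 * pi * \<kappa>)) \<partial>lborel) 
         = (\<integral>\<^sup>+r. ennreal (1 / (2 * pi * \<kappa>)) * (indicator {0<..} r * ennreal (exp (- ?a * r))) \<partial>lborel)"
        using \<kappa> by (intro nn_integral_cong) (simp add: indicator_def ennreal_mult'[symmetric])
      also have "\<dots> = ennreal (1 / (2 * pi * \<kappa>)) * ennreal (1 / ?a)"
        by (subst nn_integral_cmult, measurable, subst nn_integral_exp_neg[OF pos[OF True]]) simp
      also have "\<dots> = ennreal (1 / (2 * pi * \<kappa>) * (1 / ?a))" using \<kappa> pos[OF True] by (intro ennreal_mult[symmetric]) simp_all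
      also have "1 / (2 * pi * \<kappa>) * (1 / ?a) = 1 / (2 * pi * (\<kappa> * ?a))" by simp
      also have "\<kappa> * ?a = v\<^sup>2 + c * \<kappa> * v + \<beta> * \<kappa>" using \<kappa> by (simp add: algebra_simps)
      finally show ?thesis using True by simp
    qed simp
  qed
  finally show ?thesis .
qed

text \<open>Half of the value comes from the arctangent on the half-line, and reflection accounts
  for the other half. Equality holds, but an upper bound is all that the supersolutions ask
  for.\<close>

lemma nn_integral_cauchy:
  fixes a :: real assumes "a > 0"
  shows "(\<integral>\<^sup>+v. ennreal (1 / (v\<^sup>2 + a\<^sup>2)) \<partial>lborel) \<le> ennreal (pi / a)"
proof -
  have pos: "v\<^sup>2 + a\<^sup>2 > 0" for v using assms by (simp add: add_nonneg_pos)
  have "((\<lambda>v. arctan (v / a) / a) \<longlongrightarrow> pi * inverse a / 2) at_top"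
    using assms by real_asymp
  then have lim: "((\<lambda>v. arctan (v / a) / a) \<longlongrightarrow> (pi / 2) / a) at_top"
    by (simp add: field_simps)
  have "(\<integral>\<^sup>+v. ennreal (1 / (v\<^sup>2 + a\<^sup>2)) * indicator {0..} v \<partial>lborel) = ennreal ((pi / 2) / a - arctan (0 / a) / a)"
  proof (rule nn_integral_FTC_atLeast[OF _ _ _ lim])
    fix v :: real
    have "1 + (v / a)\<^sup>2 = (v\<^sup>2 + a\<^sup>2) / a\<^sup>2" using assms by (simp add: field_simps)
    then show "((\<lambda>v. arctan (v / a) / a) has_real_derivative 1 / (v\<^sup>2 + a\<^sup>2)) (at v)"
      using assms pos[of v] by (auto intro!: derivative_eq_intros simp: power2_eq_square)
    show "0 \<le> 1 / (v\<^sup>2 + a\<^sup>2)" using pos[of v] by simp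
  qed measurable
  then have half: "(\<integral>\<^sup>+v. ennreal (1 / (v\<^sup>2 + a\<^sup>2)) * indicator {0..} v \<partial>lborel) = ennreal (pi / (2 * a))" by simp
  have "(\<integral>\<^sup>+v. ennreal (1 / (v\<^sup>2 + a\<^sup>2)) \<partial>lborel) = (\<integral>\<^sup>+v. ennreal (1 / (v\<^sup>2 + a\<^sup>2)) * indicator {0..} v + ennreal (1 / (v\<^sup>2 + a\<^sup>2)) * indicator {..<0} v \<partial>lborel)"
    by (intro nn_integral_cong) (auto simp: indicator_def)
  also have "\<dots> = (\<integral>\<^sup>+v. ennreal (1 / (v\<^sup>2 + a\<^sup>2)) * indicator {0..} v \<partial>lborel) + (\<integral>\<^sup>+v. ennreal (1 / (v\<^sup>2 + a\<^sup>2)) * indicator {..<0} v \<partial>lborel)"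
    by (rule nn_integral_add) measurable
  also have "(\<integral>\<^sup>+v. ennreal (1 / (v\<^sup>2 + a\<^sup>2)) * indicator {..<0} v \<partial>lborel) = 
      ennreal \<bar>- 1\<bar> * (\<integral>\<^sup>+v. ennreal (1 / ((0 + (- 1) * v)\<^sup>2 + a\<^sup>2)) * indicator {..<0} (0 + (- 1) * v) \<partial>lborel)"
    by (rule nn_integral_real_affine) simp_all
  also have "\<dots> \<le> (\<integral>\<^sup>+v. ennreal (1 / (v\<^sup>2 + a\<^sup>2)) * indicator {0..} v \<partial>lborel)"
    by (simp, intro nn_integral_mono) (auto simp: indicator_def)
  finally have "(\<integral>\<^sup>+v. ennreal (1 / (v\<^sup>2 + a\<^sup>2)) \<partial>lborel) \<le> ennreal (pi / (2 * a)) + ennreal (pi / (2 * a))"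
    unfolding half by (simp add: add_left_mono)
  also have "\<dots> = ennreal (pi / a)" using assms by (subst ennreal_plus[symmetric]) simp_all
  finally show ?thesis .
qed

text \<open>Completing the square in \<open>v\<close> gives a shifted Cauchy density with scale
  \<open>a\<close>; its integral \<open>pi / a\<close> times \<open>1 / (2 * pi)\<close> is the
  bound. The condition on \<beta> is that the remaining constant be positive.\<close>

lemma heat_sq_laplace_le:
  assumes \<kappa>: "\<kappa> > 0" and \<beta>: "\<beta> > \<kappa> * c\<^sup>2 / 4"
  shows "(\<integral>\<^sup>+r. (\<integral>\<^sup>+z. ennreal (heat_sq \<kappa> r z * exp (- c * z - \<beta> * r)) \<partial>lborel) \<partial>lborel) \<le> ennreal (1 / (2 * sqrt (\<kappa> * (\<beta> - \<kappa> * c\<^sup>2 / 4))))"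
proof -
  define a where "a = sqrt (\<kappa> * (\<beta> - \<kappa> * c\<^sup>2 / 4))"
  have a2: "a\<^sup>2 = \<kappa> * (\<beta> - \<kappa> * c\<^sup>2 / 4)" and a: "a > 0" using assms by (simp_all add: a_def)
  have sq: "v\<^sup>2 + c * \<kappa> * v + \<beta> * \<kappa> = (c * \<kappa> / 2 + 1 * v)\<^sup>2 + a\<^sup>2" for v
    unfolding a2 by (simp add: power2_eq_square algebra_simps)
  have pos: "v\<^sup>2 / \<kappa> + c * v + \<beta> > 0" for v
  proof -
    have "v\<^sup>2 / \<kappa> + c * v + \<beta> = (v\<^sup>2 + c * \<kappa> * v + \<beta> * \<kappa>) / \<kappa>" using \<kappa> by (simp add: field_simps)
    then show ?thesis unfolding sq using a \<kappa> by (simp add: add_nonneg_pos)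
  qed
  have "(\<integral>\<^sup>+r. (\<integral>\<^sup>+z. ennreal (heat_sq \<kappa> r z * exp (- c * z - \<beta> * r)) \<partial>lborel) \<partial>lborel)
    = (\<integral>\<^sup>+v. ennreal (1 / (2 * pi * (v\<^sup>2 + c * \<kappa> * v + \<beta> * \<kappa>))) \<partial>lborel)"
    using heat_sq_laplace[OF \<kappa>, of UNIV c \<beta>] pos by simp
  also have "\<dots> = (\<integral>\<^sup>+v. ennreal (1 / (2 * pi)) * ennreal (1 / ((c * \<kappa> / 2 + 1 * v)\<^sup>2 + a\<^sup>2)) \<partial>lborel)"
    unfolding sq by (intro nn_integral_cong) (simp add: ennreal_mult'[symmetric])
  also have "\<dots> = ennreal (1 / (2 * pi)) * (\<integral>\<^sup>+v. ennreal (1 / ((c * \<kappa> / 2 + 1 * v)\<^sup>2 + a\<^sup>2)) \<partial>lborel)"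
    by (rule nn_integral_cmult) measurable
  also have "(\<integral>\<^sup>+v. ennreal (1 / ((c * \<kappa> / 2 + 1 * v)\<^sup>2 + a\<^sup>2)) \<partial>lborel) = (\<integral>\<^sup>+v. ennreal (1 / (v\<^sup>2 + a\<^sup>2)) \<partial>lborel)"
    using nn_integral_real_affine[of "\<lambda>v. ennreal (1 / (v\<^sup>2 + a\<^sup>2))" 1 "c * \<kappa> / 2"] by simp
  also have "ennreal (1 / (2 * pi)) * \<dots> \<le> ennreal (1 / (2 * pi)) * ennreal (pi / a)"
    by (intro mult_left_mono nn_integral_cauchy a) simp
  also have "\<dots> = ennreal (1 / (2 * a))" using a by (simp add: ennreal_mult'[symmetric])
  finally show ?thesis unfolding a_def .
qed

text \<open>The cone becomes the half-line of velocities above \<alpha>, where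
  \<open>\<beta> * \<kappa>\<close> is at most a constant multiple of \<open>v\<^sup>2\<close>. For
  \<open>\<beta> = 0\<close> the bound is \<open>1 / (2 * pi * \<alpha>)\<close>, the source of the
  constant in the lower bound, and it depends continuously on \<beta>.\<close>

lemma heat_sq_cone_ge:
  assumes \<kappa>: "\<kappa> > 0" and "\<alpha> > 0" "\<beta> \<ge> 0"
  shows "ennreal (1 / (2 * pi * \<alpha> * (1 + \<beta> * \<kappa> / \<alpha>\<^sup>2))) \<le> 
    (\<integral>\<^sup>+r. (\<integral>\<^sup>+z. ennreal (heat_sq \<kappa> r z * exp (- \<beta> * r)) * indicator {\<alpha> * r..} z \<partial>lborel) \<partial>lborel)"
proof -
  let ?d = "1 + \<beta> * \<kappa> / \<alpha>\<^sup>2"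
  have d: "?d > 0" using assms by (simp add: add_pos_nonneg)
  have lim: "((\<lambda>v::real. - 1 / v) \<longlongrightarrow> 0) at_top" by real_asymp
  have "(\<integral>\<^sup>+v. ennreal (1 / v\<^sup>2) * indicator {\<alpha>..} v \<partial>lborel) = ennreal (0 - - 1 / \<alpha>)"
  proof (rule nn_integral_FTC_atLeast[OF _ _ _ lim])
    fix v assume "\<alpha> \<le> v"
    then show "((\<lambda>v. - 1 / v) has_real_derivative 1 / v\<^sup>2) (at v)"
      using assms by (auto intro!: derivative_eq_intros simp: power2_eq_square)
  qed auto
  then have I: "(\<integral>\<^sup>+v. indicator {\<alpha>..} v * ennreal (1 / v\<^sup>2) \<partial>lborel) = ennreal (1 / \<alpha>)" by (simp add: mult.commute)
  have eq: "1 / (2 * pi * \<alpha> * ?d) = 1 / (2 * pi * ?d) * (1 / \<alpha>)" by simp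
  have "ennreal (1 / (2 * pi * \<alpha> * ?d)) = ennreal (1 / (2 * pi * ?d)) * ennreal (1 / \<alpha>)"
    unfolding eq using d assms by (intro ennreal_mult) simp_all
  also have "\<dots> = (\<integral>\<^sup>+v. ennreal (1 / (2 * pi * ?d)) * (indicator {\<alpha>..} v * ennreal (1 / v\<^sup>2)) \<partial>lborel)"
    unfolding I[symmetric] by (rule nn_integral_cmult[symmetric]) measurable
  also have "\<dots> \<le> (\<integral>\<^sup>+v. indicator {\<alpha>..} v * ennreal (1 / (2 * pi * (v\<^sup>2 + 0 * \<kappa> * v + \<beta> * \<kappa>))) \<partial>lborel)"
  proof (rule nn_integral_mono)
    fix v :: real
    show "ennreal (1 / (2 * pi * ?d)) * (indicator {\<alpha>..} v * ennreal (1 / v\<^sup>2)) \<le> indicator {\<alpha>..} v * ennreal (1 / (2 * pi * (v\<^sup>2 + 0 * \<kappa> * v + \<beta> * \<kappa>)))"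
    proof (cases "\<alpha> \<le> v")
      case True
      have v: "v > 0" using True assms by simp
      have "\<alpha>\<^sup>2 \<le> v\<^sup>2" using True assms by (intro power_mono) auto
      then have "\<beta> * \<kappa> * 1 \<le> \<beta> * \<kappa> * (v\<^sup>2 / \<alpha>\<^sup>2)" using assms by (intro mult_left_mono) auto
      then have "v\<^sup>2 + \<beta> * \<kappa> \<le> v\<^sup>2 * ?d" by (simp add: algebra_simps)
      then have "1 / (2 * pi * (v\<^sup>2 * ?d)) \<le> 1 / (2 * pi * (v\<^sup>2 + \<beta> * \<kappa>))"
        using v assms d by (intro divide_left_mono mult_left_mono mult_pos_pos add_pos_nonneg) auto
      moreover have "1 / (2 * pi * ?d) * (1 / v\<^sup>2) = 1 / (2 * pi * (v\<^sup>2 * ?d))"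
        by (simp only: times_divide_times_eq mult_1 mult_ac)
      ultimately have "ennreal (1 / (2 * pi * ?d) * (1 / v\<^sup>2)) \<le> ennreal (1 / (2 * pi * (v\<^sup>2 + \<beta> * \<kappa>)))"
        by (simp only: ennreal_leI)
      then show ?thesis using True d by (simp add: ennreal_mult'[symmetric])
    qed simp
  qed
  also have "\<dots> = (\<integral>\<^sup>+r. (\<integral>\<^sup>+z. ennreal (heat_sq \<kappa> r z * exp (- 0 * z - \<beta> * r)) * indicator {\<alpha>..} (z / r) \<partial>lborel) \<partial>lborel)"
    by (rule heat_sq_laplace[symmetric, OF \<kappa>]) (use assms in \<open>auto intro!: add_pos_nonneg divide_pos_pos\<close>)
  also have "\<dots> \<le> (\<integral>\<^sup>+r. (\<integral>\<^sup>+z. ennreal (heat_sq \<kappa> r z * exp (- \<beta> * r)) * indicator {\<alpha> * r..} z \<partial>lborel) \<partial>lborel)"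
    by (intro nn_integral_mono) (auto simp: indicator_def heat_sq_def field_simps)
  finally show ?thesis .
qed

lemma heat_sq_space_integral:
  assumes "\<kappa> > 0"
  shows "(\<integral>\<^sup>+z. ennreal (heat_sq \<kappa> r z) \<partial>lborel) = ennreal (heat_time \<kappa> r)"
proof (cases "r > 0")
  case True
  then have s: "sqrt (\<kappa> * r / 2) > 0" using assms by simp
  interpret N: prob_space "density lborel (normal_density 0 (sqrt (\<kappa> * r / 2)))" by (rule prob_space_normal_density[OF s])
  have "(\<integral>\<^sup>+z. ennreal (normal_density 0 (sqrt (\<kappa> * r / 2)) z) \<partial>lborel) = 1"
    using N.emeasure_space_1 by (simp add: emeasure_density)
  then have "(\<integral>\<^sup>+z. ennreal (heat_time \<kappa> r) * ennreal (normal_density 0 (sqrt (\<kappa> * r / 2)) z) \<partial>lborel) = ennreal (heat_time \<kappa> r)"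
    by (subst nn_integral_cmult) simp_all
  then show ?thesis unfolding heat_sq_eq_normal[OF assms True] using heat_time_nonneg[OF assms, of r]
    by (simp add: ennreal_mult)
qed (simp add: heat_sq_def heat_time_def)

text \<open>The case \<open>c = 0\<close> of \<open>heat_sq_laplace_le\<close> after integration
  over space.\<close>

lemma heat_time_laplace_le:
  assumes "\<kappa> > 0" "\<beta> > 0"
  shows "(\<integral>\<^sup>+r. ennreal (heat_time \<kappa> r * exp (- \<beta> * r)) \<partial>lborel) \<le> ennreal (1 / (2 * sqrt (\<kappa> * \<beta>)))"
proof -
  have "(\<integral>\<^sup>+r. ennreal (heat_time \<kappa> r * exp (- \<beta> * r)) \<partial>lborel) = (\<integral>\<^sup>+r. (\<integral>\<^sup>+z. ennreal (heat_sq \<kappa> r z * exp (- 0 * z - \<beta> * r)) \<partial>lborel) \<partial>lborel)"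
  proof (rule nn_integral_cong)
    fix r :: real
    have "(\<integral>\<^sup>+z. ennreal (heat_sq \<kappa> r z * exp (- 0 * z - \<beta> * r)) \<partial>lborel) = (\<integral>\<^sup>+z. ennreal (heat_sq \<kappa> r z) * ennreal (exp (- \<beta> * r)) \<partial>lborel)"
      using heat_sq_nonneg[OF assms(1)] by (intro nn_integral_cong) (simp add: ennreal_mult)
    also have "\<dots> = ennreal (heat_time \<kappa> r) * ennreal (exp (- \<beta> * r))"
      by (subst nn_integral_multc) (simp_all add: heat_sq_space_integral[OF assms(1)])
    finally show "ennreal (heat_time \<kappa> r * exp (- \<beta> * r)) = (\<integral>\<^sup>+z. ennreal (heat_sq \<kappa> r z * exp (- 0 * z - \<beta> * r)) \<partial>lborel)"
      using heat_time_nonneg[OF assms(1)] by (simp add: ennreal_mult)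
  qed
  also have "\<dots> \<le> ennreal (1 / (2 * sqrt (\<kappa> * (\<beta> - \<kappa> * 0\<^sup>2 / 4))))"
    by (rule heat_sq_laplace_le) (use assms in simp_all)
  finally show ?thesis by simp
qed

text \<open>Normal densities convolve exactly; the prefactors do not, and the quotient of
  \<open>heat_time\<close> values records the mismatch.\<close>

lemma heat_sq_convolution:
  assumes \<kappa>: "\<kappa> > 0" and r: "r > 0" "r' > 0"
  shows "(\<integral>\<^sup>+y. ennreal (heat_sq \<kappa> r (y - x) * heat_sq \<kappa> r' (z - y)) \<partial>lborel)
     = ennreal (heat_time \<kappa> r * heat_time \<kappa> r' / heat_time \<kappa> (r + r') * heat_sq \<kappa> (r + r') (z - x))"
proof -
  let ?n = "\<lambda>r. normal_density 0 (sqrt (\<kappa> * r / 2))"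
  let ?h = "heat_time \<kappa> r * heat_time \<kappa> r'"
  have s: "sqrt (\<kappa> * r / 2) > 0" "sqrt (\<kappa> * r' / 2) > 0" using assms by simp_all
  have h0: "?h \<ge> 0" using heat_time_nonneg[OF \<kappa>] by simp
  have hp: "heat_time \<kappa> (r + r') > 0" using assms by (simp add: heat_time_def)
  have "(\<integral>\<^sup>+y. ennreal (heat_sq \<kappa> r (y - x) * heat_sq \<kappa> r' (z - y)) \<partial>lborel) = 
     (\<integral>\<^sup>+y. ennreal (heat_sq \<kappa> r ((x + 1 * y) - x) * heat_sq \<kappa> r' (z - (x + 1 * y))) \<partial>lborel)"
    by (subst nn_integral_real_affine[of _ 1 x]) simp_all
  also have "\<dots> = (\<integral>\<^sup>+y. ennreal ?h * ennreal (?n r' ((z - x) - y) * ?n r y) \<partial>lborel)"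
  proof (rule nn_integral_cong)
    fix y
    have "heat_sq \<kappa> r ((x + 1 * y) - x) * heat_sq \<kappa> r' (z - (x + 1 * y)) = ?h * (?n r' ((z - x) - y) * ?n r y)"
      unfolding heat_sq_eq_normal[OF \<kappa> r(1)] heat_sq_eq_normal[OF \<kappa> r(2)] by (simp add: algebra_simps)
    then show "ennreal (heat_sq \<kappa> r ((x + 1 * y) - x) * heat_sq \<kappa> r' (z - (x + 1 * y))) = ennreal ?h * ennreal (?n r' ((z - x) - y) * ?n r y)"
      using h0 by (simp add: ennreal_mult[symmetric])
  qed
  also have "\<dots> = ennreal ?h * (\<integral>\<^sup>+y. ennreal (?n r' ((z - x) - y) * ?n r y) \<partial>lborel)"
    by (rule nn_integral_cmult) measurable
  also have "(\<integral>\<^sup>+y. ennreal (?n r' ((z - x) - y) * ?n r y) \<partial>lborel) = ennreal (normal_density 0 (sqrt ((sqrt (\<kappa> * r' / 2))\<^sup>2 + (sqrt (\<kappa> * r / 2))\<^sup>2)) (z - x))"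
    using conv_normal_density_zero_mean[OF s(2) s(1)] by (simp add: fun_eq_iff)
  also have "(sqrt (\<kappa> * r' / 2))\<^sup>2 + (sqrt (\<kappa> * r / 2))\<^sup>2 = \<kappa> * (r + r') / 2" using assms by (simp add: field_simps)
  also have "ennreal ?h * ennreal (?n (r + r') (z - x)) = ennreal (?h / heat_time \<kappa> (r + r') * heat_sq \<kappa> (r + r') (z - x))"
    unfolding heat_sq_eq_normal[OF \<kappa> add_pos_pos[OF r]] using h0 hp by (simp add: ennreal_mult[symmetric] mult.assoc)
  finally show ?thesis .
qed

lemma heat_time_half:
  assumes "\<kappa> > 0" "\<tau> > 0" "s \<ge> \<tau> / 2"
  shows "heat_time \<kappa> s \<le> sqrt 2 * heat_time \<kappa> \<tau>"
proof -
  have s: "s > 0" using assms by simp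
  have "sqrt (4 * pi * \<kappa> * \<tau>) \<le> sqrt (2 * (4 * pi * \<kappa> * s))" using assms by (intro real_sqrt_le_mono) (simp add: field_simps)
  also have "\<dots> = sqrt 2 * sqrt (4 * pi * \<kappa> * s)" by (rule real_sqrt_mult)
  finally show ?thesis unfolding heat_time_def using s assms by (simp add: divide_simps mult.commute)
qed

text \<open>On each half of the interval one of the two singular factors is comparable to
  \<open>heat_time \<kappa> \<tau>\<close> and can be pulled out. In the second half the exponential
  is moved onto the other factor, at the distance \<open>\<tau> - s\<close>. What remains is of
  order \<open>1 / sqrt \<beta>\<close>, which is the smallness needed for absorption.\<close>

lemma heat_time_convolution_le:
  assumes \<kappa>: "\<kappa> > 0" and \<beta>: "\<beta> > 0" and \<tau>: "\<tau> > 0"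
  shows "(\<integral>\<^sup>+s. ennreal (heat_time \<kappa> (\<tau> - s) * heat_time \<kappa> s * exp (- \<beta> * s)) \<partial>lborel) \<le> ennreal (heat_time \<kappa> \<tau> * (sqrt 2 / sqrt (\<kappa> * \<beta>)))"
proof -
  let ?g = "\<lambda>s. heat_time \<kappa> s * exp (- \<beta> * s)"
  let ?c = "sqrt 2 * heat_time \<kappa> \<tau>"
  have c0: "?c \<ge> 0" using heat_time_nonneg[OF \<kappa>] by simp
  have g0: "?g s \<ge> 0" for s using heat_time_nonneg[OF \<kappa>] by simp
  have pt: "heat_time \<kappa> (\<tau> - s) * heat_time \<kappa> s * exp (- \<beta> * s) \<le> ?c * ?g s + ?c * ?g (\<tau> - s)" for s
  proof (cases "s \<le> \<tau> / 2")
    case True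
    then have "heat_time \<kappa> (\<tau> - s) * ?g s \<le> ?c * ?g s" using heat_time_half[OF \<kappa> \<tau>, of "\<tau> - s"] g0 by (intro mult_right_mono) auto
    then show ?thesis using mult_nonneg_nonneg[OF c0 g0[of "\<tau> - s"]] by (simp add: mult.assoc)
  next
    case False
    have e: "exp (- \<beta> * s) \<le> exp (- \<beta> * (\<tau> - s))" using False \<beta> by simp
    have "heat_time \<kappa> (\<tau> - s) * heat_time \<kappa> s * exp (- \<beta> * s) = heat_time \<kappa> s * (heat_time \<kappa> (\<tau> - s) * exp (- \<beta> * s))" by simp
    also have "\<dots> \<le> ?c * (heat_time \<kappa> (\<tau> - s) * exp (- \<beta> * (\<tau> - s)))"
      using False c0 by (intro mult_mono mult_left_mono heat_time_half[OF \<kappa> \<tau>] e heat_time_nonneg[OF \<kappa>] mult_nonneg_nonneg) auto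
    finally show ?thesis using mult_nonneg_nonneg[OF c0 g0[of s]] by simp
  qed
  have "(\<integral>\<^sup>+s. ennreal (heat_time \<kappa> (\<tau> - s) * heat_time \<kappa> s * exp (- \<beta> * s)) \<partial>lborel) \<le> (\<integral>\<^sup>+s. ennreal ?c * ennreal (?g s) + ennreal ?c * ennreal (?g (\<tau> - s)) \<partial>lborel)"
  proof (rule nn_integral_mono)
    fix s
    have "ennreal (heat_time \<kappa> (\<tau> - s) * heat_time \<kappa> s * exp (- \<beta> * s)) \<le> ennreal (?c * ?g s + ?c * ?g (\<tau> - s))" by (rule ennreal_leI[OF pt])
    also have "\<dots> = ennreal ?c * ennreal (?g s) + ennreal ?c * ennreal (?g (\<tau> - s))"
      by (subst ennreal_plus, rule mult_nonneg_nonneg[OF c0 g0], rule mult_nonneg_nonneg[OF c0 g0], 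
        subst (1 2) ennreal_mult[OF c0 g0]) (rule refl)
    finally show "ennreal (heat_time \<kappa> (\<tau> - s) * heat_time \<kappa> s * exp (- \<beta> * s)) \<le> ennreal ?c * ennreal (?g s) + ennreal ?c * ennreal (?g (\<tau> - s))" .
  qed
  also have "\<dots> = ennreal ?c * (\<integral>\<^sup>+s. ennreal (?g s) \<partial>lborel) + ennreal ?c * (\<integral>\<^sup>+s. ennreal (?g (\<tau> - s)) \<partial>lborel)"
    by (subst nn_integral_add, measurable, subst nn_integral_cmult, measurable, subst nn_integral_cmult, measurable)
  also have "(\<integral>\<^sup>+s. ennreal (?g (\<tau> - s)) \<partial>lborel) = (\<integral>\<^sup>+s. ennreal (?g s) \<partial>lborel)"
    by (subst nn_integral_real_affine[of "\<lambda>s. ennreal (?g s)" "-1" \<tau>]) simp_all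
  also have "ennreal ?c * (\<integral>\<^sup>+s. ennreal (?g s) \<partial>lborel) + ennreal ?c * (\<integral>\<^sup>+s. ennreal (?g s) \<partial>lborel) 
     \<le> ennreal ?c * ennreal (1 / (2 * sqrt (\<kappa> * \<beta>))) + ennreal ?c * ennreal (1 / (2 * sqrt (\<kappa> * \<beta>)))"
    by (intro add_mono mult_left_mono heat_time_laplace_le \<kappa> \<beta>) simp_all
  also have "\<dots> = ennreal (?c * (1 / (2 * sqrt (\<kappa> * \<beta>))) + ?c * (1 / (2 * sqrt (\<kappa> * \<beta>))))"
    using c0 \<kappa> \<beta> by (simp only: ennreal_mult ennreal_plus mult_nonneg_nonneg divide_nonneg_nonneg zero_le_one real_sqrt_ge_zero less_imp_le zero_le_numeral)
  also have "?c * (1 / (2 * sqrt (\<kappa> * \<beta>))) + ?c * (1 / (2 * sqrt (\<kappa> * \<beta>))) = heat_time \<kappa> \<tau> * (sqrt 2 / sqrt (\<kappa> * \<beta>))"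
    by simp
  finally show ?thesis .
qed

section \<open>Renewal inequalities\<close>

lemma heat_sq_op_measurable[measurable]:
  assumes [measurable]: "(\<lambda>w. V (fst w) (snd w)) \<in> borel_measurable (lborel \<Otimes>\<^sub>M lborel)"
  shows "(\<lambda>w. heat_sq_op \<kappa> V (fst w) (snd w)) \<in> borel_measurable (lborel \<Otimes>\<^sub>M lborel)"
proof -
  have [measurable]: "(\<lambda>z. V (snd (fst z)) (snd z)) \<in> borel_measurable (((lborel \<Otimes>\<^sub>M lborel) \<Otimes>\<^sub>M lborel) \<Otimes>\<^sub>M lborel)"
  proof -
    have "(\<lambda>z. (snd (fst z), snd z)) \<in> measurable (((lborel \<Otimes>\<^sub>M lborel) \<Otimes>\<^sub>M lborel) \<Otimes>\<^sub>M lborel) (lborel \<Otimes>\<^sub>M lborel)" by measurable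
    from measurable_comp[OF this assms] show ?thesis by (simp add: comp_def)
  qed
  show ?thesis unfolding heat_sq_op_def by measurable
qed

lemma heat_sq_op_pair:
  assumes [measurable]: "(\<lambda>w. V (fst w) (snd w)) \<in> borel_measurable (lborel \<Otimes>\<^sub>M lborel)"
  shows "heat_sq_op \<kappa> V t x = (\<integral>\<^sup>+w. ennreal (heat_sq \<kappa> (t - fst w) (snd w - x)) * V (fst w) (snd w) \<partial>(lborel \<Otimes>\<^sub>M lborel))"
  unfolding heat_sq_op_def by (subst lborel.nn_integral_fst[symmetric]) simp_all

text \<open>Translation to the point \<open>(t, x)\<close> factors the exponential out of the
  operator, so it is reproduced up to the Laplace transform of the kernel. That factor is the
  renewal constant.\<close>

lemma heat_sq_op_exp:
  assumes \<kappa>: "\<kappa> > 0" and \<beta>: "\<beta> > \<kappa> * c\<^sup>2 / 4" and A: "A \<ge> 0"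
  shows "heat_sq_op \<kappa> (\<lambda>s y. ennreal (A * exp (\<beta> * s - c * y))) t x 
    \<le> ennreal (A * exp (\<beta> * t - c * x) * (1 / (2 * sqrt (\<kappa> * (\<beta> - \<kappa> * c\<^sup>2 / 4)))))"
proof -
  let ?f = "\<lambda>s y. ennreal (heat_sq \<kappa> (t - s) (y - x)) * ennreal (A * exp (\<beta> * s - c * y))"
  let ?E = "A * exp (\<beta> * t - c * x)"
  have E: "?E \<ge> 0" using A by simp
  have "heat_sq_op \<kappa> (\<lambda>s y. ennreal (A * exp (\<beta> * s - c * y))) t x = (\<integral>\<^sup>+s. (\<integral>\<^sup>+y. ?f s y \<partial>lborel) \<partial>lborel)"
    unfolding heat_sq_op_def ..
  also have "\<dots> = (\<integral>\<^sup>+s. (\<integral>\<^sup>+y. ?f s (x + 1 * y) \<partial>lborel) \<partial>lborel)"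
  proof (rule nn_integral_cong)
    fix s
    show "(\<integral>\<^sup>+y. ?f s y \<partial>lborel) = (\<integral>\<^sup>+y. ?f s (x + 1 * y) \<partial>lborel)"
      by (subst nn_integral_real_affine[of "?f s" 1 x]) simp_all
  qed
  also have "\<dots> = ennreal \<bar>- 1\<bar> * (\<integral>\<^sup>+r. (\<integral>\<^sup>+y. ?f (t + (- 1) * r) (x + 1 * y) \<partial>lborel) \<partial>lborel)"
    by (rule nn_integral_real_affine) simp_all
  also have "\<dots> = (\<integral>\<^sup>+r. (\<integral>\<^sup>+z. ennreal ?E * ennreal (heat_sq \<kappa> r z * exp (- c * z - \<beta> * r)) \<partial>lborel) \<partial>lborel)"
  proof -
    have "?f (t + (- 1) * r) (x + 1 * z) = ennreal ?E * ennreal (heat_sq \<kappa> r z * exp (- c * z - \<beta> * r))" for r z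
    proof -
      have "exp (\<beta> * (t + (- 1) * r) - c * (x + 1 * z)) = exp (\<beta> * t - c * x) * exp (- c * z - \<beta> * r)"
        unfolding exp_add[symmetric] by (simp add: algebra_simps)
      then show ?thesis using A heat_sq_nonneg[OF \<kappa>, of r z] 
        by (simp add: ennreal_mult[symmetric] mult_ac)
    qed
    then show ?thesis by simp
  qed
  also have "\<dots> = ennreal ?E * (\<integral>\<^sup>+r. (\<integral>\<^sup>+z. ennreal (heat_sq \<kappa> r z * exp (- c * z - \<beta> * r)) \<partial>lborel) \<partial>lborel)"
    by (subst nn_integral_cmult, measurable, subst nn_integral_cmult, measurable)
  also have "\<dots> \<le> ennreal ?E * ennreal (1 / (2 * sqrt (\<kappa> * (\<beta> - \<kappa> * c\<^sup>2 / 4))))"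
    by (intro mult_left_mono heat_sq_laplace_le \<kappa> \<beta>) simp
  also have "\<dots> = ennreal (?E * (1 / (2 * sqrt (\<kappa> * (\<beta> - \<kappa> * c\<^sup>2 / 4)))))"
    using \<kappa> \<beta> by (intro ennreal_mult[symmetric] E) simp
  finally show ?thesis .
qed

text \<open>Integrating the kernel of the operator against \<open>heat_sq\<close> with a growing exponential weight
  reproduces the weight up to a factor that is small when \<open>\<beta>\<close> is large.\<close>
lemma heat_sq_dual:
  assumes \<kappa>: "\<kappa> > 0" and \<beta>: "\<beta> > 0"
  shows "(\<integral>\<^sup>+s. (\<integral>\<^sup>+y. ennreal (heat_sq \<kappa> (t - s) (y - x) * exp (\<beta> * (t - s))) * ennreal (heat_sq \<kappa> (s - r) (z - y)) \<partial>lborel) \<partial>lborel)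
    \<le> ennreal (sqrt 2 / sqrt (\<kappa> * \<beta>)) * ennreal (heat_sq \<kappa> (t - r) (z - x) * exp (\<beta> * (t - r)))"
proof (cases "r < t")
  case False
  have "heat_sq \<kappa> (t - s) (y - x) * exp (\<beta> * (t - s)) = 0 \<or> heat_sq \<kappa> (s - r) (z - y) = 0" for s y
    using False by (cases "s < t") (auto simp: heat_sq_def)
  then have 0: "ennreal (heat_sq \<kappa> (t - s) (y - x) * exp (\<beta> * (t - s))) * ennreal (heat_sq \<kappa> (s - r) (z - y)) = 0" for s y
    by (metis ennreal_0 mult_zero_left mult_zero_right)
  show ?thesis unfolding 0 by simp
next
  case True
  define \<tau> where "\<tau> = t - r"
  have \<tau>: "\<tau> > 0" using True by (simp add: \<tau>_def)
  have h: "heat_time \<kappa> \<tau> > 0" using \<tau> \<kappa> by (simp add: heat_time_def)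
  \<comment> \<open>The part of the convolved kernel that does not depend on the intermediate time.
    It lacks a factor \<open>heat_time\<close>, which the bound
    \<open>heat_time_convolution_le\<close> on the time integral restores.\<close>
  let ?D = "exp (\<beta> * \<tau>) * (heat_sq \<kappa> \<tau> (z - x) / heat_time \<kappa> \<tau>)"
  have D: "?D \<ge> 0" using heat_sq_nonneg[OF \<kappa>] h by simp
  have inner: "(\<integral>\<^sup>+y. ennreal (heat_sq \<kappa> (t - s) (y - x) * exp (\<beta> * (t - s))) * ennreal (heat_sq \<kappa> (s - r) (z - y)) \<partial>lborel)
     \<le> ennreal ?D * ennreal (heat_time \<kappa> (\<tau> - (s - r)) * heat_time \<kappa> (s - r) * exp (- \<beta> * (s - r)))" for s
  proof (cases "r < s \<and> s < t")
    case True
    have "(\<integral>\<^sup>+y. ennreal (heat_sq \<kappa> (t - s) (y - x) * exp (\<beta> * (t - s))) * ennreal (heat_sq \<kappa> (s - r) (z - y)) \<partial>lborel)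
       = (\<integral>\<^sup>+y. ennreal (exp (\<beta> * (t - s))) * ennreal (heat_sq \<kappa> (t - s) (y - x) * heat_sq \<kappa> (s - r) (z - y)) \<partial>lborel)"
      using heat_sq_nonneg[OF \<kappa>] by (intro nn_integral_cong) (simp add: ennreal_mult[symmetric] mult_ac)
    also have "\<dots> = ennreal (exp (\<beta> * (t - s))) * (\<integral>\<^sup>+y. ennreal (heat_sq \<kappa> (t - s) (y - x) * heat_sq \<kappa> (s - r) (z - y)) \<partial>lborel)"
      by (rule nn_integral_cmult) measurable
    also have "\<dots> = ennreal (exp (\<beta> * (t - s))) * ennreal (heat_time \<kappa> (t - s) * heat_time \<kappa> (s - r) / heat_time \<kappa> (t - s + (s - r)) * heat_sq \<kappa> (t - s + (s - r)) (z - x))"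
      by (subst heat_sq_convolution[OF \<kappa>]) (use True in simp_all)
    also have "t - s + (s - r) = \<tau>" by (simp add: \<tau>_def)
    also have "ennreal (exp (\<beta> * (t - s))) * ennreal (heat_time \<kappa> (t - s) * heat_time \<kappa> (s - r) / heat_time \<kappa> \<tau> * heat_sq \<kappa> \<tau> (z - x))
       = ennreal (exp (\<beta> * (t - s)) * (heat_time \<kappa> (t - s) * heat_time \<kappa> (s - r) / heat_time \<kappa> \<tau> * heat_sq \<kappa> \<tau> (z - x)))"
      using heat_sq_nonneg[OF \<kappa>] heat_time_nonneg[OF \<kappa>] by (intro ennreal_mult[symmetric]) simp_all
    also have "exp (\<beta> * (t - s)) * (heat_time \<kappa> (t - s) * heat_time \<kappa> (s - r) / heat_time \<kappa> \<tau> * heat_sq \<kappa> \<tau> (z - x))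
       = ?D * (heat_time \<kappa> (\<tau> - (s - r)) * heat_time \<kappa> (s - r) * exp (- \<beta> * (s - r)))"
    proof -
      have "exp (\<beta> * (t - s)) = exp (\<beta> * \<tau>) * exp (- \<beta> * (s - r))"
        unfolding exp_add[symmetric] by (simp add: \<tau>_def algebra_simps)
      note e = this
      have t: "\<tau> - (s - r) = t - s" by (simp add: \<tau>_def)
      show ?thesis unfolding t e by simp
    qed
    also have "ennreal \<dots> = ennreal ?D * ennreal (heat_time \<kappa> (\<tau> - (s - r)) * heat_time \<kappa> (s - r) * exp (- \<beta> * (s - r)))"
      using heat_time_nonneg[OF \<kappa>] by (intro ennreal_mult D) simp
    finally show ?thesis by simp
  next
    case False
    then have "heat_sq \<kappa> (t - s) (y - x) * exp (\<beta> * (t - s)) = 0 \<or> heat_sq \<kappa> (s - r) (z - y) = 0" for y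
      by (auto simp: heat_sq_def)
    then have 0: "ennreal (heat_sq \<kappa> (t - s) (y - x) * exp (\<beta> * (t - s))) * ennreal (heat_sq \<kappa> (s - r) (z - y)) = 0" for y
      by (metis ennreal_0 mult_zero_left mult_zero_right)
    show ?thesis unfolding 0 by simp
  qed
  have "(\<integral>\<^sup>+s. (\<integral>\<^sup>+y. ennreal (heat_sq \<kappa> (t - s) (y - x) * exp (\<beta> * (t - s))) * ennreal (heat_sq \<kappa> (s - r) (z - y)) \<partial>lborel) \<partial>lborel)
    \<le> (\<integral>\<^sup>+s. ennreal ?D * ennreal (heat_time \<kappa> (\<tau> - (s - r)) * heat_time \<kappa> (s - r) * exp (- \<beta> * (s - r))) \<partial>lborel)"
    by (rule nn_integral_mono) (rule inner)
  also have "\<dots> = ennreal ?D * (\<integral>\<^sup>+s. ennreal (heat_time \<kappa> (\<tau> - (s - r)) * heat_time \<kappa> (s - r) * exp (- \<beta> * (s - r))) \<partial>lborel)"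
    by (rule nn_integral_cmult) measurable
  also have "(\<integral>\<^sup>+s. ennreal (heat_time \<kappa> (\<tau> - (s - r)) * heat_time \<kappa> (s - r) * exp (- \<beta> * (s - r))) \<partial>lborel)
     = (\<integral>\<^sup>+s. ennreal (heat_time \<kappa> (\<tau> - s) * heat_time \<kappa> s * exp (- \<beta> * s)) \<partial>lborel)"
    by (subst nn_integral_real_affine[of _ 1 r]) simp_all
  also have "ennreal ?D * \<dots> \<le> ennreal ?D * ennreal (heat_time \<kappa> \<tau> * (sqrt 2 / sqrt (\<kappa> * \<beta>)))"
    by (intro mult_left_mono heat_time_convolution_le \<kappa> \<beta> \<tau>) simp
  also have "\<dots> = ennreal (?D * (heat_time \<kappa> \<tau> * (sqrt 2 / sqrt (\<kappa> * \<beta>))))"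
    using h \<kappa> \<beta> by (intro ennreal_mult[symmetric] D) simp
  also have "?D * (heat_time \<kappa> \<tau> * (sqrt 2 / sqrt (\<kappa> * \<beta>))) = (sqrt 2 / sqrt (\<kappa> * \<beta>)) * (heat_sq \<kappa> (t - r) (z - x) * exp (\<beta> * (t - r)))"
    using h by (simp add: \<tau>_def)
  also have "ennreal \<dots> = ennreal (sqrt 2 / sqrt (\<kappa> * \<beta>)) * ennreal (heat_sq \<kappa> (t - r) (z - x) * exp (\<beta> * (t - r)))"
    using heat_sq_nonneg[OF \<kappa>] \<kappa> \<beta> by (intro ennreal_mult) simp_all
  finally show ?thesis .
qed

section \<open>Bounds for subsolutions of renewal inequalities\<close>

lemma heat_sq_op_mono:
  "(\<And>s y. s < t \<Longrightarrow> U s y \<le> V s y) \<Longrightarrow> heat_sq_op \<kappa> U t x \<le> heat_sq_op \<kappa> V t x"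
  unfolding heat_sq_op_def 
proof (intro nn_integral_mono)
  fix s y assume *: "\<And>s y. s < t \<Longrightarrow> U s y \<le> V s y"
  show "ennreal (heat_sq \<kappa> (t - s) (y - x)) * U s y \<le> ennreal (heat_sq \<kappa> (t - s) (y - x)) * V s y"
    by (cases "s < t") (auto simp: heat_sq_def intro!: mult_left_mono *)
qed

text \<open>Finiteness is known only pointwise, so a supremum of \<open>V\<close> cannot be
  absorbed. Instead the point is fixed and \<open>V\<close> is integrated against the kernel ending
  there, with an exponential weight. This integral is finite; inserting the inequality and using
  \<open>heat_sq_dual\<close> bounds it by half of itself plus a constant that is independent of the
  point.\<close>

lemma subsolution_locally_bounded:
  assumes \<kappa>: "\<kappa> > 0" and V[measurable]: "(\<lambda>w. V (fst w) (snd w)) \<in> borel_measurable (lborel \<Otimes>\<^sub>M lborel)"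
    and V0: "\<And>s y. s \<le> 0 \<Longrightarrow> V s y = 0" and \<Lambda>: "\<Lambda> \<ge> 0" and B: "B \<ge> 0"
    and sub: "\<And>t x. 0 < t \<Longrightarrow> t \<le> T \<Longrightarrow> V t x \<le> ennreal B + ennreal \<Lambda> * heat_sq_op \<kappa> V t x"
    and fin: "\<And>t x. 0 < t \<Longrightarrow> t \<le> T \<Longrightarrow> heat_sq_op \<kappa> V t x < \<infinity>"
  obtains C where "C \<ge> 0" "\<And>t x. 0 < t \<Longrightarrow> t \<le> T \<Longrightarrow> V t x \<le> ennreal C"
proof -
  interpret P: pair_sigma_finite "lborel \<Otimes>\<^sub>M lborel :: (real \<times> real) measure" "lborel \<Otimes>\<^sub>M lborel :: (real \<times> real) measure"
    by (intro pair_sigma_finite.intro sigma_finite_pair_measure sigma_finite_lborel)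
  \<comment> \<open>Large enough that the factor from \<open>heat_sq_dual\<close> times \<Lambda> is
    at most 1/2; the added 1 keeps \<beta> positive when \<Lambda> is 0.\<close>
  define \<beta> where "\<beta> = (8 * \<Lambda>\<^sup>2 + 1) / \<kappa>"
  have \<beta>: "\<beta> > 0" unfolding \<beta>_def using \<kappa> by (simp add: add_nonneg_pos)
  let ?\<theta> = "\<Lambda> * (sqrt 2 / sqrt (\<kappa> * \<beta>))"
  have \<theta>: "?\<theta> \<le> 1/2"
  proof -
    have "(2 * sqrt 2 * \<Lambda>)\<^sup>2 \<le> \<kappa> * \<beta>" unfolding \<beta>_def using \<kappa> by (simp add: power_mult_distrib)
    then have "2 * sqrt 2 * \<Lambda> \<le> sqrt (\<kappa> * \<beta>)" by (rule real_le_rsqrt)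
    then show ?thesis using \<kappa> \<beta> by (simp add: field_simps)
  qed
  \<comment> \<open>Contribution of the constant \<open>B\<close>: the exponential weight is at most
    \<open>exp (\<beta> * T)\<close> on positive times, and the operator applied to the indicator of
    positive times is dominated by \<open>heat_sq_op_exp\<close> with rate 1 and
    \<open>c = 0\<close>.\<close>
  define b where "b = B * (exp (\<beta> * T) * (exp T * (1 / (2 * sqrt \<kappa>))))"
  have b0: "b \<ge> 0" unfolding b_def using B \<kappa> by simp
  have main: "V t x \<le> ennreal (B + \<Lambda> * (2 * b))" if t: "0 < t" "t \<le> T" for t x
  proof -
    let ?P = "lborel \<Otimes>\<^sub>M lborel :: (real \<times> real) measure"
    define \<omega> where "\<omega> w = ennreal (heat_sq \<kappa> (t - fst w) (snd w - x) * exp (\<beta> * (t - fst w)))" for w :: "real \<times> real"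
    have [measurable]: "\<omega> \<in> borel_measurable ?P" unfolding \<omega>_def[abs_def] by measurable
    define l where "l = (\<integral>\<^sup>+w. \<omega> w * V (fst w) (snd w) \<partial>?P)"
    have \<omega>_le: "\<omega> w * U \<le> ennreal (exp (\<beta> * T)) * (ennreal (heat_sq \<kappa> (t - fst w) (snd w - x)) * U)" if "fst w > 0 \<or> U = 0" for w and U :: ennreal
    proof (cases "U = 0")
      case False
      then have "exp (\<beta> * (t - fst w)) \<le> exp (\<beta> * T)" using that t \<beta> by simp
      then have "heat_sq \<kappa> (t - fst w) (snd w - x) * exp (\<beta> * (t - fst w)) \<le> exp (\<beta> * T) * heat_sq \<kappa> (t - fst w) (snd w - x)"
        using heat_sq_nonneg[OF \<kappa>] by (subst mult.commute, intro mult_right_mono)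
      then have "\<omega> w \<le> ennreal (exp (\<beta> * T) * heat_sq \<kappa> (t - fst w) (snd w - x))" unfolding \<omega>_def by (rule ennreal_leI)
      also have "\<dots> = ennreal (exp (\<beta> * T)) * ennreal (heat_sq \<kappa> (t - fst w) (snd w - x))"
        using heat_sq_nonneg[OF \<kappa>] by (intro ennreal_mult) simp_all
      finally show ?thesis unfolding mult.assoc[symmetric] by (rule mult_right_mono) simp
    qed simp
    have "l \<le> (\<integral>\<^sup>+w. ennreal (exp (\<beta> * T)) * (ennreal (heat_sq \<kappa> (t - fst w) (snd w - x)) * V (fst w) (snd w)) \<partial>?P)"
      unfolding l_def by (intro nn_integral_mono \<omega>_le) (metis V0 not_le)
    also have "\<dots> = ennreal (exp (\<beta> * T)) * heat_sq_op \<kappa> V t x"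
      unfolding heat_sq_op_pair[OF V] by (rule nn_integral_cmult) measurable
    also have "\<dots> < \<infinity>" using fin[OF t] by (simp add: ennreal_mult_less_top)
    finally have l_fin: "l < \<infinity>" .
    have "l \<le> (\<integral>\<^sup>+w. ennreal B * (\<omega> w * indicator {0<..} (fst w)) + ennreal \<Lambda> * (\<omega> w * heat_sq_op \<kappa> V (fst w) (snd w)) \<partial>?P)"
      unfolding l_def
    proof (rule nn_integral_mono)
      fix w :: "real \<times> real"
      consider "fst w \<le> 0" | "fst w \<ge> t" | "0 < fst w" "fst w < t" by linarith
      then show "\<omega> w * V (fst w) (snd w) \<le> ennreal B * (\<omega> w * indicator {0<..} (fst w)) + ennreal \<Lambda> * (\<omega> w * heat_sq_op \<kappa> V (fst w) (snd w))"
      proof cases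
        case 1 then show ?thesis using V0 by simp
      next
        case 2 then show ?thesis by (simp add: \<omega>_def heat_sq_def)
      next
        case 3
        have "\<omega> w * V (fst w) (snd w) \<le> \<omega> w * (ennreal B + ennreal \<Lambda> * heat_sq_op \<kappa> V (fst w) (snd w))"
          using 3 t by (intro mult_left_mono sub) auto
        then show ?thesis using 3 by (simp add: distrib_left mult_ac)
      qed
    qed
    also have "\<dots> = ennreal B * (\<integral>\<^sup>+w. \<omega> w * indicator {0<..} (fst w) \<partial>?P) + ennreal \<Lambda> * (\<integral>\<^sup>+w. \<omega> w * heat_sq_op \<kappa> V (fst w) (snd w) \<partial>?P)"
      by (subst nn_integral_add, measurable, subst nn_integral_cmult, measurable, subst nn_integral_cmult, measurable)
    finally have l1: "l \<le> ennreal B * (\<integral>\<^sup>+w. \<omega> w * indicator {0<..} (fst w) \<partial>?P) + ennreal \<Lambda> * (\<integral>\<^sup>+w. \<omega> w * heat_sq_op \<kappa> V (fst w) (snd w) \<partial>?P)" .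
    have "(\<integral>\<^sup>+w. \<omega> w * heat_sq_op \<kappa> V (fst w) (snd w) \<partial>?P)
       = (\<integral>\<^sup>+w. (\<integral>\<^sup>+v. \<omega> w * (ennreal (heat_sq \<kappa> (fst w - fst v) (snd v - snd w)) * V (fst v) (snd v)) \<partial>?P) \<partial>?P)"
      unfolding heat_sq_op_pair[OF V] by (intro nn_integral_cong nn_integral_cmult[symmetric]) measurable
    also have "\<dots> = (\<integral>\<^sup>+v. (\<integral>\<^sup>+w. \<omega> w * (ennreal (heat_sq \<kappa> (fst w - fst v) (snd v - snd w)) * V (fst v) (snd v)) \<partial>?P) \<partial>?P)"
      by (rule P.Fubini') measurable
    also have "\<dots> = (\<integral>\<^sup>+v. (\<integral>\<^sup>+w. \<omega> w * ennreal (heat_sq \<kappa> (fst w - fst v) (snd v - snd w)) \<partial>?P) * V (fst v) (snd v) \<partial>?P)"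
      unfolding mult.assoc[symmetric] by (intro nn_integral_cong nn_integral_multc) measurable
    also have "\<dots> \<le> (\<integral>\<^sup>+v. (ennreal (sqrt 2 / sqrt (\<kappa> * \<beta>)) * \<omega> v) * V (fst v) (snd v) \<partial>?P)"
    proof (intro nn_integral_mono mult_right_mono)
      fix v :: "real \<times> real"
      have "(\<integral>\<^sup>+w. \<omega> w * ennreal (heat_sq \<kappa> (fst w - fst v) (snd v - snd w)) \<partial>?P)
        = (\<integral>\<^sup>+s. (\<integral>\<^sup>+y. ennreal (heat_sq \<kappa> (t - s) (y - x) * exp (\<beta> * (t - s))) * ennreal (heat_sq \<kappa> (s - fst v) (snd v - y)) \<partial>lborel) \<partial>lborel)"
        by (subst lborel.nn_integral_fst[symmetric]) (simp_all add: \<omega>_def)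
      also have "\<dots> \<le> ennreal (sqrt 2 / sqrt (\<kappa> * \<beta>)) * \<omega> v"
        unfolding \<omega>_def by (rule heat_sq_dual[OF \<kappa> \<beta>])
      finally show "(\<integral>\<^sup>+w. \<omega> w * ennreal (heat_sq \<kappa> (fst w - fst v) (snd v - snd w)) \<partial>?P) \<le> ennreal (sqrt 2 / sqrt (\<kappa> * \<beta>)) * \<omega> v" .
    qed simp
    also have "\<dots> = ennreal (sqrt 2 / sqrt (\<kappa> * \<beta>)) * l"
      unfolding l_def mult.assoc by (rule nn_integral_cmult) measurable
    finally have l2: "ennreal \<Lambda> * (\<integral>\<^sup>+w. \<omega> w * heat_sq_op \<kappa> V (fst w) (snd w) \<partial>?P) \<le> ennreal ?\<theta> * l"
      using \<kappa> \<beta> \<Lambda> by (subst ennreal_mult) (simp_all add: mult.assoc mult_left_mono)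
    have "(\<integral>\<^sup>+w. \<omega> w * indicator {0<..} (fst w) \<partial>?P) \<le> (\<integral>\<^sup>+w. ennreal (exp (\<beta> * T)) * (ennreal (heat_sq \<kappa> (t - fst w) (snd w - x)) * indicator {0<..} (fst w)) \<partial>?P)"
      by (intro nn_integral_mono \<omega>_le) (auto simp: indicator_def)
    also have "\<dots> = ennreal (exp (\<beta> * T)) * (\<integral>\<^sup>+w. ennreal (heat_sq \<kappa> (t - fst w) (snd w - x)) * indicator {0<..} (fst w) \<partial>?P)"
      by (rule nn_integral_cmult) measurable
    also have "(\<integral>\<^sup>+w. ennreal (heat_sq \<kappa> (t - fst w) (snd w - x)) * indicator {0<..} (fst w) \<partial>?P) = heat_sq_op \<kappa> (\<lambda>s y. indicator {0<..} s) t x"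
      by (rule heat_sq_op_pair[symmetric]) measurable
    also have "\<dots> \<le> heat_sq_op \<kappa> (\<lambda>s y. ennreal (1 * exp (1 * s - 0 * y))) t x"
      by (rule heat_sq_op_mono) (auto simp: indicator_def)
    also have "\<dots> \<le> ennreal (1 * exp (1 * t - 0 * x) * (1 / (2 * sqrt (\<kappa> * (1 - \<kappa> * 0\<^sup>2 / 4)))))"
      by (rule heat_sq_op_exp[OF \<kappa>]) simp_all
    also have "\<dots> \<le> ennreal (exp T * (1 / (2 * sqrt \<kappa>)))"
      using t \<kappa> by (intro ennreal_leI) (simp add: divide_right_mono)
    finally have "(\<integral>\<^sup>+w. \<omega> w * indicator {0<..} (fst w) \<partial>?P) \<le> ennreal (exp (\<beta> * T)) * ennreal (exp T * (1 / (2 * sqrt \<kappa>)))"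
      by (simp add: mult_left_mono)
    then have "ennreal B * (\<integral>\<^sup>+w. \<omega> w * indicator {0<..} (fst w) \<partial>?P) \<le> ennreal B * (ennreal (exp (\<beta> * T)) * ennreal (exp T * (1 / (2 * sqrt \<kappa>))))"
      by (rule mult_left_mono) simp
    also have "\<dots> = ennreal b" unfolding b_def using B \<kappa> by (simp add: ennreal_mult[symmetric])
    finally have l3: "ennreal B * (\<integral>\<^sup>+w. \<omega> w * indicator {0<..} (fst w) \<partial>?P) \<le> ennreal b" .
    have "l \<le> ennreal ?\<theta> * l + ennreal b"
      using l1 add_mono[OF l3 l2] by (simp add: add.commute)
    then have l: "l \<le> 2 * ennreal b" by (rule ennreal_half_absorb[OF _ ennreal_leI[OF \<theta>] l_fin])
    have "heat_sq_op \<kappa> V t x \<le> l"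
      unfolding l_def heat_sq_op_pair[OF V]
    proof (intro nn_integral_mono mult_right_mono)
      fix w :: "real \<times> real"
      have "heat_sq \<kappa> (t - fst w) (snd w - x) * 1 \<le> heat_sq \<kappa> (t - fst w) (snd w - x) * exp (\<beta> * (t - fst w))" 
      proof (cases "fst w < t")
        case True
        then show ?thesis using \<beta> heat_sq_nonneg[OF \<kappa>] by (intro mult_left_mono) auto
      qed (simp add: heat_sq_def)
      then show "ennreal (heat_sq \<kappa> (t - fst w) (snd w - x)) \<le> \<omega> w" unfolding \<omega>_def by (intro ennreal_leI) simp
    qed simp
    then have "V t x \<le> ennreal B + ennreal \<Lambda> * (2 * ennreal b)"
      by (intro order_trans[OF sub[OF t]] add_left_mono mult_left_mono order_trans[OF _ l]) simp_all
    also have "2 * ennreal b = ennreal (2 * b)" using b0 by (simp add: ennreal_mult)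
    also have "ennreal B + ennreal \<Lambda> * ennreal (2 * b) = ennreal (B + \<Lambda> * (2 * b))"
      using B \<Lambda> b0 by (simp add: ennreal_mult)
    finally show ?thesis .
  qed
  show thesis
    by (rule that[OF _ main]) (use B \<Lambda> b0 in simp_all)
qed

text \<open>Local boundedness gives a first bound by a constant \<open>C\<close>. Each use of the
  inequality maps the supersolution to itself and contracts the constant part by \<theta>, so
  iteration removes \<open>C\<close>. The bound \<open>B0\<close> is used for the local boundedness,
  the exponential one for the iteration.\<close>

lemma subsolution_comparison:
  assumes \<kappa>: "\<kappa> > 0" and V[measurable]: "(\<lambda>w. V (fst w) (snd w)) \<in> borel_measurable (lborel \<Otimes>\<^sub>M lborel)"
    and V0: "\<And>s y. s \<le> 0 \<Longrightarrow> V s y = 0" and \<Lambda>: "\<Lambda> \<ge> 0" and B: "B \<ge> 0"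
    and sub: "\<And>t x. 0 < t \<Longrightarrow> V t x \<le> ennreal (b t x) + ennreal \<Lambda> * heat_sq_op \<kappa> V t x"
    and fin: "\<And>t x. 0 < t \<Longrightarrow> heat_sq_op \<kappa> V t x < \<infinity>"
    and b0: "\<And>t x. 0 < t \<Longrightarrow> b t x \<le> B0" and b: "\<And>t x. 0 < t \<Longrightarrow> b t x \<le> B * exp (\<beta> * t - c * x)"
    and \<beta>: "\<beta> > \<kappa> * c\<^sup>2 / 4" and \<theta>: "\<Lambda> * (1 / (2 * sqrt (\<kappa> * (\<beta> - \<kappa> * c\<^sup>2 / 4)))) < 1"
    and t: "0 < t"
  shows "V t x \<le> ennreal (B / (1 - \<Lambda> * (1 / (2 * sqrt (\<kappa> * (\<beta> - \<kappa> * c\<^sup>2 / 4))))) * exp (\<beta> * t - c * x))"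
proof -
  define k where "k = 1 / (2 * sqrt (\<kappa> * (\<beta> - \<kappa> * c\<^sup>2 / 4)))"
  define \<theta> where "\<theta> = \<Lambda> * k"
  have k: "k > 0" unfolding k_def using \<kappa> \<beta> by simp
  have t0: "0 \<le> \<theta>" "\<theta> < 1" using \<theta> \<Lambda> k by (simp_all add: \<theta>_def k_def)
  have "\<kappa> * c\<^sup>2 / 4 \<ge> 0" using \<kappa> by simp
  then have \<beta>0: "\<beta> > 0" using \<beta> by linarith
  \<comment> \<open>The fixed point of \<open>A = B + \<theta> * A\<close>, that is, the least
    amplitude for which the iteration reproduces the exponential.\<close>
  define A where "A = B / (1 - \<theta>)"
  have A: "A \<ge> 0" "B + \<theta> * A = A" using B t0 by (simp_all add: A_def field_simps)
  have "V t x \<le> ennreal (A * exp (\<beta> * t - c * x))"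
  proof -
    define T where "T = t"
    have sub': "V t x \<le> ennreal (max 0 B0) + ennreal \<Lambda> * heat_sq_op \<kappa> V t x" if "0 < t" for t x
      by (rule order_trans[OF sub[OF that]]) (intro add_right_mono ennreal_leI, use b0[OF that, of x] in simp)
    obtain C where C: "C \<ge> 0" "\<And>t x. 0 < t \<Longrightarrow> t \<le> T \<Longrightarrow> V t x \<le> ennreal C"
      by (rule subsolution_locally_bounded[OF \<kappa> V V0 \<Lambda> _ sub' fin, of T]) auto
    have step: "0 < t \<Longrightarrow> t \<le> T \<Longrightarrow> V t x \<le> ennreal (A * exp (\<beta> * t - c * x) + \<theta> ^ n * C * exp (\<beta> * t))" for n t x
    proof (induction n arbitrary: t x)
      case 0
      have "C * 1 \<le> C * exp (\<beta> * t)" using C(1) \<beta>0 0 by (intro mult_left_mono) auto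
      then have "C \<le> A * exp (\<beta> * t - c * x) + \<theta> ^ 0 * C * exp (\<beta> * t)" using A(1) by (simp add: add_increasing)
      then show ?case by (rule order_trans[OF C(2)[OF 0] ennreal_leI])
    next
      case (Suc n)
      let ?f = "\<lambda>s y. ennreal (A * exp (\<beta> * s - c * y))" and ?g = "\<lambda>s y. ennreal (\<theta> ^ n * C * exp (\<beta> * s - 0 * y))"
      let ?E = "A * exp (\<beta> * t - c * x)" and ?G = "\<theta> ^ n * C * exp (\<beta> * t - 0 * x)"
      have c0: "\<theta> ^ n * C \<ge> 0" using t0 C by simp
      have "heat_sq_op \<kappa> V t x \<le> heat_sq_op \<kappa> (\<lambda>s y. ?f s y + ?g s y) t x"
      proof (rule heat_sq_op_mono)
        fix s y assume s: "s < t"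
        show "V s y \<le> ?f s y + ?g s y"
        proof (cases "s \<le> 0")
          case False
          have "V s y \<le> ennreal (A * exp (\<beta> * s - c * y) + \<theta> ^ n * C * exp (\<beta> * s))"
            by (rule Suc.IH) (use s False Suc.prems in simp_all)
          also have "\<dots> = ?f s y + ?g s y" using A(1) c0 by simp
          finally show ?thesis .
        qed (simp add: V0)
      qed
      also have "\<dots> = heat_sq_op \<kappa> ?f t x + heat_sq_op \<kappa> ?g t x"
        unfolding heat_sq_op_def distrib_left
        by (subst nn_integral_add, measurable, subst nn_integral_add, measurable)
      also have "\<dots> \<le> ennreal (?E * k) + ennreal (?G * k)"
      proof (rule add_mono)
        show "heat_sq_op \<kappa> ?f t x \<le> ennreal (?E * k)" unfolding k_def by (rule heat_sq_op_exp[OF \<kappa> \<beta> A(1)])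
        have "heat_sq_op \<kappa> ?g t x \<le> ennreal (?G * (1 / (2 * sqrt (\<kappa> * (\<beta> - \<kappa> * 0\<^sup>2 / 4)))))"
          by (rule heat_sq_op_exp[OF \<kappa> _ c0]) (use \<beta>0 in simp)
        \<comment> \<open>The error term has no spatial decay, so its renewal constant is the one
          for \<open>c = 0\<close>, which is no larger than \<open>k\<close>.\<close>
        also have "\<dots> \<le> ennreal (?G * k)"
          unfolding k_def using \<kappa> \<beta> \<beta>0 c0 
          by (intro ennreal_leI mult_left_mono divide_left_mono mult_pos_pos real_sqrt_le_mono) auto
        finally show "heat_sq_op \<kappa> ?g t x \<le> ennreal (?G * k)" .
      qed
      finally have op: "heat_sq_op \<kappa> V t x \<le> ennreal (?E * k) + ennreal (?G * k)" .
      have E0: "?E \<ge> 0" "?G \<ge> 0" using A(1) c0 by simp_all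
      have "V t x \<le> ennreal (B * exp (\<beta> * t - c * x)) + ennreal \<Lambda> * (ennreal (?E * k) + ennreal (?G * k))"
        by (intro order_trans[OF sub[OF Suc.prems(1)]] add_mono mult_left_mono ennreal_leI b op Suc.prems) simp
      also have "ennreal (?E * k) + ennreal (?G * k) = ennreal (?E * k + ?G * k)"
        using E0 k by (intro ennreal_plus[symmetric]) simp_all
      also have "ennreal \<Lambda> * \<dots> = ennreal (\<Lambda> * (?E * k + ?G * k))"
        using E0 k \<Lambda> by (intro ennreal_mult[symmetric]) simp_all
      also have "ennreal (B * exp (\<beta> * t - c * x)) + \<dots> = ennreal (B * exp (\<beta> * t - c * x) + \<Lambda> * (?E * k + ?G * k))"
        using E0 k \<Lambda> B by (intro ennreal_plus[symmetric]) simp_all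
      also have "B * exp (\<beta> * t - c * x) + \<Lambda> * (?E * k + ?G * k) = (B + \<theta> * A) * exp (\<beta> * t - c * x) + \<theta> ^ Suc n * C * exp (\<beta> * t)"
        by (simp add: \<theta>_def algebra_simps)
      finally show ?case unfolding A(2) .
    qed
    have "(\<lambda>n. ennreal (A * exp (\<beta> * t - c * x) + \<theta> ^ n * C * exp (\<beta> * t))) \<longlonglongrightarrow> ennreal (A * exp (\<beta> * t - c * x) + 0 * C * exp (\<beta> * t))"
      using t0 by (intro tendsto_ennrealI tendsto_add tendsto_mult tendsto_const LIMSEQ_power_zero) simp
    then have "V t x \<le> ennreal (A * exp (\<beta> * t - c * x) + 0 * C * exp (\<beta> * t))"
      by (rule LIMSEQ_le_const) (intro exI[of _ 0] allI impI step, use t in \<open>simp_all add: T_def\<close>)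
    then show ?thesis by simp
  qed
  then show ?thesis unfolding A_def \<theta>_def k_def .
qed

section \<open>Exponential bounds and positivity for the heat semigroup\<close>

lemma heat_kernel_exp:
  assumes "\<kappa> > 0" "t > 0"
  shows "heat_kernel \<kappa> t (y - x) * exp (- c * y) = exp (- c * x + c\<^sup>2 * \<kappa> * t / 2) * normal_density (x - c * \<kappa> * t) (sqrt (\<kappa> * t)) y"
proof -
  have "- (y - x)\<^sup>2 / (2 * \<kappa> * t) + - c * y = (- c * x + c\<^sup>2 * \<kappa> * t / 2) + - (y - (x - c * \<kappa> * t))\<^sup>2 / (2 * (sqrt (\<kappa> * t))\<^sup>2)"
    using assms by (simp add: field_simps power2_eq_square)
  then show ?thesis unfolding heat_kernel_def normal_density_def using assms
    by (simp add: exp_add[symmetric] mult.assoc)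
qed

text \<open>On the bounded support the datum is dominated by a multiple of
  \<open>exp (- c * y)\<close> for every real \<open>c\<close>, and exponentials are mapped to
  exponentials by shifting the Gaussian.\<close>

lemma heat_semigroup_bounds:
  assumes \<kappa>: "\<kappa> > 0" and t: "t > 0" and [measurable]: "u0 \<in> borel_measurable borel"
    and U: "\<And>y. 0 \<le> u0 y" "\<And>y. u0 y \<le> U" and R: "\<And>y. u0 y \<noteq> 0 \<Longrightarrow> \<bar>y\<bar> \<le> R"
  shows "integrable lborel (\<lambda>y. heat_kernel \<kappa> t (y - x) * u0 y)"
    "heat_semigroup \<kappa> t u0 x \<le> U * exp (\<bar>c\<bar> * R) * exp (- c * x + c\<^sup>2 * \<kappa> * t / 2)"
proof -
  have s: "sqrt (\<kappa> * t) > 0" using \<kappa> t by simp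
  have p0: "heat_kernel \<kappa> t z \<ge> 0" for z unfolding heat_kernel_def using \<kappa> t by simp
  have [measurable]: "heat_kernel \<kappa> t \<in> borel_measurable borel" unfolding heat_kernel_def[abs_def] by measurable
  let ?g = "\<lambda>y. U * exp (\<bar>c\<bar> * R) * exp (- c * x + c\<^sup>2 * \<kappa> * t / 2) * normal_density (x - c * \<kappa> * t) (sqrt (\<kappa> * t)) y"
  have U0: "U \<ge> 0" using order_trans[OF U(1) U(2)] .
  have le: "heat_kernel \<kappa> t (y - x) * u0 y \<le> ?g y" for y
  proof -
    have "u0 y \<le> U * exp (\<bar>c\<bar> * R) * exp (- c * y)"
    proof (cases "u0 y = 0")
      case False
      have "c * y \<le> \<bar>c\<bar> * \<bar>y\<bar>" by (simp add: abs_mult[symmetric])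
      also have "\<dots> \<le> \<bar>c\<bar> * R" by (intro mult_left_mono R False) simp
      finally have "1 \<le> exp (\<bar>c\<bar> * R) * exp (- c * y)" by (simp add: exp_add[symmetric])
      then have "U * 1 \<le> U * (exp (\<bar>c\<bar> * R) * exp (- c * y))" using U0 by (rule mult_left_mono)
      then show ?thesis using U(2)[of y] by simp
    qed (use U0 in simp)
    then have "heat_kernel \<kappa> t (y - x) * u0 y \<le> heat_kernel \<kappa> t (y - x) * (U * exp (\<bar>c\<bar> * R) * exp (- c * y))"
      by (intro mult_left_mono p0)
    also have "\<dots> = U * exp (\<bar>c\<bar> * R) * (heat_kernel \<kappa> t (y - x) * exp (- c * y))" by simp
    finally show ?thesis unfolding heat_kernel_exp[OF \<kappa> t] by (simp add: mult.assoc)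
  qed
  have ig: "integrable lborel ?g" using integrable_normal_density[OF s] by simp
  show i: "integrable lborel (\<lambda>y. heat_kernel \<kappa> t (y - x) * u0 y)"
  proof (rule Bochner_Integration.integrable_bound[OF ig])
    show "AE y in lborel. norm (heat_kernel \<kappa> t (y - x) * u0 y) \<le> norm (?g y)"
    proof (rule AE_I2)
      fix y
      have "norm (heat_kernel \<kappa> t (y - x) * u0 y) = heat_kernel \<kappa> t (y - x) * u0 y" using p0 U(1) by simp
      also have "\<dots> \<le> ?g y" by (rule le)
      also have "\<dots> \<le> norm (?g y)" unfolding real_norm_def by (rule abs_ge_self)
      finally show "norm (heat_kernel \<kappa> t (y - x) * u0 y) \<le> norm (?g y)" .
    qed
  qed measurable
  have "heat_semigroup \<kappa> t u0 x \<le> (LINT y|lborel. ?g y)"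
    unfolding heat_semigroup_def by (rule integral_mono[OF i ig le])
  also have "\<dots> = U * exp (\<bar>c\<bar> * R) * exp (- c * x + c\<^sup>2 * \<kappa> * t / 2)"
    using integral_normal_density[OF s] by simp
  finally show "heat_semigroup \<kappa> t u0 x \<le> U * exp (\<bar>c\<bar> * R) * exp (- c * x + c\<^sup>2 * \<kappa> * t / 2)" .
qed

text \<open>A vanishing integral would force the nonempty open set \<open>S\<close> to be a null
  set, as the kernel is strictly positive.\<close>

lemma heat_semigroup_pos:
  assumes \<kappa>: "\<kappa> > 0" and t: "t > 0" and u0: "\<And>y. 0 \<le> u0 y"
    and i: "integrable lborel (\<lambda>y. heat_kernel \<kappa> t (y - x) * u0 y)"
    and S: "open S" "S \<noteq> {}" "\<And>y. y \<in> S \<Longrightarrow> u0 y > 0"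
  shows "heat_semigroup \<kappa> t u0 x > 0"
proof -
  have p: "heat_kernel \<kappa> t z > 0" for z unfolding heat_kernel_def using \<kappa> t by simp
  have nn: "AE y in lborel. 0 \<le> heat_kernel \<kappa> t (y - x) * u0 y" using p u0 by (intro AE_I2) (simp add: less_imp_le)
  have "heat_semigroup \<kappa> t u0 x \<noteq> 0"
  proof
    assume "heat_semigroup \<kappa> t u0 x = 0"
    then have "AE y in lborel. heat_kernel \<kappa> t (y - x) * u0 y = 0"
      unfolding heat_semigroup_def using integral_nonneg_eq_0_iff_AE[OF i nn] by simp
    then have ae: "AE y in lborel. y \<notin> S" by eventually_elim (use p S(3) in \<open>force simp: less_le\<close>)
    obtain y0 where "y0 \<in> S" using S(2) by blast
    then obtain e where e: "e > 0" "ball y0 e \<subseteq> S" using S(1) open_contains_ball by blast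
    have "AE y in lborel. y \<notin> {y0 - e<..<y0 + e}"
      using ae by eventually_elim (use e(2) in \<open>auto simp: ball_eq_greaterThanLessThan\<close>)
    then have "{y0 - e<..<y0 + e} \<in> null_sets lborel" 
      using AE_iff_null_sets[of "{y0 - e<..<y0 + e}" lborel] by simp
    then have "emeasure lborel {y0 - e<..<y0 + e} = 0" by (rule null_setsD1)
    then show False using e(1) by simp
  qed
  moreover have "heat_semigroup \<kappa> t u0 x \<ge> 0" unfolding heat_semigroup_def by (rule integral_nonneg_AE[OF nn])
  ultimately show ?thesis by simp
qed

section \<open>Moments of the mild solution\<close>

text \<open>\<open>Lip\<close> and \<open>L\<close> stand for the two-sided linear bound on
  \<sigma>. The open set \<open>S\<close> on which the datum is positive comes from lower
  semicontinuity and makes the deterministic part of the solution positive everywhere.\<close>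

locale mild = noise M F W for M :: "'a measure" and F W +
  fixes \<kappa> :: real and \<sigma> u0 :: "real \<Rightarrow> real" and u :: "real \<Rightarrow> real \<Rightarrow> 'a \<Rightarrow> real" 
    and Lip L U R :: real and S :: "real set"
  assumes \<kappa>: "\<kappa> > 0" and \<sigma>_measurable[measurable]: "\<sigma> \<in> borel_measurable borel"
    and Lip: "Lip \<ge> 0" "\<And>x. \<bar>\<sigma> x\<bar> \<le> Lip * \<bar>x\<bar>" and L: "L > 0" "\<And>x. L * \<bar>x\<bar> \<le> \<bar>\<sigma> x\<bar>"
    and u0_measurable[measurable]: "u0 \<in> borel_measurable borel" 
    and u0: "\<And>y. 0 \<le> u0 y" "\<And>y. u0 y \<le> U" "\<And>y. u0 y \<noteq> 0 \<Longrightarrow> \<bar>y\<bar> \<le> R"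
    and S: "open S" "S \<noteq> {}" "\<And>y. y \<in> S \<Longrightarrow> u0 y > 0"
    and solution: "mild_solution M F W \<kappa> \<sigma> u0 u"
begin

abbreviation Pu :: "real \<Rightarrow> real \<Rightarrow> real" where
  "Pu t x \<equiv> heat_semigroup \<kappa> t u0 x"

text \<open>Extended by 0 to nonpositive times, so that \<open>heat_sq_op\<close> applied to it
  integrates over the right time interval.\<close>

definition mom :: "(real \<Rightarrow> ennreal) \<Rightarrow> real \<Rightarrow> real \<Rightarrow> ennreal" where
  "mom \<Psi> s y = (\<integral>\<^sup>+\<omega>. indicator {0<..} s * \<Psi> (u s y \<omega>) \<partial>M)"

abbreviation V :: "real \<Rightarrow> real \<Rightarrow> ennreal" where
  "V \<equiv> mom (\<lambda>x. ennreal (x\<^sup>2))"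

lemma u_predictable: "predictable M F u"
  using solution unfolding mild_solution_def by blast

lemma u_measurable: "0 < t \<Longrightarrow> u t x \<in> borel_measurable M"
  by (rule predictable_section[OF u_predictable])

lemma Psi_measurable_T3:
  assumes [measurable]: "\<Psi> \<in> borel_measurable borel"
  shows "(\<lambda>z. indicator {0<..} (fst (snd z)) * \<Psi> (u (fst (snd z)) (snd (snd z)) (fst z)) :: ennreal) \<in> borel_measurable T3"
proof -
  note [measurable] = predictable_measurable[OF u_predictable]
  have "(\<lambda>z. indicator {0<..} (fst (snd z)) * \<Psi> (u (fst (snd z)) (snd (snd z)) (fst z)) :: ennreal)
    = (\<lambda>z. indicator {0<..} (fst (snd z)) * \<Psi> (field0 u z))" by (auto simp: indicator_def fun_eq_iff)
  also have "\<dots> \<in> borel_measurable T3" by measurable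
  finally show ?thesis .
qed

lemma mom_measurable:
  assumes "\<Psi> \<in> borel_measurable borel"
  shows "(\<lambda>w. mom \<Psi> (fst w) (snd w)) \<in> borel_measurable (lborel \<Otimes>\<^sub>M lborel)"
proof -
  have "(\<lambda>z. (snd z, fst z)) \<in> measurable ((lborel \<Otimes>\<^sub>M lborel) \<Otimes>\<^sub>M M) T3" by measurable
  from measurable_comp[OF this Psi_measurable_T3[OF assms]]
  have [measurable]: "(\<lambda>z. indicator {0<..} (fst (fst z)) * \<Psi> (u (fst (fst z)) (snd (fst z)) (snd z)) :: ennreal) \<in> borel_measurable ((lborel \<Otimes>\<^sub>M lborel) \<Otimes>\<^sub>M M)"
    by (simp add: comp_def)
  show ?thesis unfolding mom_def by measurable
qed

lemma mom_nonpos: "s \<le> 0 \<Longrightarrow> mom \<Psi> s y = 0"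
  unfolding mom_def by simp

lemma mom_pos: "0 < s \<Longrightarrow> mom \<Psi> s y = (\<integral>\<^sup>+\<omega>. \<Psi> (u s y \<omega>) \<partial>M)"
  unfolding mom_def by simp

lemma heat_sq_op_mom:
  assumes [measurable]: "\<Psi> \<in> borel_measurable borel"
  shows "heat_sq_op \<kappa> (mom \<Psi>) t x = 
    (\<integral>\<^sup>+z. ennreal (heat_sq \<kappa> (t - fst (snd z)) (snd (snd z) - x)) * (indicator {0<..} (fst (snd z)) * \<Psi> (u (fst (snd z)) (snd (snd z)) (fst z))) \<partial>T3)"
proof -
  note [measurable] = Psi_measurable_T3[OF assms]
  have *: "(\<lambda>\<omega>. indicator {0<..} s * \<Psi> (u s y \<omega>)) \<in> borel_measurable M" for s y
    by (cases "0 < s") (simp_all add: measurable_compose[OF u_measurable assms])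
  show ?thesis
    by (subst T3_iterated') (simp_all add: heat_sq_op_def mom_def nn_integral_cmult[OF *])
qed

definition integrand :: "real \<Rightarrow> real \<Rightarrow> real \<Rightarrow> real \<Rightarrow> 'a \<Rightarrow> real" where
  "integrand t x s y \<omega> = indicator {0<..<t} s * heat_kernel \<kappa> (t - s) (y - x) * \<sigma> (u s y \<omega>)"

lemma mild_walsh:
  assumes "0 < t"
  obtains I where "walsh_integral M F W (integrand t x) I" "AE \<omega> in M. u t x \<omega> = Pu t x + I \<omega>"
proof -
  have "\<exists>I. walsh_integral M F W (\<lambda>s y \<omega>. indicator {0<..<t} s * heat_kernel \<kappa> (t - s) (y - x) * \<sigma> (u s y \<omega>)) I
        \<and> (AE \<omega> in M. u t x \<omega> = heat_semigroup \<kappa> t u0 x + I \<omega>)"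
    using solution assms unfolding mild_solution_def by blast
  then show thesis using that unfolding integrand_def[abs_def] by blast
qed

lemma integrand_square:
  "ennreal ((field0 (integrand t x) z)\<^sup>2) = ennreal (heat_sq \<kappa> (t - fst (snd z)) (snd (snd z) - x)) * (indicator {0<..} (fst (snd z)) * ennreal ((\<sigma> (u (fst (snd z)) (snd (snd z)) (fst z)))\<^sup>2))"
proof (cases "0 < fst (snd z) \<and> fst (snd z) < t")
  case True
  then show ?thesis unfolding integrand_def
    using heat_kernel_square[OF \<kappa>, of "t - fst (snd z)"] heat_sq_nonneg[OF \<kappa>] by (simp add: power_mult_distrib ennreal_mult)
qed (auto simp: integrand_def heat_sq_def)

text \<open>Some simple integral is at mean square distance less than 1, and simple integrals are
  square integrable. This yields finiteness without appealing to the local bound in the notion of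
  solution.\<close>

lemma walsh_square_finite:
  assumes w: "walsh_integral M F W \<phi> I"
  shows "(\<integral>\<^sup>+\<omega>. ennreal ((I \<omega>)\<^sup>2) \<partial>M) < \<infinity>"
proof -
  obtain reps where r: "\<And>n. simple_ok M F (reps n)" and
    a: "(\<lambda>n. \<integral>\<^sup>+\<omega>. ennreal ((I \<omega> - simple_int W (reps n) \<omega>)\<^sup>2) \<partial>M) \<longlonglongrightarrow> 0"
    using walsh_approx[OF w] by blast
  have "\<forall>\<^sub>F n in sequentially. (\<integral>\<^sup>+\<omega>. ennreal ((I \<omega> - simple_int W (reps n) \<omega>)\<^sup>2) \<partial>M) < 1"
    by (rule order_tendstoD(2)[OF a]) simp
  then obtain n where n: "(\<integral>\<^sup>+\<omega>. ennreal ((I \<omega> - simple_int W (reps n) \<omega>)\<^sup>2) \<partial>M) < 1"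
    using eventually_happens' sequentially_bot by blast
  have fin: "(\<integral>\<^sup>+\<omega>. ennreal ((simple_int W (reps n) \<omega>)\<^sup>2) \<partial>M) < \<infinity>"
    by (subst nn_integral_eq_integral[OF simple_int_square(1)[OF r]]) simp_all
  have "(\<integral>\<^sup>+\<omega>. ennreal ((I \<omega>)\<^sup>2) \<partial>M) \<le> ennreal (1 + 1) * (\<integral>\<^sup>+\<omega>. ennreal ((simple_int W (reps n) \<omega>)\<^sup>2) \<partial>M) 
     + ennreal (1 + 1/1) * (\<integral>\<^sup>+\<omega>. ennreal ((I \<omega> - simple_int W (reps n) \<omega>)\<^sup>2) \<partial>M)"
    by (rule nn_integral_square_le[OF walsh_measurable(1)[OF w] simple_int_measurable[OF r]]) simp
  also have "\<dots> < \<infinity>" using fin order.strict_trans[OF n, of \<infinity>] by (simp add: ennreal_mult_less_top)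
  finally show ?thesis .
qed

lemma walsh_integrand_square:
  assumes "walsh_integral M F W (integrand t x) I"
  shows "(\<integral>\<^sup>+\<omega>. ennreal ((I \<omega>)\<^sup>2) \<partial>M) = heat_sq_op \<kappa> (mom (\<lambda>x. ennreal ((\<sigma> x)\<^sup>2))) t x"
  unfolding walsh_isometry[OF assms] integrand_square by (rule heat_sq_op_mom[symmetric]) measurable

text \<open>The deterministic and stochastic parts are orthogonal because the Walsh integral has
  mean zero; the isometry evaluates the second part.\<close>

lemma second_moment_formula:
  assumes "0 < t"
  shows "V t x = ennreal ((Pu t x)\<^sup>2) + heat_sq_op \<kappa> (mom (\<lambda>x. ennreal ((\<sigma> x)\<^sup>2))) t x"
    "heat_sq_op \<kappa> (mom (\<lambda>x. ennreal ((\<sigma> x)\<^sup>2))) t x < \<infinity>"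
proof -
  obtain I where w: "walsh_integral M F W (integrand t x) I" and ae: "AE \<omega> in M. u t x \<omega> = Pu t x + I \<omega>"
    using mild_walsh[OF assms] by blast
  note fin = walsh_square_finite[OF w] and sq = walsh_integrand_square[OF w]
  have I: "I \<in> borel_measurable M" by (rule walsh_measurable(1)[OF w])
  note i2 = square_integrable_finite[OF I fin]
  note i = square_integrable_imp_integrable[OF I i2]
  show "heat_sq_op \<kappa> (mom (\<lambda>x. ennreal ((\<sigma> x)\<^sup>2))) t x < \<infinity>" using fin unfolding sq .
  have eq: "(Pu t x + I \<omega>)\<^sup>2 = (Pu t x)\<^sup>2 + 2 * Pu t x * I \<omega> + (I \<omega>)\<^sup>2" for \<omega> by (rule power2_sum[THEN trans]) simp
  have int: "integrable M (\<lambda>\<omega>. (Pu t x + I \<omega>)\<^sup>2)" unfolding eq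
    by (intro Bochner_Integration.integrable_add integrable_const integrable_mult_right i i2)
  have "V t x = (\<integral>\<^sup>+\<omega>. ennreal ((Pu t x + I \<omega>)\<^sup>2) \<partial>M)"
    unfolding mom_pos[OF assms] by (rule nn_integral_cong_AE) (use ae in eventually_elim, simp)
  also have "\<dots> = ennreal (expectation (\<lambda>\<omega>. (Pu t x + I \<omega>)\<^sup>2))"
    by (rule nn_integral_eq_integral[OF int]) simp
  also have "expectation (\<lambda>\<omega>. (Pu t x + I \<omega>)\<^sup>2) = (Pu t x)\<^sup>2 + expectation (\<lambda>\<omega>. (I \<omega>)\<^sup>2)"
  proof -
    have i1: "integrable M (\<lambda>\<omega>. 2 * Pu t x * I \<omega>)" by (rule integrable_mult_right[OF i])
    have "expectation (\<lambda>\<omega>. (Pu t x + I \<omega>)\<^sup>2) = expectation (\<lambda>\<omega>. (Pu t x)\<^sup>2 + 2 * Pu t x * I \<omega>) + expectation (\<lambda>\<omega>. (I \<omega>)\<^sup>2)"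
      unfolding eq by (intro Bochner_Integration.integral_add Bochner_Integration.integrable_add integrable_const i1 i2)
    also have "expectation (\<lambda>\<omega>. (Pu t x)\<^sup>2 + 2 * Pu t x * I \<omega>) = expectation (\<lambda>\<omega>. (Pu t x)\<^sup>2) + expectation (\<lambda>\<omega>. 2 * Pu t x * I \<omega>)"
      by (intro Bochner_Integration.integral_add integrable_const i1)
    also have "expectation (\<lambda>\<omega>. 2 * Pu t x * I \<omega>) = 0" using walsh_expectation[OF w fin] by simp
    finally show ?thesis by (simp add: prob_space)
  qed
  also have "ennreal \<dots> = ennreal ((Pu t x)\<^sup>2) + ennreal (expectation (\<lambda>\<omega>. (I \<omega>)\<^sup>2))"
    by (intro ennreal_plus Bochner_Integration.integral_nonneg) simp_all
  also have "ennreal (expectation (\<lambda>\<omega>. (I \<omega>)\<^sup>2)) = (\<integral>\<^sup>+\<omega>. ennreal ((I \<omega>)\<^sup>2) \<partial>M)"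
    by (rule nn_integral_eq_integral[symmetric, OF i2]) simp
  finally show "V t x = ennreal ((Pu t x)\<^sup>2) + heat_sq_op \<kappa> (mom (\<lambda>x. ennreal ((\<sigma> x)\<^sup>2))) t x" unfolding sq .
qed

lemma heat_sq_op_cmult:
  assumes [measurable]: "(\<lambda>w. X (fst w) (snd w)) \<in> borel_measurable (lborel \<Otimes>\<^sub>M lborel)"
  shows "heat_sq_op \<kappa> (\<lambda>s y. c * X s y) t x = c * heat_sq_op \<kappa> X t x"
proof -
  have [measurable]: "(\<lambda>w. c * X (fst w) (snd w)) \<in> borel_measurable (lborel \<Otimes>\<^sub>M lborel)" by measurable
  show ?thesis
    by (subst (1 2) heat_sq_op_pair, measurable, subst nn_integral_cmult[symmetric], measurable) (simp add: mult_ac)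
qed

lemma mom_cmult:
  assumes "\<Psi> \<in> borel_measurable borel"
  shows "mom (\<lambda>x. c * \<Psi> x) s y = c * mom \<Psi> s y"
proof (cases "0 < s")
  case True
  note [measurable] = u_measurable[OF True] assms
  show ?thesis unfolding mom_pos[OF True] by (rule nn_integral_cmult) measurable
qed (simp add: mom_nonpos)

lemma mom_mono: "(\<And>x. \<Psi> x \<le> \<Psi>' x) \<Longrightarrow> mom \<Psi> s y \<le> mom \<Psi>' s y"
  unfolding mom_def by (intro nn_integral_mono mult_left_mono) simp_all

lemma mom_sigma_le: "mom (\<lambda>x. ennreal ((\<sigma> x)\<^sup>2)) s y \<le> ennreal (Lip\<^sup>2) * V s y"
proof -
  have "mom (\<lambda>x. ennreal ((\<sigma> x)\<^sup>2)) s y \<le> mom (\<lambda>x. ennreal (Lip\<^sup>2) * ennreal (x\<^sup>2)) s y"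
  proof (rule mom_mono)
    fix x
    have "(\<sigma> x)\<^sup>2 \<le> (Lip * \<bar>x\<bar>)\<^sup>2" using Lip(2)[of x] by (metis abs_ge_zero power2_abs power_mono)
    then show "ennreal ((\<sigma> x)\<^sup>2) \<le> ennreal (Lip\<^sup>2) * ennreal (x\<^sup>2)"
      by (simp add: ennreal_mult[symmetric] power_mult_distrib ennreal_leI)
  qed
  then show ?thesis by (subst (asm) mom_cmult) simp_all
qed

lemma mom_sigma_ge: "ennreal (L\<^sup>2) * V s y \<le> mom (\<lambda>x. ennreal ((\<sigma> x)\<^sup>2)) s y"
proof -
  have "mom (\<lambda>x. ennreal (L\<^sup>2) * ennreal (x\<^sup>2)) s y \<le> mom (\<lambda>x. ennreal ((\<sigma> x)\<^sup>2)) s y"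
  proof (rule mom_mono)
    fix x
    have "(L * \<bar>x\<bar>)\<^sup>2 \<le> (\<bar>\<sigma> x\<bar>)\<^sup>2" by (intro power_mono L(2)) (use L(1) in simp)
    then show "ennreal (L\<^sup>2) * ennreal (x\<^sup>2) \<le> ennreal ((\<sigma> x)\<^sup>2)"
      by (simp add: ennreal_mult[symmetric] power_mult_distrib ennreal_leI)
  qed
  then show ?thesis by (subst (asm) mom_cmult) simp_all
qed

lemma V_measurable: "(\<lambda>w. V (fst w) (snd w)) \<in> borel_measurable (lborel \<Otimes>\<^sub>M lborel)"
  by (rule mom_measurable) measurable

lemma V_upper:
  assumes "0 < t" shows "V t x \<le> ennreal ((Pu t x)\<^sup>2) + ennreal (Lip\<^sup>2) * heat_sq_op \<kappa> V t x"
proof -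
  have "heat_sq_op \<kappa> (mom (\<lambda>x. ennreal ((\<sigma> x)\<^sup>2))) t x \<le> heat_sq_op \<kappa> (\<lambda>s y. ennreal (Lip\<^sup>2) * V s y) t x"
    by (rule heat_sq_op_mono) (rule mom_sigma_le)
  then show ?thesis unfolding second_moment_formula[OF assms] heat_sq_op_cmult[OF V_measurable] by (rule add_left_mono)
qed

lemma V_lower:
  assumes "0 < t" shows "ennreal ((Pu t x)\<^sup>2) + ennreal (L\<^sup>2) * heat_sq_op \<kappa> V t x \<le> V t x"
proof -
  have "heat_sq_op \<kappa> (\<lambda>s y. ennreal (L\<^sup>2) * V s y) t x \<le> heat_sq_op \<kappa> (mom (\<lambda>x. ennreal ((\<sigma> x)\<^sup>2))) t x"
    by (rule heat_sq_op_mono) (rule mom_sigma_ge)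
  then show ?thesis unfolding second_moment_formula[OF assms] heat_sq_op_cmult[OF V_measurable] by (rule add_left_mono)
qed

text \<open>The isometry controls the second moment of \<open>\<sigma> (u)\<close>; the lower bound
  \<open>L > 0\<close> transfers finiteness to that of \<open>u\<close>.\<close>

lemma V_op_finite:
  assumes "0 < t" shows "heat_sq_op \<kappa> V t x < \<infinity>"
proof -
  have "ennreal (L\<^sup>2) * heat_sq_op \<kappa> V t x \<le> heat_sq_op \<kappa> (mom (\<lambda>x. ennreal ((\<sigma> x)\<^sup>2))) t x"
    unfolding heat_sq_op_cmult[OF V_measurable, symmetric] by (rule heat_sq_op_mono) (rule mom_sigma_ge)
  also have "\<dots> < \<infinity>" by (rule second_moment_formula(2)[OF assms])
  finally show ?thesis using L(1) by (auto simp: ennreal_mult_less_top ennreal_eq_0_iff)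
qed

lemma Pu_bounds:
  assumes "0 < t"
  shows "0 < Pu t x" "Pu t x \<le> U * exp (\<bar>c\<bar> * R) * exp (- c * x + c\<^sup>2 * \<kappa> * t / 2)" "Pu t x \<le> U"
  using heat_semigroup_pos[OF \<kappa> assms u0(1) heat_semigroup_bounds(1)[OF \<kappa> assms u0_measurable u0] S]
    heat_semigroup_bounds(2)[OF \<kappa> assms u0_measurable u0, of x c] heat_semigroup_bounds(2)[OF \<kappa> assms u0_measurable u0, of x 0]
  by simp_all

lemma U_nonneg: "0 \<le> U" using order_trans[OF u0(1) u0(2)] .

text \<open>Decay rate \<open>c / n\<close> is used for the semigroup itself, so that the power
  decays with rate \<open>c\<close>. The exponent in time is then
  \<open>\<kappa> * c\<^sup>2 / (2 * n)\<close>, which for \<open>n \<ge> 2\<close> is below the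
  threshold already required of \<beta>.\<close>

lemma Pu_power_bound:
  assumes "0 < t" "n \<ge> 2" "\<beta> \<ge> \<kappa> * c\<^sup>2 / 4"
  shows "(Pu t x) ^ n \<le> (U * exp (\<bar>c / n\<bar> * R)) ^ n * exp (\<beta> * t - c * x)"
proof -
  have "(Pu t x) ^ n \<le> (U * exp (\<bar>c / n\<bar> * R) * exp (- (c / n) * x + (c / n)\<^sup>2 * \<kappa> * t / 2)) ^ n"
    by (intro power_mono Pu_bounds(2) less_imp_le[OF Pu_bounds(1)] assms(1))
  also have "\<dots> = (U * exp (\<bar>c / n\<bar> * R)) ^ n * exp (n * (- (c / n) * x + (c / n)\<^sup>2 * \<kappa> * t / 2))"
    unfolding power_mult_distrib exp_of_nat_mult ..
  also have "\<dots> \<le> (U * exp (\<bar>c / n\<bar> * R)) ^ n * exp (\<beta> * t - c * x)"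
  proof -
    have "n * (- (c / n) * x + (c / n)\<^sup>2 * \<kappa> * t / 2) = - c * x + (\<kappa> * c\<^sup>2 * t) / (2 * n)"
      using assms(2) by (simp add: power2_eq_square field_simps)
    also have "(\<kappa> * c\<^sup>2 * t) / (2 * n) \<le> (\<kappa> * c\<^sup>2 * t) / 4"
      using assms \<kappa> by (intro divide_left_mono) auto
    also have "(\<kappa> * c\<^sup>2 * t) / 4 \<le> \<beta> * t" using mult_right_mono[OF assms(3), of t] assms(1) by simp
    finally show ?thesis using U_nonneg by (intro mult_left_mono) auto
  qed
  finally show ?thesis .
qed

text \<open>The condition on \<open>Lip\<close> says that the renewal constant is less than 1. Since
  this constant depends on \<open>c\<close> only through its square, the comparison applies with
  \<open>c\<close> and \<open>- c\<close>, and the sign of \<open>x\<close> selects the better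
  one.\<close>

lemma second_moment_bound:
  assumes \<beta>: "\<beta> > \<kappa> * c\<^sup>2 / 4" and \<theta>: "Lip\<^sup>2 < 2 * sqrt (\<kappa> * (\<beta> - \<kappa> * c\<^sup>2 / 4))"
  obtains A where "A \<ge> 0" "\<And>t x. 0 < t \<Longrightarrow> V t x \<le> ennreal (A * exp (\<beta> * t - c * \<bar>x\<bar>))"
proof -
  define B where "B = (U * exp (\<bar>c / 2\<bar> * R)) ^ 2"
  define A where "A = B / (1 - Lip\<^sup>2 * (1 / (2 * sqrt (\<kappa> * (\<beta> - \<kappa> * c\<^sup>2 / 4)))))"
  have th: "Lip\<^sup>2 * (1 / (2 * sqrt (\<kappa> * (\<beta> - \<kappa> * c\<^sup>2 / 4)))) < 1"
    using \<theta> \<kappa> \<beta> by (simp add: divide_less_eq)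
  have B: "B \<ge> 0" unfolding B_def by simp
  have *: "V t x \<le> ennreal (A * exp (\<beta> * t - d * x))" if "0 < t" "d = c \<or> d = - c" for t x d
  proof -
    have d: "d\<^sup>2 = c\<^sup>2" "\<bar>d / 2\<bar> = \<bar>c / 2\<bar>" using that by auto
    have "V t x \<le> ennreal (B / (1 - Lip\<^sup>2 * (1 / (2 * sqrt (\<kappa> * (\<beta> - \<kappa> * d\<^sup>2 / 4))))) * exp (\<beta> * t - d * x))"
    proof (rule subsolution_comparison[OF \<kappa> V_measurable mom_nonpos _ B V_upper V_op_finite])
      show "(Pu t x)\<^sup>2 \<le> U\<^sup>2" if "0 < t" for t x
        using Pu_bounds(1,3)[OF that, of x] by (intro power_mono) auto
      show "(Pu t x)\<^sup>2 \<le> B * exp (\<beta> * t - d * x)" if "0 < t" for t x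
        using Pu_power_bound[OF that, of 2 d \<beta> x] \<beta> d unfolding B_def by simp
    qed (use \<beta> th that d in simp_all)
    then show ?thesis unfolding A_def d(1) .
  qed
  show thesis
  proof (rule that)
    show "A \<ge> 0" using B th unfolding A_def by simp
    show "V t x \<le> ennreal (A * exp (\<beta> * t - c * \<bar>x\<bar>))" if "0 < t" for t x
      using *[OF that, of c x] *[OF that, of "- c" x] by (cases "x \<ge> 0") auto
  qed
qed

lemma V_pos:
  assumes "0 < t" shows "V t x > 0"
proof -
  have "0 < ennreal ((Pu t x)\<^sup>2)" using Pu_bounds(1)[OF assms, of x] by simp
  also have "\<dots> \<le> V t x" unfolding second_moment_formula(1)[OF assms] by simp
  finally show ?thesis .
qed

end


section \<open>Higher moments of the solution\<close>

context mild begin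

lemma heat_sq_op_mom_weight:
  assumes [measurable]: "\<Psi> \<in> borel_measurable borel" "g \<in> borel_measurable borel"
  shows "heat_sq_op \<kappa> (\<lambda>s y. g s * mom \<Psi> s y) t x = 
    (\<integral>\<^sup>+z. g (fst (snd z)) * (ennreal (heat_sq \<kappa> (t - fst (snd z)) (snd (snd z) - x)) * (indicator {0<..} (fst (snd z)) * \<Psi> (u (fst (snd z)) (snd (snd z)) (fst z)))) \<partial>T3)"
proof -
  note [measurable] = Psi_measurable_T3[OF assms(1)]
  have *: "(\<lambda>\<omega>. indicator {0<..} s * \<Psi> (u s y \<omega>)) \<in> borel_measurable M" for s y
    by (cases "0 < s") (simp_all add: measurable_compose[OF u_measurable assms(1)])
  have **: "(\<lambda>\<omega>. ennreal (heat_sq \<kappa> (t - s) (y - x)) * (indicator {0<..} s * \<Psi> (u s y \<omega>))) \<in> borel_measurable M" for s y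
    using *[of s y] by measurable
  have "heat_sq_op \<kappa> (\<lambda>s y. g s * mom \<Psi> s y) t x = (\<integral>\<^sup>+s. (\<integral>\<^sup>+y. g s * (ennreal (heat_sq \<kappa> (t - s) (y - x)) * mom \<Psi> s y) \<partial>lborel) \<partial>lborel)"
    unfolding heat_sq_op_def by (simp add: mult.left_commute)
  also have "\<dots> = (\<integral>\<^sup>+s. (\<integral>\<^sup>+y. (\<integral>\<^sup>+\<omega>. g s * (ennreal (heat_sq \<kappa> (t - s) (y - x)) * (indicator {0<..} s * \<Psi> (u s y \<omega>))) \<partial>M) \<partial>lborel) \<partial>lborel)"
    unfolding nn_integral_cmult[OF **] nn_integral_cmult[OF *] mom_def ..
  also have "\<dots> = (\<integral>\<^sup>+z. g (fst (snd z)) * (ennreal (heat_sq \<kappa> (t - fst (snd z)) (snd (snd z) - x)) * (indicator {0<..} (fst (snd z)) * \<Psi> (u (fst (snd z)) (snd (snd z)) (fst z)))) \<partial>T3)"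
    by (subst T3_iterated') simp_all
  finally show ?thesis .
qed

text \<open>The weight is the squared kernel times a discount \<open>E\<close>, so the kernel
  cancels from every quotient and exactly one factor of it remains. The discount comes out as
  \<open>(1 / E) ^ m\<close> because \<open>E \<le> 1\<close>. Scaling needs a factor at least 1,
  hence the maximum with \<open>Lip\<close>.\<close>

lemma weighted_power_integrand:
  assumes \<epsilon>: "\<epsilon> > 0" and \<gamma>: "\<gamma> \<ge> 0"
  shows "weighted_power \<epsilon> m (heat_sq \<kappa> (t - s) (y - x) * exp (- \<gamma> * (t - s))) (indicator {0<..} s * integrand t x s y \<omega>)
    \<le> indicator {0<..} s * (heat_sq \<kappa> (t - s) (y - x) * exp (\<gamma> * m * (t - s)) * (max 1 Lip ^ (2*m+2) * truncated_power \<epsilon> m (u s y \<omega>)))"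
proof (cases "0 < s \<and> s < t")
  case False
  then have 0: "indicator {0<..} s * integrand t x s y \<omega> = 0" by (auto simp: integrand_def)
  show ?thesis unfolding 0 weighted_power_0
    by (intro mult_nonneg_nonneg truncated_power_nonneg[OF \<epsilon>] heat_sq_nonneg[OF \<kappa>]) simp_all
next
  case True
  define h where "h = heat_sq \<kappa> (t - s) (y - x)"
  define E where "E = exp (- \<gamma> * (t - s))"
  define v where "v = \<sigma> (u s y \<omega>)"
  have h: "h > 0" unfolding h_def heat_sq_def using True \<kappa> by simp
  have E: "0 < E" "E \<le> 1" unfolding E_def using \<gamma> True by simp_all
  have f2: "(indicator {0<..} s * integrand t x s y \<omega>)\<^sup>2 = h * v\<^sup>2"
    unfolding integrand_def h_def v_def using True heat_kernel_square[OF \<kappa>, of "t - s" "y - x"] by (simp add: power_mult_distrib)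
  have "weighted_power \<epsilon> m (h * E) (indicator {0<..} s * integrand t x s y \<omega>) = h * v\<^sup>2 * (v\<^sup>2 / (E + \<epsilon> * v\<^sup>2)) ^ m"
  proof -
    have "h * v\<^sup>2 / (h * E + \<epsilon> * (h * v\<^sup>2)) = (h * v\<^sup>2) / (h * (E + \<epsilon> * v\<^sup>2))" by (simp add: algebra_simps)
    also have "\<dots> = v\<^sup>2 / (E + \<epsilon> * v\<^sup>2)" using h by simp
    finally show ?thesis unfolding weighted_power_def f2 by simp
  qed
  also have "\<dots> \<le> h * v\<^sup>2 * (1 / E * (v\<^sup>2 / (1 + \<epsilon> * v\<^sup>2))) ^ m"
  proof (intro mult_left_mono power_mono)
    have "E * (1 + \<epsilon> * v\<^sup>2) \<le> E + \<epsilon> * v\<^sup>2" using E \<epsilon> by (simp add: algebra_simps mult_left_le_one_le)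
    then have "v\<^sup>2 / (E + \<epsilon> * v\<^sup>2) \<le> v\<^sup>2 / (E * (1 + \<epsilon> * v\<^sup>2))"
      using E \<epsilon> one_plus_pos[OF \<epsilon>, of v] by (intro divide_left_mono mult_pos_pos add_pos_nonneg) auto
    then show "v\<^sup>2 / (E + \<epsilon> * v\<^sup>2) \<le> 1 / E * (v\<^sup>2 / (1 + \<epsilon> * v\<^sup>2))" by simp
    show "0 \<le> v\<^sup>2 / (E + \<epsilon> * v\<^sup>2)" using E \<epsilon> by simp
    show "0 \<le> h * v\<^sup>2" using h by simp
  qed
  also have "\<dots> = h * (1 / E) ^ m * truncated_power \<epsilon> m v"
    unfolding truncated_power_def truncated_weight_def power_mult_distrib by (simp only: mult_ac)
  also have "(1 / E) ^ m = exp (\<gamma> * m * (t - s))"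
    unfolding E_def by (simp add: exp_minus divide_inverse exp_of_nat_mult[symmetric] mult_ac)
  also have "h * exp (\<gamma> * m * (t - s)) * truncated_power \<epsilon> m v \<le> h * exp (\<gamma> * m * (t - s)) * (max 1 Lip ^ (2*m+2) * truncated_power \<epsilon> m (u s y \<omega>))"
  proof (rule mult_left_mono)
    have "\<bar>v\<bar> \<le> \<bar>max 1 Lip * u s y \<omega>\<bar>"
      unfolding v_def abs_mult using Lip(2)[of "u s y \<omega>"] mult_right_mono[of Lip "max 1 Lip" "\<bar>u s y \<omega>\<bar>"] by simp
    then have "truncated_power \<epsilon> m v \<le> truncated_power \<epsilon> m (max 1 Lip * u s y \<omega>)" by (rule truncated_power_mono[OF \<epsilon>])
    also have "\<dots> \<le> max 1 Lip ^ (2*m+2) * truncated_power \<epsilon> m (u s y \<omega>)" by (rule truncated_power_scale[OF \<epsilon>]) simp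
    finally show "truncated_power \<epsilon> m v \<le> max 1 Lip ^ (2*m+2) * truncated_power \<epsilon> m (u s y \<omega>)" .
  qed (use h in simp)
  finally show ?thesis unfolding h_def E_def using True by simp
qed

text \<open>The discount rate for which the weight has mass at most
  \<open>1 / (2 * taylor_const m)\<close>, just small enough for absorption.\<close>

definition moment_gamma :: "nat \<Rightarrow> real" where
  "moment_gamma m = (taylor_const m)\<^sup>2 / \<kappa>"

text \<open>The product of three losses: splitting the solution into its deterministic and
  stochastic parts, the moment inequality \<open>walsh_truncated_power\<close>, and passing from
  \<open>\<sigma> (u)\<close> to \<open>u\<close>.\<close>

definition moment_const :: "nat \<Rightarrow> real" where
  "moment_const m = 4 ^ (m+1) * (2 * taylor_const m * 16 ^ (m+1)) * max 1 Lip ^ (2*m+2)"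

text \<open>The growing factor \<open>exp (\<gamma> * m * (t - s))\<close> left by the weight is a
  quotient of exponentials at the two times; moving it into the unknown leaves
  \<open>heat_sq\<close> as the kernel.\<close>

abbreviation discounted :: "real \<Rightarrow> nat \<Rightarrow> real \<Rightarrow> real \<Rightarrow> ennreal" where
  "discounted \<epsilon> m s y \<equiv> ennreal (exp (- (moment_gamma m * m) * s)) * mom (\<lambda>x. ennreal (truncated_power \<epsilon> m x)) s y"

lemma moment_gamma_pos: "moment_gamma m > 0"
  unfolding moment_gamma_def using taylor_const_pos[of m] \<kappa> by simp

lemma moment_const_pos: "moment_const m > 0"
  unfolding moment_const_def using taylor_const_pos[of m] by simp

lemma discounted_upper:
  assumes \<epsilon>: "\<epsilon> > 0" and m: "m > 0" and t: "0 < t"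
  shows "discounted \<epsilon> m t x \<le> ennreal (4 ^ (m+1) * (Pu t x) ^ (2*m+2)) + ennreal (moment_const m) * heat_sq_op \<kappa> (discounted \<epsilon> m) t x"
proof -
  obtain I where w: "walsh_integral M F W (integrand t x) I" and ae: "AE \<omega> in M. u t x \<omega> = Pu t x + I \<omega>"
    using mild_walsh[OF t] by blast
  have I[measurable]: "I \<in> borel_measurable M" by (rule walsh_measurable(1)[OF w])
  let ?\<gamma> = "moment_gamma m" and ?c = "2 * taylor_const m * 16 ^ (m+1)" and ?K = "max 1 Lip ^ (2*m+2)"
  let ?q = "\<lambda>s y. heat_sq \<kappa> (t - s) (y - x) * exp (- ?\<gamma> * (t - s))"
  note \<gamma> = moment_gamma_pos[of m] and tc = taylor_const_pos[of m]
  note [measurable] = Psi_measurable_T3[of "\<lambda>x. ennreal (truncated_power \<epsilon> m x)", simplified]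
  have Q: "(\<integral>\<^sup>+s. (\<integral>\<^sup>+y. indicator {0<..} s * ennreal (?q s y) \<partial>lborel) \<partial>lborel) \<le> ennreal (1 / (2 * taylor_const m))"
  proof -
    have "(\<integral>\<^sup>+s. (\<integral>\<^sup>+y. indicator {0<..} s * ennreal (?q s y) \<partial>lborel) \<partial>lborel) \<le> heat_sq_op \<kappa> (\<lambda>s y. ennreal (exp (- ?\<gamma> * t) * exp (?\<gamma> * s - 0 * y))) t x"
      unfolding heat_sq_op_def
    proof (intro nn_integral_mono)
      fix s y
      have "exp (- ?\<gamma> * (t - s)) = exp (- ?\<gamma> * t) * exp (?\<gamma> * s - 0 * y)"
        unfolding exp_add[symmetric] by (simp add: algebra_simps)
      then have "ennreal (?q s y) = ennreal (heat_sq \<kappa> (t - s) (y - x)) * ennreal (exp (- ?\<gamma> * t) * exp (?\<gamma> * s - 0 * y))"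
        using heat_sq_nonneg[OF \<kappa>] by (simp add: ennreal_mult[symmetric])
      then show "indicator {0<..} s * ennreal (?q s y) \<le> ennreal (heat_sq \<kappa> (t - s) (y - x)) * ennreal (exp (- ?\<gamma> * t) * exp (?\<gamma> * s - 0 * y))"
        by (simp add: indicator_def)
    qed
    also have "\<dots> \<le> ennreal (exp (- ?\<gamma> * t) * exp (?\<gamma> * t - 0 * x) * (1 / (2 * sqrt (\<kappa> * (?\<gamma> - \<kappa> * 0\<^sup>2 / 4)))))"
      by (rule heat_sq_op_exp[OF \<kappa>]) (use \<gamma> in simp_all)
    also have "exp (- ?\<gamma> * t) * exp (?\<gamma> * t - 0 * x) = 1" unfolding exp_add[symmetric] by simp
    also have "sqrt (\<kappa> * (?\<gamma> - \<kappa> * 0\<^sup>2 / 4)) = taylor_const m"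
      unfolding moment_gamma_def using \<kappa> tc by simp
    finally show ?thesis by simp
  qed
  have "ennreal (taylor_const m) * (\<integral>\<^sup>+s. (\<integral>\<^sup>+y. indicator {0<..} s * ennreal (?q s y) \<partial>lborel) \<partial>lborel)
     \<le> ennreal (taylor_const m) * ennreal (1 / (2 * taylor_const m))"
    by (intro mult_left_mono Q) simp
  also have "\<dots> = ennreal (1/2)" using tc by (simp only: ennreal_mult'[symmetric] less_imp_le) simp
  finally have Q': "ennreal (taylor_const m) * (\<integral>\<^sup>+s. (\<integral>\<^sup>+y. indicator {0<..} s * ennreal (?q s y) \<partial>lborel) \<partial>lborel) \<le> ennreal (1/2)" .
  have "(\<integral>\<^sup>+\<omega>. ennreal (truncated_power \<epsilon> m (I \<omega>)) \<partial>M) \<le> 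
     ennreal ?c * (\<integral>\<^sup>+z. ennreal (weighted_power \<epsilon> m (?q (fst (snd z)) (snd (snd z))) (field0 (integrand t x) z)) \<partial>T3)"
    by (rule walsh_truncated_power[OF w \<epsilon> m _ _ Q']) (use heat_sq_nonneg[OF \<kappa>] in auto)
  also have "\<dots> \<le> ennreal ?c * (\<integral>\<^sup>+z. ennreal (?K * exp (?\<gamma> * m * t)) * (ennreal (exp (- (?\<gamma> * m) * fst (snd z))) * 
      (ennreal (heat_sq \<kappa> (t - fst (snd z)) (snd (snd z) - x)) * (indicator {0<..} (fst (snd z)) * ennreal (truncated_power \<epsilon> m (u (fst (snd z)) (snd (snd z)) (fst z)))))) \<partial>T3)"
  proof (intro mult_left_mono nn_integral_mono)
    fix z :: "'a \<times> real \<times> real"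
    obtain \<omega> s y where z: "z = (\<omega>, s, y)" by (cases z)
    have e: "exp (?\<gamma> * m * (t - s)) = exp (?\<gamma> * m * t) * exp (- (?\<gamma> * m) * s)"
      unfolding exp_add[symmetric] by (simp add: algebra_simps)
    have "ennreal (weighted_power \<epsilon> m (?q s y) (indicator {0<..} s * integrand t x s y \<omega>))
      \<le> ennreal (indicator {0<..} s * (heat_sq \<kappa> (t - s) (y - x) * exp (?\<gamma> * m * (t - s)) * (?K * truncated_power \<epsilon> m (u s y \<omega>))))"
      by (intro ennreal_leI weighted_power_integrand \<epsilon> less_imp_le[OF \<gamma>])
    also have "\<dots> = ennreal (?K * exp (?\<gamma> * m * t)) * (ennreal (exp (- (?\<gamma> * m) * s)) * (ennreal (heat_sq \<kappa> (t - s) (y - x)) * (indicator {0<..} s * ennreal (truncated_power \<epsilon> m (u s y \<omega>)))))"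
    proof (cases "0 < s")
      case True
      have "indicator {0<..} s * (heat_sq \<kappa> (t - s) (y - x) * exp (?\<gamma> * m * (t - s)) * (?K * truncated_power \<epsilon> m (u s y \<omega>)))
        = (?K * exp (?\<gamma> * m * t)) * (exp (- (?\<gamma> * m) * s) * (heat_sq \<kappa> (t - s) (y - x) * truncated_power \<epsilon> m (u s y \<omega>)))"
        unfolding e using True by simp
      then show ?thesis using True heat_sq_nonneg[OF \<kappa>] truncated_power_nonneg[OF \<epsilon>]
        by (simp only: ennreal_mult mult_nonneg_nonneg exp_ge_zero zero_le_power max.coboundedI1 zero_le_one) simp
    qed simp
    finally show "ennreal (weighted_power \<epsilon> m (?q (fst (snd z)) (snd (snd z))) (field0 (integrand t x) z)) \<le> ennreal (?K * exp (?\<gamma> * m * t)) * (ennreal (exp (- (?\<gamma> * m) * fst (snd z))) * 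
      (ennreal (heat_sq \<kappa> (t - fst (snd z)) (snd (snd z) - x)) * (indicator {0<..} (fst (snd z)) * ennreal (truncated_power \<epsilon> m (u (fst (snd z)) (snd (snd z)) (fst z))))))"
      unfolding z by simp
  qed simp
  also have "\<dots> = ennreal ?c * (ennreal (?K * exp (?\<gamma> * m * t)) * heat_sq_op \<kappa> (discounted \<epsilon> m) t x)"
    by (subst nn_integral_cmult, measurable, subst heat_sq_op_mom_weight) simp_all
  finally have J: "(\<integral>\<^sup>+\<omega>. ennreal (truncated_power \<epsilon> m (I \<omega>)) \<partial>M) \<le> ennreal ?c * (ennreal (?K * exp (?\<gamma> * m * t)) * heat_sq_op \<kappa> (discounted \<epsilon> m) t x)" .
  have "mom (\<lambda>x. ennreal (truncated_power \<epsilon> m x)) t x = (\<integral>\<^sup>+\<omega>. ennreal (truncated_power \<epsilon> m (Pu t x + I \<omega>)) \<partial>M)"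
    unfolding mom_pos[OF t] by (rule nn_integral_cong_AE) (use ae in eventually_elim, simp)
  also have "\<dots> \<le> (\<integral>\<^sup>+\<omega>. ennreal (4 ^ (m+1) * (Pu t x) ^ (2*m+2)) + ennreal (4 ^ (m+1)) * ennreal (truncated_power \<epsilon> m (I \<omega>)) \<partial>M)"
  proof (rule nn_integral_mono)
    fix \<omega>
    have "truncated_power \<epsilon> m (Pu t x + I \<omega>) \<le> 4 ^ (m+1) * (truncated_power \<epsilon> m (Pu t x) + truncated_power \<epsilon> m (I \<omega>))"
      by (rule truncated_power_add[OF \<epsilon>])
    also have "\<dots> \<le> 4 ^ (m+1) * ((Pu t x) ^ (2*m+2) + truncated_power \<epsilon> m (I \<omega>))"
      by (intro mult_left_mono add_right_mono truncated_power_le_power \<epsilon>) simp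
    finally have "ennreal (truncated_power \<epsilon> m (Pu t x + I \<omega>)) \<le> ennreal (4 ^ (m+1) * (Pu t x) ^ (2*m+2) + 4 ^ (m+1) * truncated_power \<epsilon> m (I \<omega>))"
      unfolding distrib_left by (rule ennreal_leI)
    also have "\<dots> = ennreal (4 ^ (m+1) * (Pu t x) ^ (2*m+2)) + ennreal (4 ^ (m+1)) * ennreal (truncated_power \<epsilon> m (I \<omega>))"
      using truncated_power_nonneg[OF \<epsilon>] Pu_bounds(1)[OF t, of x]
      by (subst ennreal_plus, simp, simp, subst ennreal_mult[symmetric]) simp_all
    finally show "ennreal (truncated_power \<epsilon> m (Pu t x + I \<omega>)) \<le> ennreal (4 ^ (m+1) * (Pu t x) ^ (2*m+2)) + ennreal (4 ^ (m+1)) * ennreal (truncated_power \<epsilon> m (I \<omega>))" .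
  qed
  also have "\<dots> = ennreal (4 ^ (m+1) * (Pu t x) ^ (2*m+2)) + ennreal (4 ^ (m+1)) * (\<integral>\<^sup>+\<omega>. ennreal (truncated_power \<epsilon> m (I \<omega>)) \<partial>M)"
    by (subst nn_integral_add, measurable, subst nn_integral_cmult, measurable) (simp add: emeasure_space_1)
  also have "\<dots> \<le> ennreal (4 ^ (m+1) * (Pu t x) ^ (2*m+2)) + ennreal (4 ^ (m+1)) * (ennreal ?c * (ennreal (?K * exp (?\<gamma> * m * t)) * heat_sq_op \<kappa> (discounted \<epsilon> m) t x))"
    by (intro add_left_mono mult_left_mono J) simp
  finally have "discounted \<epsilon> m t x \<le> ennreal (exp (- (?\<gamma> * m) * t)) * (ennreal (4 ^ (m+1) * (Pu t x) ^ (2*m+2)) + ennreal (4 ^ (m+1)) * (ennreal ?c * (ennreal (?K * exp (?\<gamma> * m * t)) * heat_sq_op \<kappa> (discounted \<epsilon> m) t x)))"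
    by (rule mult_left_mono) simp
  also have "\<dots> = ennreal (exp (- (?\<gamma> * m) * t)) * ennreal (4 ^ (m+1) * (Pu t x) ^ (2*m+2)) + 
      (ennreal (exp (- (?\<gamma> * m) * t)) * ennreal (4 ^ (m+1)) * ennreal ?c * ennreal (?K * exp (?\<gamma> * m * t))) * heat_sq_op \<kappa> (discounted \<epsilon> m) t x"
    by (simp only: distrib_left mult.assoc)
  also have "ennreal (exp (- (?\<gamma> * m) * t)) * ennreal (4 ^ (m+1)) * ennreal ?c * ennreal (?K * exp (?\<gamma> * m * t)) = ennreal (moment_const m)"
  proof -
    have "ennreal (exp (- (?\<gamma> * m) * t)) * ennreal (4 ^ (m+1)) * ennreal ?c * ennreal (?K * exp (?\<gamma> * m * t)) = ennreal (exp (- (?\<gamma> * m) * t) * 4 ^ (m+1) * ?c * (?K * exp (?\<gamma> * m * t)))"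
      using tc by (simp only: ennreal_mult[symmetric] mult_nonneg_nonneg exp_ge_zero zero_le_power zero_le_numeral less_imp_le max.coboundedI1 zero_le_one)
    also have "exp (- (?\<gamma> * m) * t) * 4 ^ (m+1) * ?c * (?K * exp (?\<gamma> * m * t)) = (exp (- (?\<gamma> * m) * t) * exp (?\<gamma> * m * t)) * moment_const m"
      unfolding moment_const_def by (simp only: mult_ac)
    also have "exp (- (?\<gamma> * m) * t) * exp (?\<gamma> * m * t) = 1" unfolding exp_add[symmetric] by simp
    finally show ?thesis by simp
  qed
  also have "ennreal (exp (- (?\<gamma> * m) * t)) * ennreal (4 ^ (m+1) * (Pu t x) ^ (2*m+2)) \<le> ennreal 1 * ennreal (4 ^ (m+1) * (Pu t x) ^ (2*m+2))"
    using \<gamma> t by (intro mult_right_mono ennreal_leI) simp_all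
  finally show ?thesis by (simp add: add_right_mono)
qed

text \<open>The point is that \<open>A\<close> and \<beta> do not depend on \<epsilon>. Finiteness,
  needed to start the comparison, does use a bound by \<open>(1/\<epsilon>) ^ m\<close> times the
  second moment, but that bound is not part of the conclusion.\<close>

lemma truncated_moment_bound:
  assumes m: "m > 0"
  obtains A \<beta> where "A \<ge> 0" "\<And>\<epsilon> t x. \<epsilon> > 0 \<Longrightarrow> 0 < t \<Longrightarrow> mom (\<lambda>x. ennreal (truncated_power \<epsilon> m x)) t x \<le> ennreal (A * exp (\<beta> * t - \<bar>x\<bar>))"
proof -
  let ?\<Lambda> = "moment_const m" and ?\<gamma> = "moment_gamma m" and ?N = "2*m+2"
  \<comment> \<open>Chosen so that, for decay rate 1 or -1, the square root in the renewal constant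
    equals \<open>moment_const m + 1\<close>, which makes that constant less than 1/2.\<close>
  define \<beta> where "\<beta> = \<kappa> * 1 / 4 + (?\<Lambda> + 1)\<^sup>2 / \<kappa>"
  define B where "B = 4 ^ (m+1) * (U * exp (\<bar>1 / ?N\<bar> * R)) ^ ?N"
  define A where "A = B / (1 - ?\<Lambda> * (1 / (2 * (?\<Lambda> + 1))))"
  note \<Lambda> = moment_const_pos[of m] and \<gamma> = moment_gamma_pos[of m]
  have B: "B \<ge> 0" unfolding B_def using U_nonneg by simp
  have sq: "sqrt (\<kappa> * (\<beta> - \<kappa> * 1 / 4)) = ?\<Lambda> + 1" unfolding \<beta>_def using \<kappa> \<Lambda> by simp
  have th: "?\<Lambda> * (1 / (2 * (?\<Lambda> + 1))) < 1" using \<Lambda> by (simp add: divide_less_eq)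
  have \<beta>: "\<beta> > \<kappa> * 1 / 4" unfolding \<beta>_def using \<kappa> \<Lambda> by simp
  have *: "discounted \<epsilon> m t x \<le> ennreal (A * exp (\<beta> * t - d * x))" if \<epsilon>: "\<epsilon> > 0" and t: "0 < t" and d: "d = 1 \<or> d = - 1" for \<epsilon> t x d
  proof -
    have d2: "d\<^sup>2 = 1" "\<bar>d / real ?N\<bar> = \<bar>1 / real ?N\<bar>" using d by auto
    have meas: "(\<lambda>w. discounted \<epsilon> m (fst w) (snd w)) \<in> borel_measurable (lborel \<Otimes>\<^sub>M lborel)"
      using mom_measurable[of "\<lambda>x. ennreal (truncated_power \<epsilon> m x)"] by measurable
    have fin: "heat_sq_op \<kappa> (discounted \<epsilon> m) t x < \<infinity>" if t: "0 < t" for t x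
    proof -
      have "heat_sq_op \<kappa> (discounted \<epsilon> m) t x \<le> heat_sq_op \<kappa> (\<lambda>s y. ennreal ((1/\<epsilon>)^m) * V s y) t x"
      proof (rule heat_sq_op_mono)
        fix s y
        show "discounted \<epsilon> m s y \<le> ennreal ((1/\<epsilon>)^m) * V s y"
        proof (cases "0 < s")
          case True
          have "mom (\<lambda>x. ennreal (truncated_power \<epsilon> m x)) s y \<le> mom (\<lambda>x. ennreal ((1/\<epsilon>)^m) * ennreal (x\<^sup>2)) s y"
            using \<epsilon> by (intro mom_mono) (simp add: ennreal_mult'[symmetric] truncated_power_le_const ennreal_leI)
          also have "\<dots> = ennreal ((1/\<epsilon>)^m) * V s y" by (rule mom_cmult) measurable
          finally have "ennreal (exp (- (?\<gamma> * m) * s)) * mom (\<lambda>x. ennreal (truncated_power \<epsilon> m x)) s y \<le> 1 * (ennreal ((1/\<epsilon>)^m) * V s y)"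
            using True \<gamma> by (intro mult_mono) (simp_all add: ennreal_le_1)
          then show ?thesis by simp
        qed (simp add: mom_nonpos)
      qed
      also have "\<dots> < \<infinity>" unfolding heat_sq_op_cmult[OF V_measurable] using V_op_finite[OF t] by (simp add: ennreal_mult_less_top)
      finally show ?thesis .
    qed
    have "discounted \<epsilon> m t x \<le> ennreal (B / (1 - ?\<Lambda> * (1 / (2 * sqrt (\<kappa> * (\<beta> - \<kappa> * d\<^sup>2 / 4))))) * exp (\<beta> * t - d * x))"
    proof (rule subsolution_comparison[OF \<kappa> meas _ less_imp_le[OF \<Lambda>] B discounted_upper[OF \<epsilon> m] fin])
      show "4 ^ (m+1) * (Pu t x) ^ ?N \<le> 4 ^ (m+1) * U ^ ?N" if "0 < t" for t x
        using Pu_bounds(1,3)[OF that, of x] by (intro mult_left_mono power_mono) auto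
      show "4 ^ (m+1) * (Pu t x) ^ ?N \<le> B * exp (\<beta> * t - d * x)" if "0 < t" for t x
      proof -
        have "(Pu t x) ^ ?N \<le> (U * exp (\<bar>d / real ?N\<bar> * R)) ^ ?N * exp (\<beta> * t - d * x)"
          by (rule Pu_power_bound[OF that]) (use \<beta> d2 in simp_all)
        then have "4 ^ (m+1) * (Pu t x) ^ ?N \<le> 4 ^ (m+1) * ((U * exp (\<bar>d / real ?N\<bar> * R)) ^ ?N * exp (\<beta> * t - d * x))"
          by (rule mult_left_mono) simp
        then show ?thesis unfolding B_def d2(2) by (simp only: mult.assoc)
      qed
    qed (use \<beta> th sq t in \<open>simp_all add: mom_nonpos d2(1)\<close>)
    then show ?thesis unfolding A_def d2(1) sq .
  qed
  show thesis
  proof (rule that)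
    show A: "A \<ge> 0" unfolding A_def using B th by simp
    fix \<epsilon> t x :: real assume \<epsilon>: "\<epsilon> > 0" and t: "0 < t"
    define d :: real where "d = (if x \<ge> 0 then 1 else - 1)"
    have d: "d = 1 \<or> d = - 1" "d * x = \<bar>x\<bar>" by (auto simp: d_def)
    let ?m = "mom (\<lambda>x. ennreal (truncated_power \<epsilon> m x)) t x"
    have "?m = ennreal (exp ((?\<gamma> * m) * t)) * discounted \<epsilon> m t x"
      unfolding mult.assoc[symmetric] by (subst ennreal_mult[symmetric]) (simp_all add: exp_add[symmetric])
    also have "\<dots> \<le> ennreal (exp ((?\<gamma> * m) * t)) * ennreal (A * exp (\<beta> * t - d * x))"
      by (intro mult_left_mono * \<epsilon> t d) simp
    also have "\<dots> = ennreal (A * exp ((\<beta> + ?\<gamma> * m) * t - \<bar>x\<bar>))"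
    proof -
      have "exp ((?\<gamma> * m) * t) * (A * exp (\<beta> * t - d * x)) = A * exp ((\<beta> + ?\<gamma> * m) * t - \<bar>x\<bar>)"
      proof -
        have "exp ((\<beta> + ?\<gamma> * m) * t - \<bar>x\<bar>) = exp ((?\<gamma> * m) * t) * exp (\<beta> * t - \<bar>x\<bar>)"
          unfolding exp_add[symmetric] by (rule arg_cong[of _ _ exp]) (simp add: algebra_simps)
        then show ?thesis unfolding d(2) by (simp only: mult_ac)
      qed
      then show ?thesis using A by (simp add: ennreal_mult[symmetric])
    qed
    finally show "?m \<le> ennreal (A * exp ((\<beta> + ?\<gamma> * m) * t - \<bar>x\<bar>))" .
  qed
qed

text \<open>Fatou's lemma along \<open>\<epsilon> = 1 / (n + 1)\<close>, as the bound on the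
  truncated moments is uniform.\<close>

lemma even_moment_bound:
  assumes m: "m > 0"
  obtains A \<beta> where "A \<ge> 0" "\<And>t x. 0 < t \<Longrightarrow> (\<integral>\<^sup>+\<omega>. ennreal (u t x \<omega> ^ (2*m+2)) \<partial>M) \<le> ennreal (A * exp (\<beta> * t - \<bar>x\<bar>))"
proof -
  obtain A \<beta> where A: "A \<ge> 0" and b: "\<And>\<epsilon> t x. \<epsilon> > 0 \<Longrightarrow> 0 < t \<Longrightarrow> mom (\<lambda>x. ennreal (truncated_power \<epsilon> m x)) t x \<le> ennreal (A * exp (\<beta> * t - \<bar>x\<bar>))"
    using truncated_moment_bound[OF m] by blast
  have "(\<integral>\<^sup>+\<omega>. ennreal (u t x \<omega> ^ (2*m+2)) \<partial>M) \<le> ennreal (A * exp (\<beta> * t - \<bar>x\<bar>))" if t: "0 < t" for t x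
  proof -
    note [measurable] = u_measurable[OF t]
    let ?f = "\<lambda>n \<omega>. ennreal (truncated_power (1 / real (Suc n)) m (u t x \<omega>))"
    have lim: "(\<lambda>n. ?f n \<omega>) \<longlonglongrightarrow> ennreal (u t x \<omega> ^ (2*m+2))" for \<omega>
    proof (rule tendsto_ennrealI)
      have "(\<lambda>n. (u t x \<omega>)\<^sup>2 * ((u t x \<omega>)\<^sup>2 / (1 + 1 / real (Suc n) * (u t x \<omega>)\<^sup>2)) ^ m) \<longlonglongrightarrow> (u t x \<omega>)\<^sup>2 * ((u t x \<omega>)\<^sup>2 / (1 + 0 * (u t x \<omega>)\<^sup>2)) ^ m"
        by (intro tendsto_intros LIMSEQ_Suc[OF lim_const_over_n]) simp
      moreover have "(u t x \<omega>)\<^sup>2 * ((u t x \<omega>)\<^sup>2 / (1 + 0 * (u t x \<omega>)\<^sup>2)) ^ m = u t x \<omega> ^ (2*m+2)"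
        by (simp add: power_mult power_add power2_eq_square)
      ultimately show "(\<lambda>n. truncated_power (1 / real (Suc n)) m (u t x \<omega>)) \<longlonglongrightarrow> u t x \<omega> ^ (2*m+2)"
        unfolding truncated_power_def truncated_weight_def by simp
    qed
    have "(\<integral>\<^sup>+\<omega>. ennreal (u t x \<omega> ^ (2*m+2)) \<partial>M) = (\<integral>\<^sup>+\<omega>. liminf (\<lambda>n. ?f n \<omega>) \<partial>M)"
      using lim_imp_Liminf[OF sequentially_bot lim] by (intro nn_integral_cong) simp
    also have "\<dots> \<le> liminf (\<lambda>n. \<integral>\<^sup>+\<omega>. ?f n \<omega> \<partial>M)" by (rule nn_integral_liminf) measurable
    also have "\<dots> \<le> liminf (\<lambda>n. ennreal (A * exp (\<beta> * t - \<bar>x\<bar>)))"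
      by (intro Liminf_mono always_eventually allI) (use b[OF _ t, unfolded mom_pos[OF t]] in simp)
    also have "\<dots> = ennreal (A * exp (\<beta> * t - \<bar>x\<bar>))" by (simp add: Liminf_const)
    finally show ?thesis .
  qed
  with A show thesis by (rule that)
qed

lemma abs_powr_le:
  assumes "2 \<le> \<nu>" "\<nu> \<le> real (2*m+2)"
  shows "\<bar>v::real\<bar> powr \<nu> \<le> v\<^sup>2 + v ^ (2*m+2)"
proof (cases "v = 0")
  case False
  have N: "\<bar>v\<bar> powr real (2*m+2) = v ^ (2*m+2)" using False by (subst powr_realpow) (simp_all add: power_even_abs)
  have T: "\<bar>v\<bar> powr 2 = v\<^sup>2" using False by simp
  have nn: "0 \<le> v ^ (2*m+2)" using zero_le_even_power'[of v "m+1"] by simp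
  show ?thesis
  proof (cases "\<bar>v\<bar> \<le> 1")
    case True
    then have "\<bar>v\<bar> powr \<nu> \<le> \<bar>v\<bar> powr 2" using assms by (intro powr_mono') auto
    then show ?thesis using T nn by simp
  next
    case False
    then have "\<bar>v\<bar> powr \<nu> \<le> \<bar>v\<bar> powr real (2*m+2)" using assms by (intro powr_mono) auto
    then show ?thesis unfolding N using zero_le_power2[of v] by linarith
  qed
qed simp

text \<open>The power \<nu> lies between 2 and an even integer, whose two moments both decay with
  spatial rate 1.\<close>

lemma moment_bound:
  assumes "\<nu> \<ge> 2"
  obtains A \<beta> where "A \<ge> 0" "\<And>t x. 0 < t \<Longrightarrow> (\<integral>\<^sup>+\<omega>. ennreal (\<bar>u t x \<omega>\<bar> powr \<nu>) \<partial>M) \<le> ennreal (A * exp (\<beta> * t - \<bar>x\<bar>))"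
proof -
  \<comment> \<open>The successor ensures \<open>m > 0\<close>, as required of the higher moment
    estimate, besides \<open>2 * m + 2\<close> being at least \<nu>.\<close>
  define m where "m = Suc (nat \<lceil>\<nu>\<rceil>)"
  have m: "m > 0" "\<nu> \<le> real (2*m+2)" unfolding m_def using real_nat_ceiling_ge[of \<nu>] by simp_all
  obtain A \<beta> where A: "A \<ge> 0" and b: "\<And>t x. 0 < t \<Longrightarrow> (\<integral>\<^sup>+\<omega>. ennreal (u t x \<omega> ^ (2*m+2)) \<partial>M) \<le> ennreal (A * exp (\<beta> * t - \<bar>x\<bar>))"
    using even_moment_bound[OF m(1)] by blast
  \<comment> \<open>With this rate the square root in \<open>second_moment_bound\<close> equals
    \<open>Lip\<^sup>2 + 1\<close>, more than enough for its condition.\<close>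
  define \<beta>2 where "\<beta>2 = \<kappa> * 1\<^sup>2 / 4 + (Lip\<^sup>2 + 1)\<^sup>2 / \<kappa>"
  have "sqrt (\<kappa> * (\<beta>2 - \<kappa> * 1\<^sup>2 / 4)) = Lip\<^sup>2 + 1" "\<beta>2 > \<kappa> * 1\<^sup>2 / 4" 
    unfolding \<beta>2_def using \<kappa> by (simp_all add: add_nonneg_pos zero_less_power2[THEN iffD2] add_nonneg_eq_0_iff)
  then obtain A2 where A2: "A2 \<ge> 0" and b2: "\<And>t x. 0 < t \<Longrightarrow> V t x \<le> ennreal (A2 * exp (\<beta>2 * t - 1 * \<bar>x\<bar>))"
    using second_moment_bound[of 1 \<beta>2] by (smt (verit) zero_le_power2)
  have "(\<integral>\<^sup>+\<omega>. ennreal (\<bar>u t x \<omega>\<bar> powr \<nu>) \<partial>M) \<le> ennreal ((A + A2) * exp (max \<beta> \<beta>2 * t - \<bar>x\<bar>))" if t: "0 < t" for t x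
  proof -
    note [measurable] = u_measurable[OF t]
    have "(\<integral>\<^sup>+\<omega>. ennreal (\<bar>u t x \<omega>\<bar> powr \<nu>) \<partial>M) \<le> (\<integral>\<^sup>+\<omega>. ennreal ((u t x \<omega>)\<^sup>2) + ennreal (u t x \<omega> ^ (2*m+2)) \<partial>M)"
    proof (rule nn_integral_mono)
      fix \<omega>
      have nn: "0 \<le> u t x \<omega> ^ (2*m+2)" using zero_le_even_power'[of "u t x \<omega>" "m+1"] by simp
      show "ennreal (\<bar>u t x \<omega>\<bar> powr \<nu>) \<le> ennreal ((u t x \<omega>)\<^sup>2) + ennreal (u t x \<omega> ^ (2*m+2))"
        unfolding ennreal_plus[OF zero_le_power2 nn, symmetric] by (rule ennreal_leI[OF abs_powr_le[OF assms m(2)]])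
    qed
    also have "\<dots> = V t x + (\<integral>\<^sup>+\<omega>. ennreal (u t x \<omega> ^ (2*m+2)) \<partial>M)"
      unfolding mom_pos[OF t] by (rule nn_integral_add) measurable
    also have "\<dots> \<le> ennreal (A2 * exp (\<beta>2 * t - 1 * \<bar>x\<bar>)) + ennreal (A * exp (\<beta> * t - \<bar>x\<bar>))"
      by (intro add_mono b b2 t)
    also have "\<dots> = ennreal (A2 * exp (\<beta>2 * t - 1 * \<bar>x\<bar>) + A * exp (\<beta> * t - \<bar>x\<bar>))"
      using A A2 by (intro ennreal_plus[symmetric]) simp_all
    also have "\<dots> \<le> ennreal ((A + A2) * exp (max \<beta> \<beta>2 * t - \<bar>x\<bar>))"
    proof (rule ennreal_leI)
      have "A2 * exp (\<beta>2 * t - 1 * \<bar>x\<bar>) \<le> A2 * exp (max \<beta> \<beta>2 * t - \<bar>x\<bar>)" "A * exp (\<beta> * t - \<bar>x\<bar>) \<le> A * exp (max \<beta> \<beta>2 * t - \<bar>x\<bar>)"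
        using A A2 t by (auto intro!: mult_left_mono mult_right_mono)
      then show "A2 * exp (\<beta>2 * t - 1 * \<bar>x\<bar>) + A * exp (\<beta> * t - \<bar>x\<bar>) \<le> (A + A2) * exp (max \<beta> \<beta>2 * t - \<bar>x\<bar>)"
        unfolding distrib_right by linarith
    qed
    finally show ?thesis .
  qed
  moreover have "A + A2 \<ge> 0" using A A2 by simp
  ultimately show thesis using that by blast
qed

end

section \<open>Growth indices\<close>

text \<open>A larger speed means a smaller region for the supremum. This places every speed with
  positive rate below every speed with negative rate and so orders the two indices.\<close>

lemma growth_rate_antimono:
  assumes "\<alpha> \<le> \<alpha>'"
  shows "growth_rate M u \<nu> \<alpha>' \<le> growth_rate M u \<nu> \<alpha>"
  unfolding growth_rate_def
proof (rule Limsup_mono)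
  show "\<forall>\<^sub>F t in at_top. ereal (1 / t) * (SUP x\<in>{x. \<alpha>' * t \<le> \<bar>x\<bar>}. ereal (ln (moment M u \<nu> t x)))
      \<le> ereal (1 / t) * (SUP x\<in>{x. \<alpha> * t \<le> \<bar>x\<bar>}. ereal (ln (moment M u \<nu> t x)))"
    using eventually_gt_at_top[of 0]
  proof eventually_elim
    case (elim t)
    have "\<alpha> * t \<le> \<alpha>' * t" using assms elim by simp
    then have "{x. \<alpha>' * t \<le> \<bar>x\<bar>} \<subseteq> {x. \<alpha> * t \<le> \<bar>x\<bar>}" by auto
    then show ?case using elim by (intro ereal_mult_left_mono SUP_subset_mono) auto
  qed
qed

lemma lower_index_le_upper_index: "lower_index M u \<nu> \<le> upper_index M u \<nu>"
  unfolding lower_index_def upper_index_def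
proof (intro Sup_least Inf_greatest)
  fix a b assume "a \<in> insert 0 {ereal \<alpha> |\<alpha>. 0 < \<alpha> \<and> 0 < growth_rate M u \<nu> \<alpha>}" 
    and "b \<in> {ereal \<alpha> |\<alpha>. 0 < \<alpha> \<and> growth_rate M u \<nu> \<alpha> < 0}"
  then obtain \<beta> where b: "b = ereal \<beta>" "0 < \<beta>" "growth_rate M u \<nu> \<beta> < 0" 
    and a: "a = 0 \<or> (\<exists>\<alpha>. a = ereal \<alpha> \<and> 0 < growth_rate M u \<nu> \<alpha>)" by blast
  from a show "a \<le> b"
  proof
    assume "a = 0" then show ?thesis using b by simp
  next
    assume "\<exists>\<alpha>. a = ereal \<alpha> \<and> 0 < growth_rate M u \<nu> \<alpha>"
    then obtain \<alpha> where \<alpha>: "a = ereal \<alpha>" "0 < growth_rate M u \<nu> \<alpha>" by blast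
    have "\<not> \<beta> \<le> \<alpha>"
    proof
      assume "\<beta> \<le> \<alpha>"
      then have "growth_rate M u \<nu> \<alpha> \<le> growth_rate M u \<nu> \<beta>" by (rule growth_rate_antimono)
      then have "growth_rate M u \<nu> \<alpha> < 0" using b(3) by (rule le_less_trans)
      then show False using \<alpha>(2) by (rule less_asym)
    qed
    then show ?thesis using \<alpha> b by simp
  qed
qed

lemma growth_quotient_le:
  assumes "t > 0" "\<And>x. \<alpha> * t \<le> \<bar>x\<bar> \<Longrightarrow> ln (moment M u \<nu> t x) \<le> C * t"
  shows "ereal (1 / t) * (SUP x\<in>{x. \<alpha> * t \<le> \<bar>x\<bar>}. ereal (ln (moment M u \<nu> t x))) \<le> ereal C"
proof -
  have "ereal (1 / t) * (SUP x\<in>{x. \<alpha> * t \<le> \<bar>x\<bar>}. ereal (ln (moment M u \<nu> t x))) \<le> ereal (1 / t) * ereal (C * t)"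
    using assms by (intro ereal_mult_left_mono SUP_least) auto
  then show ?thesis using assms(1) by simp
qed

lemma growth_quotient_lessD:
  assumes "t > 0" "ereal (1 / t) * (SUP x\<in>{x. \<alpha> * t \<le> \<bar>x\<bar>}. ereal (ln (moment M u \<nu> t x))) < ereal C" "\<alpha> * t \<le> \<bar>x\<bar>"
  shows "ln (moment M u \<nu> t x) < C * t"
proof -
  have "ereal (ln (moment M u \<nu> t x)) \<le> (SUP x\<in>{x. \<alpha> * t \<le> \<bar>x\<bar>}. ereal (ln (moment M u \<nu> t x)))"
    by (rule SUP_upper) (use assms(3) in simp)
  then have "ereal (1 / t) * ereal (ln (moment M u \<nu> t x)) \<le> ereal (1 / t) * (SUP x\<in>{x. \<alpha> * t \<le> \<bar>x\<bar>}. ereal (ln (moment M u \<nu> t x)))"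
    using assms(1) by (intro ereal_mult_left_mono) auto
  also have "\<dots> < ereal C" by (rule assms(2))
  finally show ?thesis using assms(1) by (simp add: field_simps)
qed

lemma growth_rate_le_eventually:
  assumes "\<forall>\<^sub>F t in at_top. \<forall>x. \<alpha> * t \<le> \<bar>x\<bar> \<longrightarrow> ln (moment M u \<nu> t x) \<le> C * t"
  shows "growth_rate M u \<nu> \<alpha> \<le> ereal C"
  unfolding growth_rate_def
proof (rule Limsup_bounded)
  show "\<forall>\<^sub>F t in at_top. ereal (1 / t) * (SUP x\<in>{x. \<alpha> * t \<le> \<bar>x\<bar>}. ereal (ln (moment M u \<nu> t x))) \<le> ereal C"
    using assms eventually_gt_at_top[of 0] by eventually_elim (auto intro!: growth_quotient_le)
qed

lemma growth_rate_less_eventually: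
  assumes "growth_rate M u \<nu> \<alpha> < ereal C"
  shows "\<forall>\<^sub>F t in at_top. \<forall>x. \<alpha> * t \<le> \<bar>x\<bar> \<longrightarrow> ln (moment M u \<nu> t x) < C * t"
  using Limsup_lessD[OF assms[unfolded growth_rate_def]] eventually_gt_at_top[of 0]
  by eventually_elim (blast intro: growth_quotient_lessD)

text \<open>On the region beyond speed \<alpha> the exponent is at most
  \<open>(\<beta> - c * \<alpha>) * t\<close>, which is negative.\<close>

lemma growth_rate_neg:
  assumes "\<And>t x. 0 < t \<Longrightarrow> 0 < moment M u \<nu> t x" 
    and le: "\<And>t x. 0 < t \<Longrightarrow> moment M u \<nu> t x \<le> A * exp (\<beta> * t - c * \<bar>x\<bar>)"
    and "c \<ge> 0" "\<beta> < c * \<alpha>"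
  shows "growth_rate M u \<nu> \<alpha> < 0"
proof -
  have "0 < A * exp (\<beta> * 1 - c * \<bar>0\<bar>)" using assms(1)[of 1 0] le[of 1 0] by linarith
  then have A: "A > 0" by (simp add: zero_less_mult_iff)
  \<comment> \<open>Half of the gap: one half absorbs \<open>ln A\<close> for large times, the other
    remains as the decay rate.\<close>
  define \<eta> where "\<eta> = (c * \<alpha> - \<beta>) / 2"
  have \<eta>: "\<eta> > 0" using assms by (simp add: \<eta>_def)
  have "\<forall>\<^sub>F t in at_top. \<forall>x. \<alpha> * t \<le> \<bar>x\<bar> \<longrightarrow> ln (moment M u \<nu> t x) \<le> (- \<eta>) * t"
    using eventually_gt_at_top[of 0] eventually_ge_at_top[of "ln A / \<eta>"]
  proof eventually_elim
    case (elim t)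
    show ?case
    proof (intro allI impI)
      fix x assume x: "\<alpha> * t \<le> \<bar>x\<bar>"
      have "ln (moment M u \<nu> t x) \<le> ln (A * exp (\<beta> * t - c * \<bar>x\<bar>))"
        using assms(1) le elim A by (intro ln_mono) auto
      also have "\<dots> = ln A + (\<beta> * t - c * \<bar>x\<bar>)" using A by (simp add: ln_mult)
      also have "\<dots> \<le> \<eta> * t + (\<beta> * t - c * (\<alpha> * t))"
      proof -
        have "ln A \<le> \<eta> * t" using elim(2) \<eta> by (simp add: field_simps)
        moreover have "c * (\<alpha> * t) \<le> c * \<bar>x\<bar>" using x assms(3) by (rule mult_left_mono)
        ultimately show ?thesis by simp
      qed
      also have "\<dots> = (- \<eta>) * t" by (simp add: \<eta>_def field_simps)
      finally show "ln (moment M u \<nu> t x) \<le> (- \<eta>) * t" .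
    qed
  qed
  then have "growth_rate M u \<nu> \<alpha> \<le> ereal (- \<eta>)" by (rule growth_rate_le_eventually)
  also have "\<dots> < 0" using \<eta> by simp
  finally show ?thesis .
qed

section \<open>Upper bounds and comparison of moment orders\<close>

context mild begin

text \<open>\<open>moment\<close> is a real number obtained from an extended one and then passed to
  the logarithm; both conversions are faithful only after finiteness and positivity are
  known.\<close>

lemma moment_positive_finite:
  assumes \<nu>: "\<nu> \<ge> 2" and t: "0 < t"
  shows "ennreal (moment M u \<nu> t x) = (\<integral>\<^sup>+\<omega>. ennreal (\<bar>u t x \<omega>\<bar> powr \<nu>) \<partial>M)" "0 < moment M u \<nu> t x"
proof -
  note [measurable] = u_measurable[OF t]
  obtain A \<beta> where "A \<ge> 0" and "\<And>t x. 0 < t \<Longrightarrow> (\<integral>\<^sup>+\<omega>. ennreal (\<bar>u t x \<omega>\<bar> powr \<nu>) \<partial>M) \<le> ennreal (A * exp (\<beta> * t - \<bar>x\<bar>))"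
    using moment_bound[OF \<nu>] by blast
  from this(2)[OF t, of x] have fin: "(\<integral>\<^sup>+\<omega>. ennreal (\<bar>u t x \<omega>\<bar> powr \<nu>) \<partial>M) < top"
    by (rule le_less_trans) simp
  then show eq: "ennreal (moment M u \<nu> t x) = (\<integral>\<^sup>+\<omega>. ennreal (\<bar>u t x \<omega>\<bar> powr \<nu>) \<partial>M)"
    unfolding moment_def by simp
  have "(\<integral>\<^sup>+\<omega>. ennreal (\<bar>u t x \<omega>\<bar> powr \<nu>) \<partial>M) \<noteq> 0"
  proof
    assume "(\<integral>\<^sup>+\<omega>. ennreal (\<bar>u t x \<omega>\<bar> powr \<nu>) \<partial>M) = 0"
    then have "AE \<omega> in M. ennreal (\<bar>u t x \<omega>\<bar> powr \<nu>) = 0" by (subst (asm) nn_integral_0_iff_AE) simp_all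
    then have "AE \<omega> in M. ennreal ((u t x \<omega>)\<^sup>2) = 0" by eventually_elim (simp add: ennreal_eq_0_iff powr_def split: if_splits)
    then have "V t x = 0" unfolding mom_pos[OF t] by (subst nn_integral_0_iff_AE) simp_all
    then show False using V_pos[OF t, of x] by simp
  qed
  then show "0 < moment M u \<nu> t x" unfolding eq[symmetric] by (simp add: ennreal_eq_0_iff not_le)
qed

lemma moment_2:
  assumes "0 < t" shows "ennreal (moment M u 2 t x) = V t x"
proof -
  have "\<bar>v\<bar> powr 2 = v\<^sup>2" for v :: real by (cases "v = 0") simp_all
  then show ?thesis unfolding moment_positive_finite(1)[OF order_refl assms] mom_pos[OF assms] by simp
qed

lemma upper_index_finite:
  assumes \<nu>: "\<nu> \<ge> 2" shows "upper_index M u \<nu> < \<infinity>"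
proof -
  obtain A \<beta> where A: "A \<ge> 0" and b: "\<And>t x. 0 < t \<Longrightarrow> (\<integral>\<^sup>+\<omega>. ennreal (\<bar>u t x \<omega>\<bar> powr \<nu>) \<partial>M) \<le> ennreal (A * exp (\<beta> * t - \<bar>x\<bar>))"
    using moment_bound[OF \<nu>] by blast
  have "growth_rate M u \<nu> (\<bar>\<beta>\<bar> + 1) < 0"
  proof (rule growth_rate_neg[where A = A and c = 1 and \<beta> = \<beta>])
    fix t x :: real assume t: "0 < t"
    show "0 < moment M u \<nu> t x" by (rule moment_positive_finite(2)[OF \<nu> t])
    have "ennreal (moment M u \<nu> t x) \<le> ennreal (A * exp (\<beta> * t - \<bar>x\<bar>))"
      unfolding moment_positive_finite(1)[OF \<nu> t] by (rule b[OF t])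
    then show "moment M u \<nu> t x \<le> A * exp (\<beta> * t - 1 * \<bar>x\<bar>)" using A by (simp add: ennreal_le_iff)
  qed auto
  then have "upper_index M u \<nu> \<le> ereal (\<bar>\<beta>\<bar> + 1)" unfolding upper_index_def by (intro Inf_lower) auto
  also have "\<dots> < \<infinity>" by simp
  finally show ?thesis .
qed

lemma Lip_pos: "Lip > 0"
proof -
  have "L * \<bar>1\<bar> \<le> Lip * \<bar>1\<bar>" using L(2)[of 1] Lip(2)[of 1] by linarith
  then show ?thesis using L(1) by simp
qed

text \<open>For decay rate \<open>c\<close> the admissible \<beta> start just above
  \<open>\<kappa> * c\<^sup>2 / 4 + Lip ^ 4 / (4 * \<kappa>)\<close>. Every speed above
  \<open>Lip\<^sup>2 / 2\<close> is reached by taking the optimal \<open>c\<close> and a small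
  surplus.\<close>

lemma upper_index_2: "upper_index M u 2 \<le> ereal (Lip\<^sup>2 / 2)"
proof (rule ccontr)
  assume "\<not> ?thesis"
  then have "ereal (Lip\<^sup>2 / 2) < upper_index M u 2" by (simp only: not_le)
  then obtain \<alpha> where \<alpha>: "ereal (Lip\<^sup>2 / 2) < ereal \<alpha>" "ereal \<alpha> < upper_index M u 2"
    using ereal_dense2 by blast
  \<comment> \<open>The minimiser of \<open>\<kappa> * c / 4 + Lip ^ 4 / (4 * \<kappa> * c)\<close>,
    where the two terms coincide and each equals \<open>Lip\<^sup>2 / 4\<close>.\<close>
  define c where "c = Lip\<^sup>2 / \<kappa>"
  \<comment> \<open>Half of the room between the critical speed and \<alpha>: the surplus makes the
    renewal constant strictly less than 1 and still leaves \<beta> below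
    \<open>c * \<alpha>\<close>.\<close>
  define \<eta> where "\<eta> = c * (\<alpha> - Lip\<^sup>2 / 2) / 2"
  define \<beta> where "\<beta> = \<kappa> * c\<^sup>2 / 4 + (Lip\<^sup>2)\<^sup>2 / (4 * \<kappa>) + \<eta>"
  have c: "c > 0" unfolding c_def using Lip_pos \<kappa> by simp
  have \<eta>: "\<eta> > 0" unfolding \<eta>_def using c \<alpha>(1) by simp
  have \<beta>: "\<beta> > \<kappa> * c\<^sup>2 / 4" unfolding \<beta>_def using \<eta> \<kappa> by (simp add: add_nonneg_pos)
  have "(Lip\<^sup>2 / 2)\<^sup>2 < \<kappa> * (\<beta> - \<kappa> * c\<^sup>2 / 4)"
    unfolding \<beta>_def using \<eta> \<kappa> by (simp add: field_simps power2_eq_square)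
  then have "Lip\<^sup>2 / 2 < sqrt (\<kappa> * (\<beta> - \<kappa> * c\<^sup>2 / 4))" by (rule real_less_rsqrt)
  then have th: "Lip\<^sup>2 < 2 * sqrt (\<kappa> * (\<beta> - \<kappa> * c\<^sup>2 / 4))" by simp
  have "\<beta> = c * (Lip\<^sup>2 / 2) + \<eta>"
    unfolding \<beta>_def c_def using \<kappa> by (simp add: field_simps power2_eq_square)
  also have "\<dots> < c * \<alpha>" using \<eta> unfolding \<eta>_def by (simp add: field_simps)
  finally have \<beta>c: "\<beta> < c * \<alpha>" .
  obtain A where A: "A \<ge> 0" and b: "\<And>t x. 0 < t \<Longrightarrow> V t x \<le> ennreal (A * exp (\<beta> * t - c * \<bar>x\<bar>))"
    using second_moment_bound[OF \<beta> th] by blast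
  have "growth_rate M u 2 \<alpha> < 0"
  proof (rule growth_rate_neg[OF _ _ less_imp_le[OF c] \<beta>c])
    fix t x :: real assume t: "0 < t"
    show "0 < moment M u 2 t x" by (rule moment_positive_finite(2)[OF _ t]) simp
    have "ennreal (moment M u 2 t x) \<le> ennreal (A * exp (\<beta> * t - c * \<bar>x\<bar>))"
      unfolding moment_2[OF t] by (rule b[OF t])
    then show "moment M u 2 t x \<le> A * exp (\<beta> * t - c * \<bar>x\<bar>)" using A by (simp add: ennreal_le_iff)
  qed
  moreover have "\<alpha> > 0" using \<alpha>(1) zero_le_power2[of Lip] by (simp only: less_ereal.simps)
  ultimately have "upper_index M u 2 \<le> ereal \<alpha>" unfolding upper_index_def by (intro Inf_lower) auto
  then show False using \<alpha>(2) by simp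
qed

text \<open>On a probability space the second moment is at most 1 plus the moment of order \<nu>. If
  the latter had no positive growth rate, the added 1 could not create one for the former.\<close>

lemma growth_rate_pos_mono:
  assumes \<nu>: "\<nu> \<ge> 2" and pos: "growth_rate M u 2 \<alpha> > 0"
  shows "growth_rate M u \<nu> \<alpha> > 0"
proof (rule ccontr)
  assume "\<not> ?thesis"
  then have le: "growth_rate M u \<nu> \<alpha> \<le> 0" by simp
  obtain e where e: "0 < ereal e" "ereal e < growth_rate M u 2 \<alpha>" using ereal_dense2[OF pos] by blast
  then have e0: "e > 0" by simp
  have "growth_rate M u \<nu> \<alpha> < ereal (e / 2)" by (rule le_less_trans[OF le]) (use e0 in simp)
  from growth_rate_less_eventually[OF this]
  have "\<forall>\<^sub>F t in at_top. \<forall>x. \<alpha> * t \<le> \<bar>x\<bar> \<longrightarrow> ln (moment M u 2 t x) \<le> e * t"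
    \<comment> \<open>From this time on \<open>exp (e / 2 * t)\<close> is at least 2, and
      \<open>1 + y\<close> is at most \<open>y * y\<close> for such values \<open>y\<close>.\<close>
    using eventually_gt_at_top[of 0] eventually_ge_at_top[of "2 * ln 2 / e"]
  proof eventually_elim
    case (elim t)
    show ?case
    proof (intro allI impI)
      fix x assume x: "\<alpha> * t \<le> \<bar>x\<bar>"
      note t = elim(2)
      note [measurable] = u_measurable[OF t]
      have m2: "0 < moment M u 2 t x" by (rule moment_positive_finite(2)[OF order_refl t])
      have mn: "0 < moment M u \<nu> t x" by (rule moment_positive_finite(2)[OF \<nu> t])
      have "ennreal (moment M u 2 t x) \<le> (\<integral>\<^sup>+\<omega>. 1 + ennreal (\<bar>u t x \<omega>\<bar> powr \<nu>) \<partial>M)"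
        unfolding moment_2[OF t] mom_pos[OF t]
      proof (rule nn_integral_mono)
        fix \<omega>
        have "(u t x \<omega>)\<^sup>2 \<le> 1 + \<bar>u t x \<omega>\<bar> powr \<nu>"
        proof (cases "\<bar>u t x \<omega>\<bar> \<le> 1")
          case True
          then have "(u t x \<omega>)\<^sup>2 \<le> 1" by (simp add: abs_square_le_1)
          then show ?thesis using powr_ge_zero[of "\<bar>u t x \<omega>\<bar>" \<nu>] by linarith
        next
          case False
          then have "\<bar>u t x \<omega>\<bar> powr 2 \<le> \<bar>u t x \<omega>\<bar> powr \<nu>" using \<nu> by (intro powr_mono) auto
          moreover have "\<bar>u t x \<omega>\<bar> powr 2 = (u t x \<omega>)\<^sup>2" using False by (auto)
          ultimately show ?thesis by linarith
        qed
        then have "ennreal ((u t x \<omega>)\<^sup>2) \<le> ennreal (1 + \<bar>u t x \<omega>\<bar> powr \<nu>)" by (rule ennreal_leI)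
        then show "ennreal ((u t x \<omega>)\<^sup>2) \<le> 1 + ennreal (\<bar>u t x \<omega>\<bar> powr \<nu>)" by simp
      qed
      also have "\<dots> = 1 + ennreal (moment M u \<nu> t x)"
        unfolding moment_positive_finite(1)[OF \<nu> t] by (subst nn_integral_add) (simp_all add: emeasure_space_1)
      also have "\<dots> = ennreal (1 + moment M u \<nu> t x)" using mn by simp
      finally have le1: "moment M u 2 t x \<le> 1 + moment M u \<nu> t x" using mn by (subst (asm) ennreal_le_iff) simp_all
      have "ln (moment M u \<nu> t x) < e / 2 * t" using elim(1) x by blast
      then have "moment M u \<nu> t x \<le> exp (e / 2 * t)" using mn by (metis exp_le_cancel_iff exp_ln less_imp_le)
      moreover have "2 \<le> exp (e / 2 * t)"
      proof -
        have "ln 2 \<le> e / 2 * t" using elim(3) e0 by (simp add: field_simps)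
        then have "exp (ln 2) \<le> exp (e / 2 * t)" by (subst exp_le_cancel_iff)
        then show ?thesis by simp
      qed
      moreover have "1 + exp (e / 2 * t) \<le> exp (e / 2 * t) * exp (e / 2 * t)" if "2 \<le> exp (e / 2 * t)"
        using mult_right_mono[OF that, of "exp (e / 2 * t)"] that by linarith
      ultimately have "moment M u 2 t x \<le> exp (e / 2 * t) * exp (e / 2 * t)" using le1 by linarith
      also have "\<dots> = exp (e * t)" unfolding exp_add[symmetric] by (simp add: field_simps)
      finally have "ln (moment M u 2 t x) \<le> ln (exp (e * t))" using m2 by (intro ln_mono) auto
      then show "ln (moment M u 2 t x) \<le> e * t" by simp
    qed
  qed
  then have "growth_rate M u 2 \<alpha> \<le> ereal e" by (rule growth_rate_le_eventually)
  then show False using e(2) by simp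
qed

section \<open>Lower bound: mass of the second moment in a cone\<close>

lemma heat_semigroup_measurable: "(\<lambda>w. Pu (fst w) (snd w)) \<in> borel_measurable (lborel \<Otimes>\<^sub>M lborel)"
  unfolding heat_semigroup_def heat_kernel_def by measurable

lemma nn_integral_product:
  fixes a b :: "real \<Rightarrow> ennreal"
  assumes [measurable]: "a \<in> borel_measurable borel" "b \<in> borel_measurable borel"
  shows "(\<integral>\<^sup>+w. a (fst w) * b (snd w) \<partial>(lborel \<Otimes>\<^sub>M lborel)) = (\<integral>\<^sup>+t. a t \<partial>lborel) * (\<integral>\<^sup>+x. b x \<partial>lborel)"
  by (subst lborel.nn_integral_fst[symmetric]) (simp_all add: nn_integral_cmult nn_integral_multc)

text \<open>The Laplace transform of the mass of \<open>V\<close> beyond the line \<open>x = \<alpha> t\<close> satisfies a renewal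
  inequality which, for \<open>\<alpha> < L\<^sup>2 / (2 \<pi>)\<close>, has no finite solution for small positive rates.\<close>
lemma cone_laplace_infinite:
  assumes \<alpha>: "0 < \<alpha>" and \<beta>: "\<beta> \<ge> 0" and crit: "2 * pi * \<alpha> * (1 + \<beta> * \<kappa> / \<alpha>\<^sup>2) \<le> L\<^sup>2"
  shows "(\<integral>\<^sup>+w. ennreal (exp (- \<beta> * fst w)) * indicator {\<alpha> * fst w..} (snd w) * V (fst w) (snd w) \<partial>(lborel \<Otimes>\<^sub>M lborel)) = \<infinity>"
proof (rule ccontr)
  let ?P = "lborel \<Otimes>\<^sub>M lborel :: (real \<times> real) measure"
  interpret P: pair_sigma_finite ?P ?P
    by (intro pair_sigma_finite.intro sigma_finite_pair_measure sigma_finite_lborel)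
  define g where "g w = ennreal (exp (- \<beta> * fst w)) * indicator {\<alpha> * fst w..} (snd w)" for w :: "real \<times> real"
  have [measurable]: "g \<in> borel_measurable ?P"
  proof -
    have "g = (\<lambda>w. ennreal (exp (- \<beta> * fst w)) * (if \<alpha> * fst w \<le> snd w then 1 else 0))"
      by (auto simp: g_def indicator_def fun_eq_iff)
    also have "\<dots> \<in> borel_measurable ?P" by measurable
    finally show ?thesis .
  qed
  note [measurable] = V_measurable heat_sq_op_measurable[OF V_measurable] heat_semigroup_measurable
  define J where "J = (\<integral>\<^sup>+w. g w * V (fst w) (snd w) \<partial>?P)"
  \<comment> \<open>The contribution of the initial datum. If the integral \<open>J\<close> were
    finite, the renewal inequality would leave no room for it, although it is strictly
    positive.\<close>
  define a where "a w = g w * (indicator {0<..} (fst w) * ennreal ((Pu (fst w) (snd w))\<^sup>2))" for w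
  have [measurable]: "a \<in> borel_measurable ?P" unfolding a_def[abs_def] by measurable
  assume "(\<integral>\<^sup>+w. ennreal (exp (- \<beta> * fst w)) * indicator {\<alpha> * fst w..} (snd w) * V (fst w) (snd w) \<partial>?P) \<noteq> \<infinity>"
  then have J: "J \<noteq> \<infinity>" unfolding J_def g_def .
  let ?T = "\<integral>\<^sup>+r. (\<integral>\<^sup>+z. ennreal (heat_sq \<kappa> r z * exp (- \<beta> * r)) * indicator {\<alpha> * r..} z \<partial>lborel) \<partial>lborel"
  have T: "1 \<le> ennreal (L\<^sup>2) * ?T"
  proof -
    let ?d = "2 * pi * \<alpha> * (1 + \<beta> * \<kappa> / \<alpha>\<^sup>2)"
    have d: "?d > 0" using \<alpha> \<beta> \<kappa> by (intro mult_pos_pos add_pos_nonneg) simp_all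
    have "1 \<le> L\<^sup>2 * (1 / ?d)" using crit d by (simp add: field_simps)
    then have "ennreal 1 \<le> ennreal (L\<^sup>2 * (1 / ?d))" by (rule ennreal_leI)
    also have "\<dots> = ennreal (L\<^sup>2) * ennreal (1 / ?d)" using d by (intro ennreal_mult) (auto simp: less_imp_le)
    also have "\<dots> \<le> ennreal (L\<^sup>2) * ?T" by (intro mult_left_mono heat_sq_cone_ge \<kappa> \<alpha> \<beta>) simp
    finally show ?thesis by simp
  qed
  \<comment> \<open>The cone is closed under addition: a starting point in it plus a displacement in
    it stays in it. Dropping all other displacements factors the exponential and leaves the constant
    \<open>?T\<close>.\<close>
  have inner: "?T * g v \<le> (\<integral>\<^sup>+w. g w * ennreal (heat_sq \<kappa> (fst w - fst v) (snd v - snd w)) \<partial>?P)" for v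
  proof -
    obtain s y where v: "v = (s, y)" by (cases v)
    show ?thesis
    proof (cases "\<alpha> * s \<le> y")
      case False then show ?thesis unfolding v g_def by simp
    next
      case True
      have "?T * g v = (\<integral>\<^sup>+r. (\<integral>\<^sup>+z. ennreal (exp (- \<beta> * s)) * (ennreal (heat_sq \<kappa> r z * exp (- \<beta> * r)) * indicator {\<alpha> * r..} z) \<partial>lborel) \<partial>lborel)"
      proof -
        have m[measurable]: "(\<lambda>w. ennreal (heat_sq \<kappa> (fst w) (snd w) * exp (- \<beta> * fst w)) * indicator {\<alpha> * fst w..} (snd w)) \<in> borel_measurable ?P"
        proof -
          have "(\<lambda>w. ennreal (heat_sq \<kappa> (fst w) (snd w) * exp (- \<beta> * fst w)) * indicator {\<alpha> * fst w..} (snd w) :: ennreal) = 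
            (\<lambda>w. ennreal (heat_sq \<kappa> (fst w) (snd w) * exp (- \<beta> * fst w)) * (if \<alpha> * fst w \<le> snd w then 1 else 0))"
            by (auto simp: indicator_def fun_eq_iff)
          also have "\<dots> \<in> borel_measurable ?P" by measurable
          finally show ?thesis .
        qed
        have "(\<integral>\<^sup>+z. ennreal (exp (- \<beta> * s)) * (ennreal (heat_sq \<kappa> r z * exp (- \<beta> * r)) * indicator {\<alpha> * r..} z) \<partial>lborel)
          = ennreal (exp (- \<beta> * s)) * (\<integral>\<^sup>+z. ennreal (heat_sq \<kappa> r z * exp (- \<beta> * r)) * indicator {\<alpha> * r..} z \<partial>lborel)" for r
          by (rule nn_integral_cmult) measurable
        moreover have "(\<integral>\<^sup>+r. ennreal (exp (- \<beta> * s)) * (\<integral>\<^sup>+z. ennreal (heat_sq \<kappa> r z * exp (- \<beta> * r)) * indicator {\<alpha> * r..} z \<partial>lborel) \<partial>lborel) = ennreal (exp (- \<beta> * s)) * ?T"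
          using lborel.borel_measurable_nn_integral_fst[OF m] by (intro nn_integral_cmult) simp
        ultimately show ?thesis unfolding v g_def using True by (simp add: mult.commute)
      qed
      also have "\<dots> \<le> (\<integral>\<^sup>+r. (\<integral>\<^sup>+z. g (s + 1 * r, y + 1 * z) * ennreal (heat_sq \<kappa> ((s + 1 * r) - s) (y - (y + 1 * z))) \<partial>lborel) \<partial>lborel)"
      proof (intro nn_integral_mono)
        fix r z
        show "ennreal (exp (- \<beta> * s)) * (ennreal (heat_sq \<kappa> r z * exp (- \<beta> * r)) * indicator {\<alpha> * r..} z) \<le> g (s + 1 * r, y + 1 * z) * ennreal (heat_sq \<kappa> ((s + 1 * r) - s) (y - (y + 1 * z)))"
        proof (cases "\<alpha> * r \<le> z")
          case z: True
          have le: "\<alpha> * (s + r) \<le> y + z" using True z by (simp add: distrib_left)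
          have "exp (- \<beta> * s) * (heat_sq \<kappa> r z * exp (- \<beta> * r)) = exp (- \<beta> * (s + r)) * heat_sq \<kappa> r z"
          proof -
            have "exp (- \<beta> * (s + r)) = exp (- \<beta> * s) * exp (- \<beta> * r)" unfolding exp_add[symmetric] by (simp add: algebra_simps)
            then show ?thesis by simp
          qed
          note E = this
          have eq: "ennreal (exp (- \<beta> * s)) * ennreal (heat_sq \<kappa> r z * exp (- \<beta> * r)) = ennreal (exp (- \<beta> * (s + r))) * ennreal (heat_sq \<kappa> r z)"
            by (simp only: ennreal_mult[symmetric] exp_ge_zero mult_nonneg_nonneg heat_sq_nonneg[OF \<kappa>] E)
          have g: "g (s + 1 * r, y + 1 * z) = ennreal (exp (- \<beta> * (s + r)))" unfolding g_def using le by simp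
          have h: "heat_sq \<kappa> ((s + 1 * r) - s) (y - (y + 1 * z)) = heat_sq \<kappa> r z" using heat_sq_uminus by simp
          have i: "indicator {\<alpha> * r..} z = (1::ennreal)" using z by simp
          show ?thesis unfolding g h i mult_1_right eq by (rule order_refl)
        qed simp
      qed
      also have "\<dots> = (\<integral>\<^sup>+r. (\<integral>\<^sup>+x. g (s + 1 * r, x) * ennreal (heat_sq \<kappa> ((s + 1 * r) - s) (y - x)) \<partial>lborel) \<partial>lborel)"
      proof (rule nn_integral_cong)
        fix r
        show "(\<integral>\<^sup>+z. g (s + 1 * r, y + 1 * z) * ennreal (heat_sq \<kappa> ((s + 1 * r) - s) (y - (y + 1 * z))) \<partial>lborel) = 
          (\<integral>\<^sup>+x. g (s + 1 * r, x) * ennreal (heat_sq \<kappa> ((s + 1 * r) - s) (y - x)) \<partial>lborel)"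
          by (subst nn_integral_real_affine[of "\<lambda>x. g (s + 1 * r, x) * ennreal (heat_sq \<kappa> ((s + 1 * r) - s) (y - x))" 1 y]) simp_all
      qed
      also have "\<dots> = (\<integral>\<^sup>+t. (\<integral>\<^sup>+x. g (t, x) * ennreal (heat_sq \<kappa> (t - s) (y - x)) \<partial>lborel) \<partial>lborel)"
        by (subst nn_integral_real_affine[of "\<lambda>t. \<integral>\<^sup>+x. g (t, x) * ennreal (heat_sq \<kappa> (t - s) (y - x)) \<partial>lborel" 1 s]) simp_all
      also have "\<dots> = (\<integral>\<^sup>+w. g w * ennreal (heat_sq \<kappa> (fst w - fst v) (snd v - snd w)) \<partial>?P)"
        unfolding v by (subst lborel.nn_integral_fst[symmetric]) simp_all
      finally show ?thesis .
    qed
  qed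
  have "?T * J = (\<integral>\<^sup>+v. ?T * (g v * V (fst v) (snd v)) \<partial>?P)"
    unfolding J_def by (rule nn_integral_cmult[symmetric]) measurable
  also have "\<dots> \<le> (\<integral>\<^sup>+v. (\<integral>\<^sup>+w. g w * ennreal (heat_sq \<kappa> (fst w - fst v) (snd v - snd w)) \<partial>?P) * V (fst v) (snd v) \<partial>?P)"
    unfolding mult.assoc[symmetric] by (intro nn_integral_mono mult_right_mono inner) simp
  also have "\<dots> = (\<integral>\<^sup>+v. (\<integral>\<^sup>+w. g w * (ennreal (heat_sq \<kappa> (fst w - fst v) (snd v - snd w)) * V (fst v) (snd v)) \<partial>?P) \<partial>?P)"
    unfolding mult.assoc[symmetric] by (intro nn_integral_cong nn_integral_multc[symmetric]) measurable
  also have "\<dots> = (\<integral>\<^sup>+w. (\<integral>\<^sup>+v. g w * (ennreal (heat_sq \<kappa> (fst w - fst v) (snd v - snd w)) * V (fst v) (snd v)) \<partial>?P) \<partial>?P)"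
    by (rule P.Fubini'[symmetric]) measurable
  also have "\<dots> = (\<integral>\<^sup>+w. g w * heat_sq_op \<kappa> V (fst w) (snd w) \<partial>?P)"
    unfolding heat_sq_op_pair[OF V_measurable] by (intro nn_integral_cong nn_integral_cmult) measurable
  finally have TJ: "?T * J \<le> (\<integral>\<^sup>+w. g w * heat_sq_op \<kappa> V (fst w) (snd w) \<partial>?P)" .
  have "(\<integral>\<^sup>+w. a w \<partial>?P) + J \<le> (\<integral>\<^sup>+w. a w \<partial>?P) + ennreal (L\<^sup>2) * ?T * J"
    using mult_right_mono[OF T, of J] by (intro add_left_mono) simp
  also have "\<dots> \<le> (\<integral>\<^sup>+w. a w \<partial>?P) + ennreal (L\<^sup>2) * (\<integral>\<^sup>+w. g w * heat_sq_op \<kappa> V (fst w) (snd w) \<partial>?P)"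
    unfolding mult.assoc by (intro add_left_mono mult_left_mono TJ) simp
  also have "\<dots> = (\<integral>\<^sup>+w. a w + ennreal (L\<^sup>2) * (g w * heat_sq_op \<kappa> V (fst w) (snd w)) \<partial>?P)"
    by (subst nn_integral_add, measurable, subst nn_integral_cmult, measurable)
  also have "\<dots> \<le> J"
    unfolding J_def
  proof (rule nn_integral_mono)
    fix w :: "real \<times> real"
    show "a w + ennreal (L\<^sup>2) * (g w * heat_sq_op \<kappa> V (fst w) (snd w)) \<le> g w * V (fst w) (snd w)"
    proof (cases "0 < fst w")
      case True
      have "a w + ennreal (L\<^sup>2) * (g w * heat_sq_op \<kappa> V (fst w) (snd w)) = g w * (ennreal ((Pu (fst w) (snd w))\<^sup>2) + ennreal (L\<^sup>2) * heat_sq_op \<kappa> V (fst w) (snd w))"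
        unfolding a_def using True by (simp add: distrib_left mult_ac)
      also have "\<dots> \<le> g w * V (fst w) (snd w)" by (intro mult_left_mono V_lower True) simp
      finally show ?thesis .
    next
      case False
      have "heat_sq_op \<kappa> V (fst w) (snd w) \<le> heat_sq_op \<kappa> (\<lambda>s y. 0) (fst w) (snd w)"
        by (rule heat_sq_op_mono) (use False in \<open>simp add: mom_nonpos\<close>)
      then have "heat_sq_op \<kappa> V (fst w) (snd w) = 0" by (simp add: heat_sq_op_def)
      then show ?thesis unfolding a_def using False by simp
    qed
  qed
  finally have "(\<integral>\<^sup>+w. a w \<partial>?P) + J \<le> 0 + J" by simp
  \<comment> \<open>Cancelling \<open>J\<close> is legitimate because it is assumed finite.\<close>
  then have "(\<integral>\<^sup>+w. a w \<partial>?P) = 0" using J by (metis ennreal_add_left_cancel_le add.commute le_zero_eq infinity_ennreal_def)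
  then have ae: "AE w in ?P. a w = 0" by (subst (asm) nn_integral_0_iff_AE) simp_all
  \<comment> \<open>A box of measure 1 inside the cone at positive times, on which \<open>a\<close>
    is strictly positive.\<close>
  let ?B = "{0<..<1} \<times> {\<alpha><..<\<alpha> + 1} :: (real \<times> real) set"
  have "AE w in ?P. w \<notin> ?B"
    using ae
  proof eventually_elim
    case (elim w)
    show ?case
    proof
      assume "w \<in> ?B"
      then have w: "0 < fst w" "fst w < 1" "\<alpha> < snd w" by auto
      have "\<alpha> * fst w \<le> \<alpha> * 1" using w \<alpha> by (intro mult_left_mono) auto
      then have "\<alpha> * fst w \<le> snd w" using w by linarith
      then have "a w = ennreal (exp (- \<beta> * fst w)) * ennreal ((Pu (fst w) (snd w))\<^sup>2)"
        unfolding a_def g_def using w by simp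
      then show False using elim Pu_bounds(1)[OF w(1), of "snd w"] by (simp add: ennreal_eq_0_iff)
    qed
  qed
  then have "?B \<in> null_sets ?P" using AE_iff_null_sets[of ?B ?P] by simp
  then have "emeasure ?P ?B = 0" by (rule null_setsD1)
  moreover have "emeasure ?P ?B = 1" by (subst lborel.emeasure_pair_measure_Times) simp_all
  ultimately show False by simp
qed

text \<open>If the rate were not positive, the second moment beyond speed \<alpha> would eventually
  be below \<open>exp (b / 2 * t)\<close>. Combined with spatial decay for far points, this would
  make the integral of \<open>cone_laplace_infinite\<close> at rate \<open>b\<close> finite.\<close>

lemma growth_rate_2_pos:
  assumes \<alpha>: "0 < \<alpha>" "\<alpha> < L\<^sup>2 / (2 * pi)"
  shows "growth_rate M u 2 \<alpha> > 0"
proof (rule ccontr)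
  assume "\<not> ?thesis"
  then have le: "growth_rate M u 2 \<alpha> \<le> 0" by simp
  \<comment> \<open>The rate at which the critical inequality of
    \<open>cone_laplace_infinite\<close> holds with equality; it is positive because \<alpha> is
    below \<open>L\<^sup>2 / (2 * pi)\<close>.\<close>
  define b where "b = (L\<^sup>2 / (2 * pi * \<alpha>) - 1) * \<alpha>\<^sup>2 / \<kappa>"
  have "1 < L\<^sup>2 / (2 * pi * \<alpha>)" using \<alpha> by (simp add: field_simps)
  then have b: "b > 0" unfolding b_def using \<alpha> \<kappa> by simp
  have crit: "2 * pi * \<alpha> * (1 + b * \<kappa> / \<alpha>\<^sup>2) \<le> L\<^sup>2"
    unfolding b_def using \<alpha> \<kappa> by simp
  have "growth_rate M u 2 \<alpha> < ereal (b / 2)" by (rule le_less_trans[OF le]) (use b in simp)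
  from growth_rate_less_eventually[OF this] obtain t0 where t0: "\<And>t x. t0 \<le> t \<Longrightarrow> \<alpha> * t \<le> \<bar>x\<bar> \<Longrightarrow> ln (moment M u 2 t x) < b / 2 * t"
    unfolding eventually_at_top_linorder by blast
  define t1 where "t1 = max 1 t0"
  have t1: "t1 > 0" "t0 \<le> t1" by (simp_all add: t1_def)
  have V1: "V t x \<le> ennreal (exp (b / 2 * t))" if "t1 \<le> t" "\<alpha> * t \<le> \<bar>x\<bar>" for t x
  proof -
    have t: "0 < t" using that t1 by simp
    have "ln (moment M u 2 t x) < b / 2 * t" by (rule t0) (use that t1 in simp_all)
    then have "moment M u 2 t x \<le> exp (b / 2 * t)" using moment_positive_finite(2)[OF order_refl t, of x]
      by (metis exp_le_cancel_iff exp_ln less_imp_le)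
    then show ?thesis unfolding moment_2[OF t, symmetric] by (rule ennreal_leI)
  qed
  obtain A \<beta>' where A: "A \<ge> 0" and b': "\<And>t x. 0 < t \<Longrightarrow> (\<integral>\<^sup>+\<omega>. ennreal (\<bar>u t x \<omega>\<bar> powr 2) \<partial>M) \<le> ennreal (A * exp (\<beta>' * t - \<bar>x\<bar>))"
    using moment_bound[OF order_refl] by blast
  define \<beta> where "\<beta> = max \<beta>' 0"
  have \<beta>: "\<beta> \<ge> 0" "\<beta>' \<le> \<beta>" by (simp_all add: \<beta>_def)
  have V2: "V t x \<le> ennreal (A * exp (\<beta> * t - \<bar>x\<bar>))" if t: "0 < t" for t x
  proof -
    have "V t x \<le> ennreal (A * exp (\<beta>' * t - \<bar>x\<bar>))"
      unfolding moment_2[OF t, symmetric] moment_positive_finite(1)[OF order_refl t] by (rule b'[OF t])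
    also have "\<dots> \<le> ennreal (A * exp (\<beta> * t - \<bar>x\<bar>))"
      using A \<beta>(2) t by (intro ennreal_leI mult_left_mono) (simp_all add: mult_right_mono)
    finally show ?thesis .
  qed
  \<comment> \<open>Beyond \<open>\<xi> * t\<close> the bound \<open>exp (\<beta> * t - x)\<close>
    is at most \<open>exp (- x / 2)\<close>, integrable in space uniformly in time.\<close>
  define \<xi> where "\<xi> = 2 * (\<beta> + 1)"
  \<comment> \<open>Up to \<open>\<xi> * t\<close> spatial decay is introduced artificially by a
    factor \<open>exp (\<delta> * (\<xi> * t - x))\<close>, which is at least 1 there. As
    \<open>\<delta> * \<xi> = b / 4\<close>, it costs only a quarter of the available rate, and
    \<open>exp (- b / 4 * t)\<close> is left over.\<close>
  define \<delta> where "\<delta> = b / (4 * \<xi>)"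
  have \<xi>: "\<xi> > 0" and \<delta>: "\<delta> > 0" unfolding \<xi>_def \<delta>_def using \<beta> b by simp_all
  \<comment> \<open>The time factor \<open>exp (\<beta> * t1)\<close> serves the times before
    \<open>t1\<close>, where the growth hypothesis says nothing.\<close>
  define C where "C = A * exp (\<beta> * t1)"
  have C: "C \<ge> 0" unfolding C_def using A by simp
  have pt: "V t x \<le> ennreal (C * exp (- (1/2) * x) + exp (b / 2 * t) * exp (\<delta> * (\<xi> * t - x)))" if t: "0 < t" and x: "\<alpha> * t \<le> x" for t x
  proof -
    have x0: "0 < x" using \<alpha> t x by (meson less_le_trans mult_pos_pos)
    consider "t < t1" | "t1 \<le> t" "x \<le> \<xi> * t" | "\<xi> * t < x" by linarith
    then show ?thesis
    proof cases
      case 1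
      have "\<beta> * t \<le> \<beta> * t1" using 1 \<beta> by (intro mult_left_mono) auto
      then have "exp (\<beta> * t - \<bar>x\<bar>) \<le> exp (\<beta> * t1 + - (1/2) * x)" using x0 by simp
      then have "A * exp (\<beta> * t - \<bar>x\<bar>) \<le> C * exp (- (1/2) * x)"
        unfolding C_def exp_add mult.assoc by (rule mult_left_mono[OF _ A])
      then have "A * exp (\<beta> * t - \<bar>x\<bar>) \<le> C * exp (- (1/2) * x) + exp (b / 2 * t) * exp (\<delta> * (\<xi> * t - x))"
        by (rule order_trans) simp
      then show ?thesis by (rule order_trans[OF V2[OF t] ennreal_leI])
    next
      case 2
      have "0 \<le> \<delta> * (\<xi> * t - x)" using 2 \<delta> by simp
      then have "exp (b / 2 * t) * 1 \<le> exp (b / 2 * t) * exp (\<delta> * (\<xi> * t - x))" by (intro mult_left_mono) simp_all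
      then have "exp (b / 2 * t) \<le> C * exp (- (1/2) * x) + exp (b / 2 * t) * exp (\<delta> * (\<xi> * t - x))"
        using C by (simp add: add_increasing)
      moreover have "V t x \<le> ennreal (exp (b / 2 * t))" by (rule V1) (use 2 x in auto)
      ultimately show ?thesis using ennreal_leI order_trans by blast
    next
      case 3
      have "\<beta> * t \<le> x / 2" using 3 t unfolding \<xi>_def by (simp add: algebra_simps)
      then have "exp (\<beta> * t - \<bar>x\<bar>) \<le> exp (\<beta> * t1 + - (1/2) * x)" using x0 mult_nonneg_nonneg[OF \<beta>(1) less_imp_le[OF t1(1)]] by simp
      then have "A * exp (\<beta> * t - \<bar>x\<bar>) \<le> C * exp (- (1/2) * x)"
        unfolding C_def exp_add mult.assoc by (rule mult_left_mono[OF _ A])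
      then have "A * exp (\<beta> * t - \<bar>x\<bar>) \<le> C * exp (- (1/2) * x) + exp (b / 2 * t) * exp (\<delta> * (\<xi> * t - x))"
        by (rule order_trans) simp
      then show ?thesis by (rule order_trans[OF V2[OF t] ennreal_leI])
    qed
  qed
  let ?P = "lborel \<Otimes>\<^sub>M lborel :: (real \<times> real) measure"
  let ?e = "\<lambda>c r. indicator {0<..} r * ennreal (exp (- c * r))"
  have "(\<integral>\<^sup>+w. ennreal (exp (- b * fst w)) * indicator {\<alpha> * fst w..} (snd w) * V (fst w) (snd w) \<partial>?P)
    \<le> (\<integral>\<^sup>+w. ennreal C * (?e b (fst w) * ?e (1/2) (snd w)) + ?e (b / 4) (fst w) * ?e \<delta> (snd w) \<partial>?P)"
  proof (rule nn_integral_mono)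
    fix w :: "real \<times> real"
    obtain t x where w: "w = (t, x)" by (cases w)
    show "ennreal (exp (- b * fst w)) * indicator {\<alpha> * fst w..} (snd w) * V (fst w) (snd w)
      \<le> ennreal C * (?e b (fst w) * ?e (1/2) (snd w)) + ?e (b / 4) (fst w) * ?e \<delta> (snd w)"
    proof (cases "0 < t \<and> \<alpha> * t \<le> x")
      case False then show ?thesis unfolding w by (auto simp: mom_nonpos)
    next
      case True
      then have x0: "0 < x" using \<alpha> by (meson less_le_trans mult_pos_pos)
      have "ennreal (exp (- b * t)) * V t x \<le> ennreal (exp (- b * t)) * ennreal (C * exp (- (1/2) * x) + exp (b / 2 * t) * exp (\<delta> * (\<xi> * t - x)))"
        by (intro mult_left_mono pt) (use True in simp_all)
      also have "\<dots> = ennreal (exp (- b * t) * (C * exp (- (1/2) * x) + exp (b / 2 * t) * exp (\<delta> * (\<xi> * t - x))))"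
        using C by (intro ennreal_mult[symmetric] add_nonneg_nonneg mult_nonneg_nonneg) simp_all
      also have "exp (- b * t) * (C * exp (- (1/2) * x) + exp (b / 2 * t) * exp (\<delta> * (\<xi> * t - x)))
         = C * (exp (- b * t) * exp (- (1/2) * x)) + exp (- (b / 4) * t) * exp (- \<delta> * x)"
      proof -
        have e: "\<delta> * \<xi> = b / 4" unfolding \<delta>_def using \<xi> by simp
        have "- b * t + (b / 2 * t + \<delta> * (\<xi> * t - x)) = - b * t + b / 2 * t + (\<delta> * \<xi>) * t - \<delta> * x"
          by (simp add: algebra_simps)
        then have "- b * t + (b / 2 * t + \<delta> * (\<xi> * t - x)) = - (b / 4) * t + - \<delta> * x"
          unfolding e by (simp add: field_simps)
        then have "exp (- b * t) * (exp (b / 2 * t) * exp (\<delta> * (\<xi> * t - x))) = exp (- (b / 4) * t) * exp (- \<delta> * x)"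
          unfolding exp_add[symmetric] by (rule arg_cong)
        then show ?thesis unfolding distrib_left by (simp only: mult_ac)
      qed
      also have "ennreal \<dots> = ennreal C * (ennreal (exp (- b * t)) * ennreal (exp (- (1/2) * x))) + ennreal (exp (- (b / 4) * t)) * ennreal (exp (- \<delta> * x))"
        using C by (simp only: ennreal_plus ennreal_mult mult_nonneg_nonneg exp_ge_zero)
      finally show ?thesis unfolding w using True x0 by simp
    qed
  qed
  also have "\<dots> = ennreal C * (\<integral>\<^sup>+w. ?e b (fst w) * ?e (1/2) (snd w) \<partial>?P) + (\<integral>\<^sup>+w. ?e (b / 4) (fst w) * ?e \<delta> (snd w) \<partial>?P)"
    by (subst nn_integral_add, measurable, subst nn_integral_cmult, measurable)
  also have "\<dots> = ennreal C * (ennreal (1 / b) * ennreal (1 / (1/2))) + ennreal (1 / (b / 4)) * ennreal (1 / \<delta>)"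
    using b \<delta> by (subst (1 2) nn_integral_product, measurable, subst (1 2 3 4) nn_integral_exp_neg) simp_all
  also have "\<dots> < \<infinity>" by (simp add: ennreal_mult_less_top)
  finally show False unfolding cone_laplace_infinite[OF \<alpha>(1) less_imp_le[OF b] crit] by simp
qed

lemma lower_index_2: "ereal (L\<^sup>2 / (2 * pi)) \<le> lower_index M u 2"
proof (rule ccontr)
  assume "\<not> ?thesis"
  then have "lower_index M u 2 < ereal (L\<^sup>2 / (2 * pi))" by (simp only: not_le)
  then obtain \<alpha> where \<alpha>: "lower_index M u 2 < ereal \<alpha>" "ereal \<alpha> < ereal (L\<^sup>2 / (2 * pi))"
    using ereal_dense2 by blast
  have "0 \<le> lower_index M u 2" unfolding lower_index_def by (rule Sup_upper) simp
  then have "0 < ereal \<alpha>" using \<alpha>(1) by (rule le_less_trans)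
  then have "growth_rate M u 2 \<alpha> > 0" using \<alpha>(2) by (intro growth_rate_2_pos) simp_all
  then have "ereal \<alpha> \<le> lower_index M u 2" unfolding lower_index_def using \<open>0 < ereal \<alpha>\<close> by (intro Sup_upper) auto
  then show False using \<alpha>(1) by simp
qed

text \<open>Half of the speed found for the second moment works for every order, by
  \<open>growth_rate_pos_mono\<close>.\<close>

lemma lower_index_pos:
  assumes "\<nu> \<ge> 2" shows "0 < lower_index M u \<nu>"
proof -
  define \<alpha> where "\<alpha> = L\<^sup>2 / (2 * pi) / 2"
  have "0 < L\<^sup>2 / (2 * pi)" using L(1) by simp
  moreover have "0 < B \<Longrightarrow> 0 < B / 2 \<and> B / 2 < B" for B :: real by simp
  ultimately have \<alpha>: "0 < \<alpha>" "\<alpha> < L\<^sup>2 / (2 * pi)" unfolding \<alpha>_def by blast+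
  have "growth_rate M u \<nu> \<alpha> > 0" by (rule growth_rate_pos_mono[OF assms growth_rate_2_pos[OF \<alpha>]])
  then have "ereal \<alpha> \<le> lower_index M u \<nu>" unfolding lower_index_def using \<alpha>(1) by (intro Sup_upper) auto
  then show ?thesis using \<alpha>(1) by (meson ereal_less(2) less_le_trans)
qed

end

section \<open>From the stated hypotheses to the locale\<close>

text \<open>For fixed \<open>x\<close> the quotient is a lower bound for all Lipschitz constants,
  hence for their infimum; whether the infimum is attained need not be discussed.\<close>

lemma lip_const_bound:
  assumes "\<exists>C. C-lipschitz_on UNIV \<sigma>" "\<sigma> 0 = 0"
  shows "0 \<le> lip_const \<sigma>" "\<bar>\<sigma> x\<bar> \<le> lip_const \<sigma> * \<bar>x\<bar>"
proof -
  have ne: "{C. C-lipschitz_on UNIV \<sigma>} \<noteq> {}" using assms(1) by blast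
  show "0 \<le> lip_const \<sigma>" unfolding lip_const_def
    by (rule cInf_greatest[OF ne]) (auto dest: lipschitz_on_nonneg)
  show "\<bar>\<sigma> x\<bar> \<le> lip_const \<sigma> * \<bar>x\<bar>"
  proof (cases "x = 0")
    case False
    have "\<bar>\<sigma> x\<bar> / \<bar>x\<bar> \<le> lip_const \<sigma>" unfolding lip_const_def
    proof (rule cInf_greatest[OF ne])
      fix C assume "C \<in> {C. C-lipschitz_on UNIV \<sigma>}"
      then have "dist (\<sigma> x) (\<sigma> 0) \<le> C * dist x 0" by (intro lipschitz_onD) auto
      then show "\<bar>\<sigma> x\<bar> / \<bar>x\<bar> \<le> C" using False assms(2) by (simp add: dist_real_def divide_le_eq)
    qed
    then show ?thesis using False by (simp add: divide_le_eq)
  qed (use assms(2) in simp)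
qed

lemma L_const_bound: "L_const \<sigma> * \<bar>x\<bar> \<le> \<bar>\<sigma> x\<bar>"
proof (cases "x = 0")
  case False
  have "L_const \<sigma> \<le> \<bar>\<sigma> x / x\<bar>" unfolding L_const_def
    by (rule cInf_lower) (use False in \<open>auto intro: bdd_belowI[of _ 0]\<close>)
  then show ?thesis using False by (simp add: abs_divide le_divide_eq)
qed simp

lemma lsc_borel_measurable:
  assumes "lsc f" shows "f \<in> borel_measurable borel"
  unfolding borel_measurable_iff_greater using assms unfolding lsc_def by auto

theorem theorem1p3:
  fixes M :: "'a measure" and F :: "real \<Rightarrow> 'a measure"
    and W :: "real \<Rightarrow> real set \<Rightarrow> 'a \<Rightarrow> real"
    and \<kappa> :: real and \<sigma> u0 :: "real \<Rightarrow> real" and u :: "real \<Rightarrow> real \<Rightarrow> 'a \<Rightarrow> real"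
  assumes "prob_space M" and "filtration_on M F" and "white_noise M F W"
    and "\<kappa> > 0"
    and "\<exists>C. C-lipschitz_on UNIV \<sigma>" and "\<sigma> 0 = 0" and "L_const \<sigma> > 0"
    and "bounded (range u0)" and "\<forall>x. u0 x \<ge> 0" and "lsc u0"
    and "compact (closure {x. u0 x \<noteq> 0})"
    and "measure lborel (closure {x. u0 x \<noteq> 0}) > 0"
    and "mild_solution M F W \<kappa> \<sigma> u0 u"
  shows "(\<forall>\<nu>\<ge>2. 0 < lower_index M u \<nu> \<and> lower_index M u \<nu> \<le> upper_index M u \<nu>
                \<and> upper_index M u \<nu> < \<infinity>)
       \<and> ereal ((L_const \<sigma>)\<^sup>2 / (2 * pi)) \<le> lower_index M u 2
       \<and> lower_index M u 2 \<le> upper_index M u 2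
       \<and> upper_index M u 2 \<le> ereal ((lip_const \<sigma>)\<^sup>2 / 2)"
proof -
  obtain U where U: "\<And>y. norm (u0 y) \<le> U" using assms(8) unfolding bounded_iff by blast
  obtain R where R: "\<And>y. y \<in> closure {x. u0 x \<noteq> 0} \<Longrightarrow> norm y \<le> R"
    using compact_imp_bounded[OF assms(11)] unfolding bounded_iff by blast
  \<comment> \<open>A support of positive measure contains a point where the datum is positive;
    together with lower semicontinuity this gives the nonempty open set required by the
    locale.\<close>
  have "{x. u0 x \<noteq> 0} \<noteq> {}" using assms(12) by (intro notI) simp
  then have ne: "{x. u0 x > 0} \<noteq> {}" using assms(9) by (fastforce simp: less_le)
  have op: "open {x. u0 x > 0}" using assms(10) unfolding lsc_def by blast
  obtain C where "C-lipschitz_on UNIV \<sigma>" using assms(5) by blast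
  then have \<sigma>m: "\<sigma> \<in> borel_measurable borel"
    by (intro borel_measurable_continuous_onI lipschitz_on_continuous_on)
  interpret mild M F W \<kappa> \<sigma> u0 u "lip_const \<sigma>" "L_const \<sigma>" U R "{x. u0 x > 0}"
  proof (intro mild.intro noise.intro noise_axioms.intro mild_axioms.intro assms(1-4,7,13) \<sigma>m
      lip_const_bound[OF assms(5,6)] L_const_bound lsc_borel_measurable[OF assms(10)] op ne)
    show "0 \<le> u0 y" for y using assms(9) by blast
    show "u0 y \<le> U" for y using U[of y] by simp
    show "\<bar>y\<bar> \<le> R" if "u0 y \<noteq> 0" for y
      using R[of y] closure_subset[of "{x. u0 x \<noteq> 0}"] that by auto
  qed simp
  show ?thesis
    using lower_index_pos upper_index_finite lower_index_2 upper_index_2 lower_index_le_upper_index by blast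
qed

end
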